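(* Let $M$ be a von Neumann algebra with separable predual and let $E$ be a faithful normal conditional expectation defined on $M$. Then the similarity orbit $\mathcal S(E)=\{L_g(E):g\in G_M\}\simeq G_M/I_E$, considered with the quotient topology of the norm topology of $G_M$, can be given a unique complex analytic manifold structure such that it is a homogeneous space, i.e. such that the map $\Pi_E:G_M\to\mathcal S(E)$, $\Pi_E(g)=L_g(E)$, is a principal bundle with structure group $I_E$ and is a submersion.
   Context: $G_M$ denotes the group of invertible elements of $M$ with the norm topology, which is a complex analytic Banach–Lie group (open in $M$). For $g\in G_M$, $L_g(E)=gE(g^{-1}\cdot g)g^{-1}$, i.e. $L_g(E)(x)=gE(g^{-1}xg)g^{-1}$ for $x\in M$ (a bounded linear operator on $M$). $I_E=\{g\in G_M:L_g(E)=E\}$ is the isotropy group. *)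

theory Defs
  imports "HOL-Analysis.Analysis" "HOL-Algebra.Group"
begin

section \<open>Complex normed spaces and Hilbert spaces\<close>

class complex_normed_vector = real_normed_vector +
  fixes scaleC :: "complex \<Rightarrow> 'a \<Rightarrow> 'a"  (infixr \<open>*\<^sub>C\<close> 75)
  assumes scaleC_add_right: "c *\<^sub>C (x + y) = c *\<^sub>C x + c *\<^sub>C y"
    and scaleC_add_left: "(c + d) *\<^sub>C x = c *\<^sub>C x + d *\<^sub>C x"
    and scaleC_scaleC: "c *\<^sub>C d *\<^sub>C x = (c * d) *\<^sub>C x"
    and scaleC_of_real: "complex_of_real r *\<^sub>C x = r *\<^sub>R x"
    and norm_scaleC: "norm (c *\<^sub>C x) = cmod c * norm x"

text \<open>The complex inner product is linear in the first argument. Its positivity, and the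
  relation of its norm to the given one, come from the axioms of \<^class>\<open>real_inner\<close>,
  because its real part is the real inner product and \<open>cinner x x\<close> is real.\<close>

class complex_inner = complex_normed_vector + real_inner +
  fixes cinner :: "'a \<Rightarrow> 'a \<Rightarrow> complex"
  assumes cinner_commute: "cinner x y = cnj (cinner y x)"
    and cinner_add_left: "cinner (x + y) z = cinner x z + cinner y z"
    and cinner_scaleC_left: "cinner (c *\<^sub>C x) y = c * cinner x y"
    and Re_cinner: "Re (cinner x y) = inner x y"

class chilbert_space = complex_inner + complete_space

instantiation complex :: chilbert_space
begin

definition scaleC_complex :: "complex \<Rightarrow> complex \<Rightarrow> complex" where
  "scaleC_complex c z = c * z"

definition cinner_complex :: "complex \<Rightarrow> complex \<Rightarrow> complex" where
  "cinner_complex z w = z * cnj w"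

instance
  by standard
    (simp_all add: scaleC_complex_def cinner_complex_def algebra_simps norm_mult
      scaleR_conv_of_real inner_complex_def)

end

instantiation prod :: (complex_normed_vector, complex_normed_vector) complex_normed_vector
begin

definition scaleC_prod :: "complex \<Rightarrow> 'a \<times> 'b \<Rightarrow> 'a \<times> 'b" where
  "scaleC_prod c p = (c *\<^sub>C fst p, c *\<^sub>C snd p)"

instance
proof
  fix c d :: complex and x y :: "'a \<times> 'b" and r :: real
  show "c *\<^sub>C (x + y) = c *\<^sub>C x + c *\<^sub>C y" "(c + d) *\<^sub>C x = c *\<^sub>C x + d *\<^sub>C x"
    "c *\<^sub>C d *\<^sub>C x = (c * d) *\<^sub>C x" "complex_of_real r *\<^sub>C x = r *\<^sub>R x"
    by (simp_all add: scaleC_prod_def scaleC_add_right scaleC_add_left scaleC_scaleC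
        scaleC_of_real scaleR_prod_def)
  have "sqrt ((cmod c * norm (fst x))\<^sup>2 + (cmod c * norm (snd x))\<^sup>2)
      = sqrt ((cmod c)\<^sup>2 * ((norm (fst x))\<^sup>2 + (norm (snd x))\<^sup>2))"
    by (simp add: power_mult_distrib distrib_left)
  then show "norm (c *\<^sub>C x) = cmod c * norm x"
    by (simp add: scaleC_prod_def norm_prod_def norm_scaleC real_sqrt_mult)
qed

end

lemma bounded_linear_scaleC: "bounded_linear (\<lambda>x::'a::complex_normed_vector. c *\<^sub>C x)"
proof (rule bounded_linear_intro[where K = "cmod c"])
  fix r :: real and x :: 'a
  show "c *\<^sub>C (r *\<^sub>R x) = r *\<^sub>R (c *\<^sub>C x)"
    by (simp add: scaleC_of_real[symmetric] scaleC_scaleC mult.commute)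
qed (simp_all add: scaleC_add_right norm_scaleC mult.commute)

text \<open>Bounded \<^emph>\<open>real\<close>-linear maps into a complex normed space; the complex-linear ones
  are singled out in \<open>bounded_operators\<close> below.\<close>

instantiation blinfun :: (real_normed_vector, complex_normed_vector) complex_normed_vector
begin

lift_definition scaleC_blinfun :: "complex \<Rightarrow> ('a \<Rightarrow>\<^sub>L 'b) \<Rightarrow> ('a \<Rightarrow>\<^sub>L 'b)"
  is "\<lambda>c f x. c *\<^sub>C f x"
  by (rule bounded_linear_compose[OF bounded_linear_scaleC])

instance
proof
  fix c d :: complex and f g :: "'a \<Rightarrow>\<^sub>L 'b" and r :: real
  show "c *\<^sub>C (f + g) = c *\<^sub>C f + c *\<^sub>C g" "(c + d) *\<^sub>C f = c *\<^sub>C f + d *\<^sub>C f"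
    "c *\<^sub>C d *\<^sub>C f = (c * d) *\<^sub>C f" "complex_of_real r *\<^sub>C f = r *\<^sub>R f"
    by (auto intro!: blinfun_eqI simp: scaleC_blinfun.rep_eq plus_blinfun.rep_eq
        scaleR_blinfun.rep_eq scaleC_add_right scaleC_add_left scaleC_scaleC scaleC_of_real)
  have le: "norm (a *\<^sub>C h) \<le> cmod a * norm h" for a :: complex and h :: "'a \<Rightarrow>\<^sub>L 'b"
  proof (rule norm_blinfun_bound)
    fix x
    show "norm (blinfun_apply (a *\<^sub>C h) x) \<le> cmod a * norm h * norm x"
      using norm_blinfun[of h x]
      by (simp add: scaleC_blinfun.rep_eq norm_scaleC mult.assoc mult_left_mono)
  qed simp
  have one: "inverse a *\<^sub>C a *\<^sub>C h = h" if "a \<noteq> 0" for a :: complex and h :: "'a \<Rightarrow>\<^sub>L 'b"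
    using that scaleC_of_real[of 1, where 'a = 'b]
    by (auto intro!: blinfun_eqI simp: scaleC_blinfun.rep_eq scaleC_scaleC)
  show "norm (c *\<^sub>C f) = cmod c * norm f"
  proof (cases "c = 0")
    case True
    then show ?thesis using le[of 0 f] by simp
  next
    case False
    have "norm f \<le> cmod (inverse c) * norm (c *\<^sub>C f)"
      using le[of "inverse c" "c *\<^sub>C f"] one[OF False, of f] by simp
    then have "cmod c * norm f \<le> norm (c *\<^sub>C f)"
      using False by (simp add: norm_inverse norm_divide field_simps)
    then show ?thesis using le[of c f] by simp
  qed
qed

end


section \<open>Von Neumann algebras and conditional expectations\<close>

type_synonym 'h op = "'h \<Rightarrow>\<^sub>L 'h"

definition bounded_operators :: "'h::chilbert_space op set" where
  "bounded_operators = {T. \<forall>c x. blinfun_apply T (c *\<^sub>C x) = c *\<^sub>C blinfun_apply T x}"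

definition adj :: "'h::chilbert_space op \<Rightarrow> 'h op" where
  "adj T = (THE S. \<forall>x y. cinner (blinfun_apply T x) y = cinner x (blinfun_apply S y))"

definition positive_op :: "'h::chilbert_space op \<Rightarrow> bool" where
  "positive_op T \<longleftrightarrow> (\<forall>x. cinner (blinfun_apply T x) x \<in> \<real>\<^sub>\<ge>\<^sub>0)"

definition commutant :: "'h::chilbert_space op set \<Rightarrow> 'h op set" where
  "commutant S = {T \<in> bounded_operators. \<forall>x\<in>S. T o\<^sub>L x = x o\<^sub>L T}"

text \<open>Being a commutant, \<open>M\<close> is automatically a unital subalgebra of \<open>bounded_operators\<close>.\<close>

definition von_neumann_algebra :: "'h::chilbert_space op set \<Rightarrow> bool" where
  "von_neumann_algebra M \<longleftrightarrow>
     M \<subseteq> bounded_operators \<and> (\<forall>x\<in>M. adj x \<in> M) \<and> commutant (commutant M) = M"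

text \<open>The ultraweak topology is the weakest topology making all functionals
  \<open>T \<mapsto> \<Sum>\<^sub>n \<langle>T \<xi>\<^sub>n, \<eta>\<^sub>n\<rangle>\<close>, with square-summable \<open>\<xi>\<close> and \<open>\<eta>\<close>, continuous.\<close>

definition ultraweak_functionals :: "('h::chilbert_space op \<Rightarrow> complex) set" where
  "ultraweak_functionals =
     {\<lambda>T. \<Sum>n. cinner (blinfun_apply T (\<xi> n)) (\<eta> n) | \<xi> \<eta> :: nat \<Rightarrow> 'h.
        summable (\<lambda>n. (norm (\<xi> n))\<^sup>2) \<and> summable (\<lambda>n. (norm (\<eta> n))\<^sup>2)}"

definition ultraweak_topology :: "'h::chilbert_space op topology" where
  "ultraweak_topology =
     topology_generated_by {\<omega> -` W | \<omega> W. \<omega> \<in> ultraweak_functionals \<and> open W}"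

definition csubspace :: "'a::complex_normed_vector set \<Rightarrow> bool" where
  "csubspace V \<longleftrightarrow> 0 \<in> V \<and> (\<forall>x\<in>V. \<forall>y\<in>V. x + y \<in> V) \<and> (\<forall>c. \<forall>x\<in>V. c *\<^sub>C x \<in> V)"

definition clinear_on ::
  "'a::complex_normed_vector set \<Rightarrow> ('a \<Rightarrow> 'b::complex_normed_vector) \<Rightarrow> bool" where
  "clinear_on V f \<longleftrightarrow>
     (\<forall>x\<in>V. \<forall>y\<in>V. f (x + y) = f x + f y) \<and> (\<forall>c. \<forall>x\<in>V. f (c *\<^sub>C x) = c *\<^sub>C f x)"

definition predual :: "'h::chilbert_space op set \<Rightarrow> ('h op \<Rightarrow> complex) set" where
  "predual M = {\<phi> \<in> extensional M. clinear_on M \<phi> \<and>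
     continuous_map (subtopology ultraweak_topology M) euclidean \<phi>}"

text \<open>The inequality says that \<open>\<phi> - \<psi>\<close> has norm at most \<open>\<epsilon>\<close> as a functional on \<open>M\<close>.\<close>

definition separable_predual :: "'h::chilbert_space op set \<Rightarrow> bool" where
  "separable_predual M \<longleftrightarrow>
     (\<exists>D \<subseteq> predual M. countable D \<and>
        (\<forall>\<phi>\<in>predual M. \<forall>\<epsilon>>0. \<exists>\<psi>\<in>D. \<forall>x\<in>M. cmod (\<phi> x - \<psi> x) \<le> \<epsilon> * norm x))"

text \<open>Maps on \<open>M\<close> are represented by extensional functions, so that equality of such functions
  is equality of maps on \<open>M\<close>.\<close>

definition conditional_expectation ::
  "'h::chilbert_space op set \<Rightarrow> 'h op set \<Rightarrow> ('h op \<Rightarrow> 'h op) \<Rightarrow> bool" where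
  "conditional_expectation M N E \<longleftrightarrow>
     von_neumann_algebra N \<and> N \<subseteq> M \<and> E \<in> M \<rightarrow>\<^sub>E N \<and> clinear_on M E \<and>
     (\<forall>a\<in>N. E a = a) \<and>
     (\<forall>x\<in>M. positive_op x \<longrightarrow> positive_op (E x)) \<and>
     (\<forall>a\<in>N. \<forall>b\<in>N. \<forall>x\<in>M. E (a o\<^sub>L x o\<^sub>L b) = a o\<^sub>L E x o\<^sub>L b)"

definition faithful_map :: "'h::chilbert_space op set \<Rightarrow> ('h op \<Rightarrow> 'h op) \<Rightarrow> bool" where
  "faithful_map M E \<longleftrightarrow> (\<forall>x\<in>M. E (adj x o\<^sub>L x) = 0 \<longrightarrow> x = 0)"

definition normal_map :: "'h::chilbert_space op set \<Rightarrow> ('h op \<Rightarrow> 'h op) \<Rightarrow> bool" where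
  "normal_map M E \<longleftrightarrow>
     continuous_map (subtopology ultraweak_topology M) (subtopology ultraweak_topology M) E"


section \<open>The similarity orbit\<close>

definition invertible_group :: "'h::chilbert_space op set \<Rightarrow> 'h op monoid" where
  "invertible_group M = units_of \<lparr>carrier = M, mult = (o\<^sub>L), one = id_blinfun\<rparr>"

definition similarity ::
  "'h::chilbert_space op set \<Rightarrow> 'h op \<Rightarrow> ('h op \<Rightarrow> 'h op) \<Rightarrow> ('h op \<Rightarrow> 'h op)" where
  "similarity M g E =
     (\<lambda>x\<in>M. g o\<^sub>L E (inv\<^bsub>invertible_group M\<^esub> g o\<^sub>L x o\<^sub>L g) o\<^sub>L inv\<^bsub>invertible_group M\<^esub> g)"

definition similarity_orbit ::
  "'h::chilbert_space op set \<Rightarrow> ('h op \<Rightarrow> 'h op) \<Rightarrow> ('h op \<Rightarrow> 'h op) set" where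
  "similarity_orbit M E = (\<lambda>g. similarity M g E) ` carrier (invertible_group M)"

definition isotropy_group ::
  "'h::chilbert_space op set \<Rightarrow> ('h op \<Rightarrow> 'h op) \<Rightarrow> 'h op monoid" where
  "isotropy_group M E =
     (invertible_group M)\<lparr>carrier := {g \<in> carrier (invertible_group M). similarity M g E = E}\<rparr>"

definition quotient_topology :: "'a topology \<Rightarrow> ('a \<Rightarrow> 'b) \<Rightarrow> 'b topology" where
  "quotient_topology X f =
     topology (\<lambda>U. U \<subseteq> f ` topspace X \<and> openin X {x \<in> topspace X. f x \<in> U})"

lemma openin_quotient_topology:
  "openin (quotient_topology X f) U \<longleftrightarrow>
     U \<subseteq> f ` topspace X \<and> openin X {x \<in> topspace X. f x \<in> U}"
proof -
  have "istopology (\<lambda>U. U \<subseteq> f ` topspace X \<and> openin X {x \<in> topspace X. f x \<in> U})"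
    unfolding istopology_def
  proof (intro conjI allI impI)
    fix S T
    assume "S \<subseteq> f ` topspace X \<and> openin X {x \<in> topspace X. f x \<in> S}"
      and "T \<subseteq> f ` topspace X \<and> openin X {x \<in> topspace X. f x \<in> T}"
    moreover have "{x \<in> topspace X. f x \<in> S \<inter> T}
        = {x \<in> topspace X. f x \<in> S} \<inter> {x \<in> topspace X. f x \<in> T}" by auto
    ultimately show "S \<inter> T \<subseteq> f ` topspace X" "openin X {x \<in> topspace X. f x \<in> S \<inter> T}"
      by auto
  next
    fix \<K>
    assume K: "\<forall>K\<in>\<K>. K \<subseteq> f ` topspace X \<and> openin X {x \<in> topspace X. f x \<in> K}"
    then show "\<Union>\<K> \<subseteq> f ` topspace X" by auto
    have "{x \<in> topspace X. f x \<in> \<Union>\<K>} = (\<Union>K\<in>\<K>. {x \<in> topspace X. f x \<in> K})" by auto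
    then show "openin X {x \<in> topspace X. f x \<in> \<Union>\<K>}" using K by auto
  qed
  then show ?thesis
    by (simp add: quotient_topology_def topology_inverse')
qed


section \<open>Complex Banach manifolds\<close>

text \<open>Derivatives are bounded complex-linear maps on the model space \<open>V\<close> only. The library's
  \<open>has_derivative\<close> within \<open>V\<close> would ask for an extension of the derivative to the whole ambient
  space, which need not exist when \<open>V\<close> is not complemented.\<close>

definition has_cderiv_within ::
  "('a::complex_normed_vector \<Rightarrow> 'b::complex_normed_vector) \<Rightarrow> ('a \<Rightarrow> 'b) \<Rightarrow> 'a \<Rightarrow> 'a set \<Rightarrow> bool" where
  "has_cderiv_within f D x V \<longleftrightarrow>
     clinear_on V D \<and> (\<exists>K. \<forall>v\<in>V. norm (D v) \<le> K * norm v) \<and>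
     ((\<lambda>y. norm (f y - f x - D (y - x)) / norm (y - x)) \<longlongrightarrow> 0) (at x within V)"

text \<open>As in the library's one-variable theory, complex analytic maps are those which are complex
  (Frechet) differentiable at all points of an open set \<open>W\<close> of the Banach space \<open>V\<close>.\<close>

definition canalytic_on ::
  "'a::complex_normed_vector set \<Rightarrow> ('a \<Rightarrow> 'b::complex_normed_vector) \<Rightarrow> 'a set \<Rightarrow> bool" where
  "canalytic_on V f W \<longleftrightarrow> (\<forall>x\<in>W. \<exists>D. has_cderiv_within f D x V)"

text \<open>A chart \<open>(U, \<phi>, V)\<close> is a homeomorphism \<open>\<phi>\<close> of the open set \<open>U\<close> onto an open subset of the
  complex Banach space \<open>V\<close>, a complete subspace of an ambient normed space. Different charts of
  the same manifold may have different model spaces.\<close>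

type_synonym ('x, 'b) chart = "'x set \<times> ('x \<Rightarrow> 'b) \<times> 'b set"

definition chart_on :: "'x topology \<Rightarrow> ('x, 'b::complex_normed_vector) chart \<Rightarrow> bool" where
  "chart_on X = (\<lambda>(U, \<phi>, V).
     openin X U \<and> csubspace V \<and> complete V \<and> openin (top_of_set V) (\<phi> ` U) \<and>
     homeomorphic_map (subtopology X U) (top_of_set (\<phi> ` U)) \<phi>)"

definition compatible_charts ::
  "('x, 'b::complex_normed_vector) chart \<Rightarrow> ('x, 'b) chart \<Rightarrow> bool" where
  "compatible_charts = (\<lambda>(U, \<phi>, V) (U', \<psi>, V').
     canalytic_on V (\<psi> \<circ> inv_into U \<phi>) (\<phi> ` (U \<inter> U')) \<and>
     canalytic_on V' (\<phi> \<circ> inv_into U' \<psi>) (\<psi> ` (U \<inter> U')))"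

definition complex_manifold ::
  "'x topology \<Rightarrow> ('x, 'b::complex_normed_vector) chart set \<Rightarrow> bool" where
  "complex_manifold X A \<longleftrightarrow>
     Hausdorff_space X \<and> (\<forall>c\<in>A. chart_on X c) \<and> topspace X \<subseteq> \<Union> (fst ` A) \<and>
     (\<forall>c\<in>A. \<forall>d\<in>A. compatible_charts c d)"

definition maximal_atlas ::
  "'x topology \<Rightarrow> ('x, 'b::complex_normed_vector) chart set \<Rightarrow> ('x, 'b) chart set" where
  "maximal_atlas X A = {c. chart_on X c \<and> (\<forall>d\<in>A. compatible_charts c d)}"

definition complex_manifold_structure ::
  "'x topology \<Rightarrow> ('x, 'b::complex_normed_vector) chart set \<Rightarrow> bool" where
  "complex_manifold_structure X A \<longleftrightarrow> complex_manifold X A \<and> maximal_atlas X A = A"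

definition canalytic_map ::
  "'x topology \<Rightarrow> ('x, 'a::complex_normed_vector) chart set \<Rightarrow>
   'y topology \<Rightarrow> ('y, 'b::complex_normed_vector) chart set \<Rightarrow> ('x \<Rightarrow> 'y) \<Rightarrow> bool" where
  "canalytic_map X A Y B f \<longleftrightarrow> continuous_map X Y f \<and>
     (\<forall>(U, \<phi>, V)\<in>A. \<forall>(U', \<psi>, V')\<in>B.
        canalytic_on V (\<psi> \<circ> f \<circ> inv_into U \<phi>) (\<phi> ` (U \<inter> f -` U')))"

definition bianalytic_map ::
  "'x topology \<Rightarrow> ('x, 'a::complex_normed_vector) chart set \<Rightarrow>
   'y topology \<Rightarrow> ('y, 'b::complex_normed_vector) chart set \<Rightarrow> ('x \<Rightarrow> 'y) \<Rightarrow> bool" where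
  "bianalytic_map X A Y B f \<longleftrightarrow>
     (\<exists>g. homeomorphic_maps X Y f g \<and> canalytic_map X A Y B f \<and> canalytic_map Y B X A g)"

definition complemented_subspace :: "'a::complex_normed_vector set \<Rightarrow> 'a set \<Rightarrow> bool" where
  "complemented_subspace V W \<longleftrightarrow> csubspace W \<and> complete W \<and>
     (\<exists>Z. csubspace Z \<and> complete Z \<and> W \<inter> Z = {0} \<and> V = {w + z | w z. w \<in> W \<and> z \<in> Z})"

definition csubmersion ::
  "'x topology \<Rightarrow> ('x, 'a::complex_normed_vector) chart set \<Rightarrow>
   'y topology \<Rightarrow> ('y, 'b::complex_normed_vector) chart set \<Rightarrow> ('x \<Rightarrow> 'y) \<Rightarrow> bool" where
  "csubmersion X A Y B f \<longleftrightarrow> canalytic_map X A Y B f \<and>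
     (\<forall>x\<in>topspace X. \<exists>(U, \<phi>, V)\<in>A. \<exists>(U', \<psi>, V')\<in>B. x \<in> U \<and> f x \<in> U' \<and>
        (\<exists>D. has_cderiv_within (\<psi> \<circ> f \<circ> inv_into U \<phi>) D (\<phi> x) V \<and>
           D ` V = V' \<and> complemented_subspace V {v \<in> V. D v = 0}))"

definition prod_atlas ::
  "('x, 'a) chart set \<Rightarrow> ('y, 'b) chart set \<Rightarrow> ('x \<times> 'y, 'a \<times> 'b) chart set" where
  "prod_atlas A B =
     {(U \<times> U', map_prod \<phi> \<psi>, V \<times> V') | U \<phi> V U' \<psi> V'. (U, \<phi>, V) \<in> A \<and> (U', \<psi>, V') \<in> B}"

definition open_atlas :: "('x, 'a) chart set \<Rightarrow> 'x set \<Rightarrow> ('x, 'a) chart set" where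
  "open_atlas A S = {(U \<inter> S, \<phi>, V) | U \<phi> V. (U, \<phi>, V) \<in> A}"

text \<open>Charts induced on \<open>S\<close> by those charts of the manifold which map \<open>S\<close> to a complemented
  subspace of the model space. They cover \<open>S\<close> iff \<open>S\<close> is an (embedded) submanifold.\<close>

definition submanifold_atlas ::
  "('x, 'a::complex_normed_vector) chart set \<Rightarrow> 'x set \<Rightarrow> ('x, 'a) chart set" where
  "submanifold_atlas A S =
     {(U \<inter> S, \<phi>, W) | U \<phi> V W. (U, \<phi>, V) \<in> A \<and> complemented_subspace V W \<and>
        \<phi> ` (U \<inter> S) = \<phi> ` U \<inter> W}"

definition complex_Lie_group ::
  "('k, 'm) monoid_scheme \<Rightarrow> 'k topology \<Rightarrow> ('k, 'c::complex_normed_vector) chart set \<Rightarrow> bool" where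
  "complex_Lie_group K T C \<longleftrightarrow>
     group K \<and> topspace T = carrier K \<and> complex_manifold T C \<and>
     canalytic_map (prod_topology T T) (prod_atlas C C) T C (\<lambda>(k, l). k \<otimes>\<^bsub>K\<^esub> l) \<and>
     canalytic_map T C T C (\<lambda>k. inv\<^bsub>K\<^esub> k)"

text \<open>Analytic principal bundle \<open>\<pi>\<close> with total space \<open>(P, A)\<close>, base \<open>(Y, B)\<close> and structure group
  \<open>(K, T, C)\<close>, acting on the right of \<open>P\<close> by \<open>act\<close>; the maps \<open>\<tau>\<close> are equivariant local
  trivializations.\<close>

definition principal_bundle ::
  "'p topology \<Rightarrow> ('p, 'a::complex_normed_vector) chart set \<Rightarrow>
   'y topology \<Rightarrow> ('y, 'b::complex_normed_vector) chart set \<Rightarrow>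
   ('k, 'm) monoid_scheme \<Rightarrow> 'k topology \<Rightarrow> ('k, 'c::complex_normed_vector) chart set \<Rightarrow>
   ('p \<Rightarrow> 'k \<Rightarrow> 'p) \<Rightarrow> ('p \<Rightarrow> 'y) \<Rightarrow> bool" where
  "principal_bundle P A Y B K T C act \<pi> \<longleftrightarrow>
     complex_manifold P A \<and> complex_manifold Y B \<and> complex_Lie_group K T C \<and>
     canalytic_map (prod_topology P T) (prod_atlas A C) P A (\<lambda>(p, k). act p k) \<and>
     (\<forall>p\<in>topspace P. act p \<one>\<^bsub>K\<^esub> = p) \<and>
     (\<forall>p\<in>topspace P. \<forall>k\<in>carrier K. \<forall>l\<in>carrier K. act p (k \<otimes>\<^bsub>K\<^esub> l) = act (act p k) l) \<and>
     canalytic_map P A Y B \<pi> \<and> \<pi> ` topspace P = topspace Y \<and>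
     (\<forall>y\<in>topspace Y. \<exists>U \<tau>. openin Y U \<and> y \<in> U \<and>
        bianalytic_map
          (prod_topology (subtopology Y U) T) (prod_atlas (open_atlas B U) C)
          (subtopology P {p \<in> topspace P. \<pi> p \<in> U}) (open_atlas A {p \<in> topspace P. \<pi> p \<in> U}) \<tau> \<and>
        (\<forall>u\<in>U. \<forall>k\<in>carrier K. \<pi> (\<tau> (u, k)) = u \<and>
           (\<forall>l\<in>carrier K. \<tau> (u, k \<otimes>\<^bsub>K\<^esub> l) = act (\<tau> (u, k)) l)))"


section \<open>Homogeneous structures on the similarity orbit\<close>

abbreviation group_topology :: "'h::chilbert_space op set \<Rightarrow> 'h op topology" where
  "group_topology M \<equiv> top_of_set (carrier (invertible_group M))"

text \<open>The manifold structure of the invertible group as an open subset of the Banach space \<open>M\<close>.\<close>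

definition group_atlas :: "'h::chilbert_space op set \<Rightarrow> ('h op, 'h op) chart set" where
  "group_atlas M = maximal_atlas (group_topology M) {(carrier (invertible_group M), id, M)}"

definition orbit_topology ::
  "'h::chilbert_space op set \<Rightarrow> ('h op \<Rightarrow> 'h op) \<Rightarrow> ('h op \<Rightarrow> 'h op) topology" where
  "orbit_topology M E = quotient_topology (group_topology M) (\<lambda>g. similarity M g E)"

lemma topspace_orbit_topology: "topspace (orbit_topology M E) = similarity_orbit M E"
proof
  show "topspace (orbit_topology M E) \<subseteq> similarity_orbit M E"
    using openin_topspace[of "orbit_topology M E"]
    unfolding orbit_topology_def openin_quotient_topology
    by (auto simp: similarity_orbit_def)
  have "{x \<in> carrier (invertible_group M). similarity M x E \<in> similarity_orbit M E}
      = carrier (invertible_group M)"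
    by (auto simp: similarity_orbit_def)
  then have "openin (orbit_topology M E) (similarity_orbit M E)"
    unfolding orbit_topology_def openin_quotient_topology
    by (simp add: similarity_orbit_def)
  then show "similarity_orbit M E \<subseteq> topspace (orbit_topology M E)"
    by (rule openin_subset)
qed

text \<open>The isotropy group carries the norm topology and is a Lie group as a submanifold of the
  invertible group.\<close>

definition homogeneous_structure ::
  "'h::chilbert_space op set \<Rightarrow> ('h op \<Rightarrow> 'h op) \<Rightarrow>
   ('h op \<Rightarrow> 'h op, 'b::complex_normed_vector) chart set \<Rightarrow> bool" where
  "homogeneous_structure M E A \<longleftrightarrow>
     complex_manifold_structure (orbit_topology M E) A \<and>
     principal_bundle
       (group_topology M) (group_atlas M)
       (orbit_topology M E) A
       (isotropy_group M E)
       (top_of_set (carrier (isotropy_group M E)))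
       (submanifold_atlas (group_atlas M) (carrier (isotropy_group M E)))
       (o\<^sub>L)
       (\<lambda>g. similarity M g E) \<and>
     csubmersion (group_topology M) (group_atlas M) (orbit_topology M E) A
       (\<lambda>g. similarity M g E)"

end

(*
  An invertible g near 1 fixes E iff E(g) is invertible and E(g)^{-1} g lies in the centralizer
  A = {c in N' Int M. E(c x) = E(x c) for all x in M}. In the coordinates
  g |-> E(g) + E(g)^{-1} g - 1 the isotropy group is therefore the closed subspace W = N + A, and
  everything rests on complementing A in M. For this, take a faithful normal functional on M, which
  exists since the predual is separable, and compose it with E. The resulting psi is a trace on A.
  Minimizing psi((h - x)* (h - x)) over h in a ball of A that is larger than norm x yields a strong
  limit h, since psi-Cauchy sequences converge on the dense set of psi-bounded vectors. The
  minimizer turns out to satisfy norm h <= norm x, so it is interior, hence unconstrained, and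
  depends linearly on x. This gives a norm one projection P of M onto A.

  With Q w = E w + P (w - E w) and Z = ker Q, the map F w = (1 + w - Q w) k(Q w), k the inverse of the
  coordinates above, has derivative 1 at 1; inverting it locally gives charts z |-> L_{g (1 + z)} E
  of the orbit on a ball of Z, together with local sections of the orbit map.

  Any homogeneous structure has analytic local sections u |-> tau(u, 1). Composing them with the
  orbit map shows that the identity between two such structures is analytic in both directions.
*)

theory Submission
  imports Defs
begin

section \<open>Complex differentiation on closed subspaces\<close>

text \<open>Minimizing over all of A need not succeed: a psi-Cauchy sequence in A has in general
  only an unbounded limit. A norm bound makes it converge strongly, and the strong limit stays in A
  because E is normal. The obstacle is then the constraint, and the estimate for the minimizer
  removes it: left and right multiplication by 1 - t c c* are contractions, hence admissible
  variations, and psi being a trace against A turns them into bounds for h c and h* c. Density of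
  the bounded vectors rests on the bicommutant condition, which places the projection onto their
  closure in M, and on a second use of faithfulness.

  The operator type consists of real-linear maps, and the model spaces M, W, Z are closed subspaces
  of it. Derivatives, complex homogeneity and local inversion are therefore all developed relative
  to a complete subspace.

  The radii come from one estimate: F - id has Lipschitz constant at most 324 times the radius, so
  1/1000 is enough for inversion, and 1/30000 leaves room for the injectivity of the orbit
  charts.\<close>

lemma scaleC_one [simp]: "1 *\<^sub>C x = (x :: 'a::complex_normed_vector)"
  using scaleC_of_real[of 1 x] by simp

lemma scaleC_minus_one: "(-1) *\<^sub>C x = - (x :: 'a::complex_normed_vector)"
  using scaleC_of_real[of "-1" x] by simp

lemma scaleC_zero_left [simp]: "0 *\<^sub>C x = (0 :: 'a::complex_normed_vector)"
  using scaleC_of_real[of 0 x] by simp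

lemma scaleC_zero_right [simp]: "c *\<^sub>C (0 :: 'a::complex_normed_vector) = 0"
  using scaleC_add_right[of c 0 "0::'a"] by simp

lemma scaleC_minus_right: "c *\<^sub>C (- x) = - (c *\<^sub>C (x :: 'a::complex_normed_vector))"
  by (rule linear_neg[OF bounded_linear.linear[OF bounded_linear_scaleC]])

lemma scaleC_diff_right: "c *\<^sub>C (x - y) = c *\<^sub>C x - c *\<^sub>C (y :: 'a::complex_normed_vector)"
  by (rule linear_diff[OF bounded_linear.linear[OF bounded_linear_scaleC]])

lemma csubspaceD:
  assumes "csubspace V"
  shows csubspace_0: "0 \<in> V"
    and csubspace_add: "\<And>x y. x \<in> V \<Longrightarrow> y \<in> V \<Longrightarrow> x + y \<in> V"
    and csubspace_scaleC: "\<And>c x. x \<in> V \<Longrightarrow> c *\<^sub>C x \<in> V"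
    and csubspace_neg: "\<And>x. x \<in> V \<Longrightarrow> - x \<in> V"
    and csubspace_diff: "\<And>x y. x \<in> V \<Longrightarrow> y \<in> V \<Longrightarrow> x - y \<in> V"
    and csubspace_scaleR: "\<And>r x. x \<in> V \<Longrightarrow> r *\<^sub>R x \<in> V"
proof -
  note * = assms[unfolded csubspace_def]
  show "0 \<in> V" "\<And>x y. x \<in> V \<Longrightarrow> y \<in> V \<Longrightarrow> x + y \<in> V" "\<And>c x. x \<in> V \<Longrightarrow> c *\<^sub>C x \<in> V"
    using * by auto
  show neg: "- x \<in> V" if "x \<in> V" for x
    using *[THEN conjunct2, THEN conjunct2, rule_format, OF that, of "-1"] by (simp only: scaleC_minus_one)
  show "x - y \<in> V" if "x \<in> V" "y \<in> V" for x y
    using * that(1) neg[OF that(2)] unfolding diff_conv_add_uminus by blast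
  show "r *\<^sub>R x \<in> V" if "x \<in> V" for r x
    using *[THEN conjunct2, THEN conjunct2, rule_format, OF that, of "of_real r"] by (simp only: scaleC_of_real)
qed

lemma csubspace_Times: "csubspace V \<Longrightarrow> csubspace W \<Longrightarrow> csubspace (V \<times> W)"
  by (auto simp: csubspace_def scaleC_prod_def zero_prod_def)

lemma clinear_onD:
  assumes "clinear_on V f" "csubspace V"
  shows clinear_on_add: "\<And>x y. x \<in> V \<Longrightarrow> y \<in> V \<Longrightarrow> f (x + y) = f x + f y"
    and clinear_on_scaleC: "\<And>c x. x \<in> V \<Longrightarrow> f (c *\<^sub>C x) = c *\<^sub>C f x"
    and clinear_on_0: "f 0 = 0"
    and clinear_on_neg: "\<And>x. x \<in> V \<Longrightarrow> f (- x) = - f x"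
    and clinear_on_diff: "\<And>x y. x \<in> V \<Longrightarrow> y \<in> V \<Longrightarrow> f (x - y) = f x - f y"
    and clinear_on_scaleR: "\<And>r x. x \<in> V \<Longrightarrow> f (r *\<^sub>R x) = r *\<^sub>R f x"
proof -
  note * = assms(1)[unfolded clinear_on_def]
  show a: "\<And>x y. x \<in> V \<Longrightarrow> y \<in> V \<Longrightarrow> f (x + y) = f x + f y" using * by auto
  show s: "\<And>c x. x \<in> V \<Longrightarrow> f (c *\<^sub>C x) = c *\<^sub>C f x" using * by auto
  show "f 0 = 0" using a[of 0 0] csubspace_0[OF assms(2)] by simp
  show neg: "f (- x) = - f x" if "x \<in> V" for x
    using s[of x "-1"] that by (simp add: scaleC_minus_one)
  show "f (x - y) = f x - f y" if "x \<in> V" "y \<in> V" for x y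
    using a[of x "- y"] that neg csubspace_neg[OF assms(2)] by simp
  show "f (r *\<^sub>R x) = r *\<^sub>R f x" if "x \<in> V" for r x
    using s[of x "complex_of_real r"] that by (simp add: scaleC_of_real)
qed

text \<open>The limit ignores \<open>y = x\<close>, the estimate with \<open>\<le>\<close> includes
  it; linearity gives \<open>D 0 = 0\<close>, so that both sides vanish there. In this form no
  division remains, and errors can be added and composed.\<close>

lemma has_cderiv_within_iff:
  assumes V: "csubspace V"
  shows "has_cderiv_within f D x V \<longleftrightarrow> clinear_on V D \<and> (\<exists>K. \<forall>v\<in>V. norm (D v) \<le> K * norm v) \<and>
    (\<forall>e>0. \<exists>d>0. \<forall>y\<in>V. norm (y - x) < d \<longrightarrow> norm (f y - f x - D (y - x)) \<le> e * norm (y - x))"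
proof -
  have "((\<lambda>y. norm (f y - f x - D (y - x)) / norm (y - x)) \<longlongrightarrow> 0) (at x within V) \<longleftrightarrow>
    (\<forall>e>0. \<exists>d>0. \<forall>y\<in>V. norm (y - x) < d \<longrightarrow> norm (f y - f x - D (y - x)) \<le> e * norm (y - x))"
    (is "?L = ?R") if D0: "D 0 = 0"
  proof
    assume L: ?L
    show ?R
    proof (intro allI impI)
      fix e :: real assume e: "e > 0"
      from L[unfolded tendsto_iff, rule_format, OF e]
      obtain d where d: "d > 0" and
        *: "\<forall>y\<in>V. y \<noteq> x \<and> dist y x < d \<longrightarrow>
          dist (norm (f y - f x - D (y - x)) / norm (y - x)) 0 < e"
        unfolding eventually_at by (elim exE conjE) (rule that)
      show "\<exists>d>0. \<forall>y\<in>V. norm (y - x) < d \<longrightarrow> norm (f y - f x - D (y - x)) \<le> e * norm (y - x)"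
      proof (intro exI[of _ d] conjI ballI impI d)
        fix y assume y: "y \<in> V" "norm (y - x) < d"
        show "norm (f y - f x - D (y - x)) \<le> e * norm (y - x)"
        proof (cases "y = x")
          case False
          then have "norm (f y - f x - D (y - x)) / norm (y - x) < e"
            using *[rule_format, OF y(1)] y(2) by (simp add: dist_norm)
          then show ?thesis using False by (simp add: pos_divide_less_eq)
        qed (simp add: D0)
      qed
    qed
  next
    assume R: ?R
    show ?L
      unfolding tendsto_iff
    proof (intro allI impI)
      fix e :: real assume e: "e > 0"
      then obtain d where d: "d > 0" and *: "\<And>y. y \<in> V \<Longrightarrow> norm (y - x) < d \<Longrightarrow>
          norm (f y - f x - D (y - x)) \<le> e/2 * norm (y - x)"
        using R[rule_format, of "e/2"] by auto
      show "\<forall>\<^sub>F y in at x within V. dist (norm (f y - f x - D (y - x)) / norm (y - x)) 0 < e"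
        unfolding eventually_at
      proof (intro exI[of _ d] conjI ballI impI d)
        fix y assume y: "y \<in> V" "y \<noteq> x \<and> dist y x < d"
        then have "norm (f y - f x - D (y - x)) / norm (y - x) \<le> e / 2"
          using *[OF y(1)] by (simp only: dist_norm) (simp add: pos_divide_le_eq)
        also have "\<dots> < e" using e by simp
        finally show "dist (norm (f y - f x - D (y - x)) / norm (y - x)) 0 < e"
          using e by (simp add: dist_norm)
      qed
    qed
  qed
  then show ?thesis
    unfolding has_cderiv_within_def using clinear_on_0[OF _ V] by blast
qed

text \<open>Replacing the bound by \<open>max K 1\<close> makes it positive, so that it may serve as
  a divisor when tolerances are chosen.\<close>

lemma has_cderiv_withinD:
  assumes "has_cderiv_within f D x V" "csubspace V"
  obtains K where "clinear_on V D" "K > 0" "\<And>v. v \<in> V \<Longrightarrow> norm (D v) \<le> K * norm v"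
    "\<And>e. e > 0 \<Longrightarrow> \<exists>d>0. \<forall>y\<in>V. norm (y - x) < d \<longrightarrow> norm (f y - f x - D (y - x)) \<le> e * norm (y - x)"
proof -
  obtain K where K: "\<And>v. v \<in> V \<Longrightarrow> norm (D v) \<le> K * norm v"
    using assms unfolding has_cderiv_within_iff[OF assms(2)] by blast
  have "norm (D v) \<le> max K 1 * norm v" if "v \<in> V" for v
    using K[OF that] by (meson dual_order.trans max.cobounded1 mult_right_mono norm_ge_zero)
  with that[of "max K 1"] show ?thesis
    using assms unfolding has_cderiv_within_iff[OF assms(2)] by auto
qed

lemma has_cderiv_within_subspace:
  assumes "has_cderiv_within f D x V" "csubspace V" "csubspace W" "W \<subseteq> V"
  shows "has_cderiv_within f D x W"
  using assms(1,4) unfolding has_cderiv_within_iff[OF assms(2)] has_cderiv_within_iff[OF assms(3)]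
    clinear_on_def by (meson subsetD)

lemma has_cderiv_within_cong:
  assumes "has_cderiv_within f D x V" "csubspace V" "d > 0" "f x = g x"
    "\<And>y. y \<in> V \<Longrightarrow> norm (y - x) < d \<Longrightarrow> f y = g y"
  shows "has_cderiv_within g D x V"
  unfolding has_cderiv_within_iff[OF assms(2)]
proof (intro conjI allI impI)
  show "clinear_on V D" "\<exists>K. \<forall>v\<in>V. norm (D v) \<le> K * norm v"
    using assms(1) unfolding has_cderiv_within_def by auto
  fix e :: real assume "e > 0"
  then obtain d' where "d' > 0" and d': "\<And>y. y \<in> V \<Longrightarrow> norm (y - x) < d' \<Longrightarrow>
      norm (f y - f x - D (y - x)) \<le> e * norm (y - x)"
    using assms(1) unfolding has_cderiv_within_iff[OF assms(2)] by blast
  then show "\<exists>d>0. \<forall>y\<in>V. norm (y - x) < d \<longrightarrow> norm (g y - g x - D (y - x)) \<le> e * norm (y - x)"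
    using assms(3-5) by (intro exI[of _ "min d d'"]) (metis min_less_iff_conj)
qed

lemma has_cderiv_within_continuous:
  assumes "has_cderiv_within f D x V" "csubspace V" "e > 0"
  shows "\<exists>d>0. \<forall>y\<in>V. x \<in> V \<longrightarrow> norm (y - x) < d \<longrightarrow> norm (f y - f x) < e"
proof -
  from has_cderiv_withinD[OF assms(1,2)] obtain K where K: "K > 0" "\<And>v. v \<in> V \<Longrightarrow> norm (D v) \<le> K * norm v"
    "\<exists>d>0. \<forall>y\<in>V. norm (y - x) < d \<longrightarrow> norm (f y - f x - D (y - x)) \<le> 1 * norm (y - x)"
    by (metis zero_less_one)
  then obtain d where d: "d > 0"
    "\<And>y. y \<in> V \<Longrightarrow> norm (y - x) < d \<Longrightarrow> norm (f y - f x - D (y - x)) \<le> norm (y - x)" by auto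
  show ?thesis
  proof (intro exI[of _ "min d (e / (K + 1))"] conjI ballI impI)
    show "0 < min d (e / (K + 1))" using d K assms(3) by auto
    fix y assume y: "y \<in> V" "x \<in> V" "norm (y - x) < min d (e / (K + 1))"
    have "norm (f y - f x) \<le> norm (f y - f x - D (y - x)) + norm (D (y - x))"
      by (metis diff_add_cancel norm_triangle_ineq)
    also have "\<dots> \<le> norm (y - x) + K * norm (y - x)"
      using d(2)[of y] K(2)[of "y - x"] y csubspace_diff[OF assms(2)] by (intro add_mono) auto
    also have "\<dots> = norm (y - x) * (K + 1)" by (simp add: algebra_simps)
    also have "\<dots> < e" using y K(1) by (simp add: pos_less_divide_eq)
    finally show "norm (f y - f x) < e" .
  qed
qed

lemma canalytic_on_imp_continuous_on:
  assumes "canalytic_on V f W" "csubspace V" "W \<subseteq> V"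
  shows "continuous_on W f"
  unfolding continuous_on_iff
proof (intro ballI allI impI)
  fix x and e :: real assume x: "x \<in> W" and "e > 0"
  with assms obtain D where "has_cderiv_within f D x V" by (auto simp: canalytic_on_def)
  from has_cderiv_within_continuous[OF this assms(2) \<open>e > 0\<close>] x assms(3)
  show "\<exists>d>0. \<forall>x'\<in>W. dist x' x < d \<longrightarrow> dist (f x') (f x) < e"
    unfolding dist_norm by blast
qed

text \<open>The derivative takes its values in \<open>V'\<close> because \<open>V'\<close> is closed; this is needed since the
  derivative of the outer map is only linear on \<open>V'\<close>.\<close>

lemma has_cderiv_within_range:
  assumes f: "has_cderiv_within f D x V" and V: "csubspace V" "x \<in> V"
    and V': "csubspace V'" "closed V'"
    and d: "d > 0" "\<And>y. y \<in> V \<Longrightarrow> norm (y - x) < d \<Longrightarrow> f y \<in> V'"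
    and v: "v \<in> V"
  shows "D v \<in> V'"
proof (cases "v = 0")
  case True
  then show ?thesis using f V'(1)
    by (metis V(1) clinear_on_0 csubspace_0 has_cderiv_within_def)
next
  case False
  have lin: "clinear_on V D" using f by (auto simp: has_cderiv_within_def)
  have "D v \<in> closure V'"
    unfolding closure_approachable
  proof (intro allI impI)
    fix e :: real assume e: "e > 0"
    obtain d' where d': "d' > 0" "\<And>y. y \<in> V \<Longrightarrow> norm (y - x) < d' \<Longrightarrow>
        norm (f y - f x - D (y - x)) \<le> e / (2 * norm v) * norm (y - x)"
      using has_cderiv_withinD[OF f V(1)] e False
      by (metis divide_pos_pos mult_pos_pos zero_less_norm_iff zero_less_numeral)
    \<comment> \<open>A step of half the smaller radius: \<open>x + t v\<close> then satisfies both
      local hypotheses, and the difference quotient along \<open>v\<close>, which lies in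
      \<open>V'\<close>, is within \<open>e\<close> of \<open>D v\<close>.\<close>
    define t where "t = min d d' / (2 * norm v)"
    have t: "t > 0" "norm (t *\<^sub>R v) < d" "norm (t *\<^sub>R v) < d'"
      using d(1) d'(1) False by (auto simp: t_def)
    have y: "x + t *\<^sub>R v \<in> V" using V v by (simp add: csubspaceD)
    have "norm (f (x + t *\<^sub>R v) - f x - D (t *\<^sub>R v)) \<le> e / (2 * norm v) * norm (t *\<^sub>R v)"
      using d'(2)[OF y] t by simp
    also have "\<dots> = t * (e / 2)" using t False by simp
    also have "D (t *\<^sub>R v) = t *\<^sub>R D v" by (rule clinear_on_scaleR[OF lin V(1) v])
    finally have "norm ((1/t) *\<^sub>R (f (x + t *\<^sub>R v) - f x - t *\<^sub>R D v)) \<le> e / 2"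
      using t(1) by (simp add: pos_divide_le_eq mult.commute)
    then have "norm ((1/t) *\<^sub>R (f (x + t *\<^sub>R v) - f x) - D v) < e"
      using t(1) e by (simp add: scaleR_diff_right)
    moreover have "(1/t) *\<^sub>R (f (x + t *\<^sub>R v) - f x) \<in> V'"
      using d V y t by (intro csubspace_scaleR[OF V'(1)] csubspace_diff[OF V'(1)]) auto
    ultimately show "\<exists>w\<in>V'. dist w (D v) < e" by (auto simp: dist_norm)
  qed
  then show ?thesis using V'(2) by simp
qed

lemma has_cderiv_within_compose:
  assumes f: "has_cderiv_within f D x V" and V: "csubspace V" "x \<in> V"
    and g: "has_cderiv_within g D' (f x) V'" and V': "csubspace V'" "closed V'"
    and d: "d > 0" "\<And>y. y \<in> V \<Longrightarrow> norm (y - x) < d \<Longrightarrow> f y \<in> V'"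
  shows "has_cderiv_within (g \<circ> f) (D' \<circ> D) x V"
proof -
  obtain K where K: "clinear_on V D" "K > 0" "\<And>v. v \<in> V \<Longrightarrow> norm (D v) \<le> K * norm v"
    "\<And>e. e > 0 \<Longrightarrow> \<exists>d>0. \<forall>y\<in>V. norm (y - x) < d \<longrightarrow> norm (f y - f x - D (y - x)) \<le> e * norm (y - x)"
    by (rule has_cderiv_withinD[OF f V(1)]) (rule that; blast)
  obtain K' where K': "clinear_on V' D'" "K' > 0" "\<And>v. v \<in> V' \<Longrightarrow> norm (D' v) \<le> K' * norm v"
    "\<And>e. e > 0 \<Longrightarrow> \<exists>d>0. \<forall>y\<in>V'. norm (y - f x) < d \<longrightarrow> norm (g y - g (f x) - D' (y - f x)) \<le> e * norm (y - f x)"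
    by (rule has_cderiv_withinD[OF g V'(1)]) (rule that; blast)
  have DV: "D v \<in> V'" if "v \<in> V" for v
    by (rule has_cderiv_within_range[OF f V V' d that])
  have fx: "f x \<in> V'" using d(2)[OF V(2)] d(1) by simp
  show ?thesis
    unfolding has_cderiv_within_iff[OF V(1)]
  proof (intro conjI allI impI)
    show "clinear_on V (D' \<circ> D)"
      using K(1) K'(1) DV by (auto simp: clinear_on_def)
    show "\<exists>C. \<forall>v\<in>V. norm ((D' \<circ> D) v) \<le> C * norm v"
    proof (intro exI[of _ "K' * K"] ballI)
      fix v assume v: "v \<in> V"
      have "norm (D' (D v)) \<le> K' * norm (D v)" using K'(3) DV v by blast
      also have "\<dots> \<le> K' * (K * norm v)" using K(3)[OF v] K'(2) by simp
      finally show "norm ((D' \<circ> D) v) \<le> K' * K * norm v" by (simp add: mult.assoc)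
    qed
    fix e :: real assume e: "e > 0"
    \<comment> \<open>Half of \<open>e\<close> goes to each error: the remainder of \<open>f\<close>
      is multiplied by \<open>K'\<close> when \<open>D'\<close> is applied, and the remainder of
      \<open>g\<close> is measured against \<open>f y - f x\<close>, which is at most
      \<open>(K + e1) * norm (y - x)\<close>.\<close>
    define e1 where "e1 = e / (2 * K')"
    define e2 where "e2 = e / (2 * (K + e1))"
    have e1: "e1 > 0" and e2: "e2 > 0" using e K(2) K'(2) by (auto simp: e1_def e2_def add_pos_pos)
    obtain d1 where d1: "d1 > 0" "\<And>y. y \<in> V \<Longrightarrow> norm (y - x) < d1 \<Longrightarrow> norm (f y - f x - D (y - x)) \<le> e1 * norm (y - x)"
      using K(4)[OF e1] by auto
    obtain d2 where d2: "d2 > 0" "\<And>y. y \<in> V' \<Longrightarrow> norm (y - f x) < d2 \<Longrightarrow> norm (g y - g (f x) - D' (y - f x)) \<le> e2 * norm (y - f x)"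
      using K'(4)[OF e2] by auto
    obtain d3 where d3: "d3 > 0" "\<And>y. y \<in> V \<Longrightarrow> norm (y - x) < d3 \<Longrightarrow> norm (f y - f x) < d2"
      using has_cderiv_within_continuous[OF f V(1) d2(1)] V(2) by blast
    show "\<exists>d>0. \<forall>y\<in>V. norm (y - x) < d \<longrightarrow>
        norm ((g \<circ> f) y - (g \<circ> f) x - (D' \<circ> D) (y - x)) \<le> e * norm (y - x)"
    proof (intro exI[of _ "min d (min d1 d3)"] conjI ballI impI)
      show "0 < min d (min d1 d3)" using d(1) d1(1) d3(1) by simp
      fix y assume y: "y \<in> V" "norm (y - x) < min d (min d1 d3)"
      have fy: "f y \<in> V'" using d(2) y by simp
      have yx: "y - x \<in> V" using csubspace_diff[OF V(1)] y V by blast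
      have A: "norm (f y - f x - D (y - x)) \<le> e1 * norm (y - x)" using d1(2) y by simp
      have "norm (f y - f x) \<le> norm (f y - f x - D (y - x)) + norm (D (y - x))"
        by (metis diff_add_cancel norm_triangle_ineq)
      also have "\<dots> \<le> (K + e1) * norm (y - x)" using A K(3)[OF yx] by (simp add: algebra_simps)
      finally have B: "norm (f y - f x) \<le> (K + e1) * norm (y - x)" .
      have "norm (g (f y) - g (f x) - D' (f y - f x)) \<le> e2 * norm (f y - f x)"
        using d2(2) fy d3(2) y by simp
      also have "\<dots> \<le> e2 * ((K + e1) * norm (y - x))" using B e2 by simp
      also have "\<dots> = e/2 * norm (y - x)"
      proof -
        have "K + e1 \<noteq> 0" using e1 K(2) by simp
        then have "e2 * (K + e1) = e/2" unfolding e2_def by (simp only: divide_divide_eq_left[symmetric] nonzero_eq_divide_eq times_divide_eq_left) simp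
        then show ?thesis by (simp only: mult.assoc[symmetric])
      qed
      finally have C: "norm (g (f y) - g (f x) - D' (f y - f x)) \<le> e/2 * norm (y - x)" .
      have w: "f y - f x - D (y - x) \<in> V'" using fy fx DV[OF yx] V'(1) by (simp add: csubspaceD)
      have "norm (D' (f y - f x - D (y - x))) \<le> K' * (e1 * norm (y - x))"
        using K'(3)[OF w] A K'(2) by (meson dual_order.trans mult_le_cancel_left_pos)
      also have "\<dots> = e/2 * norm (y - x)" using K'(2) by (simp add: e1_def)
      also have "D' (f y - f x - D (y - x)) = D' (f y - f x) - D' (D (y - x))"
        using fy fx DV[OF yx] V'(1) by (intro clinear_on_diff[OF K'(1) V'(1)]) (auto simp: csubspaceD)
      finally have "norm (D' (f y - f x) - D' (D (y - x))) \<le> e/2 * norm (y - x)" .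
      with C have "norm ((g (f y) - g (f x) - D' (f y - f x)) + (D' (f y - f x) - D' (D (y - x))))
          \<le> e * norm (y - x)"
        using norm_triangle_ineq[of "g (f y) - g (f x) - D' (f y - f x)" "D' (f y - f x) - D' (D (y - x))"]
        by (simp add: field_simps)
      then show "norm ((g \<circ> f) y - (g \<circ> f) x - (D' \<circ> D) (y - x)) \<le> e * norm (y - x)" by simp
    qed
  qed
qed

lemma has_cderiv_within_linear:
  assumes "clinear_on V f" "csubspace V" "\<And>v. v \<in> V \<Longrightarrow> norm (f v) \<le> K * norm v" "x \<in> V"
  shows "has_cderiv_within f f x V"
  unfolding has_cderiv_within_iff[OF assms(2)]
proof (intro conjI allI impI)
  show "\<exists>K. \<forall>v\<in>V. norm (f v) \<le> K * norm v" using assms(3) by blast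
  fix e :: real assume "e > 0"
  then show "\<exists>d>0. \<forall>y\<in>V. norm (y - x) < d \<longrightarrow> norm (f y - f x - f (y - x)) \<le> e * norm (y - x)"
    using clinear_on_diff[OF assms(1,2)] assms(4) by (intro exI[of _ "1::real"]) simp
qed (rule assms)

lemma has_cderiv_within_const: "csubspace V \<Longrightarrow> has_cderiv_within (\<lambda>_. c) (\<lambda>_. 0) x V"
  by (auto simp: has_cderiv_within_iff clinear_on_def intro!: exI[of _ "1::real"])

lemma has_cderiv_within_add:
  assumes f: "has_cderiv_within f D x V" and g: "has_cderiv_within g D' x V" and V: "csubspace V"
  shows "has_cderiv_within (\<lambda>y. f y + g y) (\<lambda>v. D v + D' v) x V"
proof -
  obtain K where K: "clinear_on V D" "K > 0" "\<And>v. v \<in> V \<Longrightarrow> norm (D v) \<le> K * norm v"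
    "\<And>e. e > 0 \<Longrightarrow> \<exists>d>0. \<forall>y\<in>V. norm (y - x) < d \<longrightarrow> norm (f y - f x - D (y - x)) \<le> e * norm (y - x)"
    by (rule has_cderiv_withinD[OF f V(1)]) (rule that; blast)
  obtain K' where K': "clinear_on V D'" "K' > 0" "\<And>v. v \<in> V \<Longrightarrow> norm (D' v) \<le> K' * norm v"
    "\<And>e. e > 0 \<Longrightarrow> \<exists>d>0. \<forall>y\<in>V. norm (y - x) < d \<longrightarrow> norm (g y - g x - D' (y - x)) \<le> e * norm (y - x)"
    by (rule has_cderiv_withinD[OF g V(1)]) (rule that; blast)
  show ?thesis
    unfolding has_cderiv_within_iff[OF V(1)]
  proof (intro conjI allI impI)
    show "clinear_on V (\<lambda>v. D v + D' v)"
      using K(1) K'(1) by (auto simp: clinear_on_def scaleC_add_right)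
    show "\<exists>K. \<forall>v\<in>V. norm (D v + D' v) \<le> K * norm v"
    proof (intro exI[of _ "K + K'"] ballI)
      fix v assume "v \<in> V"
      then show "norm (D v + D' v) \<le> (K + K') * norm v"
        using norm_triangle_ineq[of "D v" "D' v"] K(3)[of v] K'(3)[of v] by (simp add: distrib_right)
    qed
    fix e :: real assume e: "e > 0"
    obtain d1 where d1: "d1 > 0" "\<And>y. y \<in> V \<Longrightarrow> norm (y - x) < d1 \<Longrightarrow> norm (f y - f x - D (y - x)) \<le> e/2 * norm (y - x)"
      using K(4)[of "e/2"] e by auto
    obtain d2 where d2: "d2 > 0" "\<And>y. y \<in> V \<Longrightarrow> norm (y - x) < d2 \<Longrightarrow> norm (g y - g x - D' (y - x)) \<le> e/2 * norm (y - x)"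
      using K'(4)[of "e/2"] e by auto
    show "\<exists>d>0. \<forall>y\<in>V. norm (y - x) < d \<longrightarrow>
        norm (f y + g y - (f x + g x) - (D (y - x) + D' (y - x))) \<le> e * norm (y - x)"
    proof (intro exI[of _ "min d1 d2"] conjI ballI impI)
      fix y assume y: "y \<in> V" "norm (y - x) < min d1 d2"
      have "norm (f y + g y - (f x + g x) - (D (y - x) + D' (y - x)))
        = norm ((f y - f x - D (y - x)) + (g y - g x - D' (y - x)))" by (simp add: algebra_simps)
      also have "\<dots> \<le> e/2 * norm (y - x) + e/2 * norm (y - x)"
        using d1(2)[of y] d2(2)[of y] y by (intro order_trans[OF norm_triangle_ineq add_mono]) auto
      finally show "norm (f y + g y - (f x + g x) - (D (y - x) + D' (y - x))) \<le> e * norm (y - x)"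
        by simp
    qed (use d1 d2 in auto)
  qed
qed

lemma has_cderiv_within_Pair:
  assumes f: "has_cderiv_within f D x V" and g: "has_cderiv_within g D' x V"
    and V: "csubspace V" "x \<in> V"
  shows "has_cderiv_within (\<lambda>y. (f y, g y)) (\<lambda>v. (D v, D' v)) x V"
proof -
  have 1: "has_cderiv_within (\<lambda>y. (f y, 0::'c)) (\<lambda>v. (D v, 0)) x V"
  proof -
    have "has_cderiv_within (\<lambda>z::'b. (z, 0::'c)) (\<lambda>z. (z, 0)) (f x) UNIV"
      by (rule has_cderiv_within_linear[where K = 1])
        (auto simp: clinear_on_def csubspace_def scaleC_prod_def)
    from has_cderiv_within_compose[OF f V this, of 1] show ?thesis
      by (simp add: o_def csubspace_def)
  qed
  have 2: "has_cderiv_within (\<lambda>y. (0::'b, g y)) (\<lambda>v. (0, D' v)) x V"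
  proof -
    have "has_cderiv_within (\<lambda>z::'c. (0::'b, z)) (\<lambda>z. (0, z)) (g x) UNIV"
      by (rule has_cderiv_within_linear[where K = 1])
        (auto simp: clinear_on_def csubspace_def scaleC_prod_def)
    from has_cderiv_within_compose[OF g V this, of 1] show ?thesis
      by (simp add: o_def csubspace_def)
  qed
  show ?thesis using has_cderiv_within_add[OF 1 2 V(1)] by simp
qed

text \<open>Complex homogeneity of the product in its second factor is only required on \<open>W\<close>, since
  real-linear operators on the left would not respect it.\<close>

lemma has_cderiv_within_bilinear:
  assumes f: "has_cderiv_within f D x V" and g: "has_cderiv_within g D' x V"
    and V: "csubspace V" "x \<in> V"
    and B: "bounded_bilinear (\<lambda>a b :: 'c::complex_normed_vector. mlt a b :: 'd::complex_normed_vector)"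
    and B1: "\<And>c a b. mlt (c *\<^sub>C a) b = c *\<^sub>C mlt a b"
    and B2: "\<And>c a b. a \<in> W \<Longrightarrow> mlt a (c *\<^sub>C b) = c *\<^sub>C mlt a b"
    and W: "f x \<in> W"
  shows "has_cderiv_within (\<lambda>y. mlt (f y) (g y)) (\<lambda>v. mlt (D v) (g x) + mlt (f x) (D' v)) x V"
proof -
  interpret B: bounded_bilinear mlt by (rule B)
  obtain C where C: "C > 0" "\<And>a b. norm (mlt a b) \<le> norm a * norm b * C" using B.pos_bounded by auto
  obtain K where K: "clinear_on V D" "K > 0" "\<And>v. v \<in> V \<Longrightarrow> norm (D v) \<le> K * norm v"
    "\<And>e. e > 0 \<Longrightarrow> \<exists>d>0. \<forall>y\<in>V. norm (y - x) < d \<longrightarrow> norm (f y - f x - D (y - x)) \<le> e * norm (y - x)"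
    by (rule has_cderiv_withinD[OF f V(1)]) (rule that; blast)
  obtain K' where K': "clinear_on V D'" "K' > 0" "\<And>v. v \<in> V \<Longrightarrow> norm (D' v) \<le> K' * norm v"
    "\<And>e. e > 0 \<Longrightarrow> \<exists>d>0. \<forall>y\<in>V. norm (y - x) < d \<longrightarrow> norm (g y - g x - D' (y - x)) \<le> e * norm (y - x)"
    by (rule has_cderiv_withinD[OF g V(1)]) (rule that; blast)
  show ?thesis
    unfolding has_cderiv_within_iff[OF V(1)]
  proof (intro conjI allI impI)
    show "clinear_on V (\<lambda>v. mlt (D v) (g x) + mlt (f x) (D' v))"
      using K(1) K'(1) B1 B2[OF W]
      by (auto simp: clinear_on_def scaleC_add_right B.add_left B.add_right)
    show "\<exists>L. \<forall>v\<in>V. norm (mlt (D v) (g x) + mlt (f x) (D' v)) \<le> L * norm v"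
    proof (intro exI[of _ "K * norm (g x) * C + norm (f x) * K' * C"] ballI)
      fix v assume v: "v \<in> V"
      have "norm (mlt (D v) (g x)) \<le> (K * norm v) * norm (g x) * C"
        using C(1) K(3)[OF v] by (intro order_trans[OF C(2)] mult_right_mono) auto
      moreover have "norm (mlt (f x) (D' v)) \<le> norm (f x) * (K' * norm v) * C"
        using C(1) K'(3)[OF v] by (intro order_trans[OF C(2)] mult_right_mono mult_left_mono) auto
      ultimately show "norm (mlt (D v) (g x) + mlt (f x) (D' v)) \<le> (K * norm (g x) * C + norm (f x) * K' * C) * norm v"
        by (intro order_trans[OF norm_triangle_ineq]) (simp add: algebra_simps)
    qed
    fix e :: real assume e: "e > 0"
    \<comment> \<open>The error of the product splits into the remainder of \<open>f\<close> against
      \<open>g y\<close>, the remainder of \<open>g\<close> against \<open>f x\<close>, and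
      \<open>D\<close> against the increment of \<open>g\<close>; each receives a third of
      \<open>e\<close>.\<close>
    define e1 where "e1 = e / (3 * (C * (norm (g x) + 1)))"
    define e2 where "e2 = e / (3 * (C * (norm (f x) + 1)))"
    define e3 where "e3 = e / (3 * (C * K))"
    have pos: "norm (g x) + 1 > 0" "norm (f x) + 1 > 0" by (auto intro: add_nonneg_pos)
    have e123: "e1 > 0" "e2 > 0" "e3 > 0"
      using e C(1) K(2) pos by (auto simp: e1_def e2_def e3_def)
    obtain d1 where d1: "d1 > 0" "\<And>y. y \<in> V \<Longrightarrow> norm (y - x) < d1 \<Longrightarrow> norm (f y - f x - D (y - x)) \<le> e1 * norm (y - x)"
      using K(4)[OF e123(1)] by auto
    obtain d2 where d2: "d2 > 0" "\<And>y. y \<in> V \<Longrightarrow> norm (y - x) < d2 \<Longrightarrow> norm (g y - g x - D' (y - x)) \<le> e2 * norm (y - x)"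
      using K'(4)[OF e123(2)] by auto
    obtain d3 where d3: "d3 > 0" "\<And>y. y \<in> V \<Longrightarrow> norm (y - x) < d3 \<Longrightarrow> norm (g y - g x) < min e3 1"
      using has_cderiv_within_continuous[OF g V(1), of "min e3 1"] V(2) e123 by (metis min_less_iff_conj zero_less_one)
    show "\<exists>d>0. \<forall>y\<in>V. norm (y - x) < d \<longrightarrow>
        norm (mlt (f y) (g y) - mlt (f x) (g x) - (mlt (D (y - x)) (g x) + mlt (f x) (D' (y - x)))) \<le> e * norm (y - x)"
    proof (intro exI[of _ "min d1 (min d2 d3)"] conjI ballI impI)
      fix y assume y: "y \<in> V" "norm (y - x) < min d1 (min d2 d3)"
      define n where "n = norm (y - x)"
      have yx: "y - x \<in> V" using csubspace_diff[OF V(1)] y V by blast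
      have gy: "norm (g y) \<le> norm (g x) + 1"
        using d3(2)[of y] y norm_triangle_ineq[of "g y - g x" "g x"] by simp
      have "norm (mlt (f y - f x - D (y - x)) (g y)) \<le> (e1 * n) * (norm (g x) + 1) * C"
        using d1(2)[of y] y gy C(1) e123 unfolding n_def
        by (intro order_trans[OF C(2)] mult_right_mono mult_mono) auto
      also have "\<dots> = e/3 * n" using C(1) pos by (simp add: e1_def)
      finally have 1: "norm (mlt (f y - f x - D (y - x)) (g y)) \<le> e/3 * n" .
      have "norm (mlt (f x) (g y - g x - D' (y - x))) \<le> (norm (f x) + 1) * (e2 * n) * C"
        using d2(2)[of y] y C(1) e123 unfolding n_def
        by (intro order_trans[OF C(2)] mult_right_mono mult_mono) auto
      also have "\<dots> = e/3 * n" using C(1) pos by (simp add: e2_def)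
      finally have 2: "norm (mlt (f x) (g y - g x - D' (y - x))) \<le> e/3 * n" .
      have "norm (mlt (D (y - x)) (g y - g x)) \<le> (K * n) * e3 * C"
        using d3(2)[of y] y K(3)[OF yx] C(1) K(2) e123 unfolding n_def
        by (intro order_trans[OF C(2)] mult_right_mono mult_mono) auto
      also have "\<dots> = e/3 * n" using C(1) K(2) by (simp add: e3_def)
      finally have 3: "norm (mlt (D (y - x)) (g y - g x)) \<le> e/3 * n" .
      have "mlt (f y) (g y) - mlt (f x) (g x) - (mlt (D (y - x)) (g x) + mlt (f x) (D' (y - x)))
        = mlt (f y - f x - D (y - x)) (g y) + mlt (f x) (g y - g x - D' (y - x)) + mlt (D (y - x)) (g y - g x)"
        by (simp add: B.diff_left B.diff_right)
      also have "norm \<dots> \<le> e/3 * n + e/3 * n + e/3 * n"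
        using 1 2 3 by (intro order_trans[OF norm_triangle_ineq add_mono]) auto
      finally show "norm (mlt (f y) (g y) - mlt (f x) (g x) - (mlt (D (y - x)) (g x) + mlt (f x) (D' (y - x)))) \<le> e * norm (y - x)"
        by (simp add: n_def)
    qed (use d1 d2 d3 in auto)
  qed
qed

section \<open>Differentiability in charts\<close>

text \<open>Differentiability at a single point, so that charts may be exchanged point by point. Of
  the target chart only the map \<open>\<psi>\<close> enters; its domain and model space are carried
  along so that the triple can be a chart.\<close>

definition cdiff_at ::
  "('x \<Rightarrow> 'y) \<Rightarrow> ('x, 'a::complex_normed_vector) chart \<Rightarrow> ('y, 'b::complex_normed_vector) chart \<Rightarrow> 'x \<Rightarrow> bool" where
  "cdiff_at f = (\<lambda>(U, \<phi>, V) (U', \<psi>, V') x. \<exists>D. has_cderiv_within (\<psi> \<circ> f \<circ> inv_into U \<phi>) D (\<phi> x) V)"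

lemma canalytic_map_iff:
  fixes A :: "('x, 'a::complex_normed_vector) chart set" and B :: "('y, 'b::complex_normed_vector) chart set"
  shows "canalytic_map X A Y B f \<longleftrightarrow> continuous_map X Y f \<and>
    (\<forall>c\<in>A. \<forall>d\<in>B. \<forall>x. x \<in> fst c \<longrightarrow> f x \<in> fst d \<longrightarrow> cdiff_at f c d x)"
proof -
  have "canalytic_on (snd (snd c)) (fst (snd d) \<circ> f \<circ> inv_into (fst c) (fst (snd c)))
      (fst (snd c) ` (fst c \<inter> f -` fst d)) \<longleftrightarrow> (\<forall>x. x \<in> fst c \<longrightarrow> f x \<in> fst d \<longrightarrow> cdiff_at f c d x)"
    for c :: "('x, 'a) chart" and d :: "('y, 'b) chart"
    by (auto simp: canalytic_on_def cdiff_at_def split_beta)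
  then show ?thesis by (simp add: canalytic_map_def split_beta)
qed

lemma compatible_charts_iff:
  "compatible_charts c d \<longleftrightarrow> (\<forall>x. x \<in> fst c \<longrightarrow> x \<in> fst d \<longrightarrow> cdiff_at id c d x \<and> cdiff_at id d c x)"
proof -
  obtain U \<phi> V U' \<psi> V' where [simp]: "c = (U, \<phi>, V)" "d = (U', \<psi>, V')" by (cases c, cases d)
  show ?thesis by (auto simp: compatible_charts_def canalytic_on_def cdiff_at_def)
qed

lemma chart_onD:
  assumes "chart_on X (U, \<phi>, V)"
  shows chart_on_openin: "openin X U" and chart_on_csubspace: "csubspace V"
    and chart_on_complete: "complete V" and chart_on_closed: "closed V"
    and chart_on_inj: "inj_on \<phi> U" and chart_on_image_subset: "\<phi> ` U \<subseteq> V"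
    and chart_on_homeomorphic: "homeomorphic_map (subtopology X U) (top_of_set (\<phi> ` U)) \<phi>"
    and chart_on_image_open: "openin (top_of_set V) (\<phi> ` U)"
proof -
  note * = assms[unfolded chart_on_def split]
  show "openin X U" "csubspace V" "complete V"
    "homeomorphic_map (subtopology X U) (top_of_set (\<phi> ` U)) \<phi>" "openin (top_of_set V) (\<phi> ` U)"
    using * by auto
  then show "closed V" "\<phi> ` U \<subseteq> V" by (auto simp: complete_imp_closed openin_imp_subset)
  show "inj_on \<phi> U"
    using * openin_subset[of X U] by (auto simp: homeomorphic_map_def topspace_subtopology Int_absorb1)
qed

text \<open>Carries an open set of the manifold over to a relative ball of the model space, the form
  in which the rules for derivatives take local hypotheses.\<close>

lemma chart_nbhd:
  assumes c: "chart_on X (U, \<phi>, V)" and x: "x \<in> U" and S: "openin X S" "x \<in> S"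
  obtains d where "d > 0" "\<And>y. y \<in> V \<Longrightarrow> norm (y - \<phi> x) < d \<Longrightarrow> y \<in> \<phi> ` (U \<inter> S)"
proof -
  have "openin (subtopology X U) (U \<inter> S)"
    using S(1) by (auto simp: openin_subtopology)
  then have "openin (top_of_set (\<phi> ` U)) (\<phi> ` (U \<inter> S))"
    using chart_on_homeomorphic[OF c] by (metis homeomorphic_map_openness_eq)
  then have "openin (top_of_set V) (\<phi> ` (U \<inter> S))"
    using chart_on_image_open[OF c] openin_trans by blast
  then show ?thesis using x S(2) that unfolding openin_euclidean_subtopology_iff
    by (metis IntI dist_norm imageI)
qed

lemma cdiff_at_cong:
  assumes c: "chart_on X c" and x: "x \<in> fst c" and S: "openin X S" "x \<in> S"
    and eq: "\<And>u. u \<in> fst c \<Longrightarrow> u \<in> S \<Longrightarrow> f u = g u" and f: "cdiff_at f c d x"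
  shows "cdiff_at g c d x"
proof -
  obtain U \<phi> V where [simp]: "c = (U, \<phi>, V)" by (cases c)
  obtain U' \<psi> V' where [simp]: "d = (U', \<psi>, V')" by (cases d)
  note c' = c[simplified]
  obtain D where D: "has_cderiv_within (\<psi> \<circ> f \<circ> inv_into U \<phi>) D (\<phi> x) V"
    using f by (auto simp: cdiff_at_def)
  obtain e where e: "e > 0" "\<And>y. y \<in> V \<Longrightarrow> norm (y - \<phi> x) < e \<Longrightarrow> y \<in> \<phi> ` (U \<inter> S)"
    using chart_nbhd[OF c' _ S] x by auto
  have "has_cderiv_within (\<psi> \<circ> g \<circ> inv_into U \<phi>) D (\<phi> x) V"
  proof (rule has_cderiv_within_cong[OF D chart_on_csubspace[OF c'] e(1)])
    show "(\<psi> \<circ> f \<circ> inv_into U \<phi>) (\<phi> x) = (\<psi> \<circ> g \<circ> inv_into U \<phi>) (\<phi> x)"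
      using x S(2) eq chart_on_inj[OF c'] by (simp add: inv_into_f_f)
    fix y assume "y \<in> V" "norm (y - \<phi> x) < e"
    then obtain u where u: "u \<in> U" "u \<in> S" "y = \<phi> u" using e(2) by blast
    then show "(\<psi> \<circ> f \<circ> inv_into U \<phi>) y = (\<psi> \<circ> g \<circ> inv_into U \<phi>) y"
      using eq chart_on_inj[OF c'] by (simp add: inv_into_f_f)
  qed
  then show ?thesis by (auto simp: cdiff_at_def)
qed

text \<open>The composite of the two representatives is the representative of
  \<open>g \<circ> f\<close> only where \<open>f\<close> stays in the domain of the middle chart;
  continuity of \<open>f\<close> provides such a neighbourhood. There the values lie in the closed
  model space of the middle chart, as the chain rule asks.\<close>

lemma cdiff_at_compose:
  assumes c: "chart_on X c" and d: "chart_on Y d" and cont: "continuous_map X Y f"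
    and x: "x \<in> fst c" "f x \<in> fst d"
    and f: "cdiff_at f c d x" and g: "cdiff_at g d e (f x)"
  shows "cdiff_at (g \<circ> f) c e x"
proof -
  obtain U \<phi> V where [simp]: "c = (U, \<phi>, V)" by (cases c)
  obtain U' \<psi> V' where [simp]: "d = (U', \<psi>, V')" by (cases d)
  obtain U'' \<xi> V'' where [simp]: "e = (U'', \<xi>, V'')" by (cases e)
  note c' = c[simplified] and d' = d[simplified]
  obtain D where D: "has_cderiv_within (\<psi> \<circ> f \<circ> inv_into U \<phi>) D (\<phi> x) V"
    using f by (auto simp: cdiff_at_def)
  obtain D' where D': "has_cderiv_within (\<xi> \<circ> g \<circ> inv_into U' \<psi>) D' (\<psi> (f x)) V'"
    using g by (auto simp: cdiff_at_def)
  have S: "openin X {u \<in> topspace X. f u \<in> U'}"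
    using cont chart_on_openin[OF d'] by (auto simp: continuous_map)
  have "x \<in> topspace X" using x(1) openin_subset[OF chart_on_openin[OF c']] by auto
  then obtain r where r: "r > 0" "\<And>y. y \<in> V \<Longrightarrow> norm (y - \<phi> x) < r \<Longrightarrow> y \<in> \<phi> ` (U \<inter> {u \<in> topspace X. f u \<in> U'})"
    using chart_nbhd[OF c' _ S] x by auto
  have inv: "inv_into U \<phi> (\<phi> u) = u" if "u \<in> U" for u
    using chart_on_inj[OF c'] that by (rule inv_into_f_f)
  have inv': "inv_into U' \<psi> (\<psi> u) = u" if "u \<in> U'" for u
    using chart_on_inj[OF d'] that by (rule inv_into_f_f)
  have V: "\<phi> x \<in> V" using chart_on_image_subset[OF c'] x by auto
  have "has_cderiv_within ((\<xi> \<circ> g \<circ> inv_into U' \<psi>) \<circ> (\<psi> \<circ> f \<circ> inv_into U \<phi>)) (D' \<circ> D) (\<phi> x) V"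
  proof (rule has_cderiv_within_compose[OF D chart_on_csubspace[OF c'] V _ chart_on_csubspace[OF d'] chart_on_closed[OF d'] r(1)])
    show "has_cderiv_within (\<xi> \<circ> g \<circ> inv_into U' \<psi>) D' ((\<psi> \<circ> f \<circ> inv_into U \<phi>) (\<phi> x)) V'"
      using D' x inv by simp
    fix y assume "y \<in> V" "norm (y - \<phi> x) < r"
    then obtain u where u: "u \<in> U" "f u \<in> U'" "y = \<phi> u" using r(2) by blast
    then show "(\<psi> \<circ> f \<circ> inv_into U \<phi>) y \<in> V'"
      using chart_on_image_subset[OF d'] inv by auto
  qed
  then have "has_cderiv_within (\<xi> \<circ> (g \<circ> f) \<circ> inv_into U \<phi>) (D' \<circ> D) (\<phi> x) V"
  proof (rule has_cderiv_within_cong[OF _ chart_on_csubspace[OF c'] r(1)])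
    fix y assume "y \<in> V" "norm (y - \<phi> x) < r"
    then obtain u where u: "u \<in> U" "f u \<in> U'" "y = \<phi> u" using r(2) by blast
    then show "((\<xi> \<circ> g \<circ> inv_into U' \<psi>) \<circ> (\<psi> \<circ> f \<circ> inv_into U \<phi>)) y = (\<xi> \<circ> (g \<circ> f) \<circ> inv_into U \<phi>) y"
      using inv inv' by simp
  qed (use x inv inv' in simp)
  then show ?thesis by (auto simp: cdiff_at_def)
qed

lemma cdiff_at_id: "chart_on X c \<Longrightarrow> x \<in> fst c \<Longrightarrow> cdiff_at id c c x"
proof -
  assume c: "chart_on X c" and x: "x \<in> fst c"
  obtain U \<phi> V where [simp]: "c = (U, \<phi>, V)" by (cases c)
  note c' = c[simplified]
  have V: "\<phi> x \<in> V" using chart_on_image_subset[OF c'] x by auto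
  obtain r where r: "r > 0" "\<And>y. y \<in> V \<Longrightarrow> norm (y - \<phi> x) < r \<Longrightarrow> y \<in> \<phi> ` (U \<inter> U)"
    using chart_nbhd[OF c' _ chart_on_openin[OF c']] x by auto
  have "has_cderiv_within (\<lambda>y. y) (\<lambda>y. y) (\<phi> x) V"
    by (rule has_cderiv_within_linear[OF _ chart_on_csubspace[OF c'], where K = 1])
      (use V in \<open>auto simp: clinear_on_def\<close>)
  then have "has_cderiv_within (\<phi> \<circ> id \<circ> inv_into U \<phi>) (\<lambda>y. y) (\<phi> x) V"
    by (rule has_cderiv_within_cong[OF _ chart_on_csubspace[OF c'] r(1)])
      (use x r(2) in \<open>auto simp: f_inv_into_f inv_into_f_f\<close>)
  then show ?thesis by (auto simp: cdiff_at_def)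
qed

lemma cdiff_at_change:
  assumes "chart_on X c" "chart_on X c'" "chart_on Y d'" "continuous_map X Y f"
    "x \<in> fst c" "x \<in> fst c'" "f x \<in> fst d'"
    "cdiff_at id c c' x" "cdiff_at f c' d' x" "cdiff_at id d' d (f x)"
  shows "cdiff_at f c d x"
proof -
  have "cdiff_at (f \<circ> id) c d' x"
    by (rule cdiff_at_compose[where Y = X and d = c']) (use assms in \<open>auto simp: id_def\<close>)
  then have "cdiff_at f c d' x" by simp
  from assms this have "cdiff_at (id \<circ> f) c d x"
    by (intro cdiff_at_compose[of X c Y d' f x id d])
  then show ?thesis by simp
qed

text \<open>Analyticity refers to all pairs of charts; changing charts on both sides reduces it to
  one convenient pair at each point. The convenient charts may take values in other types than the
  atlases.\<close>

lemma canalytic_mapI: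
  fixes A :: "('x, 'a::complex_normed_vector) chart set" and B :: "('y, 'b::complex_normed_vector) chart set"
  assumes A: "\<And>c. c \<in> A \<Longrightarrow> chart_on X c" and f: "continuous_map X Y f"
    and loc: "\<And>x. x \<in> topspace X \<Longrightarrow>
      \<exists>(c :: ('x, 'c::complex_normed_vector) chart) (d :: ('y, 'd::complex_normed_vector) chart).
      chart_on X c \<and> chart_on Y d \<and> x \<in> fst c \<and> f x \<in> fst d \<and>
      (\<forall>a\<in>A. x \<in> fst a \<longrightarrow> cdiff_at id a c x) \<and> (\<forall>b\<in>B. f x \<in> fst b \<longrightarrow> cdiff_at id d b (f x)) \<and>
      cdiff_at f c d x"
  shows "canalytic_map X A Y B f"
  unfolding canalytic_map_iff
proof (intro conjI ballI allI impI f)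
  fix a b x assume *: "a \<in> A" "b \<in> B" "x \<in> fst a" "f x \<in> fst b"
  have "x \<in> topspace X"
    using A[OF *(1)] *(3) by (cases a) (auto dest: chart_on_openin openin_subset)
  from loc[OF this] obtain c :: "('x, 'c) chart" and d :: "('y, 'd) chart" where "chart_on X c" "chart_on Y d" "x \<in> fst c" "f x \<in> fst d"
    "\<forall>a\<in>A. x \<in> fst a \<longrightarrow> cdiff_at id a c x" "\<forall>b\<in>B. f x \<in> fst b \<longrightarrow> cdiff_at id d b (f x)"
    "cdiff_at f c d x"
    by (elim exE conjE) (rule that; assumption)
  with A[OF *(1)] f * show "cdiff_at f a b x" by (auto intro: cdiff_at_change[of X a c Y d])
qed

section \<open>Maximal atlases\<close>

lemma chart_on_imp_maximal_atlas:
  assumes "complex_manifold X A" "c \<in> A" shows "c \<in> maximal_atlas X A"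
  using assms by (auto simp: complex_manifold_def maximal_atlas_def)

text \<open>Through any common point passes a chart \<open>e\<close> of \<open>A\<close>; the change
  from \<open>c\<close> to \<open>d\<close> factors through it.\<close>

lemma compatible_charts_maximal:
  assumes A: "complex_manifold X A" and c: "c \<in> maximal_atlas X A" and d: "d \<in> maximal_atlas X A"
  shows "compatible_charts c d"
  unfolding compatible_charts_iff
proof (intro allI impI)
  fix x assume x: "x \<in> fst c" "x \<in> fst d"
  have cd: "chart_on X c" "chart_on X d" using c d by (auto simp: maximal_atlas_def)
  then have "x \<in> topspace X" using x by (cases c) (auto dest: chart_on_openin openin_subset)
  then obtain e where e: "e \<in> A" "x \<in> fst e" using A by (auto simp: complex_manifold_def)
  then have e': "chart_on X e" using A by (auto simp: complex_manifold_def)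
  have "cdiff_at id c e x" "cdiff_at id e c x" "cdiff_at id d e x" "cdiff_at id e d x"
    using c d e x by (auto simp: maximal_atlas_def compatible_charts_iff)
  then show "cdiff_at id c d x \<and> cdiff_at id d c x"
    using cdiff_at_compose[of X c X e id x id d] cdiff_at_compose[of X d X e id x id c] cd e e' x
    by simp
qed

lemma complex_manifold_structure_maximal_atlas:
  assumes A: "complex_manifold X A"
  shows "complex_manifold_structure X (maximal_atlas X A)"
proof -
  have sub: "A \<subseteq> maximal_atlas X A" using chart_on_imp_maximal_atlas[OF A] by blast
  have "complex_manifold X (maximal_atlas X A)"
    unfolding complex_manifold_def
  proof (intro conjI ballI)
    show "Hausdorff_space X" using A by (auto simp: complex_manifold_def)
    show "topspace X \<subseteq> \<Union> (fst ` maximal_atlas X A)"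
      using A sub unfolding complex_manifold_def by blast
    show "chart_on X c" if "c \<in> maximal_atlas X A" for c using that by (simp add: maximal_atlas_def)
    show "compatible_charts c d" if "c \<in> maximal_atlas X A" "d \<in> maximal_atlas X A" for c d
      using that by (rule compatible_charts_maximal[OF A])
  qed
  moreover have "maximal_atlas X (maximal_atlas X A) = maximal_atlas X A"
  proof
    show "maximal_atlas X (maximal_atlas X A) \<subseteq> maximal_atlas X A"
      using sub unfolding maximal_atlas_def by blast
    show "maximal_atlas X A \<subseteq> maximal_atlas X (maximal_atlas X A)"
    proof
      fix c assume c: "c \<in> maximal_atlas X A"
      then have "chart_on X c" by (simp add: maximal_atlas_def)
      with compatible_charts_maximal[OF A c] show "c \<in> maximal_atlas X (maximal_atlas X A)"
        unfolding maximal_atlas_def[of X "maximal_atlas X A"] by blast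
    qed
  qed
  ultimately show ?thesis by (simp add: complex_manifold_structure_def)
qed

section \<open>Products and open restrictions of charts\<close>

lemma complete_Times:
  fixes V :: "'a::metric_space set" and W :: "'b::metric_space set"
  assumes V: "complete V" and W: "complete W"
  shows "complete (V \<times> W)"
  unfolding complete_def
proof (intro allI impI)
  fix f :: "nat \<Rightarrow> 'a \<times> 'b" assume "(\<forall>n. f n \<in> V \<times> W) \<and> Cauchy f"
  then have f: "\<And>n. fst (f n) \<in> V" "\<And>n. snd (f n) \<in> W" "Cauchy f" by (auto simp: mem_Times_iff)
  obtain v w where "v \<in> V" "(\<lambda>n. fst (f n)) \<longlonglongrightarrow> v" "w \<in> W" "(\<lambda>n. snd (f n)) \<longlonglongrightarrow> w"
    using V W f(1,2) Cauchy_fst[OF f(3)] Cauchy_snd[OF f(3)] unfolding complete_def by metis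
  then show "\<exists>l\<in>V \<times> W. f \<longlonglongrightarrow> l"
    using tendsto_Pair[of "\<lambda>n. fst (f n)" v sequentially "\<lambda>n. snd (f n)" w] by force
qed

definition prod_chart where
  "prod_chart = (\<lambda>(U, \<phi>, V) (U', \<psi>, V'). (U \<times> U', map_prod \<phi> \<psi>, V \<times> V'))"

lemma prod_atlas_eq: "prod_atlas A B = {prod_chart c d | c d. c \<in> A \<and> d \<in> B}"
  by (force simp: prod_atlas_def prod_chart_def)

lemma fst_prod_chart [simp]: "fst (prod_chart c d) = fst c \<times> fst d"
  by (auto simp: prod_chart_def split: prod.splits)

lemma chart_on_prod:
  assumes c: "chart_on X c" and d: "chart_on Y d"
  shows "chart_on (prod_topology X Y) (prod_chart c d)"
proof -
  obtain U \<phi> V where [simp]: "c = (U, \<phi>, V)" by (cases c)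
  obtain U' \<psi> V' where [simp]: "d = (U', \<psi>, V')" by (cases d)
  note c' = c[simplified] and d' = d[simplified]
  have e: "map_prod \<phi> \<psi> ` (U \<times> U') = \<phi> ` U \<times> \<psi> ` U'" by auto
  have top: "prod_topology (top_of_set P) (top_of_set Q) = top_of_set (P \<times> Q)" for P :: "'b set" and Q :: "'d set"
    by (simp add: prod_topology_subtopology subtopology_subtopology Int_commute
        flip: euclidean_product_topology) (simp add: Times_Int_Times)
  have "homeomorphic_map (prod_topology (subtopology X U) (subtopology Y U'))
      (prod_topology (top_of_set (\<phi> ` U)) (top_of_set (\<psi> ` U'))) (\<lambda>(x, y). (\<phi> x, \<psi> y))"
  proof -
    obtain g h where "homeomorphic_maps (subtopology X U) (top_of_set (\<phi> ` U)) \<phi> g"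
      "homeomorphic_maps (subtopology Y U') (top_of_set (\<psi> ` U')) \<psi> h"
      using chart_on_homeomorphic[OF c'] chart_on_homeomorphic[OF d'] by (auto simp: homeomorphic_map_maps)
    then have "homeomorphic_maps (prod_topology (subtopology X U) (subtopology Y U'))
      (prod_topology (top_of_set (\<phi> ` U)) (top_of_set (\<psi> ` U')))
      (\<lambda>(x, y). (\<phi> x, \<psi> y)) (\<lambda>(x, y). (g x, h y))"
      unfolding homeomorphic_maps_prod by blast
    then show ?thesis unfolding homeomorphic_map_maps by blast
  qed
  then have "homeomorphic_map (subtopology (prod_topology X Y) (U \<times> U')) (top_of_set (map_prod \<phi> \<psi> ` (U \<times> U'))) (map_prod \<phi> \<psi>)"
    unfolding e subtopology_Times top[symmetric] by (simp only: map_prod_def)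
  moreover have "openin (top_of_set (V \<times> V')) (\<phi> ` U \<times> \<psi> ` U')"
    using chart_on_image_open[OF c'] chart_on_image_open[OF d'] by (simp add: openin_Times)
  ultimately show ?thesis
    using c' d' by (auto simp: chart_on_def prod_chart_def e openin_prod_Times_iff csubspace_Times complete_Times)
qed

text \<open>Projections of products and inclusions have bounded linear representatives in suitable
  charts, so this one rule covers them all.\<close>

lemma cdiff_at_linear_rep:
  assumes c: "chart_on X (U, \<phi>, V)" and x: "x \<in> U"
    and L: "clinear_on V L" "\<And>v. v \<in> V \<Longrightarrow> norm (L v) \<le> K * norm v"
    and eq: "\<And>u. u \<in> U \<Longrightarrow> \<psi> (f u) = L (\<phi> u)"
  shows "cdiff_at f (U, \<phi>, V) (U', \<psi>, V') x"
proof -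
  have V: "\<phi> x \<in> V" using chart_on_image_subset[OF c] x by auto
  obtain r where r: "r > 0" "\<And>y. y \<in> V \<Longrightarrow> norm (y - \<phi> x) < r \<Longrightarrow> y \<in> \<phi> ` (U \<inter> U)"
    using chart_nbhd[OF c x chart_on_openin[OF c] x] by auto
  have "has_cderiv_within L L (\<phi> x) V"
    by (rule has_cderiv_within_linear[OF L(1) chart_on_csubspace[OF c] L(2) V])
  then have "has_cderiv_within (\<psi> \<circ> f \<circ> inv_into U \<phi>) L (\<phi> x) V"
    by (rule has_cderiv_within_cong[OF _ chart_on_csubspace[OF c] r(1)])
      (use x r(2) eq[OF inv_into_into[of _ \<phi> U]] eq[OF x] chart_on_inj[OF c] in \<open>auto simp: inv_into_f_f f_inv_into_f\<close>)
  then show ?thesis by (auto simp: cdiff_at_def)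
qed

lemma cdiff_at_fst:
  assumes "chart_on X c" "chart_on Y d" "p \<in> fst c \<times> fst d"
  shows "cdiff_at fst (prod_chart c d) c p"
proof -
  obtain U \<phi> V where [simp]: "c = (U, \<phi>, V)" by (cases c)
  obtain U' \<psi> V' where [simp]: "d = (U', \<psi>, V')" by (cases d)
  show ?thesis
    using assms(3) chart_on_prod[OF assms(1,2)]
    by (auto simp: prod_chart_def clinear_on_def scaleC_prod_def norm_fst_le
        intro!: cdiff_at_linear_rep[where L = fst and K = 1])
qed

lemma cdiff_at_snd:
  assumes "chart_on X c" "chart_on Y d" "p \<in> fst c \<times> fst d"
  shows "cdiff_at snd (prod_chart c d) d p"
proof -
  obtain U \<phi> V where [simp]: "c = (U, \<phi>, V)" by (cases c)
  obtain U' \<psi> V' where [simp]: "d = (U', \<psi>, V')" by (cases d)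
  show ?thesis
    using assms(3) chart_on_prod[OF assms(1,2)]
    by (auto simp: prod_chart_def clinear_on_def scaleC_prod_def norm_snd_le
        intro!: cdiff_at_linear_rep[where L = snd and K = 1])
qed

lemma cdiff_at_const: "chart_on X c \<Longrightarrow> x \<in> fst c \<Longrightarrow> cdiff_at (\<lambda>_. y) c d x"
  by (cases c; cases d) (auto simp: cdiff_at_def comp_def
      intro!: exI has_cderiv_within_const[OF chart_on_csubspace])

lemma cdiff_at_Pair:
  assumes c: "chart_on X c" and x: "x \<in> fst c"
    and f: "cdiff_at f c d x" and g: "cdiff_at g c e x"
  shows "cdiff_at (\<lambda>x. (f x, g x)) c (prod_chart d e) x"
proof -
  obtain U \<phi> V where [simp]: "c = (U, \<phi>, V)" by (cases c)
  obtain U' \<psi> V' where [simp]: "d = (U', \<psi>, V')" by (cases d)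
  obtain U'' \<xi> V'' where [simp]: "e = (U'', \<xi>, V'')" by (cases e)
  note c' = c[simplified]
  obtain D where D: "has_cderiv_within (\<psi> \<circ> f \<circ> inv_into U \<phi>) D (\<phi> x) V"
    using f by (auto simp: cdiff_at_def)
  obtain D' where D': "has_cderiv_within (\<xi> \<circ> g \<circ> inv_into U \<phi>) D' (\<phi> x) V"
    using g by (auto simp: cdiff_at_def)
  have "\<phi> x \<in> V" using chart_on_image_subset[OF c'] x by auto
  from has_cderiv_within_Pair[OF D D' chart_on_csubspace[OF c'] this]
  show ?thesis by (auto simp: cdiff_at_def prod_chart_def comp_def)
qed

lemma chart_on_open:
  assumes c: "chart_on X (U, \<phi>, V)" and S: "openin X S"
  shows "chart_on X (U \<inter> S, \<phi>, V)" "chart_on (subtopology X S) (U \<inter> S, \<phi>, V)"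
proof -
  have US: "openin X (U \<inter> S)" using chart_on_openin[OF c] S by blast
  have sub: "subtopology (subtopology X U) (U \<inter> S) = subtopology X (U \<inter> S)"
    "subtopology (subtopology X S) (U \<inter> S) = subtopology X (U \<inter> S)"
    by (simp_all add: subtopology_subtopology Int_absorb1 inf_commute inf_left_commute)
  have top: "topspace (subtopology X U) \<inter> (U \<inter> S) = U \<inter> S"
    using openin_subset[OF US] by auto
  have "openin (subtopology X U) (U \<inter> S)" using S by (auto simp: openin_subtopology)
  then have "openin (top_of_set (\<phi> ` U)) (\<phi> ` (U \<inter> S))"
    using chart_on_homeomorphic[OF c] by (metis homeomorphic_map_openness_eq)
  then have o: "openin (top_of_set V) (\<phi> ` (U \<inter> S))"
    using chart_on_image_open[OF c] openin_trans by blast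
  have "homeomorphic_map (subtopology (subtopology X U) (U \<inter> S))
      (subtopology (top_of_set (\<phi> ` U)) (\<phi> ` (U \<inter> S))) \<phi>"
  proof (rule homeomorphic_map_subtopologies[OF chart_on_homeomorphic[OF c]])
    show "\<phi> ` (topspace (subtopology X U) \<inter> (U \<inter> S)) = topspace (top_of_set (\<phi> ` U)) \<inter> \<phi> ` (U \<inter> S)"
      unfolding top by auto
  qed
  then have "homeomorphic_map (subtopology X (U \<inter> S)) (top_of_set (\<phi> ` (U \<inter> S))) \<phi>"
    unfolding sub by (simp add: subtopology_subtopology Int_absorb1 image_mono)
  then show "chart_on X (U \<inter> S, \<phi>, V)" "chart_on (subtopology X S) (U \<inter> S, \<phi>, V)"
    using c US o S by (auto simp: chart_on_def sub openin_open_subtopology)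
qed

text \<open>In the coordinates \<open>\<phi>\<close> the inclusion is the identity. The two model
  spaces may differ, so this serves open subsets and submanifolds alike.\<close>

lemma cdiff_at_inclusion:
  assumes c: "chart_on X (U', \<phi>, V')" and x: "x \<in> U'" and inj: "inj_on \<phi> U" and sub: "U' \<subseteq> U"
  shows "cdiff_at id (U', \<phi>, V') (U, \<phi>, V) x"
  by (rule cdiff_at_linear_rep[OF c x, where L = "\<lambda>v. v" and K = 1]) (auto simp: clinear_on_def)

section \<open>Local inversion\<close>

text \<open>A Lipschitz bound for \<open>F - id\<close> alone gives injectivity, open images and a
  Lipschitz inverse through Banach's fixed point theorem; derivatives enter only for the
  differentiability of the inverse. All of it takes place in the complete subspace \<open>V\<close>,
  which \<open>F\<close> must preserve.\<close>

locale near_identity =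
  fixes V :: "'a::complex_normed_vector set" and F :: "'a \<Rightarrow> 'a" and x0 :: 'a and r :: real
  assumes V: "csubspace V" "complete V" and x0: "x0 \<in> V" and r: "r > 0"
    and FV: "\<And>x. x \<in> V \<Longrightarrow> F x \<in> V"
    and lip: "\<And>x y. x \<in> V \<inter> ball x0 r \<Longrightarrow> y \<in> V \<inter> ball x0 r \<Longrightarrow>
      norm ((F x - x) - (F y - y)) \<le> norm (x - y) / 2"
begin

abbreviation B where "B \<equiv> V \<inter> ball x0 r"

lemma expand:
  assumes "x \<in> B" "y \<in> B" shows "norm (x - y) \<le> 2 * norm (F x - F y)"
  using lip[OF assms] norm_triangle_ineq4[of "F x - F y" "(F x - x) - (F y - y)"]
  by (simp add: algebra_simps)

lemma inj: "inj_on F B"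
proof (rule inj_onI)
  fix x y assume "x \<in> B" "y \<in> B" "F x = F y"
  with expand[of x y] show "x = y" by simp
qed

text \<open>A preimage of \<open>y\<close> is a fixed point of
  \<open>u \<mapsto> y - (F u - u)\<close>. On the ball of radius \<open>s\<close>, the half of
  \<open>s\<close> allowed for \<open>y\<close> and the contraction factor one half add up to
  \<open>s\<close>.\<close>

lemma surj_near:
  assumes x: "x \<in> B" and s: "s > 0" "cball x s \<inter> V \<subseteq> B" and y: "y \<in> V" "norm (y - F x) \<le> s / 2"
  shows "\<exists>u\<in>cball x s \<inter> V. F u = y"
proof -
  let ?C = "cball x s \<inter> V"
  have "\<exists>!u\<in>?C. y - (F u - u) = u"
  proof (rule Banach_fix[where c = "1/2"])
    show "complete ?C" using V(2) by (metis Int_commute closed_cball complete_Int_closed)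
    have "x \<in> ?C" using x s(1) by simp
    then show "?C \<noteq> {}" by blast
    show "(\<lambda>u. y - (F u - u)) ` ?C \<subseteq> ?C"
    proof safe
      fix u assume u: "u \<in> cball x s" "u \<in> V"
      have uB: "u \<in> B" using u s by auto
      have "norm ((y - F x) - ((F u - u) - (F x - x))) \<le> s / 2 + norm (u - x) / 2"
        using lip[OF uB x] y(2) norm_triangle_ineq4[of "y - F x" "(F u - u) - (F x - x)"] by linarith
      also have "\<dots> \<le> s" using u(1) by (simp add: dist_norm norm_minus_commute)
      finally show "y - (F u - u) \<in> cball x s"
        unfolding mem_cball by (subst dist_commute, unfold dist_norm) (simp add: algebra_simps)
      show "y - (F u - u) \<in> V" using FV[OF u(2)] u y V(1) by (simp add: csubspaceD)
    qed
    fix u v assume "u \<in> ?C" "v \<in> ?C"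
    then have "u \<in> B" "v \<in> B" using s by auto
    have "y - (F u - u) - (y - (F v - v)) = - ((F u - u) - (F v - v))"
      by (simp add: algebra_simps)
    then have "dist (y - (F u - u)) (y - (F v - v)) = norm (- ((F u - u) - (F v - v)))"
      unfolding dist_norm by (rule arg_cong)
    then show "dist (y - (F u - u)) (y - (F v - v)) \<le> 1/2 * dist u v"
      unfolding norm_minus_cancel using lip[OF \<open>u \<in> B\<close> \<open>v \<in> B\<close>] by (simp add: dist_norm)
  qed auto
  then obtain u where u: "u \<in> ?C" "y - (F u - u) = u" by blast
  have "F u = y" using u(2) by (simp add: algebra_simps)
  with u(1) show ?thesis by blast
qed

lemma open_image:
  assumes S: "openin (top_of_set V) S" "S \<subseteq> B"
  shows "openin (top_of_set V) (F ` S)"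
  unfolding openin_euclidean_subtopology_iff
proof (intro conjI ballI)
  show "F ` S \<subseteq> V" using S FV by auto
  fix y assume "y \<in> F ` S"
  then obtain x where x: "x \<in> S" "y = F x" by auto
  from S(1) x obtain e where e: "e > 0" "\<And>u. u \<in> V \<Longrightarrow> dist u x < e \<Longrightarrow> u \<in> S"
    unfolding openin_euclidean_subtopology_iff by blast
  define s where "s = e / 2"
  have s: "s > 0" "cball x s \<inter> V \<subseteq> S" using e by (auto simp: s_def dist_commute)
  show "\<exists>e>0. \<forall>z\<in>V. dist z y < e \<longrightarrow> z \<in> F ` S"
  proof (intro exI[of _ "s/2"] conjI ballI impI)
    fix z assume "z \<in> V" "dist z y < s / 2"
    then have "\<exists>u\<in>cball x s \<inter> V. F u = z"
      using x S s by (intro surj_near) (auto simp: dist_norm)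
    then show "z \<in> F ` S" using s by auto
  qed (use s in auto)
qed

lemma open_B: "openin (top_of_set V) B"
  by (metis Int_commute open_ball openin_open_Int)

text \<open>The bound on \<open>F - id\<close> passes to its derivative, hence \<open>D\<close> is
  invertible on \<open>V\<close> by the same fixed point argument, and the inverse of
  \<open>D\<close> is the derivative of the inverse.\<close>

lemma inverse_deriv:
  assumes x: "x \<in> B" and D: "has_cderiv_within F D x V"
  obtains D' where "has_cderiv_within (inv_into B F) D' (F x) V"
    "\<And>v. v \<in> V \<Longrightarrow> D' v \<in> V \<and> D (D' v) = v"
proof -
  have xV: "x \<in> V" using x by simp
  have DV: "D v \<in> V" if "v \<in> V" for v
    by (rule has_cderiv_within_range[OF D V(1) xV V(1) complete_imp_closed[OF V(2)], of 1])
      (use FV that in auto)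
  obtain K where K: "clinear_on V D" "K > 0" "\<And>v. v \<in> V \<Longrightarrow> norm (D v) \<le> K * norm v"
    "\<And>e. e > 0 \<Longrightarrow> \<exists>d>0. \<forall>y\<in>V. norm (y - x) < d \<longrightarrow> norm (F y - F x - D (y - x)) \<le> e * norm (y - x)"
    by (rule has_cderiv_withinD[OF D V(1)]) (rule that; blast)
  obtain s where s: "s > 0" "ball x s \<inter> V \<subseteq> B"
    using x open_ball[of x0 r] unfolding open_contains_ball by blast
  have near: "norm (D v - v) \<le> norm v / 2" if v: "v \<in> V" for v
  proof (cases "v = 0")
    case False
    have "norm (D v - v) \<le> norm v / 2 + e * norm v" if e: "e > 0" for e
    proof -
      obtain d where d: "d > 0" "\<And>y. y \<in> V \<Longrightarrow> norm (y - x) < d \<Longrightarrow> norm (F y - F x - D (y - x)) \<le> e * norm (y - x)"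
        using K(4)[OF e] by auto
      define t where "t = min d s / (2 * norm v)"
      have t: "t > 0" "norm (t *\<^sub>R v) < d" "norm (t *\<^sub>R v) < s"
        using d(1) s(1) False by (auto simp: t_def)
      have y: "x + t *\<^sub>R v \<in> V" using V(1) xV v by (simp add: csubspaceD)
      have yB: "x + t *\<^sub>R v \<in> B" using s(2) t(3) y by (auto simp: dist_norm subset_iff)
      have "norm (F (x + t *\<^sub>R v) - F x - t *\<^sub>R D v) \<le> e * (t * norm v)"
        using d(2)[OF y] t clinear_on_scaleR[OF K(1) V(1) v] by simp
      moreover have "norm (F (x + t *\<^sub>R v) - F x - t *\<^sub>R v) \<le> (t * norm v) / 2"
        using lip[OF yB x] t(1) by (simp add: algebra_simps)
      ultimately have "norm ((F (x + t *\<^sub>R v) - F x - t *\<^sub>R v) - (F (x + t *\<^sub>R v) - F x - t *\<^sub>R D v))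
          \<le> (t * norm v) / 2 + e * (t * norm v)"
        using norm_triangle_ineq4[of "F (x + t *\<^sub>R v) - F x - t *\<^sub>R v" "F (x + t *\<^sub>R v) - F x - t *\<^sub>R D v"]
        by linarith
      then have "norm (t *\<^sub>R (D v - v)) \<le> t * (norm v / 2 + e * norm v)"
        by (simp add: algebra_simps)
      then show ?thesis using t(1) by simp
    qed
    then have *: "norm (D v - v) \<le> norm v / 2 + e" if "e > 0" for e
      using that False by (metis divide_pos_pos nonzero_eq_divide_eq norm_eq_zero zero_less_norm_iff)
    then show ?thesis by (rule field_le_epsilon)
  qed (use clinear_on_0[OF K(1) V(1)] in simp)
  have ex: "\<exists>!v\<in>V. D v = w" if w: "w \<in> V" for w
  proof -
    have "\<exists>!v\<in>V. w - (D v - v) = v"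
    proof (rule Banach_fix[where c = "1/2"])
      show "V \<noteq> {}" using xV by auto
      show "(\<lambda>v. w - (D v - v)) ` V \<subseteq> V" using DV w V(1) by (auto simp: csubspaceD)
      fix a b assume ab: "a \<in> V" "b \<in> V"
      have "norm (D (a - b) - (a - b)) \<le> norm (a - b) / 2"
        using near ab V(1) by (simp add: csubspaceD)
      then show "dist (w - (D a - a)) (w - (D b - b)) \<le> 1/2 * dist a b"
        using clinear_on_diff[OF K(1) V(1) ab]
          by (subst dist_commute, unfold dist_norm) (simp add: algebra_simps)
    qed (use V in auto)
    moreover have "w - (D v - v) = v \<longleftrightarrow> D v = w" for v by (auto simp: algebra_simps)
    ultimately show ?thesis by simp
  qed
  define D' where "D' w = (THE v. v \<in> V \<and> D v = w)" for w
  have D': "D' w \<in> V \<and> D (D' w) = w" if "w \<in> V" for w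
    unfolding D'_def using theI'[OF ex[OF that]] by simp
  have D'_eq: "D' w = v" if "v \<in> V" "D v = w" for v w
    using ex[of w] D'[of w] DV[OF that(1)] that by metis
  have D'_norm: "norm (D' w) \<le> 2 * norm w" if "w \<in> V" for w
    using near[of "D' w"] D'[OF that] norm_triangle_ineq4[of w "w - D' w"] by simp
  have lin: "clinear_on V D'"
    unfolding clinear_on_def
  proof (intro conjI ballI allI)
    fix a b assume "a \<in> V" "b \<in> V"
    then show "D' (a + b) = D' a + D' b"
      using D' V(1) K(1) by (intro D'_eq) (auto simp: csubspaceD clinear_on_add)
  next
    fix c a assume "a \<in> V"
    then show "D' (c *\<^sub>C a) = c *\<^sub>C D' a"
      using D' V(1) K(1) by (intro D'_eq) (auto simp: csubspaceD clinear_on_scaleC)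
  qed
  have "has_cderiv_within (inv_into B F) D' (F x) V"
    unfolding has_cderiv_within_iff[OF V(1)]
  proof (intro conjI allI impI)
    show "\<exists>K. \<forall>v\<in>V. norm (D' v) \<le> K * norm v" using D'_norm by blast
    fix e :: real assume e: "e > 0"
    \<comment> \<open>A quarter of \<open>e\<close>: the inverse \<open>D'\<close> at most doubles
      norms, and so does the local inverse of \<open>F\<close>, which is also why the radius below
      is \<open>d/2\<close>.\<close>
    obtain d where d: "d > 0" "\<And>y. y \<in> V \<Longrightarrow> norm (y - x) < d \<Longrightarrow> norm (F y - F x - D (y - x)) \<le> e/4 * norm (y - x)"
      using K(4)[of "e/4"] e by auto
    obtain d2 where d2: "d2 > 0" "\<And>y. y \<in> V \<Longrightarrow> dist y (F x) < d2 \<Longrightarrow> y \<in> F ` B"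
      using open_image[OF open_B order_refl] x unfolding openin_euclidean_subtopology_iff by blast
    show "\<exists>d>0. \<forall>y\<in>V. norm (y - F x) < d \<longrightarrow>
        norm (inv_into B F y - inv_into B F (F x) - D' (y - F x)) \<le> e * norm (y - F x)"
    proof (intro exI[of _ "min (d/2) d2"] conjI ballI impI)
      fix y assume y: "y \<in> V" "norm (y - F x) < min (d/2) d2"
      then obtain u where u: "u \<in> B" "y = F u" using d2(2)[of y] by (auto simp: dist_norm)
      have ux: "norm (u - x) \<le> 2 * norm (y - F x)" using expand[OF u(1) x] u by simp
      have V2: "u - x \<in> V" "F u - F x \<in> V" using u x FV V(1) by (auto simp: csubspaceD)
      have "D' (F u - F x - D (u - x)) = D' (F u - F x) - D' (D (u - x))"
        using V2 DV by (intro clinear_on_diff[OF lin V(1)]) auto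
      also have "D' (D (u - x)) = u - x" using V2 by (intro D'_eq) auto
      finally have "norm (inv_into B F y - inv_into B F (F x) - D' (y - F x)) = norm (D' (F u - F x - D (u - x)))"
        using u x inj by (simp add: inv_into_f_f norm_minus_commute)
      also have "\<dots> \<le> 2 * norm (F u - F x - D (u - x))"
        using V2 DV V(1) by (intro D'_norm) (auto simp: csubspaceD)
      also have "\<dots> \<le> 2 * (e/4 * norm (u - x))" using d(2)[of u] u ux y by simp
      also have "\<dots> \<le> 2 * (e/4 * (2 * norm (y - F x)))" using ux e by simp
      finally show "norm (inv_into B F y - inv_into B F (F x) - D' (y - F x)) \<le> e * norm (y - F x)"
        by simp
    qed (use d d2 in auto)
  qed (rule lin)
  with that D' show thesis by blast
qed

end

section \<open>Hilbert space and adjoints\<close>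

instance chilbert_space \<subseteq> banach ..

lemma cinner_add_right: "cinner x (y + z) = cinner x y + cinner x (z :: 'a::complex_inner)"
  by (subst (1 2 3) cinner_commute) (simp add: cinner_add_left)

lemma cinner_scaleC_right: "cinner x (c *\<^sub>C y) = cnj c * cinner x (y :: 'a::complex_inner)"
  by (subst (1 2) cinner_commute) (simp add: cinner_scaleC_left)

lemma cinner_scaleR_left: "cinner (r *\<^sub>R x) y = of_real r * cinner x (y :: 'a::complex_inner)"
  by (simp add: scaleC_of_real[symmetric] cinner_scaleC_left)

lemma cinner_scaleR_right: "cinner x (r *\<^sub>R y) = of_real r * cinner x (y :: 'a::complex_inner)"
  by (simp add: scaleC_of_real[symmetric] cinner_scaleC_right)

lemma cinner_self: "cinner x x = complex_of_real ((norm (x :: 'a::complex_inner))\<^sup>2)"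
proof (rule complex_eqI)
  show "Re (cinner x x) = Re (complex_of_real ((norm x)\<^sup>2))"
    by (simp add: Re_cinner power2_norm_eq_inner)
  show "Im (cinner x x) = Im (complex_of_real ((norm x)\<^sup>2))"
    using cinner_commute[of x x] by (simp add: complex_eq_iff)
qed

lemma norm_cinner_le: "cmod (cinner x y) \<le> norm x * norm (y :: 'a::complex_inner)"
proof (cases "cinner x y = 0")
  case False
  \<comment> \<open>A phase that turns the complex inner product into its modulus, so that the real
    Cauchy-Schwarz inequality applies.\<close>
  define c where "c = cnj (cinner x y) / cmod (cinner x y)"
  have c: "cmod c = 1" using False by (simp add: c_def norm_divide)
  have "cinner (c *\<^sub>C x) y = of_real (cmod (cinner x y))"
    using False by (simp add: c_def cinner_scaleC_left complex_norm_square[symmetric] mult.commute power2_eq_square)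
  then have "cmod (cinner x y) = inner (c *\<^sub>C x) y"
    using Re_cinner[of "c *\<^sub>C x" y] by simp
  also have "\<dots> \<le> norm (c *\<^sub>C x) * norm y" by (rule norm_cauchy_schwarz)
  finally show ?thesis using c by (simp add: norm_scaleC)
qed simp

lemma bounded_bilinear_cinner: "bounded_bilinear (cinner :: 'a::complex_inner \<Rightarrow> _)"
proof
  show "\<exists>K. \<forall>a b :: 'a. norm (cinner a b) \<le> norm a * norm b * K"
    using norm_cinner_le by (intro exI[of _ 1]) auto
qed (simp_all add: cinner_add_left cinner_add_right cinner_scaleR_left cinner_scaleR_right scaleR_conv_of_real)

interpretation cinner: bounded_bilinear "cinner :: 'a::complex_inner \<Rightarrow> _"
  by (rule bounded_bilinear_cinner)

lemma cinner_eq_zero: "(\<And>y. cinner x y = 0) \<Longrightarrow> x = (0 :: 'a::complex_inner)"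
  using cinner_self[of x] by simp

lemma cinner_eqI: "(\<And>z. cinner x z = cinner y z) \<Longrightarrow> x = (y :: 'a::complex_inner)"
  using cinner_eq_zero[of "x - y"] by (simp add: cinner.diff_left)

lemma cinner_eqI': "(\<And>z. cinner z x = cinner z y) \<Longrightarrow> x = (y :: 'a::complex_inner)"
  by (rule cinner_eqI) (metis cinner_commute)

text \<open>Uniform convexity: at the midpoint \<open>F\<close> drops below the mean by a quarter of
  \<open>q\<close>, but not below its infimum, so nearly minimal points are close in
  \<open>q\<close>. Here \<open>q\<close> is an arbitrary function, which lets the same argument
  serve Hilbert space norms, the form \<open>G\<close> and the form of a faithful
  functional.\<close>

lemma minimizing_sequence:
  fixes F q :: "'a::real_vector \<Rightarrow> real"
  assumes K: "K \<noteq> {}" and lower: "\<And>a. a \<in> K \<Longrightarrow> L \<le> F a"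
    and mid: "\<And>a b. a \<in> K \<Longrightarrow> b \<in> K \<Longrightarrow> (1/2) *\<^sub>R (a + b) \<in> K"
    and conv: "\<And>a b. a \<in> K \<Longrightarrow> b \<in> K \<Longrightarrow> F ((1/2) *\<^sub>R (a + b)) \<le> (F a + F b) / 2 - q (a - b) / 4"
  obtains a m where "\<And>n. a n \<in> K" "(F \<circ> a) \<longlonglongrightarrow> m" "\<And>x. x \<in> K \<Longrightarrow> m \<le> F x"
    "\<And>n. F (a n) \<le> m + 1 / real (Suc n)"
    "\<And>e. e > 0 \<Longrightarrow> \<exists>N. \<forall>j\<ge>N. \<forall>k\<ge>N. q (a j - a k) < e"
proof -
  define m where "m = Inf (F ` K)"
  have bdd: "bdd_below (F ` K)" by (rule bdd_belowI2) (rule lower)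
  have m: "m \<le> F x" if "x \<in> K" for x
    unfolding m_def by (rule cInf_lower[OF _ bdd]) (use that in auto)
  have "\<exists>x\<in>K. F x < m + 1 / real (Suc n)" for n
    using cInf_lessD[of "F ` K" "m + 1 / real (Suc n)"] K unfolding m_def by force
  then obtain a where a: "\<And>n. a n \<in> K" "\<And>n. F (a n) < m + 1 / real (Suc n)" by metis
  have lim: "(F \<circ> a) \<longlonglongrightarrow> m"
  proof (rule tendsto_sandwich[where f = "\<lambda>_. m" and h = "\<lambda>n. m + 1 / real (Suc n)"])
    show "(\<lambda>n. m + 1 / real (Suc n)) \<longlonglongrightarrow> m"
      using tendsto_add[OF tendsto_const[of m] LIMSEQ_inverse_real_of_nat] by (simp add: inverse_eq_divide)
    show "\<forall>\<^sub>F n in sequentially. m \<le> (F \<circ> a) n" using m a(1) by simp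
    show "\<forall>\<^sub>F n in sequentially. (F \<circ> a) n \<le> m + 1 / real (Suc n)"
      using a(2) by (simp add: less_imp_le)
  qed simp
  have "\<exists>N. \<forall>j\<ge>N. \<forall>k\<ge>N. q (a j - a k) < e" if e: "e > 0" for e
  proof -
    \<comment> \<open>Beyond \<open>N\<close> the values exceed the infimum by less than
      \<open>e / 4\<close>, and the midpoint inequality turns this into
      \<open>q < e\<close>.\<close>
    obtain N where N: "1 / real (Suc N) < e / 4"
      using reals_Archimedean[of "e/4"] e by (auto simp: inverse_eq_divide)
    show ?thesis
    proof (intro exI[of _ N] allI impI)
      fix j k assume jk: "j \<ge> N" "k \<ge> N"
      have le: "F (a i) < m + e / 4" if "i \<ge> N" for i
      proof -
        have "1 / real (Suc i) \<le> 1 / real (Suc N)" using that by (simp add: frac_le)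
        with a(2)[of i] N show ?thesis by linarith
      qed
      have *: "s < e" if "X \<le> (p + r) / 2 - s / 4" "m \<le> X" "p < m + e / 4" "r < m + e / 4" for X p r s
      proof -
        have "m \<le> (p + r) / 2 - s / 4" using that(1,2) by (rule order_trans[rotated])
        also have "\<dots> < (m + e / 4 + (m + e / 4)) / 2 - s / 4" using that(3,4) by simp
        finally show ?thesis by (simp add: field_simps)
      qed
      show "q (a j - a k) < e"
        by (rule *[OF conv[OF a(1) a(1), of j k] m[OF mid[OF a(1) a(1), of j k]] le[OF jk(1)] le[OF jk(2)]])
    qed
  qed
  with a m lim show thesis by (intro that[of a m]) (auto intro: less_imp_le)
qed

text \<open>Division by \<open>t\<close> and passage to zero; the proof contradicts a positive
  \<open>a\<close> with one explicit step size.\<close>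

lemma first_order_condition:
  fixes a b T :: real
  assumes "T > 0" "\<And>t. 0 < t \<Longrightarrow> t \<le> T \<Longrightarrow> 2 * t * a \<le> t\<^sup>2 * b"
  shows "a \<le> 0"
proof (rule ccontr)
  assume "\<not> a \<le> 0"
  define t where "t = min T (a / (\<bar>b\<bar> + 1))"
  have t: "0 < t" "t \<le> T" using assms(1) \<open>\<not> a \<le> 0\<close> by (auto simp: t_def)
  have "t * (\<bar>b\<bar> + 1) \<le> a / (\<bar>b\<bar> + 1) * (\<bar>b\<bar> + 1)" by (intro mult_right_mono) (auto simp: t_def)
  then have "t * (\<bar>b\<bar> + 1) \<le> a" by (simp add: add_nonneg_eq_0_iff)
  have "t * (2 * a) \<le> t * (t * b)" using assms(2)[OF t] by (simp add: power2_eq_square mult_ac)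
  then have "2 * a \<le> t * b" using t(1) by simp
  also have "\<dots> \<le> t * (\<bar>b\<bar> + 1)" using t(1) by (intro mult_left_mono) auto
  finally show False using \<open>t * (\<bar>b\<bar> + 1) \<le> a\<close> \<open>\<not> a \<le> 0\<close> by linarith
qed

lemma parallelogram_mid:
  fixes a b x :: "'a::real_inner"
  shows "(norm (x - (1/2) *\<^sub>R (a + b)))\<^sup>2 = ((norm (x - a))\<^sup>2 + (norm (x - b))\<^sup>2) / 2 - (norm (a - b))\<^sup>2 / 4"
proof -
  have *: "x - (1/2) *\<^sub>R (a + b) = (1/2) *\<^sub>R ((x - a) + (x - b))" "a - b = (x - b) - (x - a)"
    by (simp_all add: scaleR_add_right scaleR_diff_right scaleR_2[symmetric] del: scaleR_half_double)
      (simp add: scaleR_add_right[symmetric] scaleR_2[symmetric])?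
  show ?thesis unfolding *
    by (simp add: power2_norm_eq_inner inner_add_left inner_add_right inner_diff_left inner_diff_right inner_commute[of "x - b"] field_simps)
qed

text \<open>The nearest point of \<open>K\<close> does it. Its first variation along
  \<open>v\<close> has one sign; the direction \<open>- v\<close> supplies the opposite sign, and
  the multiples of \<open>v\<close> by \<open>\<i>\<close> and \<open>- \<i>\<close> supply the
  imaginary part.\<close>

lemma orthogonal_projection_exists:
  fixes K :: "'a::chilbert_space set"
  assumes K: "csubspace K" "closed K"
  shows "\<exists>u\<in>K. \<forall>v\<in>K. cinner (x - u) v = 0"
proof -
  obtain a m where a: "\<And>n. a n \<in> K" "((\<lambda>a. (norm (x - a))\<^sup>2) \<circ> a) \<longlonglongrightarrow> m"
    "\<And>y. y \<in> K \<Longrightarrow> m \<le> (norm (x - y))\<^sup>2"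
    "\<And>e. e > 0 \<Longrightarrow> \<exists>N. \<forall>j\<ge>N. \<forall>k\<ge>N. (norm (a j - a k))\<^sup>2 < e"
  proof (rule minimizing_sequence[of K 0 "\<lambda>a. (norm (x - a))\<^sup>2" "\<lambda>a. (norm a)\<^sup>2"])
    show "K \<noteq> {}" using K csubspace_0 by blast
    show "(1/2) *\<^sub>R (a + b) \<in> K" if "a \<in> K" "b \<in> K" for a b using K that by (simp add: csubspaceD)
  qed (simp, simp add: parallelogram_mid, rule that, blast+)
  have "Cauchy a"
    unfolding Cauchy_iff
  proof (intro allI impI)
    fix e :: real assume e: "e > 0"
    obtain N where "\<forall>j\<ge>N. \<forall>k\<ge>N. (norm (a j - a k))\<^sup>2 < e\<^sup>2" using a(4)[of "e\<^sup>2"] e by auto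
    then show "\<exists>M. \<forall>m\<ge>M. \<forall>n\<ge>M. norm (a m - a n) < e" using e by (meson less_imp_le power2_less_imp_less)
  qed
  then obtain u where u: "a \<longlonglongrightarrow> u" using Cauchy_convergent convergent_def by blast
  have uK: "u \<in> K" using K(2) a(1) u closed_sequentially by blast
  have "(\<lambda>n. (norm (x - a n))\<^sup>2) \<longlonglongrightarrow> (norm (x - u))\<^sup>2" by (intro tendsto_intros u)
  with a(2) have m: "m = (norm (x - u))\<^sup>2" by (auto simp: o_def intro: LIMSEQ_unique)
  have Re0: "Re (cinner (x - u) v) \<le> 0" if v: "v \<in> K" for v
  proof (rule first_order_condition[where T = 1 and b = "(norm v)\<^sup>2"])
    fix t :: real
    have "m \<le> (norm (x - (u + t *\<^sub>R v)))\<^sup>2" using uK v K by (intro a(3)) (simp add: csubspaceD)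
    also have "(norm (x - (u + t *\<^sub>R v)))\<^sup>2 = (norm ((x - u) - t *\<^sub>R v))\<^sup>2" by (simp add: algebra_simps)
    also have "\<dots> = (norm (x - u))\<^sup>2 - 2 * t * inner (x - u) v + t\<^sup>2 * (norm v)\<^sup>2"
      unfolding power2_norm_eq_inner
      by (simp add: inner_diff_left[of "x - u"] inner_diff_right[of _ "x - u"] inner_commute[of v "x - u"] power2_eq_square right_diff_distrib)
    finally show "2 * t * Re (cinner (x - u) v) \<le> t\<^sup>2 * (norm v)\<^sup>2"
      unfolding m Re_cinner by simp
  qed simp
  have "cinner (x - u) v = 0" if v: "v \<in> K" for v
  proof (rule complex_eqI)
    show "Re (cinner (x - u) v) = Re 0"
      using Re0[OF v] Re0[OF csubspace_neg[OF K(1) v]] by (simp add: cinner.minus_right)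
    show "Im (cinner (x - u) v) = Im 0"
      using Re0[OF csubspace_scaleC[OF K(1) v, of \<i>]] Re0[OF csubspace_scaleC[OF K(1) v, of "-\<i>"]]
      by (simp add: cinner_scaleC_right)
  qed
  with uK show ?thesis by blast
qed

lemma riesz_representation:
  fixes f :: "'a::chilbert_space \<Rightarrow> complex"
  assumes add: "\<And>x y. f (x + y) = f x + f y" and scale: "\<And>c x. f (c *\<^sub>C x) = c * f x"
    and bound: "\<And>x. cmod (f x) \<le> C * norm x"
  shows "\<exists>z. \<forall>x. f x = cinner x z"
proof -
  have "bounded_linear f"
    by (rule bounded_linear_intro[of _ C])
      (use add scale[of "of_real r" for r] bound in \<open>auto simp: scaleC_of_real scaleR_conv_of_real mult.commute\<close>)
  then interpret f: bounded_linear f .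
  let ?K = "{x. f x = 0}"
  have K: "csubspace ?K" by (auto simp: csubspace_def f.zero add scale)
  have cl: "closed ?K" by (intro closed_Collect_eq f.continuous_on continuous_intros)
  show ?thesis
  proof (cases "\<forall>x. f x = 0")
    case True
    then show ?thesis by (intro exI[of _ 0]) (simp add: cinner.zero_right)
  next
    case False
    then obtain x where x: "f x \<noteq> 0" by auto
    obtain u where u: "f u = 0" "\<And>v. f v = 0 \<Longrightarrow> cinner (x - u) v = 0"
      using orthogonal_projection_exists[OF K cl, of x] by auto
    define z where "z = x - u"
    have fz: "f z \<noteq> 0" using x u by (simp add: z_def f.diff)
    then have z0: "z \<noteq> 0" using f.zero by auto
    have "f y = cinner y ((cnj (f z) / of_real ((norm z)\<^sup>2)) *\<^sub>C z)" for y
    proof -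
      \<comment> \<open>This combination lies in the kernel of \<open>f\<close>, to which
        \<open>z\<close> is orthogonal; solving the resulting equation for \<open>f y\<close>
        exhibits the representing vector.\<close>
      have "f (f y *\<^sub>C z - f z *\<^sub>C y) = 0" by (simp add: f.diff scale)
      then have "cinner z (f y *\<^sub>C z - f z *\<^sub>C y) = 0" using u(2) by (simp add: z_def)
      then have "cnj (f y) * of_real ((norm z)\<^sup>2) = cnj (f z) * cinner z y"
        by (simp add: cinner.diff_right cinner_scaleC_right cinner_self)
      then have "f y * of_real ((norm z)\<^sup>2) = f z * cinner y z"
        by (subst cinner_commute) (metis complex_cnj_cnj complex_cnj_complex_of_real complex_cnj_mult)
      then show ?thesis using z0 by (simp add: cinner_scaleC_right field_simps)
    qed
    then show ?thesis by blast
  qed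
qed

lemma bounded_operatorsD: "T \<in> bounded_operators \<Longrightarrow> blinfun_apply T (c *\<^sub>C x) = c *\<^sub>C blinfun_apply T x"
  by (simp add: bounded_operators_def)

lemma adj_exists:
  fixes T :: "'h::chilbert_space op"
  assumes T: "T \<in> bounded_operators"
  shows "\<exists>S\<in>bounded_operators. \<forall>x y. cinner (blinfun_apply T x) y = cinner x (blinfun_apply S y)"
proof -
  have "\<exists>z. \<forall>x. cinner (blinfun_apply T x) y = cinner x z" for y
  proof (rule riesz_representation[where C = "norm T * norm y"])
    fix x show "cmod (cinner (blinfun_apply T x) y) \<le> norm T * norm y * norm x"
      using norm_cinner_le[of "blinfun_apply T x" y] mult_right_mono[OF norm_blinfun[of T x], of "norm y"]
      by (simp add: mult_ac)
  qed (simp_all add: blinfun.add_right cinner_add_left bounded_operatorsD[OF T] cinner_scaleC_left)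
  then obtain S where S: "\<And>x y. cinner (blinfun_apply T x) y = cinner x (S y)" by metis
  have eq: "u = v" if "\<And>x. cinner x u = cinner x v" for u v :: 'h
    using that by (rule cinner_eqI')
  have add: "S (a + b) = S a + S b" for a b
    by (rule eq) (metis S cinner_add_right)
  have scale: "S (c *\<^sub>C a) = c *\<^sub>C S a" for c a
    by (rule eq) (metis S cinner_scaleC_right)
  have bd: "norm (S y) \<le> norm y * norm T" for y
  proof -
    have "(norm (S y))\<^sup>2 = cmod (cinner (blinfun_apply T (S y)) y)"
      unfolding S cinner_self norm_of_real by simp
    also have "\<dots> \<le> (norm T * norm (S y)) * norm y"
      by (meson mult_right_mono norm_blinfun norm_cinner_le norm_ge_zero order_trans)
    finally have "norm (S y) * norm (S y) \<le> norm (S y) * (norm y * norm T)"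
      by (simp add: power2_eq_square mult_ac)
    then show ?thesis by (cases "S y = 0") auto
  qed
  have "bounded_linear S"
    by (rule bounded_linear_intro[OF add _ bd]) (metis scale scaleC_of_real)
  then show ?thesis using S scale
    by (intro bexI[of _ "Blinfun S"]) (auto simp: bounded_operators_def bounded_linear_Blinfun_apply)
qed

lemma adj_eqI:
  assumes "\<And>x y. cinner (blinfun_apply T x) y = cinner x (blinfun_apply S y)"
  shows "adj T = (S :: 'h::chilbert_space op)"
  unfolding adj_def
proof (rule the_equality)
  fix R assume "\<forall>x y. cinner (blinfun_apply T x) y = cinner x (blinfun_apply R y)"
  with assms show "R = S" by (metis blinfun_eqI cinner_eqI')
qed (use assms in blast)

lemma adj_props:
  assumes T: "T \<in> bounded_operators"
  shows adj_in: "adj T \<in> bounded_operators"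
    and cinner_adj: "cinner (blinfun_apply T x) y = cinner x (blinfun_apply (adj T) y)"
    and cinner_adj': "cinner (blinfun_apply (adj T) x) y = cinner x (blinfun_apply T y)"
    and adj_adj: "adj (adj T) = (T :: 'h::chilbert_space op)"
proof -
  obtain S where S: "S \<in> bounded_operators" "\<And>x y. cinner (blinfun_apply T x) y = cinner x (blinfun_apply S y)"
    using adj_exists[OF T] by blast
  have [simp]: "adj T = S" by (rule adj_eqI) (rule S(2))
  show "adj T \<in> bounded_operators" "cinner (blinfun_apply T x) y = cinner x (blinfun_apply (adj T) y)"
    using S by auto
  have *: "cinner (blinfun_apply S x) y = cinner x (blinfun_apply T y)" for x y
    by (metis S(2) cinner_commute)
  then show "cinner (blinfun_apply (adj T) x) y = cinner x (blinfun_apply T y)" by simp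
  show "adj (adj T) = T" using * by (simp add: adj_eqI)
qed

lemma bounded_operators_closed:
  shows bounded_operators_id: "id_blinfun \<in> bounded_operators"
    and bounded_operators_0: "0 \<in> bounded_operators"
    and bounded_operators_add: "S \<in> bounded_operators \<Longrightarrow> T \<in> bounded_operators \<Longrightarrow> S + T \<in> bounded_operators"
    and bounded_operators_diff: "S \<in> bounded_operators \<Longrightarrow> T \<in> bounded_operators \<Longrightarrow> S - T \<in> bounded_operators"
    and bounded_operators_scaleC: "T \<in> bounded_operators \<Longrightarrow> c *\<^sub>C T \<in> bounded_operators"
    and bounded_operators_scaleR: "T \<in> bounded_operators \<Longrightarrow> r *\<^sub>R T \<in> bounded_operators"
    and bounded_operators_compose: "S \<in> bounded_operators \<Longrightarrow> T \<in> bounded_operators \<Longrightarrow> S o\<^sub>L T \<in> bounded_operators"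
  by (simp_all add: bounded_operators_def blinfun.bilinear_simps scaleC_add_right scaleC_diff_right
      scaleC_blinfun.rep_eq scaleC_scaleC scaleC_of_real[symmetric] mult.commute)

lemma adj_simps:
  assumes S: "S \<in> bounded_operators" and T: "T \<in> bounded_operators"
  shows adj_add: "adj (S + T) = adj S + adj T"
    and adj_diff: "adj (S - T) = adj S - adj T"
    and adj_compose: "adj (S o\<^sub>L T) = adj T o\<^sub>L adj S"
  by (rule adj_eqI; simp add: blinfun.bilinear_simps cinner.add_left cinner.add_right
      cinner.diff_left cinner.diff_right cinner_adj[OF S] cinner_adj[OF T])+

lemma adj_scale:
  assumes T: "T \<in> bounded_operators"
  shows adj_scaleC: "adj (c *\<^sub>C T) = cnj c *\<^sub>C adj T" and adj_scaleR: "adj (r *\<^sub>R T) = r *\<^sub>R adj T"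
  by (rule adj_eqI; simp add: blinfun.bilinear_simps cinner_adj[OF T] scaleC_blinfun.rep_eq
      cinner_scaleC_left cinner_scaleC_right cinner_scaleR_left cinner_scaleR_right)+

lemma adj_id: "adj id_blinfun = id_blinfun" by (rule adj_eqI) simp

text \<open>Polarization: the form \<open>B\<close> is sesquilinear and vanishes on the diagonal.
  The vectors \<open>x + y\<close> and \<open>x + \<i> y\<close> give
  \<open>B x y + B y x = 0\<close> and \<open>B y x = B x y\<close>.\<close>

lemma cinner_self_adjI:
  fixes T :: "'h::chilbert_space op"
  assumes T: "T \<in> bounded_operators" and real: "\<And>x. cinner (blinfun_apply T x) x \<in> \<real>"
  shows "adj T = T"
proof (rule adj_eqI)
  fix x y
  define B where "B x y = cinner (blinfun_apply T x) y - cinner x (blinfun_apply T y)" for x y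
  have diag: "B z z = 0" for z
    using real[of z] by (subst B_def, subst (2) cinner_commute) (simp add: Reals_cnj_iff)
  have add: "B (a + b) (c + d) = B a c + B a d + B b c + B b d" for a b c d
    by (simp add: B_def blinfun.add_right cinner.add_left cinner.add_right)
  have l: "B (c *\<^sub>C a) b = c * B a b" "B a (c *\<^sub>C b) = cnj c * B a b" for a b c
    by (simp_all add: B_def bounded_operatorsD[OF T] cinner_scaleC_left cinner_scaleC_right algebra_simps)
  have 1: "B x y + B y x = 0" using add[of x y x y] diag by simp
  have "\<i> * (B y x - B x y) = 0" using add[of x "\<i> *\<^sub>C y" x "\<i> *\<^sub>C y"] diag[of x] diag[of "x + \<i> *\<^sub>C y"] diag[of "\<i> *\<^sub>C y"]
    by (simp add: l algebra_simps)
  then have "B y x = B x y" by simp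
  with 1 have "B x y = 0" by simp
  then show "cinner (blinfun_apply T x) y = cinner x (blinfun_apply T y)" by (simp add: B_def)
qed

lemma positive_op_iff:
  fixes T :: "'h::chilbert_space op"
  assumes "T \<in> bounded_operators"
  shows "positive_op T \<longleftrightarrow> adj T = T \<and> (\<forall>x. 0 \<le> Re (cinner (blinfun_apply T x) x))"
proof
  assume p: "positive_op T"
  then have "cinner (blinfun_apply T x) x \<in> \<real>" for x
    unfolding positive_op_def complex_nonneg_Reals_iff complex_is_Real_iff by blast
  with assms p show "adj T = T \<and> (\<forall>x. 0 \<le> Re (cinner (blinfun_apply T x) x))"
    by (auto simp: cinner_self_adjI positive_op_def complex_nonneg_Reals_iff)
next
  assume *: "adj T = T \<and> (\<forall>x. 0 \<le> Re (cinner (blinfun_apply T x) x))"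
  have "cinner (blinfun_apply T x) x = cnj (cinner (blinfun_apply T x) x)" for x
    using cinner_adj[OF assms, of x x] * cinner_commute[of x "blinfun_apply T x"] by simp
  then have "Im (cinner (blinfun_apply T x) x) = 0" for x by (metis cnj.simps(2) equal_neg_zero)
  with * show "positive_op T"
    unfolding positive_op_def complex_nonneg_Reals_iff by simp
qed

section \<open>Commutants\<close>

lemma commutantD:
  assumes "T \<in> commutant S"
  shows "T \<in> bounded_operators" "x \<in> S \<Longrightarrow> T o\<^sub>L x = x o\<^sub>L T"
  using assms by (auto simp: commutant_def)

lemma blinfun_compose_assoc: "(a o\<^sub>L b) o\<^sub>L c = a o\<^sub>L (b o\<^sub>L c)"
  by (rule blinfun_eqI) simp

lemma blinfun_compose_id [simp]: "id_blinfun o\<^sub>L a = a" "a o\<^sub>L id_blinfun = a"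
  by (auto intro: blinfun_eqI)

interpretation compose: bounded_bilinear "(o\<^sub>L) :: ('b::real_normed_vector \<Rightarrow>\<^sub>L 'c::real_normed_vector) \<Rightarrow> ('a::real_normed_vector \<Rightarrow>\<^sub>L 'b) \<Rightarrow> _"
  by (rule bounded_bilinear_blinfun_compose)

lemma compose_scaleC_left: "(c *\<^sub>C a) o\<^sub>L b = c *\<^sub>C (a o\<^sub>L b)"
  by (rule blinfun_eqI) (simp add: scaleC_blinfun.rep_eq)

lemma compose_scaleC_right: "a \<in> bounded_operators \<Longrightarrow> a o\<^sub>L (c *\<^sub>C b) = c *\<^sub>C (a o\<^sub>L b)"
  by (rule blinfun_eqI) (simp add: scaleC_blinfun.rep_eq bounded_operatorsD)

lemma commutant_compose: "a \<in> commutant S \<Longrightarrow> b \<in> commutant S \<Longrightarrow> a o\<^sub>L b \<in> commutant S"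
  unfolding commutant_def by (auto intro: bounded_operators_compose) (metis blinfun_compose_assoc)

lemma csubspace_commutant:
  assumes "S \<subseteq> bounded_operators" shows "csubspace (commutant S)"
  using assms unfolding csubspace_def commutant_def
  by (auto simp: bounded_operators_closed compose.add_left compose.add_right compose_scaleC_left
      compose_scaleC_right subset_iff)

lemma commutant_id: "id_blinfun \<in> commutant S"
  by (simp add: commutant_def bounded_operators_id)

text \<open>Elements of the operator type are only real-linear, so complex linearity of the inverse
  \<open>b\<close> has to be derived together with its commutation.\<close>

lemma commutant_inverse:
  assumes a: "a \<in> commutant S" and b: "a o\<^sub>L b = id_blinfun" "b o\<^sub>L a = id_blinfun"
  shows "b \<in> commutant S"
proof -
  have ab: "blinfun_apply a (blinfun_apply b x) = x" "blinfun_apply b (blinfun_apply a x) = x" for x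
    using b by (metis blinfun_apply_blinfun_compose blinfun_apply_id_blinfun)+
  have "blinfun_apply b (c *\<^sub>C x) = c *\<^sub>C blinfun_apply b x" for c x
    by (metis ab bounded_operatorsD commutantD(1)[OF a])
  moreover have "b o\<^sub>L x = x o\<^sub>L b" if "x \<in> S" for x
    by (metis b blinfun_compose_assoc blinfun_compose_id commutantD(2)[OF a that])
  ultimately show ?thesis by (simp add: commutant_def bounded_operators_def)
qed

lemma commutant_strong_limit:
  fixes T :: "nat \<Rightarrow> 'h::chilbert_space op"
  assumes T: "\<And>n. T n \<in> commutant S" and lim: "\<And>x. (\<lambda>n. blinfun_apply (T n) x) \<longlonglongrightarrow> blinfun_apply A x"
  shows "A \<in> commutant S"
proof -
  have "blinfun_apply A (c *\<^sub>C x) = c *\<^sub>C blinfun_apply A x" for c x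
  proof (rule LIMSEQ_unique[OF lim])
    have "(\<lambda>n. c *\<^sub>C blinfun_apply (T n) x) \<longlonglongrightarrow> c *\<^sub>C blinfun_apply A x"
      by (rule bounded_linear.tendsto[OF bounded_linear_scaleC lim])
    then show "(\<lambda>n. blinfun_apply (T n) (c *\<^sub>C x)) \<longlonglongrightarrow> c *\<^sub>C blinfun_apply A x"
      by (simp add: bounded_operatorsD[OF commutantD(1)[OF T]])
  qed
  moreover have "A o\<^sub>L x = x o\<^sub>L A" if x: "x \<in> S" for x
  proof (rule blinfun_eqI)
    fix v
    have "(\<lambda>n. blinfun_apply x (blinfun_apply (T n) v)) \<longlonglongrightarrow> blinfun_apply x (blinfun_apply A v)"
      by (intro blinfun.tendsto tendsto_const lim)
    moreover have "blinfun_apply x (blinfun_apply (T n) v) = blinfun_apply (T n) (blinfun_apply x v)" for n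
      using commutantD(2)[OF T x] by (metis blinfun_apply_blinfun_compose)
    ultimately show "blinfun_apply (A o\<^sub>L x) v = blinfun_apply (x o\<^sub>L A) v"
      using lim[of "blinfun_apply x v"] by (simp add: LIMSEQ_unique)
  qed
  ultimately show ?thesis by (simp add: commutant_def bounded_operators_def)
qed

lemma closed_commutant: "closed (commutant S)"
  unfolding closed_sequential_limits
proof (intro allI impI, elim conjE)
  fix T A assume T: "\<forall>n. T n \<in> commutant S" "T \<longlonglongrightarrow> A"
  have "(\<lambda>n. blinfun_apply (T n) x) \<longlonglongrightarrow> blinfun_apply A x" for x
    by (rule blinfun.tendsto[OF T(2) tendsto_const])
  with T(1) show "A \<in> commutant S" by (rule_tac commutant_strong_limit[of T S A]) auto
qed

lemma complete_commutant: "complete (commutant S)"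
  by (simp add: closed_commutant complete_eq_closed)

lemma scaleC_minus_left: "(- c) *\<^sub>C x = - (c *\<^sub>C (x :: 'a::complex_normed_vector))"
  using scaleC_add_left[of c "- c" x] by (simp add: minus_unique)

section \<open>Ultraweakly continuous functionals\<close>

lemma norm_adj_le:
  assumes T: "T \<in> bounded_operators" shows "norm (adj T) \<le> norm (T :: 'h::chilbert_space op)"
proof (rule norm_blinfun_bound)
  fix y
  have "(norm (adj T y))\<^sup>2 = cmod (cinner (T (adj T y)) y)"
    unfolding cinner_adj[OF T] cinner_self norm_of_real by simp
  also have "\<dots> \<le> (norm T * norm (adj T y)) * norm y"
    by (meson mult_right_mono norm_blinfun norm_cinner_le norm_ge_zero order_trans)
  finally have "norm (adj T y) * norm (adj T y) \<le> norm (adj T y) * (norm T * norm y)"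
    by (simp add: power2_eq_square mult_ac)
  then show "norm (adj T y) \<le> norm T * norm y" by (cases "adj T y = 0") auto
qed simp

definition square_summable :: "(nat \<Rightarrow> 'a::real_normed_vector) \<Rightarrow> bool" where
  "square_summable \<alpha> \<longleftrightarrow> summable (\<lambda>n. (norm (\<alpha> n))\<^sup>2)"

text \<open>Interleaving turns the sum of two series into one series, so that two pairs of
  square-summable sequences become a single pair.\<close>

definition merge :: "(nat \<Rightarrow> 'a) \<Rightarrow> (nat \<Rightarrow> 'a) \<Rightarrow> nat \<Rightarrow> 'a" where
  "merge \<alpha> \<beta> n = (if even n then \<alpha> (n div 2) else \<beta> ((n - 1) div 2))"

lemma merge_sums:
  fixes f g :: "nat \<Rightarrow> real"
  assumes "f sums x" "g sums y" shows "merge f g sums (x + y)"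
  using sums_if[OF assms(2,1)] by (simp add: merge_def[abs_def] add.commute)

lemma merge_comp: "(\<lambda>n. f (merge \<alpha> \<beta> n)) = merge (\<lambda>n. f (\<alpha> n)) (\<lambda>n. f (\<beta> n))"
  by (auto simp: merge_def)

lemma merge_comp2: "(\<lambda>n. f (merge \<alpha> \<beta> n) (merge \<gamma> \<delta> n)) = merge (\<lambda>n. f (\<alpha> n) (\<gamma> n)) (\<lambda>n. f (\<beta> n) (\<delta> n))"
  by (auto simp: merge_def)

lemma square_summable_merge: "square_summable \<alpha> \<Longrightarrow> square_summable \<beta> \<Longrightarrow> square_summable (merge \<alpha> \<beta>)"
  unfolding square_summable_def merge_comp[of "\<lambda>x. (norm x)\<^sup>2"]
  by (blast intro: sums_summable[OF merge_sums[OF summable_sums summable_sums]])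

lemma square_summable_scaleR: "square_summable \<alpha> \<Longrightarrow> square_summable (\<lambda>n. r *\<^sub>R \<alpha> n)"
  by (simp add: square_summable_def power_mult_distrib summable_mult)

lemma square_summable_apply:
  assumes "square_summable \<alpha>" shows "square_summable (\<lambda>n. blinfun_apply T (\<alpha> n))"
  unfolding square_summable_def
proof (rule summable_comparison_test'[where N = 0])
  show "summable (\<lambda>n. (norm T)\<^sup>2 * (norm (\<alpha> n))\<^sup>2)"
    using assms by (simp add: square_summable_def summable_mult)
  show "norm ((norm (blinfun_apply T (\<alpha> n)))\<^sup>2) \<le> (norm T)\<^sup>2 * (norm (\<alpha> n))\<^sup>2" for n
    using power_mono[OF norm_blinfun[of T "\<alpha> n"], of 2] by (simp add: power_mult_distrib)
qed

lemma summable_norm_product: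
  assumes "square_summable \<alpha>" "square_summable \<beta>"
  shows "summable (\<lambda>n. norm (\<alpha> n) * norm (\<beta> n))"
proof (rule summable_comparison_test'[where N = 0])
  show "summable (\<lambda>n. (norm (\<alpha> n))\<^sup>2 + (norm (\<beta> n))\<^sup>2)"
    using assms by (simp add: square_summable_def summable_add)
  show "norm (norm (\<alpha> n) * norm (\<beta> n)) \<le> (norm (\<alpha> n))\<^sup>2 + (norm (\<beta> n))\<^sup>2" for n
  proof -
    have "0 \<le> norm (\<alpha> n) * norm (\<beta> n)" by simp
    with sum_squares_bound[of "norm (\<alpha> n)" "norm (\<beta> n)", unfolded mult.assoc] show ?thesis
      by (simp only: real_norm_def abs_mult abs_norm_cancel)
  qed
qed

lemma summable_cmod_cinner:
  assumes "square_summable \<alpha>" "square_summable \<beta>"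
  shows "summable (\<lambda>n. cmod (cinner (\<alpha> n) (\<beta> n)))"
  by (rule summable_comparison_test'[OF summable_norm_product[OF assms], where N = 0])
    (simp add: norm_cinner_le)

lemma ultraweak_functionalsE:
  assumes "\<omega> \<in> ultraweak_functionals"
  obtains \<alpha> \<beta> where "square_summable \<alpha>" "square_summable \<beta>"
    "\<And>T. \<omega> T = (\<Sum>n. cinner (blinfun_apply T (\<alpha> n)) (\<beta> n))"
  using assms that unfolding ultraweak_functionals_def square_summable_def by blast

lemma ultraweak_functionalsI:
  assumes "square_summable \<alpha>" "square_summable \<beta>"
  shows "(\<lambda>T. \<Sum>n. cinner (blinfun_apply T (\<alpha> n)) (\<beta> n)) \<in> ultraweak_functionals"
  using assms unfolding ultraweak_functionals_def square_summable_def by blast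

text \<open>Absolute values inside the series make this a seminorm in \<open>T\<close> that is
  additive under \<open>merge\<close>; one pairing can thus dominate several functionals, whereas
  adding the functionals themselves could cancel.\<close>

definition pairing :: "(nat \<Rightarrow> 'h::chilbert_space) \<Rightarrow> (nat \<Rightarrow> 'h) \<Rightarrow> 'h op \<Rightarrow> real" where
  "pairing \<alpha> \<beta> T = (\<Sum>n. cmod (cinner (blinfun_apply T (\<alpha> n)) (\<beta> n)))"

lemma summable_pairing:
  assumes "square_summable \<alpha>" "square_summable \<beta>"
  shows "summable (\<lambda>n. cmod (cinner (blinfun_apply T (\<alpha> n)) (\<beta> n)))"
  by (rule summable_cmod_cinner[OF square_summable_apply[OF assms(1)] assms(2)])

lemma pairing_nonneg:
  assumes "square_summable \<alpha>" "square_summable \<beta>"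
  shows "0 \<le> pairing \<alpha> \<beta> T"
  unfolding pairing_def by (intro suminf_nonneg summable_pairing assms) simp

lemma pairing_merge:
  assumes "square_summable \<alpha>" "square_summable \<beta>" "square_summable \<gamma>" "square_summable \<delta>"
  shows "pairing (merge \<alpha> \<gamma>) (merge \<beta> \<delta>) T = pairing \<alpha> \<beta> T + pairing \<gamma> \<delta> T"
  unfolding pairing_def
  using merge_sums[OF summable_sums[OF summable_pairing[OF assms(1,2)]] summable_sums[OF summable_pairing[OF assms(3,4)]]]
  by (intro sums_unique[symmetric]) (simp add: merge_comp2[of "\<lambda>u v. cmod (cinner (blinfun_apply T u) v)"])

lemma pairing_scaleR: 
  assumes "square_summable \<alpha>" "square_summable \<beta>"
  shows "pairing \<alpha> \<beta> (r *\<^sub>R T) = \<bar>r\<bar> * pairing \<alpha> \<beta> T"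
    "pairing (\<lambda>n. r *\<^sub>R \<alpha> n) \<beta> T = \<bar>r\<bar> * pairing \<alpha> \<beta> T"
  unfolding pairing_def
  by (simp_all add: blinfun.scaleR_left blinfun.scaleR_right cinner_scaleR_left norm_mult
      suminf_mult summable_pairing[OF assms])

text \<open>Finitely many functionals are combined into one pairing.\<close>

lemma ultraweak_nbhd_zero:
  fixes U :: "'h::chilbert_space op set"
  assumes "openin ultraweak_topology U" "0 \<in> U"
  shows "\<exists>\<alpha> \<beta> e. square_summable \<alpha> \<and> square_summable \<beta> \<and> e > 0 \<and> (\<forall>T. pairing \<alpha> \<beta> T < e \<longrightarrow> T \<in> U)"
proof -
  have "generate_topology_on {\<omega> -` W | \<omega> W. \<omega> \<in> ultraweak_functionals \<and> open W} U"
    using assms(1) unfolding ultraweak_topology_def by (rule openin_topology_generated_by)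
  then show ?thesis using assms(2)
  proof induction
    case (Int a b)
    then obtain \<alpha> \<beta> e \<gamma> \<delta> f where
      1: "square_summable \<alpha>" "square_summable \<beta>" "e > 0" "\<And>T. pairing \<alpha> \<beta> T < e \<Longrightarrow> T \<in> a" and
      2: "square_summable \<gamma>" "square_summable \<delta>" "f > 0" "\<And>T. pairing \<gamma> \<delta> T < f \<Longrightarrow> T \<in> b" by auto
    have "T \<in> a \<inter> b" if "pairing (merge \<alpha> \<gamma>) (merge \<beta> \<delta>) T < min e f" for T
      using that 1(4)[of T] 2(4)[of T] pairing_nonneg[OF 1(1,2), of T] pairing_nonneg[OF 2(1,2), of T]
      by (simp add: pairing_merge[OF 1(1,2) 2(1,2)])
    with 1 2 show ?case
      by (intro exI[of _ "merge \<alpha> \<gamma>"] exI[of _ "merge \<beta> \<delta>"] exI[of _ "min e f"])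
        (auto intro: square_summable_merge)
  next
    case (UN K)
    then obtain k where "k \<in> K" "0 \<in> k" by auto
    with UN.IH obtain \<alpha> \<beta> e where "square_summable \<alpha>" "square_summable \<beta>" "e > 0"
      "\<And>T. pairing \<alpha> \<beta> T < e \<Longrightarrow> T \<in> k" by blast
    with \<open>k \<in> K\<close> show ?case by blast
  next
    case (Basis s)
    then obtain \<omega> W where s: "s = \<omega> -` W" "\<omega> \<in> ultraweak_functionals" "open W" by auto
    obtain \<alpha> \<beta> where \<omega>: "square_summable \<alpha>" "square_summable \<beta>"
      "\<And>T. \<omega> T = (\<Sum>n. cinner (blinfun_apply T (\<alpha> n)) (\<beta> n))"
      by (rule ultraweak_functionalsE[OF s(2)]) (rule that; simp)
    have "\<omega> 0 = 0" by (simp add: \<omega> cinner.zero_left)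
    with Basis s have "0 \<in> W" by auto
    then obtain e where e: "e > 0" "ball 0 e \<subseteq> W" using s(3) open_contains_ball by blast
    have "cmod (\<omega> T) \<le> pairing \<alpha> \<beta> T" for T
      unfolding \<omega> pairing_def by (rule summable_norm[OF summable_pairing[OF \<omega>(1,2)]])
    then have "T \<in> s" if "pairing \<alpha> \<beta> T < e" for T
      using that e s by (metis le_less_trans mem_ball_0 subsetD vimageI)
    with \<omega> e show ?case by blast
  qed simp
qed

text \<open>Some zero neighbourhood given by a pairing is mapped into the unit disc; homogeneity
  extends this to a bound on all of \<open>M\<close>, the radius being absorbed into
  \<open>\<alpha>\<close>. Later arguments use ultraweak continuity of a functional on
  \<open>M\<close> through this domination only, so no series representing \<open>f\<close> is
  sought.\<close>

lemma ultraweakly_continuous_dominated: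
  fixes f :: "'h::chilbert_space op \<Rightarrow> complex"
  assumes M: "csubspace M" and f: "continuous_map (subtopology ultraweak_topology M) euclidean f"
    and scale: "\<And>r x. x \<in> M \<Longrightarrow> f (r *\<^sub>R x) = of_real r * f x"
    and top: "topspace ultraweak_topology = (UNIV :: 'h op set)"
  obtains \<alpha> \<beta> where "square_summable \<alpha>" "square_summable \<beta>" "\<And>x. x \<in> M \<Longrightarrow> cmod (f x) \<le> pairing \<alpha> \<beta> x"
proof -
  have 0: "f 0 = 0" using scale[of 0 0] csubspace_0[OF M] by simp
  have "openin (subtopology ultraweak_topology M) {x \<in> M. f x \<in> ball 0 1}"
    using openin_continuous_map_preimage[OF f, of "ball 0 1"] by (simp add: top)
  then obtain U where U: "openin ultraweak_topology U" "{x \<in> M. f x \<in> ball 0 1} = U \<inter> M"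
    by (auto simp: openin_subtopology)
  have "0 \<in> {x \<in> M. f x \<in> ball 0 1}" using 0 csubspace_0[OF M] by simp
  then have "0 \<in> U" unfolding U(2) by blast
  from ultraweak_nbhd_zero[OF U(1) this] obtain \<alpha> \<beta> e where
    *: "square_summable \<alpha>" "square_summable \<beta>" "e > 0" "\<And>T. pairing \<alpha> \<beta> T < e \<Longrightarrow> T \<in> U" by blast
  have "cmod (f x) \<le> pairing (\<lambda>n. (1/e) *\<^sub>R \<alpha> n) \<beta> x" if x: "x \<in> M" for x
  proof (rule ccontr)
    assume "\<not> cmod (f x) \<le> pairing (\<lambda>n. (1/e) *\<^sub>R \<alpha> n) \<beta> x"
    then have "1 / e * pairing \<alpha> \<beta> x < cmod (f x)"
      unfolding pairing_scaleR(2)[OF *(1,2)] using *(3) by simp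
    then have lt: "pairing \<alpha> \<beta> x < e * cmod (f x)"
      using *(3) by (simp add: pos_divide_less_eq mult.commute)
    then have pos: "cmod (f x) > 0"
      using pairing_nonneg[OF *(1,2), of x] *(3) zero_less_mult_pos[of e "cmod (f x)"]
      by (meson le_less_trans)
    \<comment> \<open>Scaling makes \<open>f\<close> take modulus one at a point where the
      neighbourhood forces modulus below one.\<close>
    define t where "t = 1 / cmod (f x)"
    have "pairing \<alpha> \<beta> (t *\<^sub>R x) < e"
      using lt pos by (simp add: pairing_scaleR(1)[OF *(1,2)] t_def pos_divide_less_eq)
    then have "t *\<^sub>R x \<in> U \<inter> M" using *(4) csubspace_scaleR[OF M x] by blast
    then have "cmod (f (t *\<^sub>R x)) < 1" unfolding U(2)[symmetric] by simp
    then show False using pos by (simp add: scale[OF x] t_def norm_mult norm_divide)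
  qed
  then show thesis using that[of "\<lambda>n. (1/e) *\<^sub>R \<alpha> n" \<beta>] square_summable_scaleR *(1,2) by blast
qed

lemma topspace_ultraweak [simp]: "topspace ultraweak_topology = (UNIV :: 'h::chilbert_space op set)"
proof -
  have "(\<lambda>T :: 'h op. \<Sum>n::nat. cinner (blinfun_apply T 0) 0) \<in> ultraweak_functionals"
    using ultraweak_functionalsI[of "\<lambda>_. 0" "\<lambda>_. 0"] by (simp add: square_summable_def)
  then have "UNIV \<in> {\<omega> -` W | (\<omega> :: 'h op \<Rightarrow> complex) W. \<omega> \<in> ultraweak_functionals \<and> open W}"
    by (smt (verit) mem_Collect_eq open_UNIV vimage_UNIV)
  then show ?thesis unfolding ultraweak_topology_def topology_generated_by_topspace by blast
qed

lemma continuous_map_ultraweak: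
  fixes \<omega> :: "'h::chilbert_space op \<Rightarrow> complex"
  assumes "\<omega> \<in> ultraweak_functionals"
  shows "continuous_map ultraweak_topology euclidean \<omega>"
  unfolding continuous_map
proof (intro conjI allI impI)
  fix U :: "complex set" assume "openin euclidean U"
  then have "\<omega> -` U \<in> {\<omega> -` W | \<omega> W. \<omega> \<in> ultraweak_functionals \<and> open W}"
    using assms by auto
  then have "openin ultraweak_topology (\<omega> -` U)"
    unfolding ultraweak_topology_def by (rule topology_generated_by_Basis)
  then show "openin ultraweak_topology {x \<in> topspace ultraweak_topology. \<omega> x \<in> U}"
    by (simp add: vimage_def)
qed simp

definition vector_functional :: "'h::chilbert_space \<Rightarrow> 'h \<Rightarrow> 'h op \<Rightarrow> complex" where
  "vector_functional \<xi> \<eta> T = cinner (blinfun_apply T \<xi>) \<eta>"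

lemma vector_functional_ultraweak: "vector_functional \<xi> \<eta> \<in> ultraweak_functionals"
proof -
  define \<delta> where "\<delta> \<zeta> n = (if n = (0::nat) then \<zeta> else 0)" for \<zeta> :: 'a and n
  have \<delta>: "square_summable (\<delta> \<zeta>)" for \<zeta>
    unfolding square_summable_def
    by (rule summable_finite[of "{0}"]) (auto simp: \<delta>_def)
  have "(\<Sum>n. cinner (blinfun_apply T (\<delta> \<xi> n)) (\<delta> \<eta> n)) = vector_functional \<xi> \<eta> T" for T
    by (subst suminf_finite[of "{0}"]) (auto simp: \<delta>_def vector_functional_def cinner.zero_right)
  then show ?thesis using ultraweak_functionalsI[OF \<delta> \<delta>, of \<xi> \<eta>] by (simp add: fun_eq_iff[symmetric])
qed

text \<open>On norm-bounded sequences strong convergence implies convergence of every pairing: the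
  terms are dominated by the summable
  \<open>C * (norm (\<alpha> n) * norm (\<beta> n))\<close>.\<close>

lemma pairing_tendsto_zero:
  fixes T :: "nat \<Rightarrow> 'h::chilbert_space op"
  assumes \<alpha>: "square_summable \<alpha>" "square_summable \<beta>"
    and bound: "\<And>k. norm (T k) \<le> C" and lim: "\<And>\<xi>. (\<lambda>k. blinfun_apply (T k) \<xi>) \<longlonglongrightarrow> 0"
  shows "(\<lambda>k. pairing \<alpha> \<beta> (T k)) \<longlonglongrightarrow> 0"
proof -
  have "((\<lambda>k. \<Sum>n. cmod (cinner (blinfun_apply (T k) (\<alpha> n)) (\<beta> n))) \<longlongrightarrow> (\<Sum>n. 0)) sequentially"
  proof (rule tannerys_theorem[THEN conjunct2, THEN conjunct2])
    show "summable (\<lambda>n. C * (norm (\<alpha> n) * norm (\<beta> n)))"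
      by (intro summable_mult summable_norm_product \<alpha>)
    show "(\<lambda>k. cmod (cinner (blinfun_apply (T k) (\<alpha> n)) (\<beta> n))) \<longlonglongrightarrow> 0" for n
      using tendsto_norm[OF cinner.tendsto[OF lim[of "\<alpha> n"] tendsto_const[of "\<beta> n"]]]
      by (simp add: cinner.zero_left)
    have "norm (cmod (cinner (blinfun_apply (T k) (\<alpha> n)) (\<beta> n))) \<le> C * (norm (\<alpha> n) * norm (\<beta> n))" for k n
    proof -
      have "cmod (cinner (blinfun_apply (T k) (\<alpha> n)) (\<beta> n)) \<le> norm (blinfun_apply (T k) (\<alpha> n)) * norm (\<beta> n)"
        by (rule norm_cinner_le)
      also have "\<dots> \<le> (norm (T k) * norm (\<alpha> n)) * norm (\<beta> n)"
        by (intro mult_right_mono norm_blinfun) simp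
      also have "\<dots> \<le> (C * norm (\<alpha> n)) * norm (\<beta> n)"
        by (intro mult_right_mono bound) simp_all
      finally show ?thesis by (simp add: mult.assoc)
    qed
    then show "\<forall>\<^sub>F (n, k) in sequentially \<times>\<^sub>F sequentially.
        norm (cmod (cinner (blinfun_apply (T k) (\<alpha> n)) (\<beta> n))) \<le> C * (norm (\<alpha> n) * norm (\<beta> n))"
      by (intro always_eventually) auto
  qed simp
  then show ?thesis by (simp add: pairing_def)
qed

section \<open>Von Neumann algebras and conditional expectations\<close>

locale vn_algebra =
  fixes M :: "'h::chilbert_space op set"
  assumes vn: "von_neumann_algebra M"
begin

lemma sub: "M \<subseteq> bounded_operators" and bounded: "x \<in> M \<Longrightarrow> x \<in> bounded_operators"
  and adj_closed: "x \<in> M \<Longrightarrow> adj x \<in> M"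
  and bicommutant: "commutant (commutant M) = M"
  using vn by (auto simp: von_neumann_algebra_def)

lemma commutant_sub: "commutant M \<subseteq> bounded_operators"
  by (auto simp: commutant_def)

lemma
  shows csub: "csubspace M" and complete: "complete M" and id_in: "id_blinfun \<in> M"
    and compose_in: "a \<in> M \<Longrightarrow> b \<in> M \<Longrightarrow> a o\<^sub>L b \<in> M"
    and inverse_in: "a \<in> M \<Longrightarrow> a o\<^sub>L b = id_blinfun \<Longrightarrow> b o\<^sub>L a = id_blinfun \<Longrightarrow> b \<in> M"
  using csubspace_commutant[OF commutant_sub] complete_commutant[of "commutant M"]
    commutant_id[of "commutant M"] commutant_compose[of a "commutant M" b]
    commutant_inverse[of a "commutant M" b]
  unfolding bicommutant by auto

lemma strong_limit:
  assumes "\<And>n. T n \<in> M" "\<And>x. (\<lambda>n. blinfun_apply (T n) x) \<longlonglongrightarrow> blinfun_apply A x"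
  shows "A \<in> M"
  using commutant_strong_limit[of T "commutant M" A] assms unfolding bicommutant by blast

lemma commutant_adj: "d \<in> commutant M \<Longrightarrow> adj d \<in> commutant M"
proof -
  assume d: "d \<in> commutant M"
  then have db: "d \<in> bounded_operators" by (rule commutantD)
  have "adj d o\<^sub>L x = x o\<^sub>L adj d" if x: "x \<in> M" for x
  proof -
    have "adj (d o\<^sub>L adj x) = adj (adj x o\<^sub>L d)"
      using commutantD(2)[OF d adj_closed[OF x]] by simp
    then show ?thesis
      using adj_compose[OF db adj_in[OF bounded[OF x]]] adj_compose[OF adj_in[OF bounded[OF x]] db]
      by (simp add: adj_adj[OF bounded[OF x]])
  qed
  then show ?thesis using adj_in[OF db] by (simp add: commutant_def)
qed

end

locale cond_exp = M: vn_algebra M + N: vn_algebra N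
  for M N :: "'h::chilbert_space op set" +
  fixes E :: "'h op \<Rightarrow> 'h op"
  assumes ce: "conditional_expectation M N E"
begin

lemma NM: "a \<in> N \<Longrightarrow> a \<in> M" and E_in: "x \<in> M \<Longrightarrow> E x \<in> N" and E_lin: "clinear_on M E"
  and E_fix: "a \<in> N \<Longrightarrow> E a = a"
  and E_pos: "x \<in> M \<Longrightarrow> positive_op x \<Longrightarrow> positive_op (E x)"
  and E_bimod: "a \<in> N \<Longrightarrow> b \<in> N \<Longrightarrow> x \<in> M \<Longrightarrow> E (a o\<^sub>L x o\<^sub>L b) = a o\<^sub>L E x o\<^sub>L b"
  and E_ext: "E \<in> extensional M"
  using ce by (auto simp: conditional_expectation_def PiE_def)

lemma E_in_M: "x \<in> M \<Longrightarrow> E x \<in> M" using E_in NM by blast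

lemma E_left: "a \<in> N \<Longrightarrow> x \<in> M \<Longrightarrow> E (a o\<^sub>L x) = a o\<^sub>L E x"
  using E_bimod[of a id_blinfun x] N.id_in by simp

lemma E_right: "a \<in> N \<Longrightarrow> x \<in> M \<Longrightarrow> E (x o\<^sub>L a) = E x o\<^sub>L a"
  using E_bimod[of id_blinfun a x] N.id_in by simp

lemma E_id: "E id_blinfun = id_blinfun" by (rule E_fix[OF N.id_in])

lemmas E_simps = clinear_onD[OF E_lin M.csub]

text \<open>Adding \<open>norm x\<close> times the identity makes \<open>x\<close> positive,
  \<open>E\<close> preserves positivity, and positive operators are self-adjoint.\<close>

lemma E_adj_self:
  assumes x: "x \<in> M" "adj x = x" shows "adj (E x) = E x"
proof -
  let ?y = "x + norm x *\<^sub>R id_blinfun"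
  have y: "?y \<in> M" using x M.csub M.id_in by (simp add: csubspaceD)
  have "0 \<le> Re (cinner (?y v) v)" for v
  proof -
    have "- Re (cinner (x v) v) \<le> cmod (cinner (x v) v)" using abs_Re_le_cmod[of "cinner (x v) v"] by simp
    also have "\<dots> \<le> norm (x v) * norm v" by (rule norm_cinner_le)
    also have "\<dots> \<le> norm x * norm v * norm v" by (intro mult_right_mono norm_blinfun) simp
    finally show ?thesis
      by (simp add: blinfun.add_left blinfun.scaleR_left cinner_add_left cinner_scaleR_left cinner_self power2_eq_square)
  qed
  moreover have "adj ?y = ?y"
    using M.bounded[OF x(1)] x(2) by (simp add: adj_add adj_scaleR bounded_operators_closed adj_id)
  ultimately have "positive_op (E ?y)"
    using E_pos[OF y] positive_op_iff[OF M.bounded[OF y]] by simp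
  then have "adj (E ?y) = E ?y"
    using positive_op_iff[OF M.bounded[OF E_in_M[OF y]]] by simp
  moreover have "E ?y = E x + norm x *\<^sub>R id_blinfun"
    using E_simps(1)[OF x(1)] E_simps(6)[OF M.id_in] M.csub M.id_in by (simp add: csubspaceD E_id)
  ultimately show ?thesis
    using M.bounded[OF E_in_M[OF x(1)]] by (simp add: adj_add adj_scaleR bounded_operators_closed adj_id)
qed

lemma E_adj:
  assumes x: "x \<in> M" shows "E (adj x) = adj (E x)"
proof -
  note bx = M.bounded[OF x]
  \<comment> \<open>Real and imaginary part of \<open>x\<close>; both are self-adjoint, so the
    previous lemma applies to each.\<close>
  define a b where "a = (1/2) *\<^sub>R (x + adj x)" and "b = (- \<i> / 2) *\<^sub>C (x - adj x)"
  have ab: "a \<in> M" "b \<in> M" using x M.csub M.adj_closed by (simp_all add: a_def b_def csubspaceD)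
  note bx' = adj_in[OF bx]
  have "adj b = cnj (- \<i> / 2) *\<^sub>C (adj x - x)"
    unfolding b_def adj_scaleC[OF bounded_operators_diff[OF bx bx']]
      adj_diff[OF bx bx'] adj_adj[OF bx] ..
  also have "\<dots> = b"
    unfolding b_def minus_diff_eq[of x "adj x", symmetric] scaleC_minus_right scaleC_minus_left[symmetric] by simp
  finally have sb: "adj b = b" .
  have sa: "adj a = a"
    unfolding a_def adj_scaleR[OF bounded_operators_add[OF bx bx']]
      adj_add[OF bx bx'] adj_adj[OF bx] by (simp add: add.commute)
  have ib: "\<i> *\<^sub>C b = (1/2) *\<^sub>R (x - adj x)"
    unfolding b_def scaleC_scaleC using scaleC_of_real[of "1/2" "x - adj x"] by simp
  have x_eq: "x = a + \<i> *\<^sub>C b" unfolding ib a_def by (simp add: scaleR_add_right[symmetric])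
  have y_eq: "adj x = a - \<i> *\<^sub>C b" unfolding ib a_def
    by (simp add: scaleR_diff_right[symmetric] scaleR_2[symmetric])
  have ibM: "\<i> *\<^sub>C b \<in> M" using ab M.csub by (simp add: csubspaceD)
  have "E (adj x) = E a - \<i> *\<^sub>C E b"
    unfolding y_eq using ab ibM E_simps(5)[of a "\<i> *\<^sub>C b"] E_simps(2)[of b \<i>] by simp
  moreover have "E x = E a + \<i> *\<^sub>C E b"
    using ab ibM E_simps(1)[of a "\<i> *\<^sub>C b"] E_simps(2)[of b \<i>] x_eq by simp
  then have "adj (E x) = adj (E a) + (- \<i>) *\<^sub>C adj (E b)"
    using M.bounded[OF E_in_M] ab by (simp add: adj_add adj_scaleC bounded_operators_closed)
  ultimately show ?thesis
    using E_adj_self[OF ab(1) sa] E_adj_self[OF ab(2) sb] by (simp add: scaleC_minus_left)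
qed

lemma positive_adj_compose: "x \<in> bounded_operators \<Longrightarrow> positive_op (adj x o\<^sub>L x)"
  by (simp add: positive_op_def cinner_adj' cinner_self complex_nonneg_Reals_iff)

text \<open>The hypothesis on vectors says that \<open>C\<close> times
  \<open>adj y o\<^sub>L y\<close> minus \<open>adj x o\<^sub>L x\<close> is a positive operator,
  and \<open>E\<close> keeps it positive.\<close>

lemma E_mono:
  assumes x: "x \<in> M" and y: "y \<in> M" and le: "\<And>v. (norm (x v))\<^sup>2 \<le> C * (norm (y v))\<^sup>2"
  shows "Re (cinner (E (adj x o\<^sub>L x) v) v) \<le> C * Re (cinner (E (adj y o\<^sub>L y) v) v)"
proof -
  let ?z = "C *\<^sub>R (adj y o\<^sub>L y) - (adj x o\<^sub>L x)"
  have bx: "x \<in> bounded_operators" and yb: "y \<in> bounded_operators" using x y M.bounded by auto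
  have xx: "adj x o\<^sub>L x \<in> M" "adj y o\<^sub>L y \<in> M" using x y M.adj_closed M.compose_in by auto
  then have yy: "C *\<^sub>R (adj y o\<^sub>L y) \<in> M" using M.csub by (simp add: csubspaceD)
  then have z: "?z \<in> M" by (rule csubspace_diff[OF M.csub _ xx(1)])
  have "cinner (?z v) v = of_real (C * (norm (y v))\<^sup>2 - (norm (x v))\<^sup>2)" for v
    by (simp add: blinfun.diff_left blinfun.scaleR_left cinner.diff_left cinner_scaleR_left cinner_adj'[OF bx] cinner_adj'[OF yb] cinner_self)
  then have "positive_op ?z" using le by (simp add: positive_op_def complex_nonneg_Reals_iff)
  then have "positive_op (E ?z)" by (rule E_pos[OF z])
  moreover have "E ?z = C *\<^sub>R E (adj y o\<^sub>L y) - E (adj x o\<^sub>L x)"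
    using E_simps(5)[OF yy xx(1)] E_simps(6)[OF xx(2)] by simp
  ultimately have "0 \<le> Re (cinner ((C *\<^sub>R E (adj y o\<^sub>L y) - E (adj x o\<^sub>L x)) v) v)"
    by (simp only: positive_op_def complex_nonneg_Reals_iff)
  then show ?thesis
    by (simp add: blinfun.diff_left blinfun.scaleR_left cinner.diff_left cinner_scaleR_left)
qed

lemma E_square: assumes x: "x \<in> M" shows "0 \<le> Re (cinner (E (adj x o\<^sub>L x) v) v)"
  using E_pos[OF M.compose_in[OF M.adj_closed[OF x] x] positive_adj_compose[OF M.bounded[OF x]]]
  by (simp add: positive_op_def complex_nonneg_Reals_iff)

text \<open>The Kadison-Schwarz inequality: positivity of \<open>E\<close> at the square of
  \<open>x - E x\<close> and the bimodule property give
  \<open>adj (E x) o\<^sub>L E x \<le> E (adj x o\<^sub>L x)\<close> as forms, and the right side is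
  at most the square of \<open>norm x\<close>.\<close>

lemma norm_E_le:
  assumes x: "x \<in> M" shows "norm (E x) \<le> norm x"
proof (rule norm_blinfun_bound)
  fix v
  note bx = M.bounded[OF x] and bE = M.bounded[OF E_in_M[OF x]]
  note [simp] = adj_diff[OF bx bE]
  let ?e = "E x"
  have eN: "?e \<in> N" "adj ?e \<in> N" using E_in[OF x] N.adj_closed by auto
  have in_M: "adj x o\<^sub>L x \<in> M" "adj x o\<^sub>L ?e \<in> M" "adj ?e o\<^sub>L x \<in> M" "adj ?e o\<^sub>L ?e \<in> M"
    using x M.adj_closed E_in_M M.compose_in by auto
  have "E (adj (x - ?e) o\<^sub>L (x - ?e)) = E (((adj x o\<^sub>L x) - (adj x o\<^sub>L ?e)) - ((adj ?e o\<^sub>L x) - (adj ?e o\<^sub>L ?e)))"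
    by (rule arg_cong[where f = E]) (simp add: compose.diff_left compose.diff_right algebra_simps)
  also have "\<dots> = (E (adj x o\<^sub>L x) - E (adj x o\<^sub>L ?e)) - (E (adj ?e o\<^sub>L x) - E (adj ?e o\<^sub>L ?e))"
    using in_M M.csub by (simp add: E_simps(5) csubspaceD)
  also have "\<dots> = E (adj x o\<^sub>L x) - (adj ?e o\<^sub>L ?e)"
    using E_right[OF eN(1) M.adj_closed[OF x]] E_left[OF eN(2) x] E_left[OF eN(2) NM[OF eN(1)]]
    by (simp add: E_adj[OF x] E_fix[OF eN(1)])
  finally have *: "E (adj (x - ?e) o\<^sub>L (x - ?e)) = E (adj x o\<^sub>L x) - (adj ?e o\<^sub>L ?e)" .
  have "x - ?e \<in> M" using x E_in_M[OF x] M.csub by (simp add: csubspaceD)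
  from E_square[OF this, of v] have "(norm (?e v))\<^sup>2 \<le> Re (cinner (E (adj x o\<^sub>L x) v) v)"
    unfolding * by (simp add: blinfun.diff_left cinner.diff_left cinner_adj'[OF bE] cinner_self)
  also have "\<dots> \<le> (norm x)\<^sup>2 * Re (cinner (E (adj id_blinfun o\<^sub>L id_blinfun) v) v)"
    using power_mono[OF norm_blinfun[of x], of _ 2] by (intro E_mono x M.id_in) (simp add: power_mult_distrib)
  also have "\<dots> = (norm x * norm v)\<^sup>2"
    by (simp add: adj_id E_id cinner_self power_mult_distrib)
  finally show "norm (?e v) \<le> norm x * norm v" by (rule power2_le_imp_le) simp
qed simp

end

section \<open>The centralizer of a conditional expectation\<close>

text \<open>Covers degenerate forms as well: for \<open>a = 0\<close> the linear term must vanish,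
  which is tested at one suitable \<open>t\<close>.\<close>

lemma discriminant_le:
  fixes a b c :: real
  assumes "\<And>t. 0 \<le> t\<^sup>2 * a + 2 * t * b + c" "0 \<le> a" "0 \<le> c"
  shows "b\<^sup>2 \<le> a * c"
proof (cases "a = 0")
  case True
  have "b = 0"
  proof (rule ccontr)
    assume b: "b \<noteq> 0"
    have "0 \<le> 2 * (- (c + 1) / (2 * b)) * b + c" using assms(1)[of "- (c + 1) / (2 * b)"] True by simp
    also have "2 * (- (c + 1) / (2 * b)) * b + c = - 1" using b by (simp add: field_simps)
    finally show False by simp
  qed
  then show ?thesis using assms by simp
next
  case False
  with assms(2) have a: "a > 0" by simp
  have "0 \<le> (- b / a)\<^sup>2 * a + 2 * (- b / a) * b + c" by (rule assms(1))
  also have "\<dots> = c - b\<^sup>2 / a" using a by (simp add: power2_eq_square field_simps)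
  finally have "b\<^sup>2 / a \<le> c" by simp
  then show ?thesis using a by (simp add: pos_divide_le_eq mult.commute)
qed

lemma le_of_square_le_mult:
  fixes a b :: real
  assumes "a\<^sup>2 \<le> a * b" "0 \<le> b" shows "a \<le> b"
proof (cases "a > 0")
  case True
  then show ?thesis using assms(1) by (simp add: power2_eq_square)
qed (use assms(2) in linarith)

context cond_exp
begin

text \<open>Normality of \<open>E\<close> enters the development only through this estimate,
  obtained from the ultraweak continuity of \<open>\<omega> \<circ> E\<close> on
  \<open>M\<close>.\<close>

lemma E_continuous_dominated:
  assumes "normal_map M E" and \<omega>: "\<omega> \<in> ultraweak_functionals"
  obtains \<alpha> \<beta> where "square_summable \<alpha>" "square_summable \<beta>"
    "\<And>x. x \<in> M \<Longrightarrow> cmod (\<omega> (E x)) \<le> pairing \<alpha> \<beta> x"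
proof -
  obtain \<alpha>' \<beta>' where \<omega>': "square_summable \<alpha>'" "square_summable \<beta>'"
    "\<And>T. \<omega> T = (\<Sum>n. cinner (blinfun_apply T (\<alpha>' n)) (\<beta>' n))"
    by (rule ultraweak_functionalsE[OF \<omega>]) (rule that; simp)
  have "continuous_map (subtopology ultraweak_topology M) ultraweak_topology E"
    using assms(1) by (simp add: normal_map_def continuous_map_in_subtopology)
  from continuous_map_compose[OF this continuous_map_ultraweak[OF \<omega>]]
  have c: "continuous_map (subtopology ultraweak_topology M) euclidean (\<omega> \<circ> E)" .
  have sc: "(\<omega> \<circ> E) (r *\<^sub>R x) = of_real r * (\<omega> \<circ> E) x" if x: "x \<in> M" for r x
  proof -
    have "summable (\<lambda>n. cinner (blinfun_apply (E x) (\<alpha>' n)) (\<beta>' n))"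
      by (rule summable_norm_cancel[OF summable_pairing[OF \<omega>'(1,2)]])
    then show ?thesis
      by (simp add: \<omega>'(3) E_simps(6)[OF x] blinfun.scaleR_left cinner_scaleR_left suminf_mult)
  qed
  show thesis
    by (rule ultraweakly_continuous_dominated[OF M.csub c sc topspace_ultraweak]) (auto intro: that)
qed

text \<open>The elements of the relative commutant of \<open>N\<close> under which \<open>E\<close>
  behaves like a trace. When \<open>N\<close> consists of the scalars, \<open>E\<close> is a state
  and this is its usual centralizer.\<close>

definition centralizer where
  "centralizer = {c \<in> M. (\<forall>a\<in>N. c o\<^sub>L a = a o\<^sub>L c) \<and> (\<forall>x\<in>M. E (c o\<^sub>L x) = E (x o\<^sub>L c))}"

lemma centralizerD:
  assumes "c \<in> centralizer"
  shows centralizer_M: "c \<in> M" and centralizer_comm: "a \<in> N \<Longrightarrow> c o\<^sub>L a = a o\<^sub>L c"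
    and centralizer_E: "x \<in> M \<Longrightarrow> E (c o\<^sub>L x) = E (x o\<^sub>L c)"
  using assms by (auto simp: centralizer_def)

lemma csubspace_centralizer: "csubspace centralizer"
  unfolding csubspace_def
proof (intro conjI ballI allI)
  show "0 \<in> centralizer" by (simp add: centralizer_def csubspace_0[OF M.csub])
next
  fix c d assume c: "c \<in> centralizer" and d: "d \<in> centralizer"
  have "E ((c + d) o\<^sub>L x) = E (x o\<^sub>L (c + d))" if x: "x \<in> M" for x
    using centralizer_E[OF c x] centralizer_E[OF d x] E_simps(1) centralizerD(1)[OF c] centralizerD(1)[OF d] x
    by (simp add: compose.add_left compose.add_right M.compose_in)
  then show "c + d \<in> centralizer"
    using centralizerD[OF c] centralizerD[OF d]
    by (simp add: centralizer_def csubspace_add[OF M.csub] compose.add_left compose.add_right)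
next
  fix k c assume c: "c \<in> centralizer"
  have "E ((k *\<^sub>C c) o\<^sub>L x) = E (x o\<^sub>L (k *\<^sub>C c))" if x: "x \<in> M" for x
    using centralizer_E[OF c x] E_simps(2) centralizerD(1)[OF c] x
    by (simp add: compose_scaleC_left compose_scaleC_right M.compose_in M.bounded)
  then show "k *\<^sub>C c \<in> centralizer"
    using centralizerD[OF c]
    by (simp add: centralizer_def csubspace_scaleC[OF M.csub] compose_scaleC_left compose_scaleC_right
        M.bounded NM)
qed

lemma id_centralizer: "id_blinfun \<in> centralizer"
  by (simp add: centralizer_def M.id_in)

lemma compose_centralizer:
  assumes c: "c \<in> centralizer" and d: "d \<in> centralizer" shows "c o\<^sub>L d \<in> centralizer"
proof -
  note cM = centralizer_M[OF c] and dM = centralizer_M[OF d]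
  have "(c o\<^sub>L d) o\<^sub>L a = a o\<^sub>L (c o\<^sub>L d)" if "a \<in> N" for a
    using centralizer_comm[OF c that] centralizer_comm[OF d that] by (metis blinfun_compose_assoc)
  moreover have "E ((c o\<^sub>L d) o\<^sub>L x) = E (x o\<^sub>L (c o\<^sub>L d))" if x: "x \<in> M" for x
  proof -
    have "E ((c o\<^sub>L d) o\<^sub>L x) = E ((d o\<^sub>L x) o\<^sub>L c)"
      unfolding blinfun_compose_assoc[of c d] by (rule centralizer_E[OF c M.compose_in[OF dM x]])
    also have "\<dots> = E ((x o\<^sub>L c) o\<^sub>L d)"
      unfolding blinfun_compose_assoc[of d x] by (rule centralizer_E[OF d M.compose_in[OF x cM]])
    finally show ?thesis by (simp add: blinfun_compose_assoc)
  qed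
  ultimately show ?thesis using M.compose_in[OF cM dM] by (simp add: centralizer_def)
qed

lemma adj_centralizer:
  assumes c: "c \<in> centralizer" shows "adj c \<in> centralizer"
proof -
  note cM = centralizer_M[OF c] and cb = M.bounded[OF centralizer_M[OF c]]
  have "adj c o\<^sub>L a = a o\<^sub>L adj c" if a: "a \<in> N" for a
  proof -
    have "adj (c o\<^sub>L adj a) = adj (adj a o\<^sub>L c)" using centralizer_comm[OF c N.adj_closed[OF a]] by simp
    then show ?thesis
      using adj_compose[OF cb N.bounded[OF N.adj_closed[OF a]]] adj_compose[OF N.bounded[OF N.adj_closed[OF a]] cb]
      by (simp add: adj_adj[OF N.bounded[OF a]])
  qed
  moreover have "E (adj c o\<^sub>L x) = E (x o\<^sub>L adj c)" if x: "x \<in> M" for x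
  proof -
    note xa = M.adj_closed[OF x]
    have "E (adj c o\<^sub>L x) = adj (E (adj x o\<^sub>L c))"
      using E_adj[OF M.compose_in[OF xa cM]] adj_compose[OF M.bounded[OF xa] cb] by (simp add: adj_adj[OF M.bounded[OF x]])
    also have "\<dots> = adj (E (c o\<^sub>L adj x))" using centralizer_E[OF c xa] by simp
    also have "\<dots> = E (x o\<^sub>L adj c)"
      using E_adj[OF M.compose_in[OF cM xa]] adj_compose[OF cb M.bounded[OF xa]] by (simp add: adj_adj[OF M.bounded[OF x]])
    finally show ?thesis .
  qed
  ultimately show ?thesis using M.adj_closed[OF cM] by (simp add: centralizer_def)
qed

lemma norm_compose_le: "norm (a o\<^sub>L b) \<le> norm a * norm b" for a b :: "'h op"
  by (rule norm_blinfun_compose)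

text \<open>The trace identity cannot be passed to the limit by norm continuity. The commutators
  with \<open>x\<close> stay bounded and converge strongly, so every pairing of their differences
  tends to zero, and with it each matrix element of \<open>E\<close> at the limit
  commutator.\<close>

lemma centralizer_strong_limit:
  assumes normal: "normal_map M E" and c: "\<And>k. c k \<in> centralizer" and bound: "\<And>k. norm (c k) \<le> C"
    and lim: "\<And>\<xi>. (\<lambda>k. blinfun_apply (c k) \<xi>) \<longlonglongrightarrow> blinfun_apply d \<xi>"
  shows "d \<in> centralizer"
proof -
  have d: "d \<in> M" by (rule M.strong_limit[OF centralizer_M[OF c] lim])
  have "d o\<^sub>L a = a o\<^sub>L d" if a: "a \<in> N" for a
  proof (rule blinfun_eqI)
    fix v
    have "(\<lambda>k. blinfun_apply (c k) (a v)) \<longlonglongrightarrow> a (d v)"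
    proof -
      have "blinfun_apply (c k) (a v) = a (c k v)" for k
        using centralizer_comm[OF c a, of k] by (metis blinfun_apply_blinfun_compose)
      then show ?thesis using blinfun.tendsto[OF tendsto_const[of a] lim[of v]] by simp
    qed
    then show "blinfun_apply (d o\<^sub>L a) v = blinfun_apply (a o\<^sub>L d) v"
      using LIMSEQ_unique[OF lim] by simp
  qed
  moreover have "E (d o\<^sub>L x) = E (x o\<^sub>L d)" if x: "x \<in> M" for x
  proof -
    let ?f = "\<lambda>c. (c o\<^sub>L x) - (x o\<^sub>L c)"
    have fM: "?f c \<in> M" if "c \<in> M" for c
      using csubspace_diff[OF M.csub M.compose_in[OF that x] M.compose_in[OF x that]] .
    have fc: "E (?f (c k)) = 0" for k
      using centralizer_E[OF c x] E_simps(5)[OF M.compose_in[OF centralizer_M[OF c] x] M.compose_in[OF x centralizer_M[OF c]]] by simp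
    have "cinner (blinfun_apply (E (?f d)) \<xi>) \<eta> = 0" for \<xi> \<eta>
    proof -
      obtain \<alpha> \<beta> where ab: "square_summable \<alpha>" "square_summable \<beta>"
        "\<And>x. x \<in> M \<Longrightarrow> cmod (vector_functional \<xi> \<eta> (E x)) \<le> pairing \<alpha> \<beta> x"
        by (rule E_continuous_dominated[OF normal vector_functional_ultraweak[of \<xi> \<eta>]]) (rule that; blast)
      have "(\<lambda>k. pairing \<alpha> \<beta> (?f d - ?f (c k))) \<longlonglongrightarrow> 0"
      proof (rule pairing_tendsto_zero[OF ab(1,2)])
        fix k
        have f: "norm (?f b) \<le> 2 * norm b * norm x" for b
          using norm_triangle_ineq4[of "b o\<^sub>L x" "x o\<^sub>L b"] norm_compose_le[of b x] norm_compose_le[of x b, unfolded mult.commute[of "norm x"]]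
          unfolding mult.assoc by linarith
        have "norm (?f d - ?f (c k)) \<le> 2 * norm d * norm x + 2 * norm (c k) * norm x"
          using norm_triangle_ineq4[of "?f d" "?f (c k)"] f[of d] f[of "c k"] by linarith
        also have "\<dots> \<le> 2 * norm d * norm x + 2 * C * norm x"
          using bound[of k] by (intro add_left_mono mult_right_mono) auto
        finally show "norm (?f d - ?f (c k)) \<le> 2 * norm d * norm x + 2 * C * norm x" .
      next
        fix \<zeta>
        have "(\<lambda>k. blinfun_apply (?f d) \<zeta> - ((c k) (x \<zeta>) - x ((c k) \<zeta>))) \<longlonglongrightarrow>
            blinfun_apply (?f d) \<zeta> - (d (x \<zeta>) - x (d \<zeta>))"
          by (intro tendsto_diff tendsto_const lim blinfun.tendsto)
        then show "(\<lambda>k. blinfun_apply (?f d - ?f (c k)) \<zeta>) \<longlonglongrightarrow> 0"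
          by (simp add: blinfun.diff_left)
      qed
      moreover have "cmod (cinner (blinfun_apply (E (?f d)) \<xi>) \<eta>) \<le> pairing \<alpha> \<beta> (?f d - ?f (c k))" for k
        using ab(3)[OF csubspace_diff[OF M.csub fM[OF d] fM[OF centralizer_M[OF c]]], of k]
          E_simps(5)[OF fM[OF d] fM[OF centralizer_M[OF c]]] fc[of k]
        by (simp add: vector_functional_def)
      ultimately have "cmod (cinner (blinfun_apply (E (?f d)) \<xi>) \<eta>) \<le> 0"
        by (intro LIMSEQ_le_const) auto
      then show ?thesis by simp
    qed
    then have "E (?f d) = 0" by (intro blinfun_eqI) (simp add: cinner_eq_zero)
    then show ?thesis using E_simps(5)[OF M.compose_in[OF d x] M.compose_in[OF x d]] by simp
  qed
  ultimately show ?thesis using d by (simp add: centralizer_def)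
qed

end

section \<open>A separating sequence\<close>

text \<open>Each functional of a countable dense set is dominated by a pairing whose first sequence
  is \<open>\<alpha> k\<close>. An \<open>x\<close> that kills all these vectors is killed by the
  dense set, hence by every vector functional. Weights merge the countably many sequences into
  one.\<close>

lemma (in vn_algebra) separating_sequence:
  assumes "separable_predual M"
  obtains \<theta> where "square_summable \<theta>" "\<And>x. x \<in> M \<Longrightarrow> (\<And>m. blinfun_apply x (\<theta> m) = 0) \<Longrightarrow> x = 0"
proof -
  obtain D where D: "D \<subseteq> predual M" "countable D"
    "\<And>\<phi> e. \<phi> \<in> predual M \<Longrightarrow> e > 0 \<Longrightarrow> \<exists>\<psi>\<in>D. \<forall>x\<in>M. cmod (\<phi> x - \<psi> x) \<le> e * norm x"
    using assms unfolding separable_predual_def by blast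
  have pre: "restrict (vector_functional \<xi> \<eta>) M \<in> predual M" for \<xi> \<eta>
  proof -
    have "continuous_map (subtopology ultraweak_topology M) euclidean (restrict (vector_functional \<xi> \<eta>) M)"
      by (rule continuous_map_eq[OF continuous_map_from_subtopology[OF continuous_map_ultraweak[OF vector_functional_ultraweak[of \<xi> \<eta>]]]]) simp
    moreover have "clinear_on M (restrict (vector_functional \<xi> \<eta>) M)"
      using csub by (simp add: clinear_on_def csubspaceD vector_functional_def blinfun.add_left cinner_add_left
          scaleC_blinfun.rep_eq cinner_scaleC_left scaleC_complex_def)
    ultimately show ?thesis by (simp add: predual_def)
  qed
  then have "D \<noteq> {}" using D(3)[OF pre[of 0 0], of 1] by auto
  then obtain \<psi> :: "nat \<Rightarrow> 'h op \<Rightarrow> complex" where \<psi>: "range \<psi> = D" using D(2) by (metis uncountable_def)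
  have "\<exists>\<alpha> \<beta>. square_summable \<alpha> \<and> square_summable \<beta> \<and> (\<forall>x\<in>M. cmod (\<psi> k x) \<le> pairing \<alpha> \<beta> x)" for k
  proof -
    have "\<psi> k \<in> predual M" using \<psi> D(1) by auto
    then have k: "clinear_on M (\<psi> k)" "continuous_map (subtopology ultraweak_topology M) euclidean (\<psi> k)"
      by (auto simp: predual_def)
    have "\<psi> k (r *\<^sub>R x) = of_real r * \<psi> k x" if "x \<in> M" for r x
      using clinear_on_scaleR[OF k(1) csub that] by (simp add: scaleR_conv_of_real)
    from ultraweakly_continuous_dominated[OF csub k(2) this topspace_ultraweak] show ?thesis by metis
  qed
  then obtain \<alpha> \<beta> where ab: "\<And>k. square_summable (\<alpha> k)" "\<And>k. square_summable (\<beta> k)"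
    "\<And>k x. x \<in> M \<Longrightarrow> cmod (\<psi> k x) \<le> pairing (\<alpha> k) (\<beta> k) x" by metis
  define s where "s k = (\<Sum>n. (norm (\<alpha> k n))\<^sup>2)" for k
  have s0: "0 \<le> s k" for k unfolding s_def using ab(1)[of k] by (intro suminf_nonneg) (auto simp: square_summable_def)
  \<comment> \<open>The weight makes the total square norm of the \<open>k\<close>-th sequence at
    most \<open>(1/2)^k\<close>; the summand 1 in the denominator covers sequences that
    vanish.\<close>
  define c where "c k = sqrt ((1/2)^k / (1 + s k))" for k :: nat
  have c: "c k > 0" "(c k)\<^sup>2 * s k \<le> (1/2)^k" for k
  proof -
    show "c k > 0" using s0[of k] by (simp add: c_def)
    have "(c k)\<^sup>2 = (1/2)^k / (1 + s k)" using s0[of k] by (simp add: c_def)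
    also have "\<dots> * s k \<le> (1/2)^k" using s0[of k] by (simp add: pos_divide_le_eq mult_left_mono)
    finally show "(c k)\<^sup>2 * s k \<le> (1/2)^k" .
  qed
  define \<theta> where "\<theta> m = (case prod_decode m of (k, n) \<Rightarrow> c k *\<^sub>R \<alpha> k n)" for m
  have "square_summable \<theta>"
    unfolding square_summable_def
  proof (rule summableI_nonneg_bounded)
    fix K
    have "(\<Sum>m<K. (norm (\<theta> m))\<^sup>2) = (\<Sum>p\<in>prod_decode ` {..<K}. (norm (c (fst p) *\<^sub>R \<alpha> (fst p) (snd p)))\<^sup>2)"
      by (subst sum.reindex) (auto simp: \<theta>_def split_beta inj_on_def prod_decode_eq)
    also have "\<dots> \<le> (\<Sum>p\<in>{..K} \<times> {..K}. (norm (c (fst p) *\<^sub>R \<alpha> (fst p) (snd p)))\<^sup>2)"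
    proof (rule sum_mono2)
      \<comment> \<open>Both components of a pair are at most its code, so a partial sum along the
        enumeration is bounded by a sum over a square.\<close>
      show "prod_decode ` {..<K} \<subseteq> {..K} \<times> {..K}"
      proof
        fix p assume "p \<in> prod_decode ` {..<K}"
        then have "prod_encode p < K" by auto
        then show "p \<in> {..K} \<times> {..K}"
          using le_prod_encode_1[of "fst p" "snd p"] le_prod_encode_2[of "snd p" "fst p"] by (cases p) auto
      qed
    qed auto
    also have "\<dots> = (\<Sum>k\<le>K. (c k)\<^sup>2 * (\<Sum>n\<le>K. (norm (\<alpha> k n))\<^sup>2))"
      by (simp add: sum.cartesian_product' power_mult_distrib sum_distrib_left)
    also have "\<dots> \<le> (\<Sum>k\<le>K. (c k)\<^sup>2 * s k)"
      unfolding s_def using ab(1)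
      by (intro sum_mono mult_left_mono sum_le_suminf) (auto simp: square_summable_def)
    also have "\<dots> \<le> (\<Sum>k\<le>K. (1/2)^k)" by (intro sum_mono c)
    also have "\<dots> \<le> (\<Sum>k. (1/2::real)^k)" by (intro sum_le_suminf) (auto intro: summable_geometric)
    also have "\<dots> = 2" by (simp add: suminf_geometric)
    finally show "(\<Sum>m<K. (norm (\<theta> m))\<^sup>2) \<le> 2" .
  qed simp
  moreover have "x = 0" if x: "x \<in> M" and z: "\<And>m. blinfun_apply x (\<theta> m) = 0" for x
  proof -
    have "blinfun_apply x (\<alpha> k n) = 0" for k n
      using z[of "prod_encode (k, n)"] c(1)[of k] by (simp add: \<theta>_def blinfun.scaleR_right)
    then have psi0: "\<psi> k x = 0" for k
      using ab(3)[OF x, of k] by (simp add: pairing_def cinner.zero_left)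
    have "cinner (blinfun_apply x \<xi>) \<eta> = 0" for \<xi> \<eta>
    proof -
      have "cmod (cinner (blinfun_apply x \<xi>) \<eta>) \<le> 0 + e" if e: "e > 0" for e
      proof -
        obtain k where k: "\<forall>y\<in>M. cmod (restrict (vector_functional \<xi> \<eta>) M y - \<psi> k y) \<le> e / (norm x + 1) * norm y"
          using D(3)[OF pre[of \<xi> \<eta>], of "e / (norm x + 1)"] e \<psi> by (force simp: add_nonneg_pos)
        have "cmod (cinner (blinfun_apply x \<xi>) \<eta>) \<le> e / (norm x + 1) * norm x"
          using k[rule_format, OF x] x by (simp add: psi0 vector_functional_def)
        also have "\<dots> \<le> e" using e by (simp add: pos_divide_le_eq add_nonneg_pos mult_left_mono)
        finally show ?thesis by simp
      qed
      then have "cmod (cinner (blinfun_apply x \<xi>) \<eta>) \<le> 0" by (rule field_le_epsilon)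
      then show ?thesis by simp
    qed
    then show ?thesis by (intro blinfun_eqI) (simp add: cinner_eq_zero)
  qed
  ultimately show thesis using that by blast
qed

section \<open>Bounded vectors of a faithful functional\<close>

text \<open>Square norm and real inner product of the Hilbert space of square-summable sequences.
  Applied to \<open>u n = x (\<tau> n)\<close>, they describe the orbit of the vector
  \<open>\<tau>\<close> under an amplification of \<open>M\<close>.\<close>

definition sq :: "(nat \<Rightarrow> 'a::real_inner) \<Rightarrow> real" where "sq u = (\<Sum>n. (norm (u n))\<^sup>2)"
definition ip :: "(nat \<Rightarrow> 'a::real_inner) \<Rightarrow> (nat \<Rightarrow> 'a) \<Rightarrow> real" where "ip u v = (\<Sum>n. inner (u n) (v n))"

lemma summable_inner:
  fixes u v :: "nat \<Rightarrow> 'a::real_inner"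
  assumes "square_summable u" "square_summable v" shows "summable (\<lambda>n. inner (u n) (v n))"
  by (rule summable_comparison_test'[OF summable_norm_product[OF assms], where N = 0])
    (simp add: Cauchy_Schwarz_ineq2)

lemma sq_expand:
  fixes u v :: "nat \<Rightarrow> 'a::real_inner"
  assumes u: "square_summable u" and v: "square_summable v"
  shows square_summable_add: "square_summable (\<lambda>n. u n + t *\<^sub>R v n)"
    and sq_add: "sq (\<lambda>n. u n + t *\<^sub>R v n) = sq u + 2 * t * ip u v + t\<^sup>2 * sq v"
proof -
  note su = u[unfolded square_summable_def] and sv = v[unfolded square_summable_def]
  have eq: "(norm (u n + t *\<^sub>R v n))\<^sup>2 = (norm (u n))\<^sup>2 + 2 * t * inner (u n) (v n) + t\<^sup>2 * (norm (v n))\<^sup>2" for n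
    unfolding power2_norm_eq_inner
    by (simp add: inner_add_left inner_add_right inner_commute[of "v n" "u n"] power2_eq_square algebra_simps)
  have "(\<lambda>n. (norm (u n + t *\<^sub>R v n))\<^sup>2) sums (sq u + 2 * t * ip u v + t\<^sup>2 * sq v)"
    unfolding eq sq_def ip_def
    by (intro sums_add sums_mult summable_sums su sv summable_inner[OF u v])
  then show "square_summable (\<lambda>n. u n + t *\<^sub>R v n)" "sq (\<lambda>n. u n + t *\<^sub>R v n) = sq u + 2 * t * ip u v + t\<^sup>2 * sq v"
    by (auto simp: square_summable_def sq_def sums_iff)
qed

lemma sq_nonneg: "square_summable u \<Longrightarrow> 0 \<le> sq u"
  unfolding sq_def square_summable_def by (intro suminf_nonneg) auto

lemma ip_le:
  assumes u: "square_summable u" and v: "square_summable v"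
  shows "ip u v \<le> sqrt (sq u) * sqrt (sq v)"
proof -
  have "(ip u v)\<^sup>2 \<le> sq v * sq u"
  proof (rule discriminant_le)
    fix t :: real
    have "0 \<le> sq (\<lambda>n. u n + t *\<^sub>R v n)" by (rule sq_nonneg[OF square_summable_add[OF u v]])
    then show "0 \<le> t\<^sup>2 * sq v + 2 * t * ip u v + sq u" unfolding sq_add[OF u v] by simp
  qed (use u v sq_nonneg in auto)
  then have "(ip u v)\<^sup>2 \<le> (sqrt (sq u) * sqrt (sq v))\<^sup>2"
    using sq_nonneg[OF u] sq_nonneg[OF v] by (simp add: power_mult_distrib mult.commute)
  then show ?thesis using sq_nonneg[OF u] sq_nonneg[OF v] by (rule_tac power2_le_imp_le) auto
qed

lemma norm_sq_le: "square_summable u \<Longrightarrow> (norm (u n))\<^sup>2 \<le> sq u"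
  unfolding sq_def square_summable_def using sum_le_suminf[of "\<lambda>n. (norm (u n))\<^sup>2" "{n}"] by simp

lemma sq_bounded:
  assumes "\<And>K. (\<Sum>n<K. (norm (u n))\<^sup>2) \<le> C" shows "sq u \<le> C"
  unfolding sq_def by (rule suminf_le_const[OF summableI_nonneg_bounded]) (use assms in auto)

text \<open>\<open>p\<close> will be the real part of a faithful normal functional composed with
  \<open>E\<close>. The sequence \<open>\<tau>\<close> records normality: the square norm given by
  \<open>p\<close> is at most that of the vector \<open>\<tau>\<close> in an amplification of
  \<open>M\<close>.\<close>

locale trace_functional = cond_exp M N E
  for M N :: "'h::chilbert_space op set" and E +
  fixes p :: "'h op \<Rightarrow> real" and \<tau> :: "nat \<Rightarrow> 'h"
  assumes normal: "normal_map M E"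
    and p_add: "\<And>x y. x \<in> M \<Longrightarrow> y \<in> M \<Longrightarrow> p (x + y) = p x + p y"
    and p_scaleR: "\<And>r x. x \<in> M \<Longrightarrow> p (r *\<^sub>R x) = r * p x"
    and p_adj: "\<And>x. x \<in> M \<Longrightarrow> p (adj x) = p x"
    and p_nonneg: "\<And>x. x \<in> M \<Longrightarrow> 0 \<le> p (adj x o\<^sub>L x)"
    and p_faithful: "\<And>x. x \<in> M \<Longrightarrow> p (adj x o\<^sub>L x) = 0 \<Longrightarrow> x = 0"
    and p_mono: "\<And>x y C. x \<in> M \<Longrightarrow> y \<in> M \<Longrightarrow> (\<And>v. (norm (blinfun_apply x v))\<^sup>2 \<le> C * (norm (blinfun_apply y v))\<^sup>2) \<Longrightarrow>
      p (adj x o\<^sub>L x) \<le> C * p (adj y o\<^sub>L y)"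
    and p_trace: "\<And>c x. c \<in> centralizer \<Longrightarrow> x \<in> M \<Longrightarrow> p (c o\<^sub>L x) = p (x o\<^sub>L c)"
    and \<tau>: "square_summable \<tau>"
    and p_dominated: "\<And>x. x \<in> M \<Longrightarrow> p (adj x o\<^sub>L x) \<le> sq (\<lambda>n. blinfun_apply x (\<tau> n))"
begin

text \<open>The real part of the GNS inner product of \<open>p\<close>.\<close>

definition b where "b x y = p (adj y o\<^sub>L x)"
abbreviation q where "q x \<equiv> b x x"

lemma in_M [simp, intro]:
  shows "x \<in> M \<Longrightarrow> y \<in> M \<Longrightarrow> x + y \<in> M" "x \<in> M \<Longrightarrow> y \<in> M \<Longrightarrow> x - y \<in> M" "x \<in> M \<Longrightarrow> r *\<^sub>R x \<in> M"
    "x \<in> M \<Longrightarrow> y \<in> M \<Longrightarrow> x o\<^sub>L y \<in> M" "x \<in> M \<Longrightarrow> adj x \<in> M" "id_blinfun \<in> M"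
  using csubspaceD[OF M.csub] M.compose_in M.adj_closed M.id_in by auto

lemma adj_M:
  shows "x \<in> M \<Longrightarrow> y \<in> M \<Longrightarrow> adj (x + y) = adj x + adj y" "x \<in> M \<Longrightarrow> y \<in> M \<Longrightarrow> adj (x - y) = adj x - adj y"
    "x \<in> M \<Longrightarrow> adj (r *\<^sub>R x) = r *\<^sub>R adj x" "x \<in> M \<Longrightarrow> y \<in> M \<Longrightarrow> adj (x o\<^sub>L y) = adj y o\<^sub>L adj x"
    "x \<in> M \<Longrightarrow> adj (adj x) = x"
  by (simp_all add: adj_simps adj_scaleR adj_adj M.bounded)

lemma b_rules:
  shows b_add_left: "x \<in> M \<Longrightarrow> y \<in> M \<Longrightarrow> z \<in> M \<Longrightarrow> b (x + y) z = b x z + b y z"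
    and b_scale_left: "x \<in> M \<Longrightarrow> z \<in> M \<Longrightarrow> b (r *\<^sub>R x) z = r * b x z"
    and b_sym: "x \<in> M \<Longrightarrow> z \<in> M \<Longrightarrow> b x z = b z x"
proof -
  show "x \<in> M \<Longrightarrow> y \<in> M \<Longrightarrow> z \<in> M \<Longrightarrow> b (x + y) z = b x z + b y z"
    by (simp add: b_def compose.add_right p_add)
  show "x \<in> M \<Longrightarrow> z \<in> M \<Longrightarrow> b (r *\<^sub>R x) z = r * b x z"
    by (simp add: b_def compose.scaleR_right p_scaleR)
  show "x \<in> M \<Longrightarrow> z \<in> M \<Longrightarrow> b x z = b z x"
    using p_adj[of "adj z o\<^sub>L x"] by (simp add: b_def adj_M)
qed

lemma b_diff_left: "x \<in> M \<Longrightarrow> y \<in> M \<Longrightarrow> z \<in> M \<Longrightarrow> b (x - y) z = b x z - b y z"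
  using b_add_left[of "x - y" y z] by simp

lemma b_add_right: "x \<in> M \<Longrightarrow> y \<in> M \<Longrightarrow> z \<in> M \<Longrightarrow> b x (y + z) = b x y + b x z"
  using b_sym b_add_left by simp

lemma b_diff_right: "x \<in> M \<Longrightarrow> y \<in> M \<Longrightarrow> z \<in> M \<Longrightarrow> b x (y - z) = b x y - b x z"
  using b_sym b_diff_left by simp

lemma b_scale_right: "x \<in> M \<Longrightarrow> y \<in> M \<Longrightarrow> b x (r *\<^sub>R y) = r * b x y"
  using b_sym b_scale_left by simp

lemma q_nonneg: "x \<in> M \<Longrightarrow> 0 \<le> q x"
  by (simp add: b_def p_nonneg)

lemma q_eq_0: "x \<in> M \<Longrightarrow> q x = 0 \<Longrightarrow> x = 0"
  by (simp add: b_def p_faithful)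

lemma q_expand:
  assumes "x \<in> M" "y \<in> M" shows "q (x + t *\<^sub>R y) = q x + 2 * t * b x y + t\<^sup>2 * q y"
  using assms by (simp add: b_add_left b_add_right b_scale_left b_scale_right b_sym[of y x] power2_eq_square algebra_simps)

lemma b_le:
  assumes x: "x \<in> M" and y: "y \<in> M" shows "b x y \<le> sqrt (q x) * sqrt (q y)"
proof -
  have "(b x y)\<^sup>2 \<le> q y * q x"
  proof (rule discriminant_le)
    fix t :: real
    show "0 \<le> t\<^sup>2 * q y + 2 * t * b x y + q x" using q_nonneg[of "x + t *\<^sub>R y"] x y by (simp add: q_expand)
  qed (use x y q_nonneg in auto)
  then have "(b x y)\<^sup>2 \<le> (sqrt (q x) * sqrt (q y))\<^sup>2"
    using q_nonneg[OF x] q_nonneg[OF y] by (simp add: power_mult_distrib mult.commute)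
  then show ?thesis using q_nonneg[OF x] q_nonneg[OF y] by (rule_tac power2_le_imp_le) auto
qed

lemma q_le_of_b: assumes "x \<in> M" "y \<in> M" "q x \<le> b x y" shows "q x \<le> q y"
proof -
  have "(sqrt (q x))\<^sup>2 \<le> sqrt (q x) * sqrt (q y)" using assms b_le[of x y] q_nonneg[of x] by simp
  then have "sqrt (q x) \<le> sqrt (q y)" by (rule le_of_square_le_mult) (simp add: assms q_nonneg)
  then show ?thesis by simp
qed

lemma q_mono: "x \<in> M \<Longrightarrow> y \<in> M \<Longrightarrow> (\<And>v. (norm (blinfun_apply x v))\<^sup>2 \<le> C * (norm (blinfun_apply y v))\<^sup>2) \<Longrightarrow> q x \<le> C * q y"
  by (simp add: b_def p_mono)

lemma q_compose_le: assumes "x \<in> M" "y \<in> M" shows "q (x o\<^sub>L y) \<le> (norm x)\<^sup>2 * q y"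
  using power_mono[OF norm_blinfun[of x], of _ 2] assms by (intro q_mono) (auto simp: power_mult_distrib)

definition G where "G x = sq (\<lambda>n. blinfun_apply x (\<tau> n))"
definition Gb where "Gb x y = ip (\<lambda>n. blinfun_apply x (\<tau> n)) (\<lambda>n. blinfun_apply y (\<tau> n))"

lemma G_expand: "G (x + t *\<^sub>R y) = G x + 2 * t * Gb x y + t\<^sup>2 * G y"
  unfolding G_def Gb_def
  by (simp add: blinfun.add_left blinfun.scaleR_left sq_add square_summable_apply \<tau>)

lemma G_nonneg: "0 \<le> G x" by (simp add: G_def sq_nonneg square_summable_apply \<tau>)

lemma Gb_le: "Gb x y \<le> sqrt (G x) * sqrt (G y)"
  unfolding G_def Gb_def by (rule ip_le) (simp_all add: square_summable_apply \<tau>)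

lemma G_self: "G x = Gb x x"
  by (simp add: G_def Gb_def sq_def ip_def power2_norm_eq_inner)

lemma Gb_adj: assumes "x \<in> M" shows "Gb (x o\<^sub>L y) z = Gb y (adj x o\<^sub>L z)"
  unfolding Gb_def ip_def by (simp add: Re_cinner[symmetric] cinner_adj M.bounded assms)

lemma G_compose_le: "G (x o\<^sub>L y) \<le> (norm x)\<^sup>2 * G y"
proof -
  have "G (x o\<^sub>L y) \<le> (\<Sum>n. (norm x)\<^sup>2 * (norm (blinfun_apply y (\<tau> n)))\<^sup>2)"
    unfolding G_def sq_def
  proof (rule suminf_le)
    show "(norm (blinfun_apply (x o\<^sub>L y) (\<tau> n)))\<^sup>2 \<le> (norm x)\<^sup>2 * (norm (blinfun_apply y (\<tau> n)))\<^sup>2" for n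
      using power_mono[OF norm_blinfun[of x "blinfun_apply y (\<tau> n)"], of 2] by (simp add: power_mult_distrib)
    show "summable (\<lambda>n. (norm (blinfun_apply (x o\<^sub>L y) (\<tau> n)))\<^sup>2)"
      using square_summable_apply[OF \<tau>] unfolding square_summable_def .
    show "summable (\<lambda>n. (norm x)\<^sup>2 * (norm (blinfun_apply y (\<tau> n)))\<^sup>2)"
      using square_summable_apply[OF \<tau>] by (intro summable_mult) (simp add: square_summable_def)
  qed
  also have "\<dots> = (norm x)\<^sup>2 * G y"
    using square_summable_apply[OF \<tau>] unfolding G_def sq_def by (intro suminf_mult) (simp add: square_summable_def)
  finally show ?thesis .
qed

lemma q_le_G: "x \<in> M \<Longrightarrow> q x \<le> G x" by (simp add: b_def G_def p_dominated)

lemma p_le: assumes "x \<in> M" shows "p x \<le> sqrt (q id_blinfun) * sqrt (G x)"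
proof -
  have "p x = b x id_blinfun" by (simp add: b_def adj_id)
  also have "\<dots> \<le> sqrt (q x) * sqrt (q id_blinfun)" by (rule b_le) (use assms in auto)
  also have "\<dots> \<le> sqrt (G x) * sqrt (q id_blinfun)"
    using q_le_G[OF assms] q_nonneg[of id_blinfun] by (intro mult_right_mono) auto
  finally show ?thesis by (simp add: mult.commute)
qed

text \<open>The vectors \<open>\<xi>\<close> for which \<open>x \<mapsto> x \<xi>\<close> is
  continuous for the norm \<open>sqrt (q x)\<close>. On them a sequence that is Cauchy for
  \<open>q\<close> converges pointwise, which is the bridge from \<open>q\<close> to the strong
  topology.\<close>

definition bounded_vectors where
  "bounded_vectors = {\<xi>. \<exists>C. \<forall>x\<in>M. norm (blinfun_apply x \<xi>) \<le> C * sqrt (q x)}"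

text \<open>An approximate Riesz representation of \<open>p\<close> by a minimizing sequence of \<open>G x - 2 * p x\<close>.\<close>

lemma representing_sequence:
  obtains a where "\<And>k. a k \<in> M" "\<And>e. e > 0 \<Longrightarrow> \<exists>K. \<forall>j\<ge>K. \<forall>k\<ge>K. G (a j - a k) < e"
    "\<And>k c. c \<in> M \<Longrightarrow> \<bar>Gb (a k) c - p c\<bar> \<le> sqrt (G c / real (Suc k))"
proof -
  define F where "F x = G x - 2 * p x" for x
  show thesis
  proof (rule minimizing_sequence[of M "- q id_blinfun" F G])
    show "M \<noteq> {}" using in_M(6) by blast
    show "- q id_blinfun \<le> F x" if x: "x \<in> M" for x
    proof -
      have "0 \<le> (sqrt (G x) - sqrt (q id_blinfun))\<^sup>2" by simp
      also have "\<dots> = G x + q id_blinfun - 2 * (sqrt (q id_blinfun) * sqrt (G x))"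
        using G_nonneg[of x] q_nonneg[of id_blinfun] by (simp add: power2_diff)
      finally show ?thesis using p_le[OF x] unfolding F_def by simp
    qed
    show "(1 / 2) *\<^sub>R (x + y) \<in> M" if "x \<in> M" "y \<in> M" for x y using that by simp
    show "F ((1 / 2) *\<^sub>R (x + y)) \<le> (F x + F y) / 2 - G (x - y) / 4" if xy: "x \<in> M" "y \<in> M" for x y
    proof -
      have 0: "G 0 = 0" by (simp add: G_def sq_def)
      have 1: "G ((1/2) *\<^sub>R (x + y)) = G (x + y) / 4"
        using G_expand[of 0 "1/2" "x + y"] 0 Gb_le[of 0 "x + y"] Gb_le[of 0 "- (x + y)"]
        by (simp add: Gb_def ip_def power2_eq_square)
      have 2: "G (x + y) = G x + 2 * Gb x y + G y" "G (x - y) = G x - 2 * Gb x y + G y"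
        using G_expand[of x 1 y] G_expand[of x "-1" y] by simp_all
      have 3: "p ((1/2) *\<^sub>R (x + y)) = (p x + p y) / 2"
        using p_scaleR[of "x + y" "1/2"] p_add[of x y] xy by simp
      show ?thesis unfolding F_def 1 2 3 by (simp add: field_simps)
    qed
  next
    fix a m assume a: "\<And>k. a k \<in> M" "\<And>x. x \<in> M \<Longrightarrow> m \<le> F x" "\<And>k. F (a k) \<le> m + 1 / real (Suc k)"
      "\<And>e. e > 0 \<Longrightarrow> \<exists>K. \<forall>j\<ge>K. \<forall>k\<ge>K. G (a j - a k) < e"
    have "\<bar>Gb (a k) c - p c\<bar> \<le> sqrt (G c / real (Suc k))" if c: "c \<in> M" for k c
    proof -
      \<comment> \<open>Near minimality holds along the whole line \<open>a k + t c\<close>: the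
        quadratic polynomial in \<open>t\<close> stays above \<open>- 1 / real (Suc k)\<close>, and
        its discriminant bounds the error of the representation.\<close>
      have "(Gb (a k) c - p c)\<^sup>2 \<le> G c * (1 / real (Suc k))"
      proof (rule discriminant_le)
        fix t :: real
        have "F (a k + t *\<^sub>R c) = F (a k) + 2 * t * (Gb (a k) c - p c) + t\<^sup>2 * G c"
          using a(1) c unfolding F_def by (simp add: G_expand p_add p_scaleR algebra_simps)
        with a(2)[of "a k + t *\<^sub>R c"] a(3)[of k] a(1) c
        show "0 \<le> t\<^sup>2 * G c + 2 * t * (Gb (a k) c - p c) + 1 / real (Suc k)" by simp
      qed (use G_nonneg in auto)
      then have "sqrt ((Gb (a k) c - p c)\<^sup>2) \<le> sqrt (G c / real (Suc k))" by (intro real_sqrt_le_mono) simp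
      then show ?thesis by simp
    qed
    with a(1,4) show thesis by (rule that)
  qed
qed

text \<open>The vectors \<open>a k (\<tau> n)\<close> converge to some \<open>\<eta> n\<close>, and
  \<open>p c\<close> is the limit of \<open>Gb (a k) c\<close>. The \<open>\<eta> n\<close> turn out
  to be bounded vectors; if \<open>r\<close> kills them, then
  \<open>Gb (a k) r = Gb (r o\<^sub>L a k) id_blinfun\<close> tends to zero, so
  \<open>p r = 0\<close>.\<close>

lemma bounded_vectors_separating:
  assumes r: "r \<in> M" "adj r = r" and zero: "\<And>\<xi>. \<xi> \<in> bounded_vectors \<Longrightarrow> blinfun_apply r \<xi> = 0"
  shows "p r = 0"
proof -
  obtain a where a: "\<And>k. a k \<in> M" "\<And>e. e > 0 \<Longrightarrow> \<exists>K. \<forall>j\<ge>K. \<forall>k\<ge>K. G (a j - a k) < e"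
    "\<And>k c. c \<in> M \<Longrightarrow> \<bar>Gb (a k) c - p c\<bar> \<le> sqrt (G c / real (Suc k))"
    by (rule representing_sequence) (rule that; blast)
  have le: "(norm (blinfun_apply x (\<tau> n)))\<^sup>2 \<le> G x" for x n
    unfolding G_def by (rule norm_sq_le[OF square_summable_apply[OF \<tau>], of x n])
  have "Cauchy (\<lambda>k. blinfun_apply (a k) (\<tau> n))" for n
    unfolding Cauchy_iff
  proof (intro allI impI)
    fix e :: real assume e: "e > 0"
    obtain K where K: "\<And>j k. j \<ge> K \<Longrightarrow> k \<ge> K \<Longrightarrow> G (a j - a k) < e\<^sup>2" using a(2)[of "e\<^sup>2"] e by auto
    have "norm (blinfun_apply (a j) (\<tau> n) - blinfun_apply (a k) (\<tau> n)) < e" if "j \<ge> K" "k \<ge> K" for j k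
      using le[of "a j - a k" n] K[OF that] e by (simp add: blinfun.diff_left power2_less_imp_less[of _ e])
    then show "\<exists>K. \<forall>j\<ge>K. \<forall>k\<ge>K. norm (blinfun_apply (a j) (\<tau> n) - blinfun_apply (a k) (\<tau> n)) < e" by blast
  qed
  then have "(\<lambda>k. blinfun_apply (a k) (\<tau> n)) \<longlonglongrightarrow> lim (\<lambda>k. blinfun_apply (a k) (\<tau> n))" for n
    using Cauchy_convergent convergent_LIMSEQ_iff by blast
  then obtain \<eta> where \<eta>: "\<And>n. (\<lambda>k. blinfun_apply (a k) (\<tau> n)) \<longlonglongrightarrow> \<eta> n"
    by (rule that)
  have inv0: "(\<lambda>k. sqrt (1 / real (Suc k))) \<longlonglongrightarrow> 0"
    using tendsto_real_sqrt[OF LIMSEQ_inverse_real_of_nat] by (simp add: inverse_eq_divide)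
  have "\<eta> n \<in> bounded_vectors" for n
  proof -
    have "norm (blinfun_apply x (\<eta> n)) \<le> 1 * sqrt (q x)" if x: "x \<in> M" for x
    proof -
      \<comment> \<open>\<open>G\<close> of \<open>x o\<^sub>L a k\<close> is the value of
        \<open>Gb (a k)\<close> at \<open>adj x o\<^sub>L (x o\<^sub>L a k)\<close>, hence nearly
        \<open>p\<close> of the latter, that is \<open>b (x o\<^sub>L a k) x\<close>. Cauchy-Schwarz
        and \<open>q \<le> G\<close> leave one factor \<open>?g\<close> on the right, which
        cancels.\<close>
      have g: "norm (blinfun_apply x (blinfun_apply (a k) (\<tau> n))) \<le> sqrt (q x) + norm (adj x) * sqrt (1 / real (Suc k))" for k
      proof -
        let ?y = "x o\<^sub>L a k" and ?g = "sqrt (G (x o\<^sub>L a k))"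
        have y: "?y \<in> M" "adj x o\<^sub>L ?y \<in> M" using x a(1) by auto
        have "G ?y = Gb (a k) (adj x o\<^sub>L ?y)" unfolding G_self by (rule Gb_adj[OF x])
        also have "\<dots> \<le> p (adj x o\<^sub>L ?y) + sqrt (G (adj x o\<^sub>L ?y) / real (Suc k))" using a(3)[OF y(2), of k] by linarith
        also have "p (adj x o\<^sub>L ?y) = b ?y x" by (simp add: b_def)
        also have "\<dots> \<le> sqrt (q ?y) * sqrt (q x)" by (rule b_le[OF y(1) x])
        also have "\<dots> \<le> ?g * sqrt (q x)" using q_le_G[OF y(1)] q_nonneg[OF x] by (intro mult_right_mono) auto
        also have "sqrt (G (adj x o\<^sub>L ?y) / real (Suc k)) \<le> sqrt ((norm (adj x))\<^sup>2 * G ?y * (1 / real (Suc k)))"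
          using G_compose_le[of "adj x" ?y] by (intro real_sqrt_le_mono) (simp add: divide_right_mono)
        also have "\<dots> = ?g * (norm (adj x) * sqrt (1 / real (Suc k)))"
          by (simp only: real_sqrt_mult) (simp add: mult_ac)
        finally have "?g\<^sup>2 \<le> ?g * (sqrt (q x) + norm (adj x) * sqrt (1 / real (Suc k)))"
          using G_nonneg[of ?y] by (simp add: algebra_simps)
        then have "?g \<le> sqrt (q x) + norm (adj x) * sqrt (1 / real (Suc k))"
          by (rule le_of_square_le_mult) (use q_nonneg[OF x] in simp)
        moreover have "norm (blinfun_apply x (blinfun_apply (a k) (\<tau> n))) \<le> ?g"
          using real_sqrt_le_mono[OF le[of ?y n]] by simp
        ultimately show ?thesis by linarith
      qed
      have "(\<lambda>k. norm (blinfun_apply x (blinfun_apply (a k) (\<tau> n)))) \<longlonglongrightarrow> norm (blinfun_apply x (\<eta> n))"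
        by (intro tendsto_norm blinfun.tendsto tendsto_const \<eta>)
      moreover have "(\<lambda>k. sqrt (q x) + norm (adj x) * sqrt (1 / real (Suc k))) \<longlonglongrightarrow> sqrt (q x) + norm (adj x) * 0"
        by (intro tendsto_intros inv0)
      ultimately show ?thesis using g by (intro LIMSEQ_le) auto
    qed
    then show ?thesis unfolding bounded_vectors_def by blast
  qed
  then have r\<eta>: "blinfun_apply r (\<eta> n) = 0" for n using zero by blast
  \<comment> \<open>Since \<open>r\<close> kills each \<open>\<eta> n\<close>, partial sums of
    \<open>G (r o\<^sub>L a k)\<close> are limits over \<open>j\<close> of those of
    \<open>G (r o\<^sub>L (a k - a j))\<close>, which the Cauchy property controls.\<close>
  have small: "\<exists>K. \<forall>k\<ge>K. G (r o\<^sub>L a k) \<le> (norm r)\<^sup>2 * e" if e: "e > 0" for e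
  proof -
    obtain K where K: "\<And>j k. j \<ge> K \<Longrightarrow> k \<ge> K \<Longrightarrow> G (a j - a k) < e" using a(2)[OF e] by auto
    have "G (r o\<^sub>L a k) \<le> (norm r)\<^sup>2 * e" if k: "k \<ge> K" for k
      unfolding G_def
    proof (rule sq_bounded)
      fix L
      have "(\<lambda>j. \<Sum>n<L. (norm (blinfun_apply (r o\<^sub>L (a k - a j)) (\<tau> n)))\<^sup>2) \<longlonglongrightarrow>
          (\<Sum>n<L. (norm (blinfun_apply r (blinfun_apply (a k) (\<tau> n) - \<eta> n)))\<^sup>2)"
        unfolding blinfun_apply_blinfun_compose blinfun.diff_left by (intro tendsto_intros blinfun.tendsto \<eta>)
      moreover have "(\<Sum>n<L. (norm (blinfun_apply (r o\<^sub>L (a k - a j)) (\<tau> n)))\<^sup>2) \<le> (norm r)\<^sup>2 * e" if j: "j \<ge> K" for j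
      proof -
        have "(\<Sum>n<L. (norm (blinfun_apply (r o\<^sub>L (a k - a j)) (\<tau> n)))\<^sup>2) \<le> G (r o\<^sub>L (a k - a j))"
          unfolding G_def sq_def using square_summable_apply[OF \<tau>]
          by (intro sum_le_suminf) (auto simp: square_summable_def simp del: blinfun_apply_blinfun_compose)
        also have "\<dots> \<le> (norm r)\<^sup>2 * G (a k - a j)" by (rule G_compose_le)
        also have "\<dots> \<le> (norm r)\<^sup>2 * e" using K[OF k j] by (intro mult_left_mono) auto
        finally show ?thesis .
      qed
      ultimately have "(\<Sum>n<L. (norm (blinfun_apply r (blinfun_apply (a k) (\<tau> n) - \<eta> n)))\<^sup>2) \<le> (norm r)\<^sup>2 * e"
        by (intro LIMSEQ_le_const2) auto
      then show "(\<Sum>n<L. (norm (blinfun_apply (r o\<^sub>L a k) (\<tau> n)))\<^sup>2) \<le> (norm r)\<^sup>2 * e"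
        by (simp add: blinfun.diff_right r\<eta>)
    qed
    then show ?thesis by blast
  qed
  have "\<bar>p r\<bar> \<le> 0 + e" if e: "e > 0" for e
  proof -
    \<comment> \<open>Chosen so that
      \<open>(norm r + 1) * sqrt d * (sqrt (G id_blinfun) + 1)\<close> is
      \<open>e / 2\<close>.\<close>
    define d where "d = (e / (2 * ((norm r + 1) * (sqrt (G id_blinfun) + 1))))\<^sup>2"
    have pos: "(norm r + 1) * (sqrt (G id_blinfun) + 1) > 0" using G_nonneg by (intro mult_pos_pos add_nonneg_pos) auto
    have d: "d > 0" unfolding d_def using e pos by (intro zero_less_power divide_pos_pos) auto
    have sd: "sqrt d = e / (2 * ((norm r + 1) * (sqrt (G id_blinfun) + 1)))"
      unfolding d_def using e pos by (subst real_sqrt_abs) simp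
    obtain K where K: "\<And>k. k \<ge> K \<Longrightarrow> G (r o\<^sub>L a k) \<le> (norm r)\<^sup>2 * d" using small[OF d] by blast
    have "(\<lambda>k. sqrt (G r) * sqrt (1 / real (Suc k))) \<longlonglongrightarrow> sqrt (G r) * 0" by (intro tendsto_intros inv0)
    then have "\<forall>\<^sub>F k in sequentially. sqrt (G r) * sqrt (1 / real (Suc k)) < e / 2"
      using e by (intro order_tendstoD(2)) auto
    then obtain K' where K': "\<And>k. k \<ge> K' \<Longrightarrow> sqrt (G r) * sqrt (1 / real (Suc k)) < e / 2"
      unfolding eventually_sequentially by blast
    define k where "k = max K K'"
    have "\<bar>Gb (a k) r\<bar> \<le> e / 2"
    proof -
      have g: "sqrt (G (r o\<^sub>L a k)) \<le> (norm r + 1) * sqrt d"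
      proof -
        have "sqrt (G (r o\<^sub>L a k)) \<le> sqrt ((norm r)\<^sup>2 * d)" using K[of k] by (intro real_sqrt_le_mono) (simp add: k_def)
        also have "\<dots> = norm r * sqrt d" by (simp add: real_sqrt_mult)
        also have "\<dots> \<le> (norm r + 1) * sqrt d" using d by (intro mult_right_mono) auto
        finally show ?thesis .
      qed
      have "Gb (r o\<^sub>L a k) z = Gb (a k) (r o\<^sub>L z)" for z using Gb_adj[OF r(1)] r(2) by simp
      then have "Gb (a k) r = Gb (r o\<^sub>L a k) id_blinfun" by simp
      moreover have "Gb (r o\<^sub>L a k) (- id_blinfun) = - Gb (r o\<^sub>L a k) id_blinfun"
        unfolding Gb_def ip_def by (simp add: blinfun.minus_left suminf_minus summable_inner square_summable_apply[OF \<tau>, of "r o\<^sub>L a k", simplified] square_summable_apply[OF \<tau>, of id_blinfun, simplified])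
      moreover have "G (- id_blinfun) = G id_blinfun" by (simp add: G_def sq_def blinfun.minus_left)
      ultimately have "\<bar>Gb (a k) r\<bar> \<le> sqrt (G (r o\<^sub>L a k)) * sqrt (G id_blinfun)"
        using Gb_le[of "r o\<^sub>L a k" id_blinfun] Gb_le[of "r o\<^sub>L a k" "- id_blinfun"] by simp
      also have "\<dots> \<le> ((norm r + 1) * sqrt d) * (sqrt (G id_blinfun) + 1)"
        using g d G_nonneg by (intro mult_mono) auto
      also have "\<dots> = e / 2" unfolding sd using pos by (simp add: field_simps)
      finally show ?thesis .
    qed
    moreover have "\<bar>Gb (a k) r - p r\<bar> \<le> e / 2"
    proof -
      have "sqrt (G r / real (Suc k)) = sqrt (G r) * sqrt (1 / real (Suc k))" by (simp add: real_sqrt_divide)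
      also have "\<dots> < e / 2" by (rule K') (simp add: k_def)
      finally show ?thesis using a(3)[OF r(1), of k] by linarith
    qed
    ultimately show ?thesis by linarith
  qed
  then have "\<bar>p r\<bar> \<le> 0" by (rule field_le_epsilon)
  then show ?thesis by simp
qed

lemma csubspace_bounded_vectors: "csubspace bounded_vectors"
  unfolding csubspace_def
proof (intro conjI ballI allI)
  show "0 \<in> bounded_vectors" unfolding bounded_vectors_def by (auto intro!: exI[of _ 0] simp: blinfun.zero_right)
next
  fix x y assume "x \<in> bounded_vectors" "y \<in> bounded_vectors"
  then obtain C D where C: "\<And>a. a \<in> M \<Longrightarrow> norm (blinfun_apply a x) \<le> C * sqrt (q a)"
    and D: "\<And>a. a \<in> M \<Longrightarrow> norm (blinfun_apply a y) \<le> D * sqrt (q a)" unfolding bounded_vectors_def by auto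
  have "norm (blinfun_apply a (x + y)) \<le> (C + D) * sqrt (q a)" if "a \<in> M" for a
    using C[OF that] D[OF that] norm_triangle_ineq[of "blinfun_apply a x" "blinfun_apply a y"]
    by (simp add: blinfun.add_right distrib_right)
  then show "x + y \<in> bounded_vectors" unfolding bounded_vectors_def by blast
next
  fix c x assume "x \<in> bounded_vectors"
  then obtain C where C: "\<And>a. a \<in> M \<Longrightarrow> norm (blinfun_apply a x) \<le> C * sqrt (q a)" unfolding bounded_vectors_def by auto
  have "norm (blinfun_apply a (c *\<^sub>C x)) \<le> (cmod c * C) * sqrt (q a)" if "a \<in> M" for a
    using mult_left_mono[OF C[OF that], of "cmod c"]
    by (simp add: bounded_operatorsD[OF M.bounded[OF that]] norm_scaleC mult.assoc)
  then show "c *\<^sub>C x \<in> bounded_vectors" unfolding bounded_vectors_def by blast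
qed

text \<open>An element of the commutant moves past every \<open>a\<close> in \<open>M\<close> and
  costs only its norm. The closure of the bounded vectors is therefore invariant under the
  commutant.\<close>

lemma commutant_bounded_vectors:
  assumes d: "d \<in> commutant M" and \<xi>: "\<xi> \<in> bounded_vectors" shows "blinfun_apply d \<xi> \<in> bounded_vectors"
proof -
  obtain C where C: "\<And>a. a \<in> M \<Longrightarrow> norm (blinfun_apply a \<xi>) \<le> C * sqrt (q a)" using \<xi> unfolding bounded_vectors_def by auto
  have "norm (blinfun_apply a (blinfun_apply d \<xi>)) \<le> (norm d * C) * sqrt (q a)" if a: "a \<in> M" for a
  proof -
    have "blinfun_apply a (blinfun_apply d \<xi>) = blinfun_apply d (blinfun_apply a \<xi>)"
      using commutantD(2)[OF d a] by (metis blinfun_apply_blinfun_compose)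
    also have "norm \<dots> \<le> norm d * (C * sqrt (q a))"
      using C[OF a] by (rule_tac order_trans[OF norm_blinfun mult_left_mono]) auto
    finally show ?thesis by (simp add: mult.assoc)
  qed
  then show ?thesis unfolding bounded_vectors_def by blast
qed

end

lemma csubspace_closure:
  assumes "csubspace (V :: 'a::complex_normed_vector set)" shows "csubspace (closure V)"
  unfolding csubspace_def
proof (intro conjI ballI allI)
  show "0 \<in> closure V" using csubspace_0[OF assms] closure_subset by blast
  show "x + y \<in> closure V" if "x \<in> closure V" "y \<in> closure V" for x y
  proof -
    obtain u v where "\<And>n. u n \<in> V" "u \<longlonglongrightarrow> x" "\<And>n. v n \<in> V" "v \<longlonglongrightarrow> y"
      using \<open>x \<in> closure V\<close> \<open>y \<in> closure V\<close> unfolding closure_sequential by blast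
    then show ?thesis unfolding closure_sequential
      by (intro exI[of _ "\<lambda>n. u n + v n"]) (auto intro: tendsto_add csubspace_add[OF assms])
  qed
  show "c *\<^sub>C x \<in> closure V" if x: "x \<in> closure V" for c x
  proof -
    obtain u where "\<And>n. u n \<in> V" "u \<longlonglongrightarrow> x" using x unfolding closure_sequential by blast
    then show ?thesis unfolding closure_sequential
      by (intro exI[of _ "\<lambda>n. c *\<^sub>C u n"])
        (auto intro: bounded_linear.tendsto[OF bounded_linear_scaleC] csubspace_scaleC[OF assms])
  qed
qed

text \<open>The last clause, uniqueness of the orthogonal decomposition, is what later shows that
  the projection commutes with operators preserving both \<open>K\<close> and its orthogonal
  complement.\<close>

lemma orthogonal_projection_operator:
  fixes K :: "'h::chilbert_space set"
  assumes K: "csubspace K" "closed K"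
  obtains r where "r \<in> bounded_operators" "\<And>x. blinfun_apply r x \<in> K" "\<And>x. x \<in> K \<Longrightarrow> blinfun_apply r x = x"
    "\<And>x v. v \<in> K \<Longrightarrow> cinner (x - blinfun_apply r x) v = 0"
    "\<And>x u. u \<in> K \<Longrightarrow> (\<And>v. v \<in> K \<Longrightarrow> cinner (x - u) v = 0) \<Longrightarrow> blinfun_apply r x = u"
proof -
  obtain f where f: "\<And>x. f x \<in> K" "\<And>x v. v \<in> K \<Longrightarrow> cinner (x - f x) v = 0"
  proof -
    have "\<forall>x. \<exists>u. u \<in> K \<and> (\<forall>v\<in>K. cinner (x - u) v = 0)"
      using orthogonal_projection_exists[OF K] by blast
    from choice[OF this] show thesis using that by blast
  qed
  have uniq: "f x = u" if u: "u \<in> K" "\<And>v. v \<in> K \<Longrightarrow> cinner (x - u) v = 0" for x u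
  proof -
    have fu: "f x - u \<in> K" by (rule csubspace_diff[OF K(1) f(1) u(1)])
    have "cinner (f x - u) (f x - u) = 0"
      using u(2)[OF fu] f(2)[OF fu, of x] cinner.diff_left[of "x - u" "x - f x" "f x - u"] by simp
    then show ?thesis by (simp only: cinner_self) simp
  qed
  have add: "f (x + y) = f x + f y" for x y
  proof (rule uniq)
    fix v assume v: "v \<in> K"
    have "cinner ((x - f x) + (y - f y)) v = 0"
      unfolding cinner_add_left f(2)[OF v, of x] f(2)[OF v, of y] by simp
    then show "cinner (x + y - (f x + f y)) v = 0" by (simp add: algebra_simps)
  qed (rule csubspace_add[OF K(1) f(1) f(1)])
  have scale: "f (c *\<^sub>C x) = c *\<^sub>C f x" for c x
  proof (rule uniq)
    fix v assume v: "v \<in> K"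
    have "cinner (c *\<^sub>C (x - f x)) v = 0" unfolding cinner_scaleC_left f(2)[OF v, of x] by simp
    then show "cinner (c *\<^sub>C x - c *\<^sub>C f x) v = 0" by (simp add: scaleC_diff_right)
  qed (rule csubspace_scaleC[OF K(1) f(1)])
  have bd: "norm (f x) \<le> norm x * 1" for x
  proof -
    have "cinner (x - f x) (f x) = 0" using f by blast
    then have "complex_of_real ((norm (f x))\<^sup>2) = cinner x (f x)" by (simp add: cinner.diff_left cinner_self)
    then have "cmod (complex_of_real ((norm (f x))\<^sup>2)) = cmod (cinner x (f x))" by (rule arg_cong)
    also have "\<dots> \<le> norm x * norm (f x)" by (rule norm_cinner_le)
    finally have "(norm (f x))\<^sup>2 \<le> norm (f x) * norm x" unfolding norm_of_real by (simp add: mult.commute)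
    then show ?thesis using le_of_square_le_mult[of "norm (f x)" "norm x"] by simp
  qed
  have "bounded_linear f"
    by (rule bounded_linear_intro[OF add _ bd]) (metis scale scaleC_of_real)
  note [simp] = bounded_linear_Blinfun_apply[OF this]
  show thesis
  proof (rule that[of "Blinfun f"])
    show "Blinfun f \<in> bounded_operators" by (simp add: bounded_operators_def scale)
    show "blinfun_apply (Blinfun f) x = x" if "x \<in> K" for x
      using that by (simp, intro uniq) (auto simp: cinner.zero_left)
  qed (use f uniq in auto)
qed

section \<open>Density of the bounded vectors\<close>

context trace_functional
begin

text \<open>Let \<open>r\<close> project onto the closure. Invariance under the commutant, which is
  closed under adjoints, puts \<open>r\<close> into the bicommutant, that is into \<open>M\<close>.
  The projection \<open>id_blinfun - r\<close> kills all bounded vectors, so \<open>p\<close>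
  vanishes on it and faithfulness makes it zero.\<close>

lemma bounded_vectors_dense: "closure bounded_vectors = UNIV"
proof -
  let ?K = "closure bounded_vectors"
  have K: "csubspace ?K" "closed ?K" using csubspace_closure[OF csubspace_bounded_vectors] by auto
  obtain r where r: "r \<in> bounded_operators" "\<And>x. blinfun_apply r x \<in> ?K" "\<And>x. x \<in> ?K \<Longrightarrow> blinfun_apply r x = x"
    "\<And>x v. v \<in> ?K \<Longrightarrow> cinner (x - blinfun_apply r x) v = 0"
    "\<And>x u. u \<in> ?K \<Longrightarrow> (\<And>v. v \<in> ?K \<Longrightarrow> cinner (x - u) v = 0) \<Longrightarrow> blinfun_apply r x = u"
    by (rule orthogonal_projection_operator[OF K]) (rule that; blast)
  have dK: "blinfun_apply d x \<in> ?K" if d: "d \<in> commutant M" and x: "x \<in> ?K" for d x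
  proof -
    obtain u where u: "\<And>n. u n \<in> bounded_vectors" "u \<longlonglongrightarrow> x" using x unfolding closure_sequential by blast
    then show ?thesis unfolding closure_sequential
      by (intro exI[of _ "\<lambda>n. blinfun_apply d (u n)"])
        (auto intro: blinfun.tendsto commutant_bounded_vectors[OF d])
  qed
  have "r \<in> commutant (commutant M)"
  proof -
    have "r o\<^sub>L d = d o\<^sub>L r" if d: "d \<in> commutant M" for d
    proof (rule blinfun_eqI)
      fix x
      have "blinfun_apply r (blinfun_apply d x) = blinfun_apply d (blinfun_apply r x)"
      proof (rule r(5)[OF dK[OF d r(2)]])
        fix v assume v: "v \<in> ?K"
        have "cinner (blinfun_apply d (x - blinfun_apply r x)) v = cinner (x - blinfun_apply r x) (blinfun_apply (adj d) v)"
          by (rule cinner_adj[OF commutantD(1)[OF d]])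
        also have "\<dots> = 0" by (rule r(4)[OF dK[OF M.commutant_adj[OF d] v]])
        finally show "cinner (blinfun_apply d x - blinfun_apply d (blinfun_apply r x)) v = 0"
          by (simp add: blinfun.diff_right)
      qed
      then show "blinfun_apply (r o\<^sub>L d) x = blinfun_apply (d o\<^sub>L r) x" by simp
    qed
    then show ?thesis using r(1) by (simp add: commutant_def)
  qed
  then have rM: "r \<in> M" unfolding M.bicommutant .
  have sr: "adj r = r"
  proof (rule cinner_self_adjI[OF r(1)])
    fix x
    have "cinner (blinfun_apply r x) x = cinner x (blinfun_apply r x) + (cinner (blinfun_apply r x) (x - blinfun_apply r x) - cinner (x - blinfun_apply r x) (blinfun_apply r x))"
      by (simp add: cinner.diff_left cinner.diff_right)
    also have "cinner (x - blinfun_apply r x) (blinfun_apply r x) = 0" by (rule r(4)[OF r(2)])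
    also have "cinner (blinfun_apply r x) (x - blinfun_apply r x) = 0"
      using r(4)[OF r(2), of x x] by (subst cinner_commute) simp
    finally have "cinner (blinfun_apply r x) x = cnj (cinner (blinfun_apply r x) x)"
      using cinner_commute[of x "blinfun_apply r x"] by simp
    then show "cinner (blinfun_apply r x) x \<in> \<real>" by (metis Reals_cnj_iff)
  qed
  define s where "s = id_blinfun - r"
  have s: "s \<in> M" "adj s = s" using rM sr by (auto simp: s_def adj_M adj_id)
  have "s o\<^sub>L s = s"
    by (rule blinfun_eqI) (simp add: s_def blinfun.diff_left blinfun.diff_right r(3)[OF r(2)])
  moreover have "p s = 0"
  proof (rule bounded_vectors_separating[OF s])
    fix \<xi> assume "\<xi> \<in> bounded_vectors"
    then have "\<xi> \<in> ?K" using closure_subset by blast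
    then show "blinfun_apply s \<xi> = 0" by (simp add: s_def blinfun.diff_left r(3))
  qed
  ultimately have "s = 0" using p_faithful[OF s(1)] s(2) by simp
  then have "blinfun_apply r x = x" for x by (simp add: s_def)
  then show ?thesis using r(2) by (metis UNIV_eq_I)
qed

end

section \<open>The projection onto the centralizer\<close>

text \<open>The norms of the iterates \<open>z j\<close> are log-convex because \<open>T\<close> is
  self-adjoint, so successive ratios never decrease. A first ratio above \<open>L\<close> would
  force growth beyond every multiple of \<open>L ^ j\<close>. This bounds \<open>T\<close> at one
  vector without spectral theory.\<close>

lemma self_adjoint_growth:
  fixes T :: "'h::chilbert_space op"
  assumes T: "T \<in> bounded_operators" "adj T = T" and z: "\<And>j. z (Suc j) = blinfun_apply T (z j)"
    and growth: "\<And>j. norm (z j) \<le> C * L ^ j" and L: "0 \<le> L"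
  shows "norm (z 1) \<le> L * norm (z 0)"
proof (rule ccontr)
  assume neg: "\<not> norm (z 1) \<le> L * norm (z 0)"
  have conv: "(norm (z (Suc j)))\<^sup>2 \<le> norm (z j) * norm (z (Suc (Suc j)))" for j
  proof -
    have "(norm (z (Suc j)))\<^sup>2 = cmod (cinner (z (Suc j)) (z (Suc j)))" unfolding cinner_self norm_of_real by simp
    also have "cinner (z (Suc j)) (z (Suc j)) = cinner (z j) (z (Suc (Suc j)))"
      using cinner_adj[OF T(1), of "z j" "z (Suc j)"] T(2) by (simp add: z)
    also have "cmod \<dots> \<le> norm (z j) * norm (z (Suc (Suc j)))" by (rule norm_cinner_le)
    finally show ?thesis .
  qed
  have z0: "norm (z 0) > 0"
  proof (rule ccontr)
    assume "\<not> norm (z 0) > 0"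
    then have "z 0 = 0" by simp
    then show False using neg z[of 0] by (simp add: blinfun.zero_right)
  qed
  define \<rho> where "\<rho> = norm (z 1) / norm (z 0)"
  have \<rho>: "\<rho> > L" using neg z0 by (simp add: \<rho>_def pos_less_divide_eq)
  then have \<rho>0: "\<rho> > 0" using L by simp
  have step: "norm (z j) > 0 \<and> \<rho> * norm (z j) \<le> norm (z (Suc j))" for j
  proof (induction j)
    case 0
    then show ?case using z0 by (simp add: \<rho>_def)
  next
    case (Suc j)
    then have pos: "norm (z (Suc j)) > 0" using \<rho>0 by (smt (verit) mult_pos_pos)
    have "norm (z j) * (\<rho> * norm (z (Suc j))) \<le> norm (z (Suc j)) * norm (z (Suc j))"
      using Suc pos by (metis mult.assoc mult.commute mult_right_mono less_imp_le)
    also have "\<dots> \<le> norm (z j) * norm (z (Suc (Suc j)))" using conv[of j] by (simp add: power2_eq_square)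
    finally show ?case using Suc pos by simp
  qed
  have pow: "\<rho> ^ j * norm (z 0) \<le> norm (z j)" for j
  proof (induction j)
    case (Suc j)
    have "\<rho> ^ Suc j * norm (z 0) \<le> \<rho> * norm (z j)" using Suc \<rho>0 by (simp add: mult.assoc)
    with step[of j] show ?case by linarith
  qed simp
  show False
  proof (cases "L = 0")
    case True
    then show False using growth[of 1] neg by simp
  next
    case False
    with L have L: "L > 0" by simp
    have bd: "(\<rho> / L) ^ j \<le> C / norm (z 0)" for j
    proof -
      have "\<rho> ^ j * norm (z 0) \<le> C * L ^ j" using pow[of j] growth[of j] by linarith
      then show ?thesis using z0 L by (simp add: power_divide field_simps)
    qed
    have "1 < \<rho> / L" using \<rho> L by simp
    from real_arch_pow[OF this, of "C / norm (z 0)"] bd show False by (meson not_le)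
  qed
qed

context trace_functional
begin

text \<open>The norm bound carries convergence from the dense bounded vectors to all vectors, and it
  keeps the limit in the centralizer. That the limit is minimal needs convergence in
  \<open>q\<close>; this comes from \<open>q \<le> G\<close> and dominated convergence for
  \<open>G\<close>.\<close>

lemma minimizer_exists:
  assumes x: "x \<in> M" and R: "R \<ge> 0"
  obtains h where "h \<in> centralizer" "norm h \<le> R" "\<And>k. k \<in> centralizer \<Longrightarrow> norm k \<le> R \<Longrightarrow> q (x - h) \<le> q (x - k)"
proof -
  let ?K = "{k \<in> centralizer. norm k \<le> R}"
  have KM: "k \<in> M" if "k \<in> ?K" for k using that centralizer_M by blast
  have mid: "(1/2) *\<^sub>R (k + l) \<in> ?K" if "k \<in> ?K" "l \<in> ?K" for k l
    using that csubspace_centralizer norm_triangle_ineq[of k l] by (simp add: csubspaceD)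
  have para: "q (x - (1/2) *\<^sub>R (k + l)) \<le> (q (x - k) + q (x - l)) / 2 - q (k - l) / 4" if "k \<in> ?K" "l \<in> ?K" for k l
  proof -
    have kl: "k \<in> M" "l \<in> M" using that KM by auto
    define u v where "u = x - k" and "v = x - l"
    have uv: "u \<in> M" "v \<in> M" using kl x by (auto simp: u_def v_def)
    have A: "x - (1/2) *\<^sub>R (k + l) = (1/2) *\<^sub>R (u + v)"
      by (simp add: u_def v_def scaleR_add_right scaleR_diff_right) (simp add: scaleR_add_left[symmetric] algebra_simps)?
    have B: "k - l = v - u" by (simp add: u_def v_def)
    have "q ((1/2) *\<^sub>R (u + v)) = (q u + 2 * b u v + q v) / 4"
      using uv b_sym[of v u]
      by (simp add: b_scale_left b_scale_right b_add_left b_add_right) (simp add: add_divide_distrib)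
    moreover have "q (v - u) = q v - 2 * b u v + q u"
      using uv b_sym[of v u] by (simp add: b_diff_left b_diff_right)
    ultimately show ?thesis unfolding A B u_def[symmetric] v_def[symmetric] by (simp add: field_simps)
  qed
  show thesis
  proof (rule minimizing_sequence[of ?K 0 "\<lambda>k. q (x - k)" q])
    show "?K \<noteq> {}" using csubspace_0[OF csubspace_centralizer] R by auto
    show "0 \<le> q (x - k)" if "k \<in> ?K" for k using q_nonneg x KM[OF that] by simp
    show "(1/2) *\<^sub>R (k + l) \<in> ?K" if "k \<in> ?K" "l \<in> ?K" for k l using that by (rule mid)
    show "q (x - (1/2) *\<^sub>R (k + l)) \<le> (q (x - k) + q (x - l)) / 2 - q (k - l) / 4" if "k \<in> ?K" "l \<in> ?K" for k l
      using that by (rule para)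
  next
    fix a m assume a: "\<And>n. a n \<in> ?K" and lim: "((\<lambda>k. q (x - k)) \<circ> a) \<longlonglongrightarrow> m" and m: "\<And>k. k \<in> ?K \<Longrightarrow> m \<le> q (x - k)"
      and cau: "\<And>e. e > 0 \<Longrightarrow> \<exists>N. \<forall>j\<ge>N. \<forall>k\<ge>N. q (a j - a k) < e"
    have aM: "a n \<in> M" and aR: "norm (a n) \<le> R" and aC: "a n \<in> centralizer" for n using a KM by auto
    have cauD: "Cauchy (\<lambda>n. blinfun_apply (a n) \<zeta>)" if \<zeta>: "\<zeta> \<in> bounded_vectors" for \<zeta>
      unfolding Cauchy_iff
    proof (intro allI impI)
      fix e :: real assume e: "e > 0"
      obtain C where C: "\<And>y. y \<in> M \<Longrightarrow> norm (blinfun_apply y \<zeta>) \<le> C * sqrt (q y)" using \<zeta> unfolding bounded_vectors_def by blast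
      define D where "D = \<bar>C\<bar> + 1"
      have D: "D > 0" "norm (blinfun_apply y \<zeta>) \<le> D * sqrt (q y)" if "y \<in> M" for y
      proof -
        show "D > 0" by (simp add: D_def)
        have "C * sqrt (q y) \<le> D * sqrt (q y)" using q_nonneg[OF that] by (intro mult_right_mono) (auto simp: D_def)
        with C[OF that] show "norm (blinfun_apply y \<zeta>) \<le> D * sqrt (q y)" by linarith
      qed
      have D0: "D > 0" by (simp add: D_def)
      obtain N where N: "\<And>j k. j \<ge> N \<Longrightarrow> k \<ge> N \<Longrightarrow> q (a j - a k) < (e / D)\<^sup>2" using cau[of "(e / D)\<^sup>2"] e D0 by auto
      have "norm (blinfun_apply (a j) \<zeta> - blinfun_apply (a k) \<zeta>) < e" if jk: "j \<ge> N" "k \<ge> N" for j k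
      proof -
        have "norm (blinfun_apply (a j - a k) \<zeta>) \<le> D * sqrt (q (a j - a k))" using aM by (intro D) auto
        also have "\<dots> < D * sqrt ((e / D)\<^sup>2)" using N[OF jk] D0 by (intro mult_strict_left_mono real_sqrt_less_mono) auto
        also have "\<dots> = e" using D0 e by simp
        finally show ?thesis by (simp add: blinfun.diff_left)
      qed
      then show "\<exists>N. \<forall>j\<ge>N. \<forall>k\<ge>N. norm (blinfun_apply (a j) \<zeta> - blinfun_apply (a k) \<zeta>) < e" by blast
    qed
    have "Cauchy (\<lambda>n. blinfun_apply (a n) \<xi>)" for \<xi>
      unfolding Cauchy_iff
    proof (intro allI impI)
      fix e :: real assume e: "e > 0"
      \<comment> \<open>Twice \<open>e / 4\<close> for replacing \<open>\<xi>\<close> by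
        \<open>\<zeta>\<close>, and \<open>e / 2\<close> for the convergence at
        \<open>\<zeta>\<close>; \<open>R + 1\<close> avoids a zero divisor.\<close>
      define d where "d = e / (4 * (R + 1))"
      have d: "d > 0" using e R by (simp add: d_def)
      have "\<xi> \<in> closure bounded_vectors" using bounded_vectors_dense by simp
      then obtain \<zeta> where \<zeta>: "\<zeta> \<in> bounded_vectors" "dist \<zeta> \<xi> < d" using d unfolding closure_approachable by blast
      obtain N where N: "\<And>j k. j \<ge> N \<Longrightarrow> k \<ge> N \<Longrightarrow> norm (blinfun_apply (a j) \<zeta> - blinfun_apply (a k) \<zeta>) < e / 2"
        using cauD[OF \<zeta>(1), unfolded Cauchy_iff, rule_format, of "e/2"] e by auto
      have near: "norm (blinfun_apply (a j) \<xi> - blinfun_apply (a j) \<zeta>) \<le> e / 4" for j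
      proof -
        have "norm (blinfun_apply (a j) (\<xi> - \<zeta>)) \<le> norm (a j) * norm (\<xi> - \<zeta>)" by (rule norm_blinfun)
        also have "\<dots> \<le> (R + 1) * d" using aR[of j] \<zeta>(2) R by (intro mult_mono) (auto simp: dist_norm norm_minus_commute)
        also have "\<dots> = e / 4"
        proof -
          have "4 * R + 4 \<noteq> 0" using R by linarith
          then show ?thesis by (simp add: d_def field_simps)
        qed
        finally show ?thesis by (simp add: blinfun.diff_right)
      qed
      have "norm (blinfun_apply (a j) \<xi> - blinfun_apply (a k) \<xi>) < e" if jk: "j \<ge> N" "k \<ge> N" for j k
      proof -
        have "blinfun_apply (a j) \<xi> - blinfun_apply (a k) \<xi> = (blinfun_apply (a j) \<xi> - blinfun_apply (a j) \<zeta>) + (blinfun_apply (a j) \<zeta> - blinfun_apply (a k) \<zeta>) - (blinfun_apply (a k) \<xi> - blinfun_apply (a k) \<zeta>)" by simp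
        also have "norm \<dots> \<le> norm (blinfun_apply (a j) \<xi> - blinfun_apply (a j) \<zeta>) + norm (blinfun_apply (a j) \<zeta> - blinfun_apply (a k) \<zeta>) + norm (blinfun_apply (a k) \<xi> - blinfun_apply (a k) \<zeta>)"
          by (meson norm_triangle_ineq norm_triangle_ineq4 add_right_mono order_trans)
        also have "\<dots> < e" using near[of j] near[of k] N[OF jk] by linarith
        finally show ?thesis .
      qed
      then show "\<exists>N. \<forall>j\<ge>N. \<forall>k\<ge>N. norm (blinfun_apply (a j) \<xi> - blinfun_apply (a k) \<xi>) < e" by blast
    qed
    then have conv: "(\<lambda>n. blinfun_apply (a n) \<xi>) \<longlonglongrightarrow> lim (\<lambda>n. blinfun_apply (a n) \<xi>)" for \<xi>
      using Cauchy_convergent convergent_LIMSEQ_iff by blast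
    define f where "f \<xi> = lim (\<lambda>n. blinfun_apply (a n) \<xi>)" for \<xi>
    note f = conv[folded f_def]
    have fb: "norm (f \<xi>) \<le> norm \<xi> * R" for \<xi>
    proof (rule LIMSEQ_le_const2[OF tendsto_norm[OF f]])
      have "norm (blinfun_apply (a n) \<xi>) \<le> norm \<xi> * R" for n
        using norm_blinfun[of "a n" \<xi>] mult_right_mono[OF aR[of n], of "norm \<xi>"] by (simp add: mult.commute)
      then show "\<exists>N. \<forall>n\<ge>N. norm (blinfun_apply (a n) \<xi>) \<le> norm \<xi> * R" by blast
    qed
    have "bounded_linear f"
    proof (rule bounded_linear_intro[OF _ _ fb])
      show "f (\<xi> + \<eta>) = f \<xi> + f \<eta>" for \<xi> \<eta>
        using LIMSEQ_unique[OF f[of "\<xi> + \<eta>"]] tendsto_add[OF f[of \<xi>] f[of \<eta>]] by (simp add: blinfun.add_right)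
      show "f (r *\<^sub>R \<xi>) = r *\<^sub>R f \<xi>" for r \<xi>
        using LIMSEQ_unique[OF f[of "r *\<^sub>R \<xi>"]] tendsto_scaleR[OF tendsto_const[of r] f[of \<xi>]] by (simp add: blinfun.scaleR_right)
    qed
    note app = bounded_linear_Blinfun_apply[OF this]
    define h where "h = Blinfun f"
    have hlim: "(\<lambda>n. blinfun_apply (a n) \<xi>) \<longlonglongrightarrow> blinfun_apply h \<xi>" for \<xi> using f by (simp add: h_def app)
    have hC: "h \<in> centralizer" by (rule centralizer_strong_limit[OF normal aC aR hlim])
    then have hM: "h \<in> M" by (rule centralizer_M)
    have hR: "norm h \<le> R"
      using R fb by (intro norm_blinfun_bound) (simp_all add: h_def app mult.commute)
    have G0: "(\<lambda>n. G (a n - h)) \<longlonglongrightarrow> 0"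
    proof -
      have "((\<lambda>n. \<Sum>j. (norm (blinfun_apply (a n - h) (\<tau> j)))\<^sup>2) \<longlongrightarrow> (\<Sum>j::nat. 0)) sequentially"
      proof (rule tannerys_theorem[THEN conjunct2, THEN conjunct2])
        show "summable (\<lambda>j. (2 * R)\<^sup>2 * (norm (\<tau> j))\<^sup>2)" using \<tau> by (intro summable_mult) (simp add: square_summable_def)
        show "(\<lambda>n. (norm (blinfun_apply (a n - h) (\<tau> j)))\<^sup>2) \<longlonglongrightarrow> 0" for j
        proof -
          have "(\<lambda>n. (norm (blinfun_apply (a n) (\<tau> j) - blinfun_apply h (\<tau> j)))\<^sup>2) \<longlonglongrightarrow> (norm (blinfun_apply h (\<tau> j) - blinfun_apply h (\<tau> j)))\<^sup>2"
            by (intro tendsto_intros hlim)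
          then show ?thesis by (simp add: blinfun.diff_left)
        qed
        have "norm ((norm (blinfun_apply (a n - h) (\<tau> j)))\<^sup>2) \<le> (2 * R)\<^sup>2 * (norm (\<tau> j))\<^sup>2" for n j
        proof -
          have "norm (blinfun_apply (a n - h) (\<tau> j)) \<le> norm (a n - h) * norm (\<tau> j)" by (rule norm_blinfun)
          also have "\<dots> \<le> (2 * R) * norm (\<tau> j)"
            using norm_triangle_ineq4[of "a n" h] aR[of n] hR by (intro mult_right_mono) auto
          finally show ?thesis using power_mono[of "norm (blinfun_apply (a n - h) (\<tau> j))" "(2 * R) * norm (\<tau> j)" 2]
            by (simp add: power_mult_distrib)
        qed
        then show "\<forall>\<^sub>F (j, n) in sequentially \<times>\<^sub>F sequentially. norm ((norm (blinfun_apply (a n - h) (\<tau> j)))\<^sup>2) \<le> (2 * R)\<^sup>2 * (norm (\<tau> j))\<^sup>2"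
          by (intro always_eventually) auto
      qed simp
      then show ?thesis by (simp add: G_def sq_def)
    qed
    have "q (x - h) \<le> m"
    proof (rule LIMSEQ_le_const)
      let ?u = "\<lambda>n. q (x - a n) + 2 * (sqrt (q (x - a n)) * sqrt (G (a n - h))) + G (a n - h)"
      have "?u \<longlonglongrightarrow> m + 2 * (sqrt m * sqrt 0) + 0"
        using lim unfolding o_def by (intro tendsto_intros G0)
      then show "?u \<longlonglongrightarrow> m" by simp
      have "q (x - h) \<le> ?u n" for n
      proof -
        have M: "x - a n \<in> M" "a n - h \<in> M" using x aM hM by auto
        have "q (x - h) = q ((x - a n) + 1 *\<^sub>R (a n - h))" by simp
        also have "\<dots> = q (x - a n) + 2 * b (x - a n) (a n - h) + q (a n - h)"
          unfolding q_expand[OF M] by simp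
        also have "\<dots> \<le> q (x - a n) + 2 * (sqrt (q (x - a n)) * sqrt (q (a n - h))) + q (a n - h)"
          using b_le[OF M] by simp
        also have "\<dots> \<le> ?u n"
          using q_le_G[OF M(2)] q_nonneg[OF M(1)] by (intro add_mono mult_left_mono) auto
        finally show ?thesis .
      qed
      then show "\<exists>N. \<forall>n\<ge>N. q (x - h) \<le> ?u n" by blast
    qed
    then show thesis using that[OF hC hR] m order_trans by blast
  qed
qed

text \<open>Only directions that keep \<open>h - t u\<close> in the ball for small positive
  \<open>t\<close> are admissible, so the first variation has a sign but may fail to vanish.\<close>

lemma minimizer_variation:
  assumes x: "x \<in> M" and h: "h \<in> centralizer"
    and min: "\<And>k. k \<in> centralizer \<Longrightarrow> norm k \<le> R \<Longrightarrow> q (x - h) \<le> q (x - k)"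
    and u: "u \<in> centralizer" and s: "s > 0" "\<And>t. 0 < t \<Longrightarrow> t \<le> s \<Longrightarrow> norm (h - t *\<^sub>R u) \<le> R"
  shows "0 \<le> b (x - h) u"
proof -
  note M = centralizer_M[OF h] centralizer_M[OF u]
  have "- b (x - h) u \<le> 0"
  proof (rule first_order_condition[OF s(1)])
    fix t :: real assume t: "0 < t" "t \<le> s"
    have k: "h - t *\<^sub>R u \<in> centralizer" using csubspace_centralizer h u by (simp add: csubspaceD)
    have "q (x - h) \<le> q (x - (h - t *\<^sub>R u))" by (rule min[OF k s(2)[OF t]])
    also have "x - (h - t *\<^sub>R u) = (x - h) + t *\<^sub>R u" by simp
    also have "q \<dots> = q (x - h) + 2 * t * b (x - h) u + t\<^sup>2 * q u" by (rule q_expand) (use x M in auto)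
    finally show "2 * t * - b (x - h) u \<le> t\<^sup>2 * q u" by simp
  qed
  then show ?thesis by simp
qed

text \<open>When the square is expanded, the first-order term, \<open>- 2 * t\<close> times the
  square of \<open>norm w\<close>, outweighs the second-order one as long as \<open>t\<close> times
  the square of \<open>norm (adj c)\<close> is at most 2.\<close>

lemma contraction_near_id:
  fixes c :: "'h op"
  assumes c: "c \<in> M" and t: "0 < t" "t * (norm (adj c))\<^sup>2 \<le> 2"
  shows "norm (blinfun_apply (id_blinfun - t *\<^sub>R (c o\<^sub>L adj c)) v) \<le> norm v"
proof -
  define w where "w = blinfun_apply (adj c) v"
  have cb: "c \<in> bounded_operators" by (rule M.bounded[OF c])
  have i: "inner v (blinfun_apply c w) = (norm w)\<^sup>2"
    using cinner_adj'[OF cb, of v w] cinner_self[of w] unfolding w_def[symmetric] by (metis Re_complex_of_real Re_cinner)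
  have n: "norm (blinfun_apply c w) \<le> norm (adj c) * norm w"
    using norm_blinfun[of c w] norm_adj_le[OF adj_in[OF cb]] adj_adj[OF cb] mult_right_mono[of "norm c" "norm (adj c)" "norm w"]
    by simp
  have "(norm (v - y))\<^sup>2 = (norm v)\<^sup>2 - 2 * inner v y + (norm y)\<^sup>2" for y
    by (simp add: power2_norm_eq_inner inner_diff_left inner_diff_right inner_commute[of y v])
  from this[of "t *\<^sub>R blinfun_apply c w"]
  have "(norm (v - t *\<^sub>R blinfun_apply c w))\<^sup>2 = (norm v)\<^sup>2 - 2 * t * (norm w)\<^sup>2 + t\<^sup>2 * (norm (blinfun_apply c w))\<^sup>2"
    by (simp add: i power_mult_distrib)
  also have "\<dots> \<le> (norm v)\<^sup>2 - 2 * t * (norm w)\<^sup>2 + t\<^sup>2 * (norm (adj c) * norm w)\<^sup>2"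
    using n by (intro add_left_mono mult_left_mono power_mono) auto
  also have "\<dots> = (norm v)\<^sup>2 - t * (norm w)\<^sup>2 * (2 - t * (norm (adj c))\<^sup>2)" by (simp add: power_mult_distrib power2_eq_square algebra_simps)
  also have "\<dots> \<le> (norm v)\<^sup>2" using t by simp
  finally have "norm (v - t *\<^sub>R blinfun_apply c w) \<le> norm v" by (rule power2_le_imp_le) simp
  then show ?thesis by (simp add: blinfun.diff_left blinfun.scaleR_left w_def)
qed

lemma norm_contraction_near_id:
  assumes "c \<in> M" "0 < t" "t * (norm (adj c))\<^sup>2 \<le> 2"
  shows "norm (id_blinfun - t *\<^sub>R (c o\<^sub>L adj c)) \<le> 1"
  by (rule norm_blinfun_bound) (use contraction_near_id[OF assms] in auto)

text \<open>The minimizer over a ball larger than the norm of \<open>x\<close> lies in its interior. The variations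
  \<open>h (1 - t c c*)\<close> and \<open>(1 - t c c*) h\<close> stay in the ball, and the trace property turns the
  resulting first-order conditions into bounds for \<open>q\<close> from which the growth of \<open>(h* h)\<^sup>j\<close> on
  bounded vectors can be estimated.\<close>

lemma minimizer_norm:
  assumes x: "x \<in> M" and h: "h \<in> centralizer" and hR: "norm h \<le> R"
    and min: "\<And>k. k \<in> centralizer \<Longrightarrow> norm k \<le> R \<Longrightarrow> q (x - h) \<le> q (x - k)"
  shows "norm h \<le> norm x"
proof -
  note hM = centralizer_M[OF h]
  have ha: "adj h \<in> centralizer" by (rule adj_centralizer[OF h])
  have step_size: "\<exists>s>0. \<forall>t. 0 < t \<longrightarrow> t \<le> s \<longrightarrow> t * (norm (adj c))\<^sup>2 \<le> 2" for c :: "'h op"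
  proof (intro exI[of _ "2 / ((norm (adj c))\<^sup>2 + 1)"] conjI allI impI)
    have p: "(norm (adj c))\<^sup>2 + 1 > 0" by (intro add_nonneg_pos) auto
    show "2 / ((norm (adj c))\<^sup>2 + 1) > 0" using p by simp
    fix t assume t: "0 < t" "t \<le> 2 / ((norm (adj c))\<^sup>2 + 1)"
    then have "t * ((norm (adj c))\<^sup>2 + 1) \<le> 2" using p by (simp add: pos_le_divide_eq)
    with t(1) show "t * (norm (adj c))\<^sup>2 \<le> 2" by (simp add: distrib_left)
  qed
  have Rnn: "R \<ge> 0" using hR norm_ge_zero order_trans by blast
  have right: "q (h o\<^sub>L c) \<le> (norm x)\<^sup>2 * q c" if c: "c \<in> centralizer" for c
  proof -
    note cM = centralizer_M[OF c] and ca = adj_centralizer[OF c]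
    obtain s where s: "s > 0" "\<And>t. 0 < t \<Longrightarrow> t \<le> s \<Longrightarrow> t * (norm (adj c))\<^sup>2 \<le> 2" using step_size by blast
    let ?u = "h o\<^sub>L (c o\<^sub>L adj c)"
    have "0 \<le> b (x - h) ?u"
    proof (rule minimizer_variation[OF x h min _ s(1)])
      show "?u \<in> centralizer" by (intro compose_centralizer h c ca)
      fix t assume t: "0 < t" "t \<le> s"
      have "h - t *\<^sub>R ?u = h o\<^sub>L (id_blinfun - t *\<^sub>R (c o\<^sub>L adj c))" by (simp add: compose.diff_right compose.scaleR_right)
      then have "norm (h - t *\<^sub>R ?u) \<le> norm h * norm (id_blinfun - t *\<^sub>R (c o\<^sub>L adj c))" using norm_compose_le by simp
      also have "\<dots> \<le> R * 1" using hR Rnn norm_contraction_near_id[OF cM t(1) s(2)[OF t]] by (intro mult_mono) auto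
      finally show "norm (h - t *\<^sub>R ?u) \<le> R" by simp
    qed
    \<comment> \<open>The trace property cycles \<open>c\<close> to the right end, where it joins
      \<open>x - h\<close>; the variation becomes a comparison of \<open>h o\<^sub>L c\<close> with
      \<open>x o\<^sub>L c\<close>.\<close>
    also have "b (x - h) ?u = p (c o\<^sub>L ((adj c o\<^sub>L adj h) o\<^sub>L (x - h)))"
      using hM cM by (simp add: b_def adj_M blinfun_compose_assoc)
    also have "\<dots> = p (((adj c o\<^sub>L adj h) o\<^sub>L (x - h)) o\<^sub>L c)" by (rule p_trace[OF c]) (use hM cM x in auto)
    also have "\<dots> = b ((x - h) o\<^sub>L c) (h o\<^sub>L c)" using hM cM by (simp add: b_def adj_M blinfun_compose_assoc)
    also have "\<dots> = b (x o\<^sub>L c) (h o\<^sub>L c) - q (h o\<^sub>L c)"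
      unfolding compose.diff_left by (rule b_diff_left) (use hM cM x in auto)
    finally have "q (h o\<^sub>L c) \<le> b (h o\<^sub>L c) (x o\<^sub>L c)" using b_sym[of "x o\<^sub>L c" "h o\<^sub>L c"] hM cM x by simp
    then have "q (h o\<^sub>L c) \<le> q (x o\<^sub>L c)" by (rule q_le_of_b[rotated 2]) (use hM cM x in auto)
    also have "\<dots> \<le> (norm x)\<^sup>2 * q c" by (rule q_compose_le[OF x cM])
    finally show ?thesis .
  qed
  have left: "q (adj h o\<^sub>L c) \<le> (norm x)\<^sup>2 * q c" if c: "c \<in> centralizer" for c
  proof -
    note cM = centralizer_M[OF c] and ca = adj_centralizer[OF c]
    obtain s where s: "s > 0" "\<And>t. 0 < t \<Longrightarrow> t \<le> s \<Longrightarrow> t * (norm (adj c))\<^sup>2 \<le> 2" using step_size by blast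
    let ?u = "(c o\<^sub>L adj c) o\<^sub>L h"
    have "0 \<le> b (x - h) ?u"
    proof (rule minimizer_variation[OF x h min _ s(1)])
      show "?u \<in> centralizer" by (intro compose_centralizer h c ca)
      fix t assume t: "0 < t" "t \<le> s"
      have "h - t *\<^sub>R ?u = (id_blinfun - t *\<^sub>R (c o\<^sub>L adj c)) o\<^sub>L h" by (simp add: compose.diff_left compose.scaleR_left)
      then have "norm (h - t *\<^sub>R ?u) \<le> norm (id_blinfun - t *\<^sub>R (c o\<^sub>L adj c)) * norm h" using norm_compose_le by simp
      also have "\<dots> \<le> 1 * R" using hR Rnn norm_contraction_near_id[OF cM t(1) s(2)[OF t]] by (intro mult_mono) auto
      finally show "norm (h - t *\<^sub>R ?u) \<le> R" by simp
    qed
    also have "b (x - h) ?u = p ((adj h o\<^sub>L c) o\<^sub>L (adj c o\<^sub>L (x - h)))"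
      using hM cM by (simp add: b_def adj_M blinfun_compose_assoc)
    also have "\<dots> = p ((adj c o\<^sub>L (x - h)) o\<^sub>L (adj h o\<^sub>L c))"
      by (rule p_trace[OF compose_centralizer[OF ha c]]) (use hM cM x in auto)
    also have "\<dots> = b (adj h o\<^sub>L c) (adj (x - h) o\<^sub>L c)" using hM cM x by (simp add: b_def adj_M blinfun_compose_assoc)
    also have "\<dots> = b (adj h o\<^sub>L c) (adj x o\<^sub>L c) - q (adj h o\<^sub>L c)"
      unfolding adj_M(2)[OF x hM] compose.diff_left by (rule b_diff_right) (use hM cM x in auto)
    finally have "q (adj h o\<^sub>L c) \<le> b (adj h o\<^sub>L c) (adj x o\<^sub>L c)" by simp
    then have "q (adj h o\<^sub>L c) \<le> q (adj x o\<^sub>L c)" by (rule q_le_of_b[rotated 2]) (use hM cM x in auto)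
    also have "\<dots> \<le> (norm (adj x))\<^sup>2 * q c" by (rule q_compose_le) (use x cM in auto)
    also have "\<dots> \<le> (norm x)\<^sup>2 * q c"
      using norm_adj_le[OF M.bounded[OF x]] q_nonneg[OF cM] by (intro mult_right_mono power_mono) auto
    finally show ?thesis .
  qed
  define T where "T = adj h o\<^sub>L h"
  have TM: "T \<in> M" "T \<in> centralizer" "adj T = T"
    using hM h ha by (auto simp: T_def adj_M intro: compose_centralizer)
  define P where "P = rec_nat id_blinfun (\<lambda>_ S. T o\<^sub>L S)"
  have P: "P 0 = id_blinfun" "P (Suc j) = T o\<^sub>L P j" for j by (simp_all add: P_def)
  have PC: "P j \<in> centralizer" for j
    by (induction j) (auto simp: P id_centralizer intro: compose_centralizer TM)
  \<comment> \<open>A factor \<open>T\<close> costs one use of \<open>left\<close> and one of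
    \<open>right\<close>, each contributing the square of \<open>norm x\<close>; after the square
    root the vectors \<open>z j\<close> grow at most like the powers of the square of
    \<open>norm x\<close>.\<close>
  have qP: "q (P j) \<le> ((norm x)\<^sup>2) ^ j * ((norm x)\<^sup>2) ^ j * q id_blinfun" for j
  proof (induction j)
    case (Suc j)
    have "q (P (Suc j)) = q (adj h o\<^sub>L (h o\<^sub>L P j))" by (simp add: P T_def blinfun_compose_assoc)
    also have "\<dots> \<le> (norm x)\<^sup>2 * q (h o\<^sub>L P j)" by (rule left[OF compose_centralizer[OF h PC]])
    also have "\<dots> \<le> (norm x)\<^sup>2 * ((norm x)\<^sup>2 * q (P j))" by (rule mult_left_mono[OF right[OF PC]]) simp
    also have "\<dots> \<le> (norm x)\<^sup>2 * ((norm x)\<^sup>2 * (((norm x)\<^sup>2) ^ j * ((norm x)\<^sup>2) ^ j * q id_blinfun))"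
      using Suc by (intro mult_left_mono) auto
    finally show ?case by (simp add: mult_ac)
  qed (simp add: P)
  have dense: "norm (blinfun_apply h \<xi>) \<le> norm x * norm \<xi>" if \<xi>: "\<xi> \<in> bounded_vectors" for \<xi>
  proof -
    obtain C where C: "\<And>y. y \<in> M \<Longrightarrow> norm (blinfun_apply y \<xi>) \<le> C * sqrt (q y)" using \<xi> unfolding bounded_vectors_def by blast
    define z where "z j = blinfun_apply (P j) \<xi>" for j
    have "norm (z 1) \<le> (norm x)\<^sup>2 * norm (z 0)"
    proof (rule self_adjoint_growth[OF M.bounded[OF TM(1)] TM(3)])
      show "z (Suc j) = blinfun_apply T (z j)" for j by (simp add: z_def P)
      show "norm (z j) \<le> (\<bar>C\<bar> * sqrt (q id_blinfun)) * ((norm x)\<^sup>2) ^ j" for j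
      proof -
        have "norm (z j) \<le> C * sqrt (q (P j))" unfolding z_def by (rule C[OF centralizer_M[OF PC]])
        also have "\<dots> \<le> \<bar>C\<bar> * sqrt (q (P j))" using q_nonneg[OF centralizer_M[OF PC]] by (intro mult_right_mono) auto
        also have "\<dots> \<le> \<bar>C\<bar> * sqrt (((norm x)\<^sup>2) ^ j * ((norm x)\<^sup>2) ^ j * q id_blinfun)"
          by (intro mult_left_mono real_sqrt_le_mono qP) simp
        also have "\<dots> = (\<bar>C\<bar> * sqrt (q id_blinfun)) * ((norm x)\<^sup>2) ^ j" by (simp add: real_sqrt_mult mult_ac)
        finally show ?thesis .
      qed
    qed simp
    then have T: "norm (blinfun_apply T \<xi>) \<le> (norm x)\<^sup>2 * norm \<xi>" by (simp add: z_def P)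
    have "(norm (blinfun_apply h \<xi>))\<^sup>2 = cmod (cinner (blinfun_apply T \<xi>) \<xi>)"
      unfolding T_def blinfun_apply_blinfun_compose cinner_adj'[OF M.bounded[OF hM]] cinner_self norm_of_real by simp
    also have "\<dots> \<le> ((norm x)\<^sup>2 * norm \<xi>) * norm \<xi>"
      by (rule order_trans[OF norm_cinner_le mult_right_mono[OF T]]) simp
    finally have "(norm (blinfun_apply h \<xi>))\<^sup>2 \<le> (norm x * norm \<xi>)\<^sup>2" by (simp add: power2_eq_square mult_ac)
    then show ?thesis by (rule power2_le_imp_le) simp
  qed
  show ?thesis
  proof (rule norm_blinfun_bound)
    fix \<xi>
    have "\<xi> \<in> closure bounded_vectors" using bounded_vectors_dense by simp
    then obtain u where u: "\<And>n. u n \<in> bounded_vectors" "u \<longlonglongrightarrow> \<xi>" unfolding closure_sequential by blast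
    show "norm (blinfun_apply h \<xi>) \<le> norm x * norm \<xi>"
    proof (rule LIMSEQ_le)
      show "(\<lambda>n. norm (blinfun_apply h (u n))) \<longlonglongrightarrow> norm (blinfun_apply h \<xi>)"
        by (intro tendsto_norm blinfun.tendsto tendsto_const u)
      show "(\<lambda>n. norm x * norm (u n)) \<longlonglongrightarrow> norm x * norm \<xi>" by (intro tendsto_intros u)
      show "\<exists>N. \<forall>n\<ge>N. norm (blinfun_apply h (u n)) \<le> norm x * norm (u n)" using dense u(1) by blast
    qed
  qed simp
qed

lemma decomposition:
  assumes x: "x \<in> M"
  shows "\<exists>h\<in>centralizer. norm h \<le> norm x \<and> (\<forall>c\<in>centralizer. b (x - h) c = 0)"
proof -
  obtain h where h: "h \<in> centralizer" "norm h \<le> norm x + 1"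
    and min: "\<And>k. k \<in> centralizer \<Longrightarrow> norm k \<le> norm x + 1 \<Longrightarrow> q (x - h) \<le> q (x - k)"
    by (rule minimizer_exists[OF x, of "norm x + 1"]) (simp, rule that)
  have hx: "norm h \<le> norm x" by (rule minimizer_norm[OF x h min])
  have nonneg: "0 \<le> b (x - h) c" if c: "c \<in> centralizer" for c
  \<comment> \<open>\<open>h\<close> has norm at most \<open>norm x\<close> while the ball has
    radius \<open>norm x + 1\<close>, so this step length is admissible in every direction
    \<open>c\<close>, including \<open>- c\<close>.\<close>
  proof (rule minimizer_variation[OF x h(1) min c, where s = "1 / (norm c + 1)"])
    have p: "norm c + 1 > 0" by (intro add_nonneg_pos) auto
    show "1 / (norm c + 1) > 0" using p by simp
    fix t assume t: "0 < t" "t \<le> 1 / (norm c + 1)"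
    then have "t * (norm c + 1) \<le> 1" using p by (simp add: pos_le_divide_eq)
    then have "t * norm c \<le> 1" using t(1) by (simp add: distrib_left)
    then show "norm (h - t *\<^sub>R c) \<le> norm x + 1" using norm_triangle_ineq4[of h "t *\<^sub>R c"] hx t(1) by simp
  qed
  have "b (x - h) c = 0" if c: "c \<in> centralizer" for c
  proof -
    have "b (x - h) (- c) = - b (x - h) c"
      using b_scale_right[of "x - h" c "-1"] x centralizer_M[OF h(1)] centralizer_M[OF c] by simp
    then show ?thesis using nonneg[OF c] nonneg[OF csubspace_neg[OF csubspace_centralizer c]] by simp
  qed
  with h hx show ?thesis by blast
qed

text \<open>Orthogonality to the centralizer determines \<open>h\<close>, because \<open>q\<close>
  is definite; uniqueness makes the choice linear. The form \<open>b\<close> is only real-bilinear,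
  so for complex scalars the factor \<open>k\<close> is moved to \<open>c\<close> as
  \<open>cnj k\<close>.\<close>

lemma centralizer_projection:
  obtains P where "\<And>x. x \<in> M \<Longrightarrow> P x \<in> centralizer" "\<And>c. c \<in> centralizer \<Longrightarrow> P c = c"
    "clinear_on M P" "\<And>x. x \<in> M \<Longrightarrow> norm (P x) \<le> norm x"
proof -
  have "\<forall>x. \<exists>h. x \<in> M \<longrightarrow> h \<in> centralizer \<and> norm h \<le> norm x \<and> (\<forall>c\<in>centralizer. b (x - h) c = 0)"
    using decomposition by blast
  from choice[OF this] obtain P where P: "\<And>x. x \<in> M \<Longrightarrow> P x \<in> centralizer" "\<And>x. x \<in> M \<Longrightarrow> norm (P x) \<le> norm x"
    "\<And>x c. x \<in> M \<Longrightarrow> c \<in> centralizer \<Longrightarrow> b (x - P x) c = 0" by blast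
  have uniq: "P x = h" if x: "x \<in> M" and h: "h \<in> centralizer" "\<And>c. c \<in> centralizer \<Longrightarrow> b (x - h) c = 0" for x h
  proof -
    have d: "P x - h \<in> centralizer" by (rule csubspace_diff[OF csubspace_centralizer P(1)[OF x] h(1)])
    note M = centralizer_M[OF d] centralizer_M[OF h(1)] centralizer_M[OF P(1)[OF x]]
    have "q (P x - h) = b ((x - h) - (x - P x)) (P x - h)" by simp
    also have "\<dots> = b (x - h) (P x - h) - b (x - P x) (P x - h)" by (rule b_diff_left) (use M x in auto)
    also have "\<dots> = 0" using h(2)[OF d] P(3)[OF x d] by simp
    finally have "P x - h = 0" using q_eq_0[OF M(1)] by blast
    then show ?thesis by simp
  qed
  have "P c = c" if c: "c \<in> centralizer" for c
    by (rule uniq[OF centralizer_M[OF c] c]) (simp add: b_def p_scaleR[of 0 0, simplified] csubspace_0[OF M.csub])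
  moreover have "clinear_on M P"
    unfolding clinear_on_def
  proof (intro conjI ballI allI)
    fix x y assume xy: "x \<in> M" "y \<in> M"
    note PM = centralizer_M[OF P(1)]
    show "P (x + y) = P x + P y"
    proof (rule uniq)
      fix c assume c: "c \<in> centralizer"
      have "x + y - (P x + P y) = (x - P x) + (y - P y)" by simp
      also have "b \<dots> c = b (x - P x) c + b (y - P y) c" by (rule b_add_left) (use xy PM centralizer_M[OF c] in auto)
      finally show "b (x + y - (P x + P y)) c = 0" using P(3)[OF xy(1) c] P(3)[OF xy(2) c] by simp
    qed (use xy P(1) csubspace_add[OF csubspace_centralizer] in auto)
  next
    fix k x assume x: "x \<in> M"
    show "P (k *\<^sub>C x) = k *\<^sub>C P x"
    proof (rule uniq)
      fix c assume c: "c \<in> centralizer"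
      have kc: "cnj k *\<^sub>C c \<in> centralizer" by (rule csubspace_scaleC[OF csubspace_centralizer c])
      have "b (k *\<^sub>C x - k *\<^sub>C P x) c = p (adj c o\<^sub>L (k *\<^sub>C (x - P x)))" by (simp add: b_def scaleC_diff_right)
      also have "\<dots> = p (adj (cnj k *\<^sub>C c) o\<^sub>L (x - P x))"
        using M.bounded[OF centralizer_M[OF c]]
        by (simp add: adj_scaleC compose_scaleC_left compose_scaleC_right adj_in)
      also have "\<dots> = 0" using P(3)[OF x kc] by (simp add: b_def)
      finally show "b (k *\<^sub>C x - k *\<^sub>C P x) c = 0" .
    qed (use x P(1) M.csub csubspace_centralizer in \<open>auto simp: csubspaceD\<close>)
  qed
  ultimately show thesis using P(1,2) by (intro that[of P]) auto
qed

end

section \<open>The functional obtained from a separating sequence\<close>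

context cond_exp
begin

text \<open>\<open>p\<close> sums the diagonal matrix elements of \<open>E x\<close> along a
  separating sequence, which together with faithfulness of \<open>E\<close> makes it faithful. It
  satisfies the trace identity against the centralizer because \<open>E\<close> already
  does.\<close>

theorem centralizer_complemented:
  assumes "separable_predual M" "faithful_map M E" and normal: "normal_map M E"
  obtains P where "\<And>x. x \<in> M \<Longrightarrow> P x \<in> centralizer" "\<And>c. c \<in> centralizer \<Longrightarrow> P c = c"
    "clinear_on M P" "\<And>x. x \<in> M \<Longrightarrow> norm (P x) \<le> norm x"
proof -
  have "\<exists>\<theta>. square_summable \<theta> \<and> (\<forall>x\<in>M. (\<forall>m. blinfun_apply x (\<theta> m) = 0) \<longrightarrow> x = 0)"
    by (rule M.separating_sequence[OF assms(1)]) blast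
  then obtain \<theta> where \<theta>: "square_summable \<theta>" "\<And>x. x \<in> M \<Longrightarrow> (\<And>m. blinfun_apply x (\<theta> m) = 0) \<Longrightarrow> x = 0"
    by blast
  define \<omega> where "\<omega> = (\<lambda>T. \<Sum>n. cinner (blinfun_apply T (\<theta> n)) (\<theta> n))"
  have \<omega>: "\<omega> \<in> ultraweak_functionals" unfolding \<omega>_def by (rule ultraweak_functionalsI[OF \<theta>(1) \<theta>(1)])
  have sum: "summable (\<lambda>n. cinner (blinfun_apply T (\<theta> n)) (\<theta> n))" for T
    by (rule summable_norm_cancel[OF summable_pairing[OF \<theta>(1) \<theta>(1)]])
  define p where "p x = Re (\<omega> (E x))" for x
  have p_eq: "p x = (\<Sum>n. Re (cinner (blinfun_apply (E x) (\<theta> n)) (\<theta> n)))"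
    and p_sum: "summable (\<lambda>n. Re (cinner (blinfun_apply (E x) (\<theta> n)) (\<theta> n)))" for x
    using sums_Re[OF summable_sums[OF sum[of "E x"]]] by (auto simp: p_def \<omega>_def sums_iff)
  obtain \<alpha> \<beta> where ab: "square_summable \<alpha>" "square_summable \<beta>" "\<And>x. x \<in> M \<Longrightarrow> cmod (\<omega> (E x)) \<le> pairing \<alpha> \<beta> x"
    by (rule E_continuous_dominated[OF normal \<omega>]) (rule that; blast)
  \<comment> \<open>A matrix element of \<open>adj x o\<^sub>L x\<close> between
    \<open>\<alpha> n\<close> and \<open>\<beta> n\<close> is at most the product of the norms of
    their images under \<open>x\<close>, hence at most the sum of the squares; interleaving both
    sequences records that sum.\<close>
  interpret trace_functional M N E p "merge \<alpha> \<beta>"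
  proof
    show "normal_map M E" by (rule normal)
    fix x y assume x: "x \<in> M" and y: "y \<in> M"
    show "p (x + y) = p x + p y"
      unfolding p_def \<omega>_def E_simps(1)[OF x y]
      by (simp add: blinfun.add_left cinner_add_left suminf_add[symmetric] sum)
  next
    fix r :: real and x assume x: "x \<in> M"
    show "p (r *\<^sub>R x) = r * p x"
      unfolding p_eq E_simps(6)[OF x]
      by (simp add: blinfun.scaleR_left cinner_scaleR_left suminf_mult p_sum)
  next
    fix x assume x: "x \<in> M"
    have "Re (cinner (blinfun_apply (adj (E x)) v) v) = Re (cinner (blinfun_apply (E x) v) v)" for v
      unfolding cinner_adj'[OF M.bounded[OF E_in_M[OF x]]] by (subst cinner_commute) simp
    then show "p (adj x) = p x" unfolding p_eq E_adj[OF x] by simp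
  next
    fix x assume x: "x \<in> M"
    show "0 \<le> p (adj x o\<^sub>L x)" unfolding p_eq by (intro suminf_nonneg p_sum E_square[OF x])
  next
    fix x assume x: "x \<in> M" and p0: "p (adj x o\<^sub>L x) = 0"
    let ?e = "E (adj x o\<^sub>L x)"
    have xx: "adj x o\<^sub>L x \<in> M" by (intro M.compose_in M.adj_closed x)
    note e = M.bounded[OF E_in_M[OF xx]]
    have pos: "positive_op ?e" by (rule E_pos[OF xx positive_adj_compose[OF M.bounded[OF x]]])
    have z: "Re (cinner (blinfun_apply ?e (\<theta> n)) (\<theta> n)) = 0" for n
      using p0 unfolding p_eq using suminf_eq_zero_iff[OF p_sum] E_square[OF x] by blast
    have "blinfun_apply ?e (\<theta> n) = 0" for n
    proof -
      define w where "w = blinfun_apply ?e (\<theta> n)"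
      have sa: "adj ?e = ?e" and nn: "\<And>v. 0 \<le> Re (cinner (blinfun_apply ?e v) v)" using positive_op_iff[OF e] pos by auto
      \<comment> \<open>Cauchy-Schwarz for the positive form of \<open>?e\<close>: it vanishes at
        \<open>\<theta> n\<close>, so the discriminant forces \<open>w = ?e (\<theta> n)\<close> to
        be zero.\<close>
      have "(Re (cinner w w))\<^sup>2 \<le> Re (cinner (blinfun_apply ?e w) w) * 0"
      proof (rule discriminant_le)
        fix t :: real
        have "cinner (blinfun_apply ?e w) (\<theta> n) = cinner w w" using cinner_adj[OF e, of w "\<theta> n"] sa by (simp add: w_def)
        moreover have "cinner (blinfun_apply ?e (\<theta> n)) w = cinner w w" by (simp add: w_def)
        ultimately have "Re (cinner (blinfun_apply ?e (\<theta> n + t *\<^sub>R w)) (\<theta> n + t *\<^sub>R w)) =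
            t\<^sup>2 * Re (cinner (blinfun_apply ?e w) w) + 2 * t * Re (cinner w w) + 0"
          using z[of n] by (simp add: blinfun.add_right blinfun.scaleR_right cinner_add_left cinner_add_right
              cinner_scaleR_left cinner_scaleR_right power2_eq_square algebra_simps)
        then show "0 \<le> t\<^sup>2 * Re (cinner (blinfun_apply ?e w) w) + 2 * t * Re (cinner w w) + 0" using nn by metis
      qed (use nn in auto)
      then have "w = 0" by (simp add: cinner_self)
      then show ?thesis by (simp add: w_def)
    qed
    then have "?e = 0" by (rule \<theta>(2)[OF E_in_M[OF xx]])
    then show "x = 0" using assms(2) x unfolding faithful_map_def by blast
  next
    fix x y C assume x: "x \<in> M" and y: "y \<in> M" and le: "\<And>v. (norm (blinfun_apply x v))\<^sup>2 \<le> C * (norm (blinfun_apply y v))\<^sup>2"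
    show "p (adj x o\<^sub>L x) \<le> C * p (adj y o\<^sub>L y)"
      unfolding p_eq suminf_mult[OF p_sum, symmetric]
      by (intro suminf_le E_mono[OF x y le] p_sum summable_mult)
  next
    fix c x assume "c \<in> centralizer" "x \<in> M"
    then have "E (c o\<^sub>L x) = E (x o\<^sub>L c)" by (rule centralizer_E)
    then show "p (c o\<^sub>L x) = p (x o\<^sub>L c)" by (simp only: p_def)
  next
    show "square_summable (merge \<alpha> \<beta>)" by (rule square_summable_merge[OF ab(1,2)])
    fix x assume x: "x \<in> M"
    note sa = square_summable_apply[OF ab(1), of x] and sb = square_summable_apply[OF ab(2), of x]
    have "p (adj x o\<^sub>L x) \<le> pairing \<alpha> \<beta> (adj x o\<^sub>L x)"
      using ab(3)[OF M.compose_in[OF M.adj_closed[OF x] x]] complex_Re_le_cmod order_trans unfolding p_def by blast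
    also have "\<dots> \<le> (\<Sum>n. norm (blinfun_apply x (\<alpha> n)) * norm (blinfun_apply x (\<beta> n)))"
      unfolding pairing_def
    proof (rule suminf_le)
      show "cmod (cinner (blinfun_apply (adj x o\<^sub>L x) (\<alpha> n)) (\<beta> n)) \<le> norm (blinfun_apply x (\<alpha> n)) * norm (blinfun_apply x (\<beta> n))" for n
        unfolding blinfun_apply_blinfun_compose cinner_adj'[OF M.bounded[OF x]] by (rule norm_cinner_le)
    qed (intro summable_pairing ab summable_norm_product sa sb)+
    also have "\<dots> \<le> (\<Sum>n. (norm (blinfun_apply x (\<alpha> n)))\<^sup>2 + (norm (blinfun_apply x (\<beta> n)))\<^sup>2)"
    proof (rule suminf_le)
      fix n
      have "0 \<le> norm (blinfun_apply x (\<alpha> n)) * norm (blinfun_apply x (\<beta> n))" by simp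
      with sum_squares_bound[of "norm (blinfun_apply x (\<alpha> n))" "norm (blinfun_apply x (\<beta> n))", unfolded mult.assoc]
      show "norm (blinfun_apply x (\<alpha> n)) * norm (blinfun_apply x (\<beta> n)) \<le> (norm (blinfun_apply x (\<alpha> n)))\<^sup>2 + (norm (blinfun_apply x (\<beta> n)))\<^sup>2"
        by linarith
    qed (use sa sb in \<open>auto simp: square_summable_def intro!: summable_add summable_norm_product\<close>)
    also have "\<dots> = (\<Sum>n. (norm (blinfun_apply x (\<alpha> n)))\<^sup>2) + (\<Sum>n. (norm (blinfun_apply x (\<beta> n)))\<^sup>2)"
      by (rule suminf_add[symmetric]) (use sa sb in \<open>simp_all only: square_summable_def\<close>)
    also have "\<dots> = sq (\<lambda>n. blinfun_apply x (merge \<alpha> \<beta> n))"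
      unfolding sq_def merge_comp[of "\<lambda>v. (norm (blinfun_apply x v))\<^sup>2"]
      by (rule sums_unique[OF merge_sums[OF summable_sums summable_sums]])
        (use sa sb in \<open>simp_all only: square_summable_def\<close>)
    finally show "p (adj x o\<^sub>L x) \<le> sq (\<lambda>n. blinfun_apply x (merge \<alpha> \<beta> n))" .
  qed
  show thesis by (rule centralizer_projection) (fact that)
qed

end

section \<open>The group of invertible elements\<close>

lemma norm_id_blinfun_le: "norm (id_blinfun :: 'a::real_normed_vector \<Rightarrow>\<^sub>L 'a) \<le> 1"
  by (rule norm_blinfun_bound) auto

context vn_algebra
begin

abbreviation "Gr \<equiv> carrier (invertible_group M)"
abbreviation gi where "gi g \<equiv> inv\<^bsub>invertible_group M\<^esub> g"

lemma monoid_M: "monoid \<lparr>carrier = M, mult = (o\<^sub>L), one = id_blinfun\<rparr>"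
  by standard (auto simp: compose_in id_in blinfun_compose_assoc)

lemma group_Gr: "group (invertible_group M)"
  unfolding invertible_group_def by (rule monoid.units_group[OF monoid_M])

lemma mult_Gr [simp]: "x \<otimes>\<^bsub>invertible_group M\<^esub> y = x o\<^sub>L y"
  and one_Gr [simp]: "\<one>\<^bsub>invertible_group M\<^esub> = id_blinfun"
  by (simp_all add: invertible_group_def units_of_def)

lemma Gr_iff: "g \<in> Gr \<longleftrightarrow> g \<in> M \<and> (\<exists>h\<in>M. h o\<^sub>L g = id_blinfun \<and> g o\<^sub>L h = id_blinfun)"
  by (simp add: invertible_group_def units_of_def Units_def)

lemma Gr_M: "g \<in> Gr \<Longrightarrow> g \<in> M" by (simp add: Gr_iff)

lemma Gr_rules:
  shows Gr_id: "id_blinfun \<in> Gr" and Gr_compose: "g \<in> Gr \<Longrightarrow> h \<in> Gr \<Longrightarrow> g o\<^sub>L h \<in> Gr"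
    and Gr_gi: "g \<in> Gr \<Longrightarrow> gi g \<in> Gr"
    and gi_left: "g \<in> Gr \<Longrightarrow> gi g o\<^sub>L g = id_blinfun" and gi_right: "g \<in> Gr \<Longrightarrow> g o\<^sub>L gi g = id_blinfun"
    and gi_compose: "g \<in> Gr \<Longrightarrow> h \<in> Gr \<Longrightarrow> gi (g o\<^sub>L h) = gi h o\<^sub>L gi g"
    and gi_gi: "g \<in> Gr \<Longrightarrow> gi (gi g) = g" and gi_id: "gi id_blinfun = id_blinfun"
  using group.is_monoid[OF group_Gr, THEN monoid.one_closed] group.is_monoid[OF group_Gr, THEN monoid.m_closed, of g h]
    group.inv_closed[OF group_Gr, of g] group.l_inv[OF group_Gr, of g] group.r_inv[OF group_Gr, of g]
    group.inv_mult_group[OF group_Gr, of g h] group.inv_inv[OF group_Gr, of g] group.inv_eq_1_iff[OF group_Gr, of "\<one>\<^bsub>invertible_group M\<^esub>"]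
  by simp_all

lemma gi_left': "g \<in> Gr \<Longrightarrow> gi g o\<^sub>L (g o\<^sub>L x) = x" and gi_right': "g \<in> Gr \<Longrightarrow> g o\<^sub>L (gi g o\<^sub>L x) = x"
  by (simp_all add: blinfun_compose_assoc[symmetric] gi_left gi_right)

lemma GrI: "g \<in> M \<Longrightarrow> h \<in> M \<Longrightarrow> h o\<^sub>L g = id_blinfun \<Longrightarrow> g o\<^sub>L h = id_blinfun \<Longrightarrow> g \<in> Gr"
  by (auto simp: Gr_iff)

lemma gi_eqI: assumes "g \<in> Gr" "h o\<^sub>L g = id_blinfun" shows "gi g = h"
  by (metis assms blinfun_compose_assoc blinfun_compose_id gi_right)

text \<open>The inverse is obtained as the fixed point of \<open>y \<mapsto> 1 + (1 - x) y\<close>.\<close>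

lemma near_id_invertible:
  assumes x: "x \<in> M" "norm (x - id_blinfun) < 1"
  shows "x \<in> Gr" and "norm (gi x) \<le> 1 / (1 - norm (x - id_blinfun))"
proof -
  let ?c = "norm (x - id_blinfun)"
  have d: "id_blinfun - x \<in> M" using x id_in csub by (simp add: csubspaceD)
  have "\<exists>!y\<in>M. id_blinfun + ((id_blinfun - x) o\<^sub>L y) = y"
  proof (rule Banach_fix[OF complete _ _ x(2)])
    show "(\<lambda>y. id_blinfun + ((id_blinfun - x) o\<^sub>L y)) ` M \<subseteq> M"
      using csub id_in compose_in[OF d] by (auto simp: csubspaceD)
    fix y z
    have "dist (id_blinfun + ((id_blinfun - x) o\<^sub>L y)) (id_blinfun + ((id_blinfun - x) o\<^sub>L z)) = norm ((id_blinfun - x) o\<^sub>L (y - z))"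
      by (simp add: dist_norm compose.diff_right)
    also have "\<dots> \<le> norm (id_blinfun - x) * norm (y - z)" by (rule norm_blinfun_compose)
    finally show "dist (id_blinfun + ((id_blinfun - x) o\<^sub>L y)) (id_blinfun + ((id_blinfun - x) o\<^sub>L z)) \<le> ?c * dist y z"
      by (simp add: dist_norm norm_minus_commute)
  qed (use id_in in auto)
  then obtain y where y: "y \<in> M" "id_blinfun + ((id_blinfun - x) o\<^sub>L y) = y" by blast
  have "\<exists>!z\<in>M. id_blinfun + (z o\<^sub>L (id_blinfun - x)) = z"
  proof (rule Banach_fix[OF complete _ _ x(2)])
    show "(\<lambda>z. id_blinfun + (z o\<^sub>L (id_blinfun - x))) ` M \<subseteq> M"
      using csub id_in compose_in[OF _ d] by (auto simp: csubspaceD)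
    fix y z
    have "dist (id_blinfun + (y o\<^sub>L (id_blinfun - x))) (id_blinfun + (z o\<^sub>L (id_blinfun - x))) = norm ((y - z) o\<^sub>L (id_blinfun - x))"
      by (simp add: dist_norm compose.diff_left)
    also have "\<dots> \<le> norm (y - z) * norm (id_blinfun - x)" by (rule norm_blinfun_compose)
    finally show "dist (id_blinfun + (y o\<^sub>L (id_blinfun - x))) (id_blinfun + (z o\<^sub>L (id_blinfun - x))) \<le> ?c * dist y z"
      by (simp add: dist_norm norm_minus_commute mult.commute)
  qed (use id_in in auto)
  then obtain z where z: "z \<in> M" "id_blinfun + (z o\<^sub>L (id_blinfun - x)) = z" by blast
  have xy: "x o\<^sub>L y = id_blinfun" using y(2) by (simp add: compose.diff_left)
  have zx: "z o\<^sub>L x = id_blinfun" using z(2) by (simp add: compose.diff_right)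
  have "z = y" by (metis xy zx blinfun_compose_assoc blinfun_compose_id)
  then show G: "x \<in> Gr" using GrI[OF x(1) y(1)] xy zx by simp
  have "gi x = y" using gi_eqI[OF G] zx \<open>z = y\<close> by simp
  moreover have "norm y \<le> 1 + ?c * norm y"
  proof -
    have "norm y \<le> norm (id_blinfun :: 'h op) + norm ((id_blinfun - x) o\<^sub>L y)" using y(2) norm_triangle_ineq by metis
    also have "\<dots> \<le> 1 + norm (id_blinfun - x) * norm y" by (intro add_mono norm_id_blinfun_le norm_blinfun_compose)
    finally show ?thesis by (simp add: norm_minus_commute)
  qed
  ultimately show "norm (gi x) \<le> 1 / (1 - ?c)" using x(2) by (simp add: pos_le_divide_eq algebra_simps)
qed

text \<open>Multiplying by \<open>gi g\<close> reduces to the identity: within the given radius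
  \<open>gi g o\<^sub>L y\<close> has distance at most one half from it, so its inverse has norm at
  most 2. The uniform bound on \<open>gi y\<close> serves to differentiate inversion.\<close>

lemma near_invertible:
  assumes g: "g \<in> Gr"
  obtains d where "d > 0" "\<And>y. y \<in> M \<Longrightarrow> norm (y - g) < d \<Longrightarrow> y \<in> Gr \<and> norm (gi y) \<le> 2 * norm (gi g)"
proof (rule that[of "1 / (2 * (norm (gi g) + 1))"])
  have p: "norm (gi g) + 1 > 0" by (intro add_nonneg_pos) auto
  show "1 / (2 * (norm (gi g) + 1)) > 0" using p by simp
  fix y assume y: "y \<in> M" "norm (y - g) < 1 / (2 * (norm (gi g) + 1))"
  let ?x = "gi g o\<^sub>L y"
  have xM: "?x \<in> M" using y g Gr_gi Gr_M compose_in by blast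
  have "?x - id_blinfun = gi g o\<^sub>L (y - g)" using g by (simp add: compose.diff_right gi_left)
  then have "norm (?x - id_blinfun) \<le> norm (gi g) * norm (y - g)" using norm_blinfun_compose by simp
  also have "\<dots> \<le> (norm (gi g) + 1) * (1 / (2 * (norm (gi g) + 1)))" using y by (intro mult_mono) auto
  also have "\<dots> = 1 / 2" using p by simp
  finally have half: "norm (?x - id_blinfun) \<le> 1 / 2" .
  then have G: "?x \<in> Gr" "norm (gi ?x) \<le> 1 / (1 - norm (?x - id_blinfun))"
    using near_id_invertible[OF xM] by auto
  have "1 / (1 - norm (?x - id_blinfun)) \<le> 1 / (1/2)" using half by (intro divide_left_mono) auto
  then have n: "norm (gi ?x) \<le> 2" using G(2) by simp
  have y_eq: "y = g o\<^sub>L ?x" using g by (simp add: gi_right')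
  then have yG: "y \<in> Gr" using Gr_compose[OF g G(1)] by simp
  have "gi y = gi ?x o\<^sub>L gi g" using gi_compose[OF g G(1)] y_eq by simp
  then have "norm (gi y) \<le> norm (gi ?x) * norm (gi g)" using norm_blinfun_compose by metis
  also have "\<dots> \<le> 2 * norm (gi g)" using n by (intro mult_right_mono) auto
  finally show "y \<in> Gr \<and> norm (gi y) \<le> 2 * norm (gi g)" using yG by simp
qed

lemma open_Gr: "openin (top_of_set M) Gr"
  unfolding openin_euclidean_subtopology_iff
proof (intro conjI ballI subsetI)
  fix g assume g: "g \<in> Gr"
  obtain d where "d > 0" "\<And>y. y \<in> M \<Longrightarrow> norm (y - g) < d \<Longrightarrow> y \<in> Gr \<and> norm (gi y) \<le> 2 * norm (gi g)"
    using near_invertible[OF g] by blast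
  then show "\<exists>e>0. \<forall>x'\<in>M. dist x' g < e \<longrightarrow> x' \<in> Gr" by (auto simp: dist_norm)
qed (rule Gr_M)

text \<open>Keeps only the existence of a derivative. Analyticity asks for no more, and the rules
  below can then be chained without naming derivatives.\<close>

definition cd :: "('h op \<Rightarrow> 'h op) \<Rightarrow> 'h op \<Rightarrow> bool" where
  "cd f x \<longleftrightarrow> (\<exists>D. has_cderiv_within f D x M)"

lemma cd_id: "x \<in> M \<Longrightarrow> cd (\<lambda>y. y) x"
  unfolding cd_def
  by (rule exI[of _ "\<lambda>y. y"], rule has_cderiv_within_linear[where K = 1]) (auto simp: csub clinear_on_def)

lemma cd_const: "cd (\<lambda>y. c) x"
  unfolding cd_def by (rule exI[of _ "\<lambda>_. 0"]) (rule has_cderiv_within_const[OF csub])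

lemma cd_add: "cd f x \<Longrightarrow> cd g x \<Longrightarrow> cd (\<lambda>y. f y + g y) x"
  unfolding cd_def by (blast intro: has_cderiv_within_add csub)

lemma cd_compose:
  assumes x: "x \<in> M" "f x \<in> M" and f: "cd f x" and g: "cd g x"
  shows "cd (\<lambda>y. f y o\<^sub>L g y) x"
proof -
  obtain D D' where D: "has_cderiv_within f D x M" "has_cderiv_within g D' x M" using f g unfolding cd_def by blast
  show ?thesis unfolding cd_def
    by (intro exI, rule has_cderiv_within_bilinear[OF D csub x(1) bounded_bilinear_blinfun_compose compose_scaleC_left, where W = M])
      (auto simp: compose_scaleC_right bounded x)
qed

lemma cd_chain:
  assumes x: "x \<in> M" and f: "cd f x" and g: "cd g (f x)"
    and d: "d > 0" "\<And>y. y \<in> M \<Longrightarrow> norm (y - x) < d \<Longrightarrow> f y \<in> M"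
  shows "cd (\<lambda>y. g (f y)) x"
proof -
  obtain D D' where D: "has_cderiv_within f D x M" "has_cderiv_within g D' (f x) M" using f g unfolding cd_def by blast
  have "closed M" by (rule complete_imp_closed[OF complete])
  from has_cderiv_within_compose[OF D(1) csub x D(2) csub this d] show ?thesis
    unfolding cd_def o_def by blast
qed

lemma cd_linear:
  assumes L: "clinear_on M L" "\<And>v. v \<in> M \<Longrightarrow> norm (L v) \<le> K * norm v" and x: "x \<in> M"
  shows "cd L x"
  unfolding cd_def by (intro exI, rule has_cderiv_within_linear[OF L(1) csub L(2) x])

lemma cd_linear_compose:
  assumes L: "clinear_on M L" "\<And>v. v \<in> M \<Longrightarrow> norm (L v) \<le> K * norm v" and x: "x \<in> M"
    and f: "cd f x" "\<And>y. y \<in> M \<Longrightarrow> f y \<in> M"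
  shows "cd (\<lambda>y. L (f y)) x"
  by (rule cd_chain[OF x f(1) cd_linear[OF L f(2)[OF x]], of 1]) (use f in auto)

lemma cd_diff: assumes "x \<in> M" "cd f x" "cd g x" "\<And>y. y \<in> M \<Longrightarrow> g y \<in> M" shows "cd (\<lambda>y. f y - g y) x"
proof -
  have "cd (\<lambda>y. - g y) x"
    by (rule cd_linear_compose[where K = 1 and L = uminus]) (use assms in \<open>auto simp: clinear_on_def scaleC_minus_right\<close>)
  from cd_add[OF assms(2) this] show ?thesis by simp
qed

text \<open>The remainder is \<open>gi y o\<^sub>L (y - g) o\<^sub>L gi g o\<^sub>L (y - g)
  o\<^sub>L gi g\<close>, of second order because \<open>gi y\<close> stays bounded near
  \<open>g\<close>.\<close>

lemma cd_gi:
  assumes g: "g \<in> Gr" shows "cd (\<lambda>y. gi y) g"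
proof -
  note gM = Gr_M[OF g] and giM = Gr_M[OF Gr_gi[OF g]]
  let ?D = "\<lambda>v. - ((gi g o\<^sub>L v) o\<^sub>L gi g)"
  have "has_cderiv_within (\<lambda>y. gi y) ?D g M"
    unfolding has_cderiv_within_iff[OF csub]
  proof (intro conjI allI impI)
    show "clinear_on M ?D"
      by (simp add: clinear_on_def compose.add_left compose.add_right compose_scaleC_left compose_scaleC_right
          bounded giM scaleC_minus_right)
    have nD: "norm ((a o\<^sub>L v) o\<^sub>L c) \<le> norm a * norm v * norm c" for a v c :: "'h op"
      by (meson mult_right_mono norm_blinfun_compose norm_ge_zero order_trans)
    show "\<exists>K. \<forall>v\<in>M. norm (?D v) \<le> K * norm v"
      by (intro exI[of _ "norm (gi g) * norm (gi g)"] ballI)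
        (use nD[of "gi g" _ "gi g"] in \<open>simp add: mult_ac\<close>)
    fix e :: real assume e: "e > 0"
    obtain d where d: "d > 0" "\<And>y. y \<in> M \<Longrightarrow> norm (y - g) < d \<Longrightarrow> y \<in> Gr \<and> norm (gi y) \<le> 2 * norm (gi g)"
      using near_invertible[OF g] by blast
    define c where "c = 2 * norm (gi g) * (norm (gi g) * norm (gi g)) + 1"
    have c: "c > 0" unfolding c_def by (intro add_nonneg_pos) auto
    show "\<exists>d>0. \<forall>y\<in>M. norm (y - g) < d \<longrightarrow> norm (gi y - gi g - ?D (y - g)) \<le> e * norm (y - g)"
    proof (intro exI[of _ "min d (e / c)"] conjI ballI impI)
      show "0 < min d (e / c)" using d(1) e c by simp
      fix y assume y: "y \<in> M" "norm (y - g) < min d (e / c)"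
      then have yG: "y \<in> Gr" "norm (gi y) \<le> 2 * norm (gi g)" using d(2) by auto
      have eq: "gi y - gi g - ?D (y - g) = (gi y o\<^sub>L (y - g)) o\<^sub>L ((gi g o\<^sub>L (y - g)) o\<^sub>L gi g)"
        by (simp add: compose.diff_left compose.diff_right blinfun_compose_assoc gi_left gi_right gi_left' gi_right' yG g)
      have "norm (gi y - gi g - ?D (y - g)) \<le> (norm (gi y) * norm (y - g)) * (norm (gi g) * norm (y - g) * norm (gi g))"
        unfolding eq by (rule order_trans[OF norm_blinfun_compose mult_mono[OF norm_blinfun_compose nD]]) auto
      also have "\<dots> \<le> ((2 * norm (gi g)) * norm (y - g)) * (norm (gi g) * norm (y - g) * norm (gi g))"
        using yG(2) by (intro mult_right_mono) auto
      also have "\<dots> = (2 * norm (gi g) * (norm (gi g) * norm (gi g))) * norm (y - g) * norm (y - g)" by (simp add: mult_ac)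
      also have "\<dots> \<le> c * norm (y - g) * norm (y - g)" by (intro mult_right_mono) (auto simp: c_def)
      also have "\<dots> \<le> e * norm (y - g)"
      proof (intro mult_right_mono)
        have "norm (y - g) \<le> e / c" using y(2) by simp
        then show "c * norm (y - g) \<le> e" using c by (simp add: pos_le_divide_eq mult.commute)
      qed simp
      finally show "norm (gi y - gi g - ?D (y - g)) \<le> e * norm (y - g)" .
    qed
  qed
  then show ?thesis unfolding cd_def by blast
qed

lemma cd_cong:
  assumes "cd f x" "d > 0" "\<And>y. y \<in> M \<Longrightarrow> norm (y - x) < d \<Longrightarrow> f y = g y" "x \<in> M"
  shows "cd g x"
proof -
  obtain D where D: "has_cderiv_within f D x M" using assms(1) unfolding cd_def by blast
  have "f x = g x" using assms(3)[of x] assms(2,4) by simp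
  from has_cderiv_within_cong[OF D csub assms(2) this assms(3)] show ?thesis unfolding cd_def by blast
qed

lemma cd_continuous_on: "S \<subseteq> M \<Longrightarrow> (\<And>x. x \<in> S \<Longrightarrow> cd f x) \<Longrightarrow> continuous_on S f"
  using canalytic_on_imp_continuous_on[of M f S, OF _ csub] unfolding canalytic_on_def cd_def by blast

lemma cd_open_preimage:
  assumes S: "openin (top_of_set M) S" and T: "openin (top_of_set M) T"
    and f: "\<And>x. x \<in> S \<Longrightarrow> cd f x" "\<And>x. x \<in> S \<Longrightarrow> f x \<in> M"
  shows "openin (top_of_set M) {x \<in> S. f x \<in> T}"
proof -
  have "continuous_on S f" by (rule cd_continuous_on[OF openin_imp_subset[OF S] f(1)])
  then have "openin (top_of_set S) (S \<inter> f -` T)"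
    using T f(2) by (auto intro: continuous_openin_preimage)
  moreover have "S \<inter> f -` T = {x \<in> S. f x \<in> T}" by auto
  ultimately show ?thesis using openin_trans[OF _ S] by simp
qed

end

section \<open>The isotropy group near the identity\<close>

lemma complete_kernel:
  assumes V: "csubspace V" "complete V" and L: "clinear_on V L" "\<And>v. v \<in> V \<Longrightarrow> norm (L v) \<le> K * norm v"
  shows "csubspace {v \<in> V. L v = 0}" "complete {v \<in> V. L v = 0}"
proof -
  show "csubspace {v \<in> V. L v = 0}"
    using V(1) clinear_onD[OF L(1) V(1)] by (auto simp: csubspace_def)
  have "continuous_on V L"
    by (rule canalytic_on_imp_continuous_on[OF _ V(1) order_refl])
      (auto simp: canalytic_on_def intro!: exI has_cderiv_within_linear[OF L(1) V(1) L(2)])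
  then have "closed (V \<inter> L -` {0})" by (rule continuous_closed_preimage) (auto intro: complete_imp_closed V)
  moreover have "V \<inter> L -` {0} = {v \<in> V. L v = 0}" by auto
  ultimately have "closed {v \<in> V. L v = 0}" by simp
  then have "complete (V \<inter> {v \<in> V. L v = 0})" by (rule complete_Int_closed[OF V(2)])
  moreover have "V \<inter> {v \<in> V. L v = 0} = {v \<in> V. L v = 0}" by auto
  ultimately show "complete {v \<in> V. L v = 0}" by simp
qed

text \<open>Each product of two factors changes by at most \<open>2 * \<epsilon> * \<delta>\<close>,
  the triple product by \<open>3 * \<epsilon> * \<delta>\<close> because
  \<open>\<epsilon> \<le> 1\<close>; three products of the first kind and one of the second give
  9.\<close>

lemma blinfun_triple_diff:
  fixes a b c a' b' c' :: "'a::real_normed_vector \<Rightarrow>\<^sub>L 'a"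
  assumes e: "0 \<le> \<epsilon>" "\<epsilon> \<le> 1" and n: "norm a \<le> \<epsilon>" "norm b \<le> \<epsilon>" "norm c \<le> \<epsilon>" "norm a' \<le> \<epsilon>" "norm b' \<le> \<epsilon>" "norm c' \<le> \<epsilon>"
    and d: "norm (a - a') \<le> \<delta>" "norm (b - b') \<le> \<delta>" "norm (c - c') \<le> \<delta>"
  shows "norm (((a o\<^sub>L b) + (a o\<^sub>L c) + (b o\<^sub>L c) + (a o\<^sub>L (b o\<^sub>L c))) - ((a' o\<^sub>L b') + (a' o\<^sub>L c') + (b' o\<^sub>L c') + (a' o\<^sub>L (b' o\<^sub>L c')))) \<le> 9 * \<epsilon> * \<delta>"
proof -
  have d0: "0 \<le> \<delta>" using d(1) norm_ge_zero order_trans by blast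
  have pair: "norm ((u o\<^sub>L v) - (u' o\<^sub>L v')) \<le> 2 * \<epsilon> * \<delta>"
    if "norm u \<le> \<epsilon>" "norm v' \<le> \<epsilon>" "norm (u - u') \<le> \<delta>" "norm (v - v') \<le> \<delta>" for u v u' v' :: "'a \<Rightarrow>\<^sub>L 'a"
  proof -
    have "(u o\<^sub>L v) - (u' o\<^sub>L v') = (u o\<^sub>L (v - v')) + ((u - u') o\<^sub>L v')"
      by (simp add: compose.diff_left compose.diff_right)
    also have "norm \<dots> \<le> norm u * norm (v - v') + norm (u - u') * norm v'"
      by (intro order_trans[OF norm_triangle_ineq] add_mono norm_blinfun_compose)
    also have "\<dots> \<le> \<epsilon> * \<delta> + \<delta> * \<epsilon>" using that e d0 by (intro add_mono mult_mono) auto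
    finally show ?thesis by (simp add: algebra_simps)
  qed
  have p1: "norm ((a o\<^sub>L b) - (a' o\<^sub>L b')) \<le> 2 * \<epsilon> * \<delta>" and p2: "norm ((a o\<^sub>L c) - (a' o\<^sub>L c')) \<le> 2 * \<epsilon> * \<delta>"
    and p3: "norm ((b o\<^sub>L c) - (b' o\<^sub>L c')) \<le> 2 * \<epsilon> * \<delta>" using n d by (auto intro: pair)
  have "(a o\<^sub>L (b o\<^sub>L c)) - (a' o\<^sub>L (b' o\<^sub>L c')) = (a o\<^sub>L ((b o\<^sub>L c) - (b' o\<^sub>L c'))) + ((a - a') o\<^sub>L (b' o\<^sub>L c'))"
    by (simp add: compose.diff_left compose.diff_right)
  also have "norm \<dots> \<le> norm a * norm ((b o\<^sub>L c) - (b' o\<^sub>L c')) + norm (a - a') * norm (b' o\<^sub>L c')"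
    by (intro order_trans[OF norm_triangle_ineq] add_mono norm_blinfun_compose)
  also have "\<dots> \<le> 1 * (2 * \<epsilon> * \<delta>) + \<delta> * (\<epsilon> * 1)"
  proof (intro add_mono mult_mono)
    have "norm (b' o\<^sub>L c') \<le> norm b' * norm c'" by (rule norm_blinfun_compose)
    also have "\<dots> \<le> \<epsilon> * 1" using n e by (intro mult_mono) auto
    finally show "norm (b' o\<^sub>L c') \<le> \<epsilon> * 1" .
  qed (use n d e d0 p3 in auto)
  finally have p4: "norm ((a o\<^sub>L (b o\<^sub>L c)) - (a' o\<^sub>L (b' o\<^sub>L c'))) \<le> 3 * \<epsilon> * \<delta>" by (simp add: mult_ac)
  have "((a o\<^sub>L b) + (a o\<^sub>L c) + (b o\<^sub>L c) + (a o\<^sub>L (b o\<^sub>L c))) - ((a' o\<^sub>L b') + (a' o\<^sub>L c') + (b' o\<^sub>L c') + (a' o\<^sub>L (b' o\<^sub>L c')))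
    = (((a o\<^sub>L b) - (a' o\<^sub>L b')) + ((a o\<^sub>L c) - (a' o\<^sub>L c'))) + (((b o\<^sub>L c) - (b' o\<^sub>L c')) + ((a o\<^sub>L (b o\<^sub>L c)) - (a' o\<^sub>L (b' o\<^sub>L c'))))"
    by simp
  also have "norm \<dots> \<le> (norm ((a o\<^sub>L b) - (a' o\<^sub>L b')) + norm ((a o\<^sub>L c) - (a' o\<^sub>L c'))) + (norm ((b o\<^sub>L c) - (b' o\<^sub>L c')) + norm ((a o\<^sub>L (b o\<^sub>L c)) - (a' o\<^sub>L (b' o\<^sub>L c'))))"
    by (intro order_trans[OF norm_triangle_ineq] add_mono norm_triangle_ineq)
  also have "\<dots> \<le> 9 * \<epsilon> * \<delta>" using p1 p2 p3 p4 by simp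
  finally show ?thesis .
qed

locale complemented_cond_exp = cond_exp M N E
  for M N :: "'h::chilbert_space op set" and E +
  fixes P :: "'h op \<Rightarrow> 'h op"
  assumes P_in: "\<And>x. x \<in> M \<Longrightarrow> P x \<in> centralizer" and P_fix: "\<And>c. c \<in> centralizer \<Longrightarrow> P c = c"
    and P_lin: "clinear_on M P" and P_norm: "\<And>x. x \<in> M \<Longrightarrow> norm (P x) \<le> norm x"
begin

abbreviation "Gr \<equiv> M.Gr"
abbreviation "gi \<equiv> M.gi"
abbreviation "cd \<equiv> M.cd"

lemma MI [simp]:
  shows "x \<in> M \<Longrightarrow> y \<in> M \<Longrightarrow> x + y \<in> M" "x \<in> M \<Longrightarrow> y \<in> M \<Longrightarrow> x - y \<in> M"
    "x \<in> M \<Longrightarrow> y \<in> M \<Longrightarrow> x o\<^sub>L y \<in> M" "id_blinfun \<in> M" "0 \<in> M" "x \<in> M \<Longrightarrow> c *\<^sub>C x \<in> M"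
  using csubspaceD[OF M.csub] M.compose_in M.id_in by auto

section \<open>Elements of the isotropy group and fibres of the orbit map\<close>

abbreviation "Iso \<equiv> carrier (isotropy_group M E)"
abbreviation Pi where "Pi g \<equiv> similarity M g E"

lemma Iso_iff: "g \<in> Iso \<longleftrightarrow> g \<in> Gr \<and> Pi g = E"
  by (simp add: isotropy_group_def)

lemma Iso_Gr: "g \<in> Iso \<Longrightarrow> g \<in> Gr" by (simp add: Iso_iff)

lemma similarity_compose:
  assumes g: "g \<in> Gr" and h: "h \<in> Gr"
  shows "Pi (g o\<^sub>L h) = similarity M g (Pi h)"
  using M.Gr_M[OF g] M.Gr_M[OF M.Gr_gi[OF g]]
  by (auto simp: similarity_def fun_eq_iff restrict_def M.gi_compose[OF g h] blinfun_compose_assoc)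

lemma similarity_id: "Pi id_blinfun = E"
proof
  fix x show "Pi id_blinfun x = E x"
    using E_ext by (cases "x \<in> M") (simp_all add: similarity_def M.gi_id extensional_def)
qed

lemma similarity_inverse:
  assumes g: "g \<in> Gr" shows "similarity M (gi g) (Pi g) = E"
  using similarity_compose[OF M.Gr_gi[OF g] g] M.gi_left[OF g] similarity_id by simp

lemma Pi_eq_iff:
  assumes g: "g \<in> Gr" and h: "h \<in> Gr"
  shows "Pi g = Pi h \<longleftrightarrow> gi g o\<^sub>L h \<in> Iso"
proof
  assume "Pi g = Pi h"
  then have "Pi (gi g o\<^sub>L h) = E" using similarity_compose[OF M.Gr_gi[OF g] h] similarity_inverse[OF g] by simp
  then show "gi g o\<^sub>L h \<in> Iso" by (simp add: Iso_iff g h M.Gr_gi M.Gr_compose)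
next
  assume k: "gi g o\<^sub>L h \<in> Iso"
  have "Pi (g o\<^sub>L (gi g o\<^sub>L h)) = similarity M g (Pi (gi g o\<^sub>L h))"
    by (rule similarity_compose[OF g Iso_Gr[OF k]])
  then show "Pi g = Pi h" using k by (simp add: M.gi_right'[OF g] Iso_iff)
qed

lemma Pi_Iso: "g \<in> Gr \<Longrightarrow> k \<in> Iso \<Longrightarrow> Pi (g o\<^sub>L k) = Pi g"
  using similarity_compose[of g k] by (simp add: Iso_iff)

lemma Iso_rules:
  shows Iso_id: "id_blinfun \<in> Iso" and Iso_compose: "g \<in> Iso \<Longrightarrow> h \<in> Iso \<Longrightarrow> g o\<^sub>L h \<in> Iso"
    and Iso_gi: "g \<in> Iso \<Longrightarrow> gi g \<in> Iso"
proof -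
  show "id_blinfun \<in> Iso" by (simp add: Iso_iff M.Gr_id similarity_id)
  show "g \<in> Iso \<Longrightarrow> h \<in> Iso \<Longrightarrow> g o\<^sub>L h \<in> Iso" using Pi_Iso[of g h] by (simp add: Iso_iff M.Gr_compose)
  show "g \<in> Iso \<Longrightarrow> gi g \<in> Iso" using similarity_inverse[of g] by (simp add: Iso_iff M.Gr_gi)
qed

lemma IsoI:
  assumes g: "g \<in> Gr" and eq: "\<And>x. x \<in> M \<Longrightarrow> g o\<^sub>L E (gi g o\<^sub>L x o\<^sub>L g) o\<^sub>L gi g = E x"
  shows "g \<in> Iso"
  using g eq E_ext by (auto simp: Iso_iff similarity_def restrict_def fun_eq_iff extensional_def)

lemma IsoD:
  assumes "g \<in> Iso" "x \<in> M" shows "g o\<^sub>L E (gi g o\<^sub>L x o\<^sub>L g) o\<^sub>L gi g = E x"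
proof -
  have "Pi g x = E x" using assms(1) by (simp add: Iso_iff)
  then show ?thesis using assms(2) by (simp add: similarity_def)
qed

lemma gi_N: "a \<in> N \<Longrightarrow> a \<in> Gr \<Longrightarrow> gi a \<in> N"
  using N.inverse_in M.gi_left M.gi_right by blast

lemma N_Iso: assumes a: "a \<in> N" "a \<in> Gr" shows "a \<in> Iso"
proof (rule IsoI[OF a(2)])
  fix x assume "x \<in> M"
  then show "a o\<^sub>L E (gi a o\<^sub>L x o\<^sub>L a) o\<^sub>L gi a = E x"
    using E_bimod[OF gi_N[OF a] a(1)] a by (simp add: blinfun_compose_assoc M.gi_right' M.gi_right)
qed

text \<open>Conjugation by \<open>c\<close> is invisible to \<open>E\<close> by the trace identity,
  and \<open>c\<close> commutes with the value of \<open>E\<close>, which lies in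
  \<open>N\<close>.\<close>

lemma centralizer_Iso: assumes c: "c \<in> centralizer" "c \<in> Gr" shows "c \<in> Iso"
proof (rule IsoI[OF c(2)])
  fix x assume x: "x \<in> M"
  have "gi c o\<^sub>L x \<in> M" using x M.Gr_M[OF M.Gr_gi[OF c(2)]] by simp
  then have "E (gi c o\<^sub>L x o\<^sub>L c) = E (c o\<^sub>L (gi c o\<^sub>L x))" using centralizer_E[OF c(1)] by simp
  also have "\<dots> = E x" using c by (simp add: M.gi_right')
  finally have "c o\<^sub>L E (gi c o\<^sub>L x o\<^sub>L c) = E x o\<^sub>L c" using centralizer_comm[OF c(1) E_in[OF x]] by simp
  then show "c o\<^sub>L E (gi c o\<^sub>L x o\<^sub>L c) o\<^sub>L gi c = E x" using c by (simp add: blinfun_compose_assoc M.gi_right)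
qed

text \<open>For \<open>a \<in> N\<close>, \<open>k a = \<theta>(a) k\<close> with \<open>\<theta>(a) \<in> N\<close> implies \<open>E(k) a = \<theta>(a) E(k)\<close>.\<close>

lemma Iso_centralizer:
  assumes k: "k \<in> Iso" and Ek: "E k \<in> Gr" shows "gi (E k) o\<^sub>L k \<in> centralizer"
proof -
  note kG = Iso_Gr[OF k] and kM = M.Gr_M[OF Iso_Gr[OF k]]
  have EN: "E k \<in> N" "gi (E k) \<in> N" using E_in[OF kM] gi_N[OF _ Ek] by auto
  let ?c = "gi (E k) o\<^sub>L k"
  have cI: "?c \<in> Iso" by (rule Iso_compose[OF Iso_gi[OF N_Iso[OF EN(1) Ek]] k])
  note cG = Iso_Gr[OF cI] and cM = M.Gr_M[OF Iso_Gr[OF cI]]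
  have kinv: "gi k \<in> M" using M.Gr_M[OF M.Gr_gi[OF kG]] .
  have comm: "?c o\<^sub>L a = a o\<^sub>L ?c" if a: "a \<in> N" for a
  proof -
    define \<theta> where "\<theta> = k o\<^sub>L a o\<^sub>L gi k"
    have \<theta>M: "\<theta> \<in> M" using a NM kM kinv by (simp add: \<theta>_def)
    have "gi k o\<^sub>L \<theta> o\<^sub>L k = a" using kG by (simp add: \<theta>_def blinfun_compose_assoc M.gi_left' M.gi_left)
    then have "\<theta> = E \<theta>" using IsoD[OF k \<theta>M] E_fix[OF a] by (simp add: \<theta>_def)
    then have \<theta>N: "\<theta> \<in> N" using E_in[OF \<theta>M] by simp
    have ka: "k o\<^sub>L a = \<theta> o\<^sub>L k" using kG by (simp add: \<theta>_def blinfun_compose_assoc M.gi_left)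
    then have "E k o\<^sub>L a = \<theta> o\<^sub>L E k" using E_right[OF a kM] E_left[OF \<theta>N kM] by simp
    then have "a o\<^sub>L gi (E k) = gi (E k) o\<^sub>L \<theta>" using Ek
      by (metis M.gi_left' M.gi_right blinfun_compose_assoc blinfun_compose_id(2))
    then show ?thesis using ka by (metis blinfun_compose_assoc)
  qed
  have "E (?c o\<^sub>L x) = E (x o\<^sub>L ?c)" if x: "x \<in> M" for x
  proof -
    have cx: "?c o\<^sub>L x \<in> M" using cM x by simp
    have "E (?c o\<^sub>L x) = ?c o\<^sub>L E (gi ?c o\<^sub>L (?c o\<^sub>L x) o\<^sub>L ?c) o\<^sub>L gi ?c" by (rule IsoD[OF cI cx, symmetric])
    also have "gi ?c o\<^sub>L (?c o\<^sub>L x) o\<^sub>L ?c = x o\<^sub>L ?c" using M.gi_left'[OF cG, of x] by simp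
    also have "?c o\<^sub>L E (x o\<^sub>L ?c) = E (x o\<^sub>L ?c) o\<^sub>L ?c" by (rule comm) (rule E_in, use cM x in simp)
    finally show ?thesis using M.gi_right[OF cG] by (simp add: blinfun_compose_assoc)
  qed
  then show ?thesis using cM comm by (simp add: centralizer_def)
qed

subsection \<open>The splitting of \<open>M\<close>\<close>

text \<open>The identity lies in both \<open>N\<close> and the centralizer, so adding
  \<open>E\<close> and \<open>P\<close> would count the overlap twice. Removing \<open>E w\<close>
  first makes \<open>Q\<close> the identity on the sum of the two spaces, which is the set
  \<open>W\<close> below.\<close>

definition Q where "Q w = E w + P (w - E w)"
definition W where "W = {w \<in> M. w - E w \<in> centralizer}"
definition Z where "Z = {z \<in> M. Q z = 0}"

text \<open>\<open>E c\<close> commutes with \<open>N\<close> and lies in it, so it is central there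
  and the trace identity follows from the bimodule property. As a consequence \<open>W\<close>
  contains \<open>N\<close> and the centralizer, and \<open>Q\<close> maps into it.\<close>

lemma E_centralizer: assumes c: "c \<in> centralizer" shows "E c \<in> centralizer"
proof -
  note cM = centralizer_M[OF c]
  have comm: "E c o\<^sub>L a = a o\<^sub>L E c" if a: "a \<in> N" for a
    using E_left[OF a cM] E_right[OF a cM] centralizer_comm[OF c a] by simp
  then have "E (E c o\<^sub>L x) = E (x o\<^sub>L E c)" if "x \<in> M" for x
    using E_left[OF E_in[OF cM] that] E_right[OF E_in[OF cM] that] E_in[OF that] by simp
  with comm show ?thesis using E_in_M[OF cM] by (simp add: centralizer_def)
qed

lemma Q_M: "w \<in> M \<Longrightarrow> Q w \<in> M" using E_in_M P_in centralizer_M by (simp add: Q_def)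

lemma Q_W: assumes w: "w \<in> M" shows "Q w \<in> W"
proof -
  have d: "w - E w \<in> M" using w E_in_M by simp
  have c: "P (w - E w) \<in> centralizer" by (rule P_in[OF d])
  have "E (Q w) = E w + E (P (w - E w))"
    unfolding Q_def using E_simps(1)[OF E_in_M[OF w] centralizer_M[OF c]] E_fix[OF E_in[OF w]] by simp
  then have "Q w - E (Q w) = P (w - E w) - E (P (w - E w))" by (simp add: Q_def)
  then show ?thesis
    using csubspace_diff[OF csubspace_centralizer c E_centralizer[OF c]] Q_M[OF w] by (simp add: W_def)
qed

lemma W_M: "w \<in> W \<Longrightarrow> w \<in> M" by (simp add: W_def)
lemma Z_M: "z \<in> Z \<Longrightarrow> z \<in> M" by (simp add: Z_def)

lemma Q_fix: "w \<in> W \<Longrightarrow> Q w = w" using P_fix by (simp add: W_def Q_def)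

lemma Q_lin: "clinear_on M Q"
  unfolding clinear_on_def
proof (intro conjI ballI allI)
  fix x y assume x: "x \<in> M" and y: "y \<in> M"
  have "P (x + y - E (x + y)) = P ((x - E x) + (y - E y))" using E_simps(1)[OF x y] by (simp add: algebra_simps)
  also have "\<dots> = P (x - E x) + P (y - E y)" by (rule clinear_on_add[OF P_lin M.csub]) (use x y E_in_M in auto)
  finally show "Q (x + y) = Q x + Q y" using E_simps(1)[OF x y] by (simp add: Q_def)
next
  fix c x assume x: "x \<in> M"
  have "P (c *\<^sub>C x - E (c *\<^sub>C x)) = P (c *\<^sub>C (x - E x))" using E_simps(2)[OF x] by (simp add: scaleC_diff_right)
  also have "\<dots> = c *\<^sub>C P (x - E x)" by (rule clinear_on_scaleC[OF P_lin M.csub]) (use x E_in_M in auto)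
  finally show "Q (c *\<^sub>C x) = c *\<^sub>C Q x" using E_simps(2)[OF x] by (simp add: Q_def scaleC_add_right)
qed

lemmas Q_simps = clinear_onD[OF Q_lin M.csub]

lemma Q_norm: assumes w: "w \<in> M" shows "norm (Q w) \<le> 3 * norm w"
proof -
  have "norm (Q w) \<le> norm (E w) + norm (P (w - E w))" unfolding Q_def by (rule norm_triangle_ineq)
  also have "\<dots> \<le> norm (E w) + norm (w - E w)" using P_norm w E_in_M by simp
  also have "\<dots> \<le> norm (E w) + (norm w + norm (E w))" by (intro add_left_mono norm_triangle_ineq4)
  finally show ?thesis using norm_E_le[OF w] by simp
qed

lemma R_lin: "clinear_on M (\<lambda>w. w - Q w)"
  using Q_simps by (simp add: clinear_on_def scaleC_diff_right)

lemma R_norm: "w \<in> M \<Longrightarrow> norm (w - Q w) \<le> 4 * norm w"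
  using Q_norm[of w] norm_triangle_ineq4[of w "Q w"] by simp

lemma R_Z: "w \<in> M \<Longrightarrow> w - Q w \<in> Z"
  using Q_simps(5)[of w "Q w"] Q_M Q_fix[OF Q_W] by (simp add: Z_def)

lemma W_eq: "W = {w \<in> M. w - Q w = 0}"
proof
  show "W \<subseteq> {w \<in> M. w - Q w = 0}" using Q_fix by (auto simp: W_def)
  show "{w \<in> M. w - Q w = 0} \<subseteq> W"
  proof
    fix w assume "w \<in> {w \<in> M. w - Q w = 0}"
    then have "w \<in> M" "Q w = w" by auto
    with Q_W[of w] show "w \<in> W" by simp
  qed
qed

lemma Z_props: "csubspace Z" "complete Z" and W_props: "csubspace W" "complete W"
  unfolding Z_def W_eq using complete_kernel[OF M.csub M.complete Q_lin Q_norm] complete_kernel[OF M.csub M.complete R_lin R_norm] by auto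

lemma complemented_W: "complemented_subspace M W"
  unfolding complemented_subspace_def
proof (intro conjI exI[of _ Z] W_props Z_props)
  show "W \<inter> Z = {0}" using csubspace_0[OF W_props(1)] csubspace_0[OF Z_props(1)] Q_fix by (auto simp: Z_def)
  show "M = {w + z |w z. w \<in> W \<and> z \<in> Z}"
  proof
    show "M \<subseteq> {w + z |w z. w \<in> W \<and> z \<in> Z}"
    proof
      fix x assume x: "x \<in> M"
      have "x = Q x + (x - Q x)" by simp
      then show "x \<in> {w + z |w z. w \<in> W \<and> z \<in> Z}" using Q_W[OF x] R_Z[OF x] by blast
    qed
    show "{w + z |w z. w \<in> W \<and> z \<in> Z} \<subseteq> M" using W_M Z_M by auto
  qed
qed

lemma id_W: "id_blinfun \<in> W" by (simp add: W_def E_id csubspace_0[OF csubspace_centralizer])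
lemma Q_id: "Q id_blinfun = id_blinfun" by (rule Q_fix[OF id_W])

subsection \<open>Coordinates adapted to the isotropy group\<close>

text \<open>The shift by the identity gives \<open>E (\<Phi> k) = E k\<close>, so both factors of
  \<open>k\<close> can be recovered from the sum \<open>w\<close>: they are \<open>E w\<close> and
  \<open>id_blinfun + w - E w\<close>. The inverse \<open>\<Psi>\<close> multiplies them.\<close>

definition \<Phi> where "\<Phi> k = E k + (gi (E k) o\<^sub>L k) - id_blinfun"
definition \<Psi> where "\<Psi> w = E w o\<^sub>L (id_blinfun + w - E w)"

lemma \<Psi>_M: "w \<in> M \<Longrightarrow> \<Psi> w \<in> M" using E_in_M by (simp add: \<Psi>_def)

lemma \<Phi>_props:
  assumes k: "k \<in> M" "E k \<in> Gr"
  shows \<Phi>_M: "\<Phi> k \<in> M" and E_\<Phi>: "E (\<Phi> k) = E k" and \<Psi>_\<Phi>: "\<Psi> (\<Phi> k) = k"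
    and \<Phi>_rest: "id_blinfun + \<Phi> k - E (\<Phi> k) = gi (E k) o\<^sub>L k"
proof -
  have N: "gi (E k) \<in> N" by (rule gi_N[OF E_in[OF k(1)] k(2)])
  have ck: "gi (E k) o\<^sub>L k \<in> M" using NM[OF N] k by simp
  show "\<Phi> k \<in> M" using E_in_M[OF k(1)] ck by (simp add: \<Phi>_def)
  have "E (\<Phi> k) = (E (E k) + E (gi (E k) o\<^sub>L k)) - E id_blinfun"
    unfolding \<Phi>_def using E_in_M[OF k(1)] ck by (simp add: E_simps(1) E_simps(5))
  also have "\<dots> = E k" using E_left[OF N k(1)] M.gi_left[OF k(2)] by (simp add: E_fix[OF E_in[OF k(1)]] E_id)
  finally show *: "E (\<Phi> k) = E k" .
  show r: "id_blinfun + \<Phi> k - E (\<Phi> k) = gi (E k) o\<^sub>L k" unfolding * by (simp add: \<Phi>_def)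
  show "\<Psi> (\<Phi> k) = k" unfolding \<Psi>_def r unfolding * by (rule M.gi_right'[OF k(2)])
qed

lemma \<Psi>_props:
  assumes w: "w \<in> M" "E w \<in> Gr"
  shows E_\<Psi>: "E (\<Psi> w) = E w" and \<Phi>_\<Psi>: "\<Phi> (\<Psi> w) = w"
proof -
  have r: "id_blinfun + w - E w \<in> M" using w E_in_M by simp
  have "E (\<Psi> w) = E w o\<^sub>L E (id_blinfun + w - E w)" unfolding \<Psi>_def by (rule E_left[OF E_in[OF w(1)] r])
  also have "E (id_blinfun + w - E w) = id_blinfun"
    using w E_in_M[OF w(1)] by (simp add: E_simps(1) E_simps(5) E_id E_fix[OF E_in[OF w(1)]])
  finally show *: "E (\<Psi> w) = E w" by simp
  show "\<Phi> (\<Psi> w) = w" unfolding \<Phi>_def * unfolding \<Psi>_def by (simp add: M.gi_left'[OF w(2)])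
qed

text \<open>\<open>\<Phi> k - E (\<Phi> k)\<close> is \<open>gi (E k) o\<^sub>L k\<close> minus the
  identity, and the identity belongs to the centralizer; so membership in \<open>W\<close> says that
  the second factor of \<open>k\<close> lies in the centralizer.\<close>

lemma \<Phi>_W_iff: assumes k: "k \<in> Gr" "E k \<in> Gr" shows "\<Phi> k \<in> W \<longleftrightarrow> k \<in> Iso"
proof -
  note kM = M.Gr_M[OF k(1)]
  note rest = \<Phi>_rest[OF kM k(2)]
  have eq: "\<Phi> k - E (\<Phi> k) = (gi (E k) o\<^sub>L k) - id_blinfun" unfolding rest[symmetric] by simp
  show ?thesis
  proof
    assume "\<Phi> k \<in> W"
    then have "(gi (E k) o\<^sub>L k) - id_blinfun \<in> centralizer" by (simp add: W_def eq)
    from csubspace_add[OF csubspace_centralizer this id_centralizer]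
    have c: "gi (E k) o\<^sub>L k \<in> centralizer" by simp
    have "E k o\<^sub>L (gi (E k) o\<^sub>L k) \<in> Iso"
      by (intro Iso_compose N_Iso E_in kM k centralizer_Iso[OF c] M.Gr_compose M.Gr_gi)
    then show "k \<in> Iso" by (simp add: M.gi_right'[OF k(2)])
  next
    assume "k \<in> Iso"
    from csubspace_diff[OF csubspace_centralizer Iso_centralizer[OF this k(2)] id_centralizer]
    show "\<Phi> k \<in> W" using \<Phi>_M[OF kM k(2)] by (simp add: W_def eq)
  qed
qed

lemma cd_E: "x \<in> M \<Longrightarrow> cd E x" by (rule M.cd_linear[OF E_lin, of 1]) (use norm_E_le in auto)
lemma cd_Q: "x \<in> M \<Longrightarrow> cd Q x" by (rule M.cd_linear[OF Q_lin Q_norm])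

lemma cd_\<Psi>: assumes w: "w \<in> M" shows "cd \<Psi> w"
  unfolding \<Psi>_def[abs_def]
  by (intro M.cd_compose M.cd_diff M.cd_add M.cd_const M.cd_id cd_E w E_in_M)

lemma \<Omega>_open: "openin (top_of_set M) {k \<in> M. E k \<in> Gr}"
  by (rule M.cd_open_preimage[OF _ M.open_Gr]) (use cd_E E_in_M in auto)

lemma cd_\<Phi>: assumes k: "k \<in> M" "E k \<in> Gr" shows "cd \<Phi> k"
proof -
  obtain d where d: "d > 0" "\<And>y. y \<in> M \<Longrightarrow> dist y k < d \<Longrightarrow> y \<in> {k \<in> M. E k \<in> Gr}"
    using \<Omega>_open k unfolding openin_euclidean_subtopology_iff by blast
  have g: "cd (\<lambda>y. gi (E y)) k"
    by (rule M.cd_chain[OF k(1) cd_E[OF k(1)] M.cd_gi[OF k(2)] zero_less_one]) (rule E_in_M)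
  have "cd (\<lambda>y. E y + (gi (E y) o\<^sub>L y)) k"
    by (intro M.cd_add M.cd_compose cd_E g M.cd_id k M.Gr_M[OF M.Gr_gi[OF k(2)]])
  from M.cd_diff[OF k(1) this M.cd_const[of id_blinfun]] show ?thesis by (simp add: \<Phi>_def[abs_def])
qed

subsection \<open>The product map and its local inverse\<close>

definition F where "F w = (id_blinfun + (w - Q w)) o\<^sub>L \<Psi> (Q w)"

lemma F_M: "w \<in> M \<Longrightarrow> F w \<in> M" using Q_M \<Psi>_M by (simp add: F_def)

lemma cd_F: assumes w: "w \<in> M" shows "cd F w"
proof -
  have 1: "cd (\<lambda>w. \<Psi> (Q w)) w"
    by (rule M.cd_chain[OF w cd_Q[OF w] cd_\<Psi>[OF Q_M[OF w]] zero_less_one]) (rule Q_M)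
  have 2: "cd (\<lambda>w. id_blinfun + (w - Q w)) w" by (intro M.cd_add M.cd_const M.cd_diff M.cd_id cd_Q w Q_M)
  show ?thesis unfolding F_def[abs_def] by (rule M.cd_compose[OF w _ 2 1]) (use w Q_M in simp)
qed

text \<open>Expanding the triple product shows that \<open>F w - w\<close> consists of terms of order at least two
  in \<open>w - 1\<close>.\<close>

lemma F_expand:
  assumes w: "w \<in> M"
  defines "a \<equiv> w - Q w" and "b \<equiv> E (Q w) - id_blinfun" and "c \<equiv> Q w - E (Q w)"
  shows "F w - w = (a o\<^sub>L b) + (a o\<^sub>L c) + (b o\<^sub>L c) + (a o\<^sub>L (b o\<^sub>L c))"
proof -
  have "F w = (id_blinfun + a) o\<^sub>L ((id_blinfun + b) o\<^sub>L (id_blinfun + c))"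
    by (simp add: F_def \<Psi>_def a_def b_def c_def algebra_simps)
  moreover have "w = id_blinfun + a + b + c" by (simp add: a_def b_def c_def)
  ultimately show ?thesis by (simp add: compose.add_left compose.add_right)
qed

text \<open>\<open>Q\<close> has norm at most 3 and \<open>E\<close> at most 1, so the three linear
  parts have norms at most 4, 3 and 6. The shifted parts all vanish at the identity, which makes the
  first three estimates Lipschitz estimates against that point.\<close>

lemma parts_norm:
  assumes w: "w \<in> M"
  shows "norm (w - Q w) \<le> 6 * norm (w - id_blinfun)" "norm (E (Q w) - id_blinfun) \<le> 6 * norm (w - id_blinfun)"
    "norm (Q w - E (Q w)) \<le> 6 * norm (w - id_blinfun)"
    and parts_lip: "w' \<in> M \<Longrightarrow> norm ((w - Q w) - (w' - Q w')) \<le> 6 * norm (w - w')"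
      "w' \<in> M \<Longrightarrow> norm ((E (Q w) - id_blinfun) - (E (Q w') - id_blinfun)) \<le> 6 * norm (w - w')"
      "w' \<in> M \<Longrightarrow> norm ((Q w - E (Q w)) - (Q w' - E (Q w'))) \<le> 6 * norm (w - w')"
proof -
  have *: "norm ((w - Q w) - (v - Q v)) \<le> 6 * norm (w - v) \<and> norm (E (Q w) - E (Q v)) \<le> 6 * norm (w - v) \<and>
      norm ((Q w - E (Q w)) - (Q v - E (Q v))) \<le> 6 * norm (w - v)" if v: "v \<in> M" for v
  proof (intro conjI)
    have d: "w - v \<in> M" using w v by simp
    have q: "norm (Q (w - v)) \<le> 3 * norm (w - v)" by (rule Q_norm[OF d])
    have e: "norm (E (Q (w - v))) \<le> 3 * norm (w - v)" using norm_E_le[OF Q_M[OF d]] q by linarith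
    have Qd: "Q (w - v) = Q w - Q v" and Ed: "E (Q (w - v)) = E (Q w) - E (Q v)"
      using Q_simps(5)[OF w v] E_simps(5)[OF Q_M[OF w] Q_M[OF v]] by auto
    have n: "0 \<le> norm (w - v)" by simp
    have "(w - Q w) - (v - Q v) = (w - v) - Q (w - v)" by (simp add: Qd)
    also have "norm \<dots> \<le> 4 * norm (w - v)" by (rule R_norm[OF d])
    finally show "norm ((w - Q w) - (v - Q v)) \<le> 6 * norm (w - v)" using n by linarith
    show "norm (E (Q w) - E (Q v)) \<le> 6 * norm (w - v)" using e n unfolding Ed[symmetric] by linarith
    have "(Q w - E (Q w)) - (Q v - E (Q v)) = Q (w - v) - E (Q (w - v))" unfolding Ed unfolding Qd by (simp add: algebra_simps)
    also have "norm \<dots> \<le> norm (Q (w - v)) + norm (E (Q (w - v)))" by (rule norm_triangle_ineq4)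
    finally show "norm ((Q w - E (Q w)) - (Q v - E (Q v))) \<le> 6 * norm (w - v)" using q e by linarith
  qed
  show "norm (w - Q w) \<le> 6 * norm (w - id_blinfun)" "norm (E (Q w) - id_blinfun) \<le> 6 * norm (w - id_blinfun)"
    "norm (Q w - E (Q w)) \<le> 6 * norm (w - id_blinfun)"
    using *[OF M.id_in] by (simp_all add: Q_id E_id)
  show "w' \<in> M \<Longrightarrow> norm ((w - Q w) - (w' - Q w')) \<le> 6 * norm (w - w')"
      "w' \<in> M \<Longrightarrow> norm ((E (Q w) - id_blinfun) - (E (Q w') - id_blinfun)) \<le> 6 * norm (w - w')"
      "w' \<in> M \<Longrightarrow> norm ((Q w - E (Q w)) - (Q w' - E (Q w'))) \<le> 6 * norm (w - w')"
    using * by simp_all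
qed

text \<open>With \<open>\<epsilon> = 6 * \<rho>\<close> and
  \<open>\<delta> = 6 * norm (w - v)\<close> the constant is 9 times 36. The upper bound on
  \<open>\<rho>\<close> is the condition \<open>\<epsilon> \<le> 1\<close>.\<close>

lemma F_lip:
  assumes \<rho>: "0 \<le> \<rho>" "\<rho> \<le> 1/6" and w: "w \<in> M" "norm (w - id_blinfun) \<le> \<rho>" and v: "v \<in> M" "norm (v - id_blinfun) \<le> \<rho>"
  shows "norm ((F w - w) - (F v - v)) \<le> 324 * \<rho> * norm (w - v)"
proof -
  have "norm ((F w - w) - (F v - v)) \<le> 9 * (6 * \<rho>) * (6 * norm (w - v))"
    unfolding F_expand[OF w(1)] F_expand[OF v(1)]
    by (rule blinfun_triple_diff) (use \<rho> w v parts_norm[OF w(1)] parts_norm[OF v(1)] parts_lip[OF w(1) v(1)] in linarith)+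
  then show ?thesis by simp
qed

text \<open>The radius makes 0.324 a Lipschitz constant of \<open>F - id\<close>, below the required
  one half.\<close>

sublocale near_identity M F id_blinfun "1/1000"
proof
  show "csubspace M" "complete M" "id_blinfun \<in> M" "(1/1000 :: real) > 0" by (simp_all add: M.csub M.complete)
  show "x \<in> M \<Longrightarrow> F x \<in> M" for x by (rule F_M)
  fix x y assume "x \<in> M \<inter> ball id_blinfun (1/1000)" "y \<in> M \<inter> ball id_blinfun (1/1000)"
  then have xy: "x \<in> M" "norm (x - id_blinfun) \<le> 1/1000" "y \<in> M" "norm (y - id_blinfun) \<le> 1/1000"
    by (auto simp: dist_norm norm_minus_commute)
  have "norm (F x - x - (F y - y)) \<le> 324 * (1/1000) * norm (x - y)" by (rule F_lip) (use xy in auto)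
  then show "norm (F x - x - (F y - y)) \<le> norm (x - y) / 2" using norm_ge_zero[of "x - y"] by linarith
qed

lemma F_id: "F id_blinfun = id_blinfun" by (simp add: F_def Q_id \<Psi>_def E_id)

text \<open>Taking \<open>\<rho>\<close> in the Lipschitz estimate to be the distance to the
  identity itself makes the error quadratic.\<close>

lemma F_deriv_id: "has_cderiv_within F (\<lambda>v. v) id_blinfun M"
  unfolding has_cderiv_within_iff[OF M.csub]
proof (intro conjI allI impI)
  show "clinear_on M (\<lambda>v. v)" by (simp add: clinear_on_def)
  show "\<exists>K. \<forall>v\<in>M. norm v \<le> K * norm v" by (intro exI[of _ 1]) simp
  fix e :: real assume e: "e > 0"
  show "\<exists>d>0. \<forall>y\<in>M. norm (y - id_blinfun) < d \<longrightarrow> norm (F y - F id_blinfun - (y - id_blinfun)) \<le> e * norm (y - id_blinfun)"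
  proof (intro exI[of _ "min (1/6) (e / 324)"] conjI ballI impI)
    fix y assume y: "y \<in> M" "norm (y - id_blinfun) < min (1/6) (e / 324)"
    let ?\<rho> = "norm (y - id_blinfun)"
    have "norm ((F y - y) - (F id_blinfun - id_blinfun)) \<le> 324 * ?\<rho> * ?\<rho>" by (rule F_lip) (use y in auto)
    also have "\<dots> \<le> e * ?\<rho>" using y by (intro mult_right_mono) auto
    finally show "norm (F y - F id_blinfun - (y - id_blinfun)) \<le> e * ?\<rho>" by (simp add: algebra_simps)
  qed (use e in auto)
qed

definition Fi where "Fi = inv_into B F"

lemma Fi_F: "w \<in> B \<Longrightarrow> Fi (F w) = w" unfolding Fi_def by (rule inv_into_f_f[OF inj])

lemma cd_Fi: assumes w: "w \<in> B" shows "cd Fi (F w)"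
proof -
  obtain D where "has_cderiv_within F D w M" using cd_F w unfolding M.cd_def by blast
  from inverse_deriv[OF w this] show ?thesis unfolding M.cd_def Fi_def by blast
qed

lemma Fi_deriv_id: obtains D where "has_cderiv_within Fi D id_blinfun M" "\<And>v. v \<in> M \<Longrightarrow> D v = v"
proof (rule inverse_deriv[OF _ F_deriv_id])
  fix D assume "has_cderiv_within (inv_into B F) D (F id_blinfun) M" "\<And>v. v \<in> M \<Longrightarrow> D v \<in> M \<and> D v = v"
  then show thesis using that[of D] by (simp add: F_id Fi_def)
qed simp

lemma B_iff: "w \<in> B \<longleftrightarrow> w \<in> M \<and> norm (w - id_blinfun) < 1/1000"
  unfolding Int_iff mem_ball dist_norm by (subst norm_minus_commute) (rule refl)

text \<open>In the ball all factors of \<open>F w\<close> are closer than 1 to the identity, hence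
  invertible; the two factors of \<open>\<Psi> (Q w)\<close> lie in \<open>N\<close> and in the
  centralizer, which puts their product into the isotropy group.\<close>

lemma B_parts:
  assumes w: "w \<in> B"
  shows B_left: "id_blinfun + (w - Q w) \<in> Gr" and B_right: "\<Psi> (Q w) \<in> Iso"
proof -
  have wM: "w \<in> M" "norm (w - id_blinfun) < 1/1000" using w unfolding B_iff by blast+
  note p = parts_norm[OF wM(1)]
  show "id_blinfun + (w - Q w) \<in> Gr"
    by (rule M.near_id_invertible) (use wM p Q_M in auto)
  have E: "E (Q w) \<in> Gr" by (rule M.near_id_invertible) (use wM p Q_M E_in_M in auto)
  have "id_blinfun + Q w - E (Q w) \<in> Gr"
    by (rule M.near_id_invertible) (use wM p Q_M E_in_M in \<open>auto simp: algebra_simps\<close>)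
  moreover have "id_blinfun + (Q w - E (Q w)) \<in> centralizer"
    using csubspace_add[OF csubspace_centralizer id_centralizer] Q_W[OF wM(1)] by (simp add: W_def)
  ultimately have "id_blinfun + Q w - E (Q w) \<in> Iso" by (intro centralizer_Iso) (simp_all add: algebra_simps)
  then show "\<Psi> (Q w) \<in> Iso" unfolding \<Psi>_def by (rule Iso_compose[OF N_Iso[OF E_in[OF Q_M[OF wM(1)]] E]])
qed

end

section \<open>Charts of the group and of the orbit\<close>

text \<open>Restricting a target chart changes only its domain, which differentiability at a point
  does not see.\<close>

lemma cdiff_at_target: "cdiff_at f c (U, \<psi>, V) x \<longleftrightarrow> cdiff_at f c (U', \<psi>, V') x"
  by (cases c) (simp add: cdiff_at_def)

lemma cdiff_at_open_source:
  assumes c: "chart_on X (U, \<phi>, V)" and S: "openin X S" "x \<in> U" "x \<in> S" and f: "cdiff_at f (U, \<phi>, V) d x"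
  shows "cdiff_at f (U \<inter> S, \<phi>, V) d x"
proof -
  have c': "chart_on X (U \<inter> S, \<phi>, V)" by (rule chart_on_open(1)[OF c S(1)])
  have "cdiff_at id (U \<inter> S, \<phi>, V) (U, \<phi>, V) x"
    by (rule cdiff_at_inclusion[OF c' _ chart_on_inj[OF c]]) (use S in auto)
  from cdiff_at_compose[OF c' c _ _ _ this, where g = f and e = d] S f show ?thesis by simp
qed

lemma cdiff_at_open_source_rev:
  assumes c: "chart_on X (U, \<phi>, V)" and S: "openin X S" "x \<in> U" "x \<in> S" and f: "cdiff_at f (U \<inter> S, \<phi>, V) d x"
  shows "cdiff_at f (U, \<phi>, V) d x"
proof -
  have c': "chart_on X (U \<inter> S, \<phi>, V)" by (rule chart_on_open(1)[OF c S(1)])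
  have "cdiff_at id (U, \<phi>, V) (U \<inter> S, \<phi>, V) x"
    using cdiff_at_id[OF c, of x] S(2) unfolding cdiff_at_target[of id _ U \<phi> V x "U \<inter> S" V] by simp
  from cdiff_at_compose[OF c c' _ _ _ this, where g = f and e = d] S f show ?thesis by simp
qed

context complemented_cond_exp
begin

abbreviation "GTop \<equiv> group_topology M"
abbreviation "c0 \<equiv> (Gr, id, M) :: ('h op, 'h op) chart"

lemma inv_into_id: "y \<in> Gr \<Longrightarrow> inv_into Gr id y = y"
  using inv_into_f_f[of id Gr y] by simp

lemma Gr_nbhd: assumes "x \<in> Gr" obtains d where "d > 0" "\<And>y. y \<in> M \<Longrightarrow> norm (y - x) < d \<Longrightarrow> y \<in> Gr"
  by (rule M.near_invertible[OF assms]) blast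

lemma cdiff_c0_iff:
  assumes x: "x \<in> Gr"
  shows "cdiff_at f c0 (U, \<psi>, V) x \<longleftrightarrow> (\<exists>D. has_cderiv_within (\<psi> \<circ> f) D x M)"
proof -
  obtain d where d: "d > 0" "\<And>y. y \<in> M \<Longrightarrow> norm (y - x) < d \<Longrightarrow> y \<in> Gr" using Gr_nbhd[OF x] by blast
  have "has_cderiv_within (\<psi> \<circ> f \<circ> inv_into Gr id) D x M \<longleftrightarrow> has_cderiv_within (\<psi> \<circ> f) D x M" for D
    by (rule iffI; erule has_cderiv_within_cong[OF _ M.csub d(1)]) (use x d(2) inv_into_id in auto)
  then show ?thesis by (simp add: cdiff_at_def)
qed

lemma cdiff_c0_cd: "x \<in> Gr \<Longrightarrow> cd f x \<Longrightarrow> cdiff_at f c0 c0 x"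
  unfolding cdiff_c0_iff M.cd_def by simp

lemma openin_GTop: "openin GTop U \<longleftrightarrow> openin (top_of_set M) U \<and> U \<subseteq> Gr"
  by (meson M.open_Gr openin_imp_subset openin_subset_trans openin_trans M.Gr_M subsetI)

lemma group_chart_on:
  assumes U: "openin (top_of_set M) U" "U \<subseteq> Gr" and T: "openin (top_of_set M) T" "\<phi> ` U = T"
    and \<phi>: "\<And>u. u \<in> U \<Longrightarrow> cd \<phi> u" and \<psi>: "\<And>w. w \<in> T \<Longrightarrow> cd \<psi> w" and inv: "\<And>u. u \<in> U \<Longrightarrow> \<psi> (\<phi> u) = u"
  shows "chart_on GTop (U, \<phi>, M)"
proof -
  have UM: "U \<subseteq> M" "T \<subseteq> M" using openin_imp_subset[OF U(1)] openin_imp_subset[OF T(1)] .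
  have sub: "subtopology GTop U = top_of_set U" using U(2) by (simp add: subtopology_subtopology Int_absorb1)
  have "homeomorphic_maps (top_of_set U) (top_of_set T) \<phi> \<psi>"
    unfolding homeomorphic_maps_def
  proof (intro conjI)
    show "continuous_map (top_of_set U) (top_of_set T) \<phi>"
      using M.cd_continuous_on[OF UM(1) \<phi>] T(2) by (auto simp: continuous_map_in_subtopology)
    show "continuous_map (top_of_set T) (top_of_set U) \<psi>"
      using M.cd_continuous_on[OF UM(2) \<psi>] T(2) inv by (auto simp: continuous_map_in_subtopology)
  qed (use inv T(2) in auto)
  then have "homeomorphic_map (subtopology GTop U) (top_of_set (\<phi> ` U)) \<phi>"
    unfolding sub T(2) homeomorphic_map_maps by blast
  then show ?thesis using U T by (simp add: chart_on_def openin_GTop M.csub M.complete)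
qed

lemma chart_c0: "chart_on GTop c0"
  by (rule group_chart_on[OF M.open_Gr order_refl M.open_Gr, where \<psi> = "\<lambda>x. x"])
    (auto simp: id_def intro: M.cd_id M.Gr_M)

lemma complex_manifold_c0: "complex_manifold GTop {c0}"
  unfolding complex_manifold_def
proof (intro conjI ballI)
  show "Hausdorff_space GTop" by (simp add: Hausdorff_space_subtopology)
  show "compatible_charts c d" if "c \<in> {c0}" "d \<in> {c0}" for c d
    using that cdiff_at_id[OF chart_c0] by (auto simp: compatible_charts_iff)
qed (use chart_c0 in auto)

lemma complex_manifold_group: "complex_manifold GTop (group_atlas M)"
  using complex_manifold_structure_maximal_atlas[OF complex_manifold_c0]
  by (simp add: complex_manifold_structure_def group_atlas_def)

lemma c0_in: "c0 \<in> group_atlas M"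
  unfolding group_atlas_def by (rule chart_on_imp_maximal_atlas[OF complex_manifold_c0]) simp

lemma group_atlasD:
  assumes "a \<in> group_atlas M"
  shows "chart_on GTop a" "x \<in> fst a \<Longrightarrow> cdiff_at id a c0 x" "x \<in> fst a \<Longrightarrow> cdiff_at id c0 a x" "fst a \<subseteq> Gr"
proof -
  show a: "chart_on GTop a" using assms by (simp add: group_atlas_def maximal_atlas_def)
  then show sub: "fst a \<subseteq> Gr" by (cases a) (auto dest!: chart_on_openin openin_subset)
  have "compatible_charts a c0" using assms by (simp add: group_atlas_def maximal_atlas_def)
  then show "x \<in> fst a \<Longrightarrow> cdiff_at id a c0 x" "x \<in> fst a \<Longrightarrow> cdiff_at id c0 a x"
    using sub by (auto simp: compatible_charts_iff)
qed

text \<open>A map and an inverse that are both differentiable on open sets of \<open>M\<close> give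
  a chart compatible with the inclusion; the charts adapted to the isotropy group and the translated
  charts arise in this way.\<close>

lemma group_chartI:
  assumes U: "openin (top_of_set M) U" "U \<subseteq> Gr" and T: "openin (top_of_set M) T" "\<phi> ` U = T"
    and \<phi>: "\<And>u. u \<in> U \<Longrightarrow> cd \<phi> u" and \<psi>: "\<And>w. w \<in> T \<Longrightarrow> cd \<psi> w" and inv: "\<And>u. u \<in> U \<Longrightarrow> \<psi> (\<phi> u) = u"
  shows "(U, \<phi>, M) \<in> group_atlas M"
proof -
  have c: "chart_on GTop (U, \<phi>, M)" by (rule group_chart_on[OF assms])
  have "cdiff_at id (U, \<phi>, M) c0 u \<and> cdiff_at id c0 (U, \<phi>, M) u" if u: "u \<in> U" for u
  proof
    show "cdiff_at id c0 (U, \<phi>, M) u" using \<phi>[OF u] u U(2) by (subst cdiff_c0_iff) (auto simp: M.cd_def)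
    obtain d where d: "d > 0" "\<And>y. y \<in> M \<Longrightarrow> norm (y - \<phi> u) < d \<Longrightarrow> y \<in> \<phi> ` (U \<inter> U)"
      using chart_nbhd[OF c u chart_on_openin[OF c] u] by blast
    obtain D where D: "has_cderiv_within \<psi> D (\<phi> u) M" using \<psi>[of "\<phi> u"] u T(2) unfolding M.cd_def by blast
    have eq: "\<psi> y = inv_into U \<phi> y" if y: "y \<in> M" "norm (y - \<phi> u) < d" for y
    proof -
      obtain v where "v \<in> U" "y = \<phi> v" using d(2)[OF y] by auto
      then show ?thesis using inv chart_on_inj[OF c] by (simp add: inv_into_f_f)
    qed
    have "has_cderiv_within (id \<circ> id \<circ> inv_into U \<phi>) D (\<phi> u) M"
      by (rule has_cderiv_within_cong[OF D M.csub d(1)])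
        (use u d(1) eq inv chart_on_inj[OF c] in \<open>auto simp: inv_into_f_f\<close>)
    then show "cdiff_at id (U, \<phi>, M) c0 u" by (auto simp: cdiff_at_def)
  qed
  then show ?thesis using c by (auto simp: group_atlas_def maximal_atlas_def compatible_charts_iff)
qed

subsection \<open>Group operations in charts\<close>

text \<open>Reduces maps into the group to the inclusion chart \<open>c0\<close>, where
  differentiability is that of operator-valued maps.\<close>

lemma cdiff_to_group:
  assumes "chart_on X c" "continuous_map X GTop f" "x \<in> fst c" "cdiff_at f c c0 x" "b \<in> group_atlas M" "f x \<in> fst b"
  shows "cdiff_at f c b x"
proof -
  have "f x \<in> Gr" using group_atlasD(4)[OF assms(5)] assms(6) by blast
  then have "cdiff_at (id \<circ> f) c b x"
    using assms group_atlasD[OF assms(5)] by (intro cdiff_at_compose[OF assms(1) chart_c0]) auto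
  then show ?thesis by simp
qed

lemma continuous_compose_GTop:
  assumes "continuous_map X GTop f" "continuous_map X GTop g" shows "continuous_map X GTop (\<lambda>x. f x o\<^sub>L g x)"
proof -
  have "continuous_map X (prod_topology euclidean euclidean) (\<lambda>x. (f x, g x))"
    by (rule continuous_map_pairedI) (use assms in \<open>auto simp: continuous_map_in_subtopology\<close>)
  then have "continuous_map X euclidean (\<lambda>x. (f x, g x))" by simp
  moreover have "continuous_map euclidean euclidean (\<lambda>p :: 'h op \<times> 'h op. fst p o\<^sub>L snd p)"
    by (simp add: continuous_on_fst continuous_on_snd bounded_bilinear.continuous_on[OF bounded_bilinear_blinfun_compose] continuous_on_id)
  ultimately have "continuous_map X euclidean ((\<lambda>p. fst p o\<^sub>L snd p) \<circ> (\<lambda>x. (f x, g x)))" by (rule continuous_map_compose)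
  then show ?thesis using assms M.Gr_compose by (auto simp: continuous_map_in_subtopology o_def Pi_iff)
qed

text \<open>Multiplication is differentiated on \<open>M \<times> M\<close>; it is complex
  homogeneous in its second argument because the first one is taken in \<open>M\<close>.\<close>

lemma cdiff_mult:
  assumes c: "chart_on X c" "x \<in> fst c" and f: "continuous_map X GTop f" "cdiff_at f c c0 x"
    and g: "continuous_map X GTop g" "cdiff_at g c c0 x"
  shows "cdiff_at (\<lambda>x. f x o\<^sub>L g x) c c0 x"
proof -
  have xX: "x \<in> topspace X" using c by (cases c) (auto dest: chart_on_openin openin_subset)
  have fg: "f x \<in> Gr" "g x \<in> Gr" using f(1) g(1) xX by (auto simp: continuous_map_def)
  note cc = chart_on_prod[OF chart_c0 chart_c0]
  have V: "csubspace (M \<times> M)" "(f x, g x) \<in> M \<times> M" using fg M.Gr_M M.csub by (auto intro: csubspace_Times)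
  have 1: "has_cderiv_within fst fst (f x, g x) (M \<times> M)" "has_cderiv_within snd snd (f x, g x) (M \<times> M)"
    by (rule has_cderiv_within_linear[where K = 1, OF _ V(1) _ V(2)]; auto simp: clinear_on_def scaleC_prod_def norm_fst_le norm_snd_le)+
  have bil: "has_cderiv_within (\<lambda>p. fst p o\<^sub>L snd p) (\<lambda>v. (fst v o\<^sub>L snd (f x, g x)) + (fst (f x, g x) o\<^sub>L snd v)) (f x, g x) (M \<times> M)"
    by (rule has_cderiv_within_bilinear[OF 1 V bounded_bilinear_blinfun_compose compose_scaleC_left, where W = M])
      (use fg M.Gr_M in \<open>auto simp: compose_scaleC_right M.bounded\<close>)
  obtain d where d: "d > 0" "\<And>p. p \<in> M \<times> M \<Longrightarrow> norm (p - (f x, g x)) < d \<Longrightarrow> p \<in> Gr \<times> Gr"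
    using openin_Times[OF M.open_Gr M.open_Gr] fg unfolding openin_euclidean_subtopology_iff dist_norm by (metis mem_Sigma_iff)
  have inv: "inv_into (Gr \<times> Gr) (map_prod id id) p = p" if "p \<in> Gr \<times> Gr" for p
    using inv_into_f_f[of "map_prod id id" "Gr \<times> Gr" p] that by (simp add: map_prod_ident id_def inj_on_def)
  have "has_cderiv_within (id \<circ> (\<lambda>p. fst p o\<^sub>L snd p) \<circ> inv_into (Gr \<times> Gr) (map_prod id id))
      (\<lambda>v. (fst v o\<^sub>L snd (f x, g x)) + (fst (f x, g x) o\<^sub>L snd v)) (f x, g x) (M \<times> M)"
    by (rule has_cderiv_within_cong[OF bil V(1) d(1)]) (use fg V(2) d(2) in \<open>simp_all add: inv\<close>)
  then have m: "cdiff_at (\<lambda>p. fst p o\<^sub>L snd p) (prod_chart c0 c0) c0 (f x, g x)"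
    by (auto simp: cdiff_at_def prod_chart_def)
  have "cdiff_at ((\<lambda>p. fst p o\<^sub>L snd p) \<circ> (\<lambda>x. (f x, g x))) c c0 x"
    by (rule cdiff_at_compose[OF c(1) cc continuous_map_pairedI[OF f(1) g(1)] c(2) _ cdiff_at_Pair[OF c f(2) g(2)] m])
      (use fg in simp)
  then show ?thesis by (simp add: o_def)
qed

lemma continuous_gi: "continuous_map GTop GTop (\<lambda>x. gi x)"
  using M.cd_continuous_on[of Gr "\<lambda>x. gi x"] M.cd_gi M.Gr_M M.Gr_gi by (auto simp: continuous_map_in_subtopology)

lemma cdiff_gi:
  assumes c: "chart_on X c" "x \<in> fst c" and f: "continuous_map X GTop f" "cdiff_at f c c0 x"
  shows "cdiff_at (\<lambda>x. gi (f x)) c c0 x"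
proof -
  have "x \<in> topspace X" using c by (cases c) (auto dest: chart_on_openin openin_subset)
  then have fx: "f x \<in> Gr" using f(1) by (auto simp: continuous_map_def)
  have "cdiff_at ((\<lambda>x. gi x) \<circ> f) c c0 x"
    by (rule cdiff_at_compose[OF c(1) chart_c0 f(1) c(2) _ f(2) cdiff_c0_cd[OF fx M.cd_gi[OF fx]]]) (use fx in simp)
  then show ?thesis by (simp add: o_def)
qed

subsection \<open>The isotropy group as a submanifold\<close>

abbreviation "IT \<equiv> top_of_set Iso"
abbreviation "IA \<equiv> submanifold_atlas (group_atlas M) Iso"

lemma Iso_sub: "Iso \<subseteq> Gr" using Iso_Gr by blast

lemma continuous_incl: "continuous_map IT GTop (\<lambda>x. x)"
  using Iso_sub by (auto simp: continuous_map_in_subtopology)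

lemma IA_E:
  assumes "e \<in> IA"
  obtains U \<phi> V where "(U, \<phi>, V) \<in> group_atlas M" "fst e = U \<inter> Iso" "fst (snd e) = \<phi>" "chart_on IT e"
    "\<And>k. k \<in> fst e \<Longrightarrow> cdiff_at id e c0 k"
proof -
  from assms obtain U \<phi> V W' where e: "e = (U \<inter> Iso, \<phi>, W')" "(U, \<phi>, V) \<in> group_atlas M" "complemented_subspace V W'"
    "\<phi> ` (U \<inter> Iso) = \<phi> ` U \<inter> W'"
    by (auto simp: submanifold_atlas_def)
  note c = group_atlasD(1)[OF e(2)]
  have W': "csubspace W'" "complete W'" using e(3) by (auto simp: complemented_subspace_def)
  have W'V: "W' \<subseteq> V"
  proof
    fix w assume "w \<in> W'"
    obtain Z' where "csubspace Z'" "V = {w + z |w z. w \<in> W' \<and> z \<in> Z'}" using e(3) unfolding complemented_subspace_def by blast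
    then have "w + 0 \<in> V" using csubspace_0[of Z'] \<open>w \<in> W'\<close> by blast
    then show "w \<in> V" by simp
  qed
  have UG: "U \<subseteq> Gr" using group_atlasD(4)[OF e(2)] by simp
  have t: "subtopology (subtopology GTop U) (U \<inter> Iso) = subtopology IT (U \<inter> Iso)"
  proof -
    have "Gr \<inter> U \<inter> (U \<inter> Iso) = Iso \<inter> (U \<inter> Iso)" using Iso_sub by auto
    then show ?thesis by (simp only: subtopology_subtopology)
  qed
  have "homeomorphic_map (subtopology (subtopology GTop U) (U \<inter> Iso)) (subtopology (top_of_set (\<phi> ` U)) (\<phi> ` (U \<inter> Iso))) \<phi>"
    by (rule homeomorphic_map_subtopologies[OF chart_on_homeomorphic[OF c]]) (use UG in auto)
  then have h: "homeomorphic_map (subtopology IT (U \<inter> Iso)) (top_of_set (\<phi> ` (U \<inter> Iso))) \<phi>"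
    unfolding t by (simp add: subtopology_subtopology Int_absorb1 image_mono)
  have oU: "openin IT (U \<inter> Iso)"
  proof -
    obtain S where "open S" "U = Gr \<inter> S" using chart_on_openin[OF c] by (auto simp: openin_open)
    then have "U \<inter> Iso = Iso \<inter> S" using Iso_sub by auto
    then show ?thesis using \<open>open S\<close> by (auto simp: openin_open)
  qed
  have oI: "openin (top_of_set W') (\<phi> ` (U \<inter> Iso))"
  proof -
    obtain S where "open S" "\<phi> ` U = V \<inter> S" using chart_on_image_open[OF c] by (auto simp: openin_open)
    then have "\<phi> ` (U \<inter> Iso) = W' \<inter> S" using e(4) W'V by auto
    then show ?thesis using \<open>open S\<close> by (auto simp: openin_open)
  qed
  have ce: "chart_on IT e" unfolding e(1) chart_on_def using oU W' oI h by simp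
  have "cdiff_at id e c0 k" if k: "k \<in> fst e" for k
  proof -
    have kU: "k \<in> U" "k \<in> Iso" using k e(1) by auto
    have "cdiff_at id e (U, \<phi>, V) k"
      unfolding e(1) by (rule cdiff_at_inclusion[OF ce[unfolded e(1)] _ chart_on_inj[OF c]]) (use kU in auto)
    from cdiff_at_compose[OF ce c _ k _ this, where g = id and e = c0] have "cdiff_at (id \<circ> id) e c0 k"
      using kU group_atlasD(2)[OF e(2)] continuous_incl by (simp add: id_def)
    then show ?thesis by simp
  qed
  with that[OF e(2)] ce e(1) show thesis by simp
qed

lemma IA_chart: "e \<in> IA \<Longrightarrow> chart_on IT e" by (rule IA_E) auto
lemma IA_incl: "e \<in> IA \<Longrightarrow> k \<in> fst e \<Longrightarrow> cdiff_at id e c0 k" by (rule IA_E) auto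
lemma IA_Iso: "e \<in> IA \<Longrightarrow> fst e \<subseteq> Iso" by (rule IA_E) auto

text \<open>A submanifold chart uses the same map \<open>\<phi>\<close> as the ambient chart, so
  differentiability into the group is already differentiability into the isotropy group.\<close>

lemma cdiff_to_IA:
  assumes e: "e \<in> IA" and X: "chart_on X c" "continuous_map X GTop f" "x \<in> fst c" "cdiff_at f c c0 x" "f x \<in> fst e"
  shows "cdiff_at f c e x"
proof -
  obtain U \<phi> V where U: "(U, \<phi>, V) \<in> group_atlas M" "fst e = U \<inter> Iso" "fst (snd e) = \<phi>" by (rule IA_E[OF e]) auto
  have "cdiff_at f c (U, \<phi>, V) x" by (rule cdiff_to_group[OF X(1-4) U(1)]) (use X(5) U(2) in simp)
  then show ?thesis unfolding cdiff_at_target[of f c U _ V x "fst e" "snd (snd e)"] U(3)[symmetric] by simp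
qed

text \<open>The coordinates \<open>\<Phi>\<close> are centred at the identity; left translation by
  \<open>gi k\<close> moves them to \<open>k\<close> and preserves the isotropy group. The image is
  described through \<open>\<Psi>\<close> as an open set, so that \<open>\<phi>\<close> becomes a
  chart of the group which carries the isotropy group to \<open>W\<close>.\<close>

lemma isotropy_chart:
  assumes k: "k \<in> Iso" shows "\<exists>e\<in>IA. k \<in> fst e"
proof -
  have kG: "k \<in> Gr" "gi k \<in> Gr" and kM: "k \<in> M" "gi k \<in> M" using k Iso_Gr M.Gr_gi M.Gr_M by auto
  define U where "U = {y \<in> Gr. E (gi k o\<^sub>L y) \<in> Gr}"
  define \<phi> where "\<phi> y = \<Phi> (gi k o\<^sub>L y)" for y
  define T where "T = {w \<in> {w \<in> M. E w \<in> Gr}. \<Psi> w \<in> Gr}"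
  have cdL: "cd (\<lambda>y. gi k o\<^sub>L y) y" if "y \<in> M" for y
    by (rule M.cd_compose[OF that kM(2) M.cd_const M.cd_id[OF that]])
  have U: "openin (top_of_set M) U" unfolding U_def
  proof (rule M.cd_open_preimage[OF M.open_Gr M.open_Gr])
    fix y assume "y \<in> Gr"
    then have y: "y \<in> M" "gi k o\<^sub>L y \<in> M" using kM M.Gr_M by auto
    show "cd (\<lambda>y. E (gi k o\<^sub>L y)) y" by (rule M.cd_linear_compose[OF E_lin, of 1, OF _ y(1) cdL[OF y(1)]]) (use norm_E_le kM in auto)
    show "E (gi k o\<^sub>L y) \<in> M" by (rule E_in_M[OF y(2)])
  qed
  have T: "openin (top_of_set M) T" unfolding T_def
    by (rule M.cd_open_preimage[OF \<Omega>_open M.open_Gr]) (use cd_\<Psi> \<Psi>_M in auto)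
  have UD: "gi k o\<^sub>L y \<in> Gr" "gi k o\<^sub>L y \<in> M" "E (gi k o\<^sub>L y) \<in> Gr" if "y \<in> U" for y
    using that kG M.Gr_compose[OF kG(2)] M.Gr_M by (auto simp: U_def)
  have img: "\<phi> ` U = T"
  proof (intro equalityI subsetI)
    fix w assume "w \<in> \<phi> ` U"
    then obtain y where y: "y \<in> U" "w = \<phi> y" by auto
    note d = UD[OF y(1)]
    show "w \<in> T" unfolding y(2) \<phi>_def T_def using d \<Phi>_M[OF d(2,3)] E_\<Phi>[OF d(2,3)] \<Psi>_\<Phi>[OF d(2,3)] by simp
  next
    fix w assume w: "w \<in> T"
    then have w': "w \<in> M" "E w \<in> Gr" "\<Psi> w \<in> Gr" by (auto simp: T_def)
    have "gi k o\<^sub>L (k o\<^sub>L \<Psi> w) = \<Psi> w" by (rule M.gi_left'[OF kG(1)])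
    then have "k o\<^sub>L \<Psi> w \<in> U" "\<phi> (k o\<^sub>L \<Psi> w) = w"
      using w' M.Gr_compose[OF kG(1) w'(3)] E_\<Psi>[OF w'(1,2)] \<Phi>_\<Psi>[OF w'(1,2)] by (simp_all add: U_def \<phi>_def)
    then show "w \<in> \<phi> ` U" by force
  qed
  have chart: "(U, \<phi>, M) \<in> group_atlas M"
  proof (rule group_chartI[OF U _ T img, where \<psi> = "\<lambda>w. k o\<^sub>L \<Psi> w"])
    show "U \<subseteq> Gr" by (auto simp: U_def)
    show "cd \<phi> u" if u: "u \<in> U" for u
    proof -
      have uM: "u \<in> M" using u M.Gr_M by (auto simp: U_def)
      show ?thesis unfolding \<phi>_def[abs_def]
        by (rule M.cd_chain[OF uM cdL[OF uM] cd_\<Phi>[OF UD(2,3)[OF u]] zero_less_one]) (use kM in simp)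
    qed
    show "cd (\<lambda>w. k o\<^sub>L \<Psi> w) w" if "w \<in> T" for w
      by (rule M.cd_compose[OF _ kM(1) M.cd_const cd_\<Psi>]) (use that in \<open>auto simp: T_def\<close>)
    show "k o\<^sub>L \<Psi> (\<phi> u) = u" if u: "u \<in> U" for u
      using \<Psi>_\<Phi>[OF UD(2,3)[OF u]] M.gi_right'[OF kG(1)] by (simp add: \<phi>_def)
  qed
  have iff: "\<phi> y \<in> W \<longleftrightarrow> y \<in> Iso" if y: "y \<in> U" for y
  proof -
    have "\<phi> y \<in> W \<longleftrightarrow> gi k o\<^sub>L y \<in> Iso" unfolding \<phi>_def by (rule \<Phi>_W_iff[OF UD(1,3)[OF y]])
    also have "\<dots> \<longleftrightarrow> y \<in> Iso"
      using Iso_compose[OF k, of "gi k o\<^sub>L y"] Iso_compose[OF Iso_gi[OF k], of y] M.gi_right'[OF kG(1), of y] by auto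
    finally show ?thesis .
  qed
  have "\<phi> ` (U \<inter> Iso) = \<phi> ` U \<inter> W"
    using iff by auto
  then have "(U \<inter> Iso, \<phi>, W) \<in> IA" using chart complemented_W by (auto simp: submanifold_atlas_def)
  moreover have "k \<in> U" using kG M.gi_left[OF kG(1)] M.Gr_id by (simp add: U_def E_id)
  ultimately show ?thesis using k by force
qed

lemma complex_manifold_Iso: "complex_manifold IT IA"
  unfolding complex_manifold_def
proof (intro conjI ballI)
  show "Hausdorff_space IT" by (simp add: Hausdorff_space_subtopology)
  show "chart_on IT e" if "e \<in> IA" for e by (rule IA_chart[OF that])
  show "topspace IT \<subseteq> \<Union> (fst ` IA)" using isotropy_chart by fastforce
  have *: "cdiff_at id e e' x" if e: "e \<in> IA" "e' \<in> IA" "x \<in> fst e" "x \<in> fst e'" for e e' x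
    by (rule cdiff_to_IA[OF e(2) IA_chart[OF e(1)]]) (use e IA_incl[OF e(1)] continuous_incl in \<open>auto simp: id_def\<close>)
  show "compatible_charts e e'" if "e \<in> IA" "e' \<in> IA" for e e'
    using *[OF that] *[OF that(2,1)] by (auto simp: compatible_charts_iff)
qed

lemma isotropy_simps [simp]:
  "k \<otimes>\<^bsub>isotropy_group M E\<^esub> l = k o\<^sub>L l" "\<one>\<^bsub>isotropy_group M E\<^esub> = id_blinfun"
  by (simp_all add: isotropy_group_def)

lemma subgroup_Iso: "subgroup Iso (invertible_group M)"
  by (rule subgroup.intro) (use Iso_sub Iso_compose Iso_id Iso_gi in auto)

lemma isotropy_eq: "isotropy_group M E = (invertible_group M)\<lparr>carrier := Iso\<rparr>"
  by (simp add: isotropy_group_def)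

lemma group_Iso: "group (isotropy_group M E)"
  by (subst isotropy_eq) (rule subgroup.subgroup_is_group[OF subgroup_Iso M.group_Gr])

lemma inv_Iso: "k \<in> Iso \<Longrightarrow> inv\<^bsub>isotropy_group M E\<^esub> k = gi k"
  by (subst isotropy_eq) (rule group.m_inv_consistent[OF M.group_Gr subgroup_Iso])

lemma prod_GTop:
  assumes "continuous_map X GTop f"
  shows "continuous_map (prod_topology X Y) GTop (\<lambda>p. f (fst p))" "continuous_map (prod_topology Y X) GTop (\<lambda>p. f (snd p))"
  using continuous_map_compose[OF continuous_map_fst assms] continuous_map_compose[OF continuous_map_snd assms]
  by (auto simp: o_def)

lemma cdiff_fst_compose:
  assumes "chart_on X c" "chart_on Y d" "p \<in> fst c \<times> fst d" "cdiff_at f c e (fst p)"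
  shows "cdiff_at (\<lambda>p. f (fst p)) (prod_chart c d) e p"
  using cdiff_at_compose[OF chart_on_prod[OF assms(1,2)] assms(1) continuous_map_fst, where x = p and g = f and e = e] assms cdiff_at_fst[OF assms(1-3)]
  by (auto simp: o_def)

lemma cdiff_snd_compose:
  assumes "chart_on X c" "chart_on Y d" "p \<in> fst c \<times> fst d" "cdiff_at f d e (snd p)"
  shows "cdiff_at (\<lambda>p. f (snd p)) (prod_chart c d) e p"
  using cdiff_at_compose[OF chart_on_prod[OF assms(1,2)] assms(2) continuous_map_snd, where x = p and g = f and e = e] assms cdiff_at_snd[OF assms(1-3)]
  by (auto simp: o_def)

lemma continuous_into_IT:
  assumes "continuous_map X GTop f" "\<And>x. x \<in> topspace X \<Longrightarrow> f x \<in> Iso" shows "continuous_map X IT f"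
  using assms by (auto simp: continuous_map_in_subtopology)

lemma complex_Lie_group_Iso: "complex_Lie_group (isotropy_group M E) IT IA"
  unfolding complex_Lie_group_def
proof (intro conjI)
  show "group (isotropy_group M E)" by (rule group_Iso)
  show "complex_manifold IT IA" by (rule complex_manifold_Iso)
  let ?m = "\<lambda>(k, l). k \<otimes>\<^bsub>isotropy_group M E\<^esub> l"
  have m: "?m = (\<lambda>p. fst p o\<^sub>L snd p)" by (auto simp: fun_eq_iff)
  have c1: "continuous_map (prod_topology IT IT) GTop fst" and c2: "continuous_map (prod_topology IT IT) GTop snd"
    by (rule prod_GTop[OF continuous_incl])+
  have cm: "continuous_map (prod_topology IT IT) GTop (\<lambda>p. fst p o\<^sub>L snd p)" by (rule continuous_compose_GTop[OF c1 c2])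
  show "canalytic_map (prod_topology IT IT) (prod_atlas IA IA) IT IA ?m"
    unfolding canalytic_map_iff m prod_atlas_eq
  proof (intro conjI ballI allI impI)
    show "continuous_map (prod_topology IT IT) IT (\<lambda>p. fst p o\<^sub>L snd p)"
      by (rule continuous_into_IT[OF cm]) (use Iso_compose in auto)
    fix a e p assume a: "a \<in> {prod_chart c d |c d. c \<in> IA \<and> d \<in> IA}" and e: "e \<in> IA" "p \<in> fst a" "fst p o\<^sub>L snd p \<in> fst e"
    then obtain c d where cd: "c \<in> IA" "d \<in> IA" "a = prod_chart c d" by blast
    note ch = IA_chart[OF cd(1)] IA_chart[OF cd(2)]
    have p: "p \<in> fst c \<times> fst d" using e(2) cd(3) by simp
    have "cdiff_at (\<lambda>p. id (fst p)) a c0 p" "cdiff_at (\<lambda>p. id (snd p)) a c0 p"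
      unfolding cd(3) using p by (intro cdiff_fst_compose[OF ch] cdiff_snd_compose[OF ch] IA_incl cd; auto)+
    then have "cdiff_at (\<lambda>p. fst p o\<^sub>L snd p) a c0 p"
      using e(2) chart_on_prod[OF ch] cd(3) by (intro cdiff_mult[OF _ _ c1 _ c2]) auto
    then show "cdiff_at (\<lambda>p. fst p o\<^sub>L snd p) a e p"
      by (intro cdiff_to_IA[OF e(1) _ cm]) (use chart_on_prod[OF ch] cd(3) e in auto)
  qed
  show "canalytic_map IT IA IT IA (\<lambda>k. inv\<^bsub>isotropy_group M E\<^esub> k)"
    unfolding canalytic_map_iff
  proof (intro conjI ballI allI impI)
    have cg: "continuous_map IT GTop (\<lambda>k. gi k)" using continuous_map_compose[OF continuous_incl continuous_gi] by (simp add: o_def)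
    have "continuous_map IT IT (\<lambda>k. gi k)" by (rule continuous_into_IT[OF cg]) (use Iso_gi in auto)
    then show "continuous_map IT IT (\<lambda>k. inv\<^bsub>isotropy_group M E\<^esub> k)" by (rule continuous_map_eq) (use inv_Iso in auto)
    fix c e k assume c: "c \<in> IA" and e: "e \<in> IA" and k: "k \<in> fst c" "inv\<^bsub>isotropy_group M E\<^esub> k \<in> fst e"
    have kI: "k \<in> Iso" using IA_Iso[OF c] k by auto
    have "cdiff_at (\<lambda>x. gi (id x)) c c0 k"
      by (rule cdiff_gi[OF IA_chart[OF c] k(1) _ IA_incl[OF c k(1)]]) (use continuous_incl in \<open>simp add: id_def\<close>)
    then have "cdiff_at (\<lambda>x. gi x) c e k"
      by (intro cdiff_to_IA[OF e IA_chart[OF c] cg k(1)]) (use k inv_Iso[OF kI] in auto)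
    then show "cdiff_at (\<lambda>k. inv\<^bsub>isotropy_group M E\<^esub> k) c e k"
      by (rule cdiff_at_cong[OF IA_chart[OF c] k(1) openin_topspace, rotated 2]) (use kI inv_Iso IA_Iso[OF c] in auto)
  qed
qed simp

subsection \<open>Charts of the orbit\<close>

abbreviation "Ob \<equiv> orbit_topology M E"

lemma openin_Ob: "openin Ob V \<longleftrightarrow> V \<subseteq> Pi ` Gr \<and> openin GTop {x \<in> Gr. Pi x \<in> V}"
  by (simp add: orbit_topology_def openin_quotient_topology)

lemma topspace_Ob: "topspace Ob = Pi ` Gr"
  by (simp add: topspace_orbit_topology similarity_orbit_def)

lemma continuous_Pi: "continuous_map GTop Ob Pi"
  unfolding continuous_map by (auto simp: topspace_Ob openin_Ob)

text \<open>The radius fits the proof of injectivity: there a point at distance at most 1/30000 +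
  20/30000 from the identity must lie in the ball of radius 1/1000 = 30/30000.\<close>

definition T where "T = {z \<in> Z. norm z < 1/30000}"
definition \<sigma> where "\<sigma> g z = Pi (g o\<^sub>L (id_blinfun + z))"
text \<open>The part of the ball on which the component of \<open>w\<close> in \<open>Z\<close>
  belongs to the coordinate domain \<open>T\<close>; on its image under \<open>F\<close> the chart
  of the orbit can be computed from the local inverse.\<close>

definition Bp where "Bp = {w \<in> B. norm (w - Q w) < 1/30000}"
definition \<phi> where "\<phi> g = inv_into T (\<sigma> g)"
definition U where "U g = \<sigma> g ` T"
abbreviation ch where "ch g \<equiv> (U g, \<phi> g, Z)"

lemma T_Gr: "z \<in> T \<Longrightarrow> id_blinfun + z \<in> Gr"
  by (rule M.near_id_invertible) (auto simp: T_def Z_M)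

lemma T_Bp: assumes z: "z \<in> T" shows "id_blinfun + z \<in> Bp" "Q (id_blinfun + z) = id_blinfun" "F (id_blinfun + z) = id_blinfun + z"
proof -
  have zM: "z \<in> M" "Q z = 0" "norm z < 1/30000" using z by (auto simp: T_def Z_def)
  show q: "Q (id_blinfun + z) = id_blinfun" using Q_simps(1)[OF M.id_in zM(1)] zM(2) by (simp add: Q_id)
  show "id_blinfun + z \<in> Bp" unfolding Bp_def B_iff using zM q by simp
  show "F (id_blinfun + z) = id_blinfun + z" unfolding F_def q by (simp add: \<Psi>_def E_id)
qed


lemma norm_inverse_near:
  assumes x: "x \<in> M" "norm (x - id_blinfun) \<le> 1/2" shows "x \<in> Gr" "norm (gi x) \<le> 2"
proof -
  have lt: "norm (x - id_blinfun) < 1" using x(2) by linarith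
  show "x \<in> Gr" by (rule M.near_id_invertible(1)[OF x(1) lt])
  have "norm (gi x) \<le> 1 / (1 - norm (x - id_blinfun))" by (rule M.near_id_invertible(2)[OF x(1) lt])
  also have "\<dots> \<le> 1 / (1/2)" using x(2) by (intro divide_left_mono) auto
  finally show "norm (gi x) \<le> 2" by simp
qed

text \<open>Injectivity of the charts: if \<open>(1 + z) k = 1 + z'\<close> with \<open>k\<close> in the isotropy group, then \<open>k\<close>
  is close to \<open>1\<close>, hence \<open>1 + z'\<close> is also the value of \<open>F\<close> at \<open>z + \<Phi> k\<close>.\<close>

lemma T_unique:
  assumes z: "z \<in> T" and z': "z' \<in> T" and k: "gi (id_blinfun + z) o\<^sub>L (id_blinfun + z') \<in> Iso"
  shows "z = z'"
proof -
  define x where "x = gi (id_blinfun + z) o\<^sub>L (id_blinfun + z')"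
  note G = T_Gr[OF z] T_Gr[OF z']
  have n: "norm z < 1/30000" "norm z' < 1/30000" "z \<in> M" "z' \<in> M" "Q z = 0" using z z' by (auto simp: T_def Z_def)
  have g2: "norm (gi (id_blinfun + z)) \<le> 2" by (rule norm_inverse_near) (use n in auto)
  have xM: "x \<in> M" and xG: "x \<in> Gr" using G M.Gr_gi M.Gr_compose M.Gr_M by (auto simp: x_def)
  have "x - id_blinfun = gi (id_blinfun + z) o\<^sub>L (z' - z)"
    using M.gi_left[OF G(1)] by (simp add: x_def compose.add_right compose.diff_right algebra_simps)
  then have "norm (x - id_blinfun) \<le> norm (gi (id_blinfun + z)) * norm (z' - z)" using norm_blinfun_compose by simp
  \<comment> \<open>Distances to the identity are tracked in units of 1/30000: 4 for
    \<open>x\<close> and for \<open>E x\<close>, so 8 for their difference, 16 for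
    \<open>gi (E x) o\<^sub>L x\<close>, 20 for \<open>\<Phi> x\<close>, and less than 21 for
    \<open>w\<close>, below the 30 of the ball.\<close>
  also have "\<dots> \<le> 2 * (2/30000)" using g2 n norm_triangle_ineq4[of z' z] by (intro mult_mono) auto
  finally have nx: "norm (x - id_blinfun) \<le> 4/30000" by simp
  have "E x - id_blinfun = E (x - id_blinfun)" using E_simps(5)[OF xM M.id_in] by (simp add: E_id)
  then have nE: "norm (E x - id_blinfun) \<le> 4/30000" using norm_E_le[of "x - id_blinfun"] xM nx by simp
  have Ex: "E x \<in> Gr" "norm (gi (E x)) \<le> 2"
    by (rule norm_inverse_near[OF E_in_M[OF xM]]; use nE in linarith)+
  have "(gi (E x) o\<^sub>L x) - id_blinfun = gi (E x) o\<^sub>L (x - E x)" by (simp add: compose.diff_right M.gi_left[OF Ex(1)])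
  then have "norm ((gi (E x) o\<^sub>L x) - id_blinfun) \<le> norm (gi (E x)) * norm (x - E x)" using norm_blinfun_compose by simp
  also have "\<dots> \<le> 2 * (8/30000)"
    using Ex(2) nx nE norm_triangle_ineq4[of "x - id_blinfun" "E x - id_blinfun"] by (intro mult_mono) auto
  finally have nc: "norm ((gi (E x) o\<^sub>L x) - id_blinfun) \<le> 16/30000" by simp
  have d: "\<Phi> x - id_blinfun = (E x - id_blinfun) + ((gi (E x) o\<^sub>L x) - id_blinfun)" by (simp add: \<Phi>_def)
  have n\<Phi>: "norm (\<Phi> x - id_blinfun) \<le> 20/30000"
    unfolding d using norm_triangle_ineq[of "E x - id_blinfun" "(gi (E x) o\<^sub>L x) - id_blinfun"] nE nc by linarith
  define w where "w = z + \<Phi> x"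
  have wM: "w \<in> M" using n \<Phi>_M[OF xM Ex(1)] by (simp add: w_def)
  have "norm (w - id_blinfun) \<le> norm z + norm (\<Phi> x - id_blinfun)"
    unfolding w_def using norm_triangle_ineq[of z "\<Phi> x - id_blinfun"] by (simp add: algebra_simps)
  then have wB: "w \<in> B" unfolding B_iff using wM n n\<Phi> by simp
  have "\<Phi> x \<in> W" using \<Phi>_W_iff[OF xG Ex(1)] k by (simp add: x_def)
  then have Qw: "Q w = \<Phi> x" using Q_simps(1)[OF n(3) \<Phi>_M[OF xM Ex(1)]] n(5) Q_fix by (simp add: w_def)
  have "F w = (id_blinfun + z) o\<^sub>L x" unfolding F_def Qw by (simp add: w_def \<Psi>_\<Phi>[OF xM Ex(1)])
  also have "\<dots> = F (id_blinfun + z')" unfolding T_Bp(3)[OF z'] x_def by (rule M.gi_right'[OF G(1)])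
  finally have "w = id_blinfun + z'" by (rule inj_onD[OF inj _ wB]) (use T_Bp(1)[OF z'] in \<open>simp add: Bp_def\<close>)
  then have "w - Q w = z'" using T_Bp(2)[OF z'] by simp
  then show ?thesis by (simp add: Qw) (simp add: w_def)
qed

lemma inj_\<sigma>: assumes g: "g \<in> Gr" shows "inj_on (\<sigma> g) T"
proof (rule inj_onI)
  fix z z' assume z: "z \<in> T" "z' \<in> T" and eq: "\<sigma> g z = \<sigma> g z'"
  note G = T_Gr[OF z(1)] T_Gr[OF z(2)]
  have "gi (g o\<^sub>L (id_blinfun + z)) o\<^sub>L (g o\<^sub>L (id_blinfun + z')) \<in> Iso"
    using Pi_eq_iff[OF M.Gr_compose[OF g G(1)] M.Gr_compose[OF g G(2)]] eq by (simp add: \<sigma>_def)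
  then show "z = z'" by (intro T_unique[OF z]) (simp add: M.gi_compose[OF g G(1)] blinfun_compose_assoc M.gi_left'[OF g])
qed

lemma \<phi>_\<sigma>: "g \<in> Gr \<Longrightarrow> z \<in> T \<Longrightarrow> \<phi> g (\<sigma> g z) = z"
  unfolding \<phi>_def by (rule inv_into_f_f[OF inj_\<sigma>])

text \<open>The factors \<open>\<Psi> (Q w)\<close> and \<open>k\<close> belong to the isotropy
  group and disappear under the orbit map.\<close>

lemma Pi_F:
  assumes g: "g \<in> Gr" and k: "k \<in> Iso" and w: "w \<in> Bp"
  shows "Pi (g o\<^sub>L F w o\<^sub>L k) = \<sigma> g (w - Q w)" "w - Q w \<in> T"
proof -
  have wB: "w \<in> B" "w \<in> M" using w by (auto simp: Bp_def)
  have "g o\<^sub>L F w o\<^sub>L k = (g o\<^sub>L (id_blinfun + (w - Q w))) o\<^sub>L (\<Psi> (Q w) o\<^sub>L k)"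
    unfolding F_def by (simp only: blinfun_compose_assoc)
  moreover have "Pi ((g o\<^sub>L (id_blinfun + (w - Q w))) o\<^sub>L (\<Psi> (Q w) o\<^sub>L k)) = \<sigma> g (w - Q w)"
    unfolding \<sigma>_def by (rule Pi_Iso[OF M.Gr_compose[OF g B_left[OF wB(1)]] Iso_compose[OF B_right[OF wB(1)] k]])
  ultimately show "Pi (g o\<^sub>L F w o\<^sub>L k) = \<sigma> g (w - Q w)" by (simp only:)
  show "w - Q w \<in> T" using R_Z[OF wB(2)] w by (simp add: T_def Bp_def)
qed

lemma open_Bp: "openin (top_of_set M) Bp"
proof -
  have "openin (top_of_set M) {w \<in> B. w - Q w \<in> M \<inter> ball 0 (1/30000)}"
    by (rule M.cd_open_preimage[OF open_B openin_open_Int[OF open_ball]])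
      (use Q_M cd_Q in \<open>auto intro!: M.cd_diff M.cd_id\<close>)
  moreover have "{w \<in> B. w - Q w \<in> M \<inter> ball 0 (1/30000)} = Bp" using Q_M by (auto simp: Bp_def)
  ultimately show ?thesis by simp
qed

text \<open>Write \<open>Pi y\<close> as \<open>\<sigma> g z\<close>; then \<open>y\<close> is
  \<open>g o\<^sub>L (id_blinfun + z)\<close> times an element \<open>k\<close> of the isotropy
  group, and \<open>F\<close> fixes \<open>id_blinfun + z\<close>. Points of the fibre far from
  \<open>g\<close> are thereby moved into the range where \<open>F\<close> is inverted.\<close>

lemma orbit_point:
  assumes g: "g \<in> Gr" and y: "y \<in> Gr" "Pi y \<in> U g"
  obtains k where "k \<in> Iso" "gi g o\<^sub>L y o\<^sub>L gi k \<in> F ` Bp"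
proof -
  obtain z where z: "z \<in> T" "Pi y = \<sigma> g z" using y(2) by (auto simp: U_def)
  have h: "g o\<^sub>L (id_blinfun + z) \<in> Gr" by (rule M.Gr_compose[OF g T_Gr[OF z(1)]])
  define k where "k = gi (g o\<^sub>L (id_blinfun + z)) o\<^sub>L y"
  have k: "k \<in> Iso" using Pi_eq_iff[OF h y(1)] z(2) by (simp add: k_def \<sigma>_def)
  have "(g o\<^sub>L (id_blinfun + z)) o\<^sub>L k = y" unfolding k_def by (rule M.gi_right'[OF h])
  then have "gi g o\<^sub>L y o\<^sub>L gi k = id_blinfun + z"
    using M.gi_left'[OF g] M.gi_right[OF Iso_Gr[OF k]] by (metis blinfun_compose_assoc blinfun_compose_id(2))
  then show thesis using that[OF k] T_Bp(1,3)[OF z(1)] by (metis imageI)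
qed

definition \<rho> where "\<rho> x = Fi x - Q (Fi x)"

text \<open>One \<open>k\<close> serves all \<open>y\<close> that satisfy the condition, so on this
  set the coordinate of \<open>Pi y\<close> is a two-sided translation followed by
  \<open>\<rho>\<close>.\<close>

lemma orbit_local:
  assumes g: "g \<in> Gr" and k: "k \<in> Iso" and y: "y \<in> M" "gi g o\<^sub>L y o\<^sub>L gi k \<in> F ` Bp"
  shows "y \<in> Gr" "Pi y \<in> U g" "\<phi> g (Pi y) = \<rho> (gi g o\<^sub>L y o\<^sub>L gi k)"
proof -
  obtain w where w: "w \<in> Bp" "gi g o\<^sub>L y o\<^sub>L gi k = F w" using y(2) by auto
  note kG = Iso_Gr[OF k]
  have y_eq: "y = g o\<^sub>L F w o\<^sub>L k"
    unfolding w(2)[symmetric] by (simp add: blinfun_compose_assoc M.gi_right'[OF g] M.gi_left[OF kG])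
  have wB: "w \<in> B" using w(1) by (simp add: Bp_def)
  have "F w \<in> Gr" unfolding F_def by (rule M.Gr_compose[OF B_left[OF wB] Iso_Gr[OF B_right[OF wB]]])
  then show "y \<in> Gr" unfolding y_eq by (intro M.Gr_compose g kG)
  have "Fi (F w) = w" by (rule Fi_F[OF wB])
  then show "Pi y \<in> U g" "\<phi> g (Pi y) = \<rho> (gi g o\<^sub>L y o\<^sub>L gi k)"
    unfolding w(2) unfolding y_eq Pi_F(1)[OF g k w(1)] using Pi_F(2)[OF g k w(1)] \<phi>_\<sigma>[OF g] by (auto simp: U_def \<rho>_def)
qed

lemma cd_\<rho>: assumes x: "x \<in> F ` Bp" shows "cd \<rho> x"
proof -
  obtain w where w: "w \<in> Bp" "x = F w" using x by auto
  then have wB: "w \<in> B" "w \<in> M" by (auto simp: Bp_def)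
  have xM: "x \<in> M" using F_M[OF wB(2)] w(2) by simp
  have o: "openin (top_of_set M) (F ` B)" by (rule open_image[OF open_B order_refl])
  have "x \<in> F ` B" using wB w(2) by blast
  then obtain d where d: "d > 0" "\<And>y. y \<in> M \<Longrightarrow> dist y x < d \<Longrightarrow> y \<in> F ` B"
    using o unfolding openin_euclidean_subtopology_iff by blast
  have "cd (\<lambda>x. (\<lambda>w. w - Q w) (Fi x)) x"
  proof (rule M.cd_chain[where f = Fi, OF xM _ _ d(1)])
    show "cd Fi x" unfolding w(2) by (rule cd_Fi[OF wB(1)])
    have "Fi x \<in> M" unfolding w(2) Fi_F[OF wB(1)] by (rule wB(2))
    then show "cd (\<lambda>w. w - Q w) (Fi x)" by (intro M.cd_diff M.cd_id cd_Q Q_M)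
    fix y assume "y \<in> M" "norm (y - x) < d"
    then have "y \<in> F ` B" using d(2) by (simp add: dist_norm)
    then show "Fi y \<in> M" using Fi_F by auto
  qed
  then show ?thesis by (simp add: \<rho>_def[abs_def])
qed

text \<open>The formula with \<open>\<rho>\<close> is valid on a neighbourhood of \<open>y\<close>,
  which yields openness of the preimage and differentiability together, even when \<open>y\<close>
  is far from \<open>g\<close>.\<close>

lemma cd_\<phi>_Pi:
  assumes g: "g \<in> Gr" and y: "y \<in> Gr" "Pi y \<in> U g"
  shows "cd (\<lambda>y. \<phi> g (Pi y)) y" "\<exists>d>0. \<forall>y'\<in>M. norm (y' - y) < d \<longrightarrow> y' \<in> Gr \<and> Pi y' \<in> U g"
proof -
  obtain k where k: "k \<in> Iso" "gi g o\<^sub>L y o\<^sub>L gi k \<in> F ` Bp" by (rule orbit_point[OF g y])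
  define L where "L y = gi g o\<^sub>L y o\<^sub>L gi k" for y
  have giM: "gi g \<in> M" "gi k \<in> M" using M.Gr_M M.Gr_gi g Iso_Gr[OF k(1)] by auto
  have LM: "L x \<in> M" if "x \<in> M" for x using giM that by (simp add: L_def)
  have cL: "cd L x" if x: "x \<in> M" for x
    unfolding L_def[abs_def] by (rule M.cd_compose[OF x _ M.cd_compose[OF x giM(1) M.cd_const M.cd_id[OF x]] M.cd_const]) (use x giM in simp)
  have yM: "y \<in> M" by (rule M.Gr_M[OF y(1)])
  have oM: "openin (top_of_set M) M" by simp
  have "openin (top_of_set M) {x \<in> M. L x \<in> F ` Bp}"
    by (rule M.cd_open_preimage[OF oM open_image[OF open_Bp]]) (use cL LM in \<open>auto simp: Bp_def\<close>)
  moreover have "y \<in> {x \<in> M. L x \<in> F ` Bp}" using yM k(2) by (simp add: L_def)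
  ultimately obtain d where d: "d > 0" "\<And>x. x \<in> M \<Longrightarrow> dist x y < d \<Longrightarrow> L x \<in> F ` Bp"
    unfolding openin_euclidean_subtopology_iff by blast
  have loc: "x \<in> Gr" "Pi x \<in> U g" "\<phi> g (Pi x) = \<rho> (L x)" if "x \<in> M" "norm (x - y) < d" for x
    using orbit_local[OF g k(1) that(1)] d(2)[OF that(1)] that(2) by (auto simp: L_def dist_norm)
  then show "\<exists>d>0. \<forall>y'\<in>M. norm (y' - y) < d \<longrightarrow> y' \<in> Gr \<and> Pi y' \<in> U g" using d(1) by blast
  have "cd (\<lambda>x. \<rho> (L x)) y"
    by (rule M.cd_chain[OF yM cL[OF yM] cd_\<rho> zero_less_one]) (use k(2) LM in \<open>auto simp: L_def\<close>)
  then show "cd (\<lambda>y. \<phi> g (Pi y)) y" by (rule M.cd_cong[OF _ d(1) _ yM]) (use loc(3) in auto)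
qed

lemma U_sub: assumes g: "g \<in> Gr" shows "U g \<subseteq> Pi ` Gr"
  using M.Gr_compose[OF g T_Gr] by (auto simp: U_def \<sigma>_def)

lemma open_preimage_U:
  assumes g: "g \<in> Gr" shows "openin (top_of_set M) {y \<in> Gr. Pi y \<in> U g}"
  unfolding openin_euclidean_subtopology_iff dist_norm
  using cd_\<phi>_Pi(2)[OF g] M.Gr_M by fastforce

lemma openin_U: "g \<in> Gr \<Longrightarrow> openin Ob (U g)"
  using open_preimage_U U_sub by (auto simp: openin_Ob openin_GTop)

lemma image_\<phi>: "g \<in> Gr \<Longrightarrow> \<phi> g ` U g = T"
  using \<phi>_\<sigma> by (force simp: U_def)

lemma \<sigma>_\<phi>: "g \<in> Gr \<Longrightarrow> u \<in> U g \<Longrightarrow> \<phi> g u \<in> T \<and> \<sigma> g (\<phi> g u) = u"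
  using \<phi>_\<sigma> by (auto simp: U_def)

lemma continuous_translate:
  assumes g: "g \<in> Gr" shows "continuous_map (top_of_set T) GTop (\<lambda>z. g o\<^sub>L (id_blinfun + z))"
proof -
  have "continuous_on T (\<lambda>z. g o\<^sub>L (id_blinfun + z))"
    by (intro continuous_intros bounded_bilinear.continuous_on[OF bounded_bilinear_blinfun_compose])
  then show ?thesis using M.Gr_compose[OF g T_Gr] by (auto simp: continuous_map_in_subtopology)
qed

lemma openin_T: "openin (top_of_set Z) T"
proof -
  have "T = Z \<inter> ball 0 (1/30000)" by (auto simp: T_def)
  then show ?thesis by (simp add: openin_open_Int)
qed

text \<open>Openness in the orbit is openness of the preimage in the group, so continuity of
  \<open>\<phi> g\<close> is tested on \<open>\<phi> g (Pi y)\<close>; continuity of the inverse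
  comes from that of the orbit map.\<close>

lemma chart_ch: assumes g: "g \<in> Gr" shows "chart_on Ob (ch g)"
proof -
  have "homeomorphic_maps (subtopology Ob (U g)) (top_of_set T) (\<phi> g) (\<sigma> g)"
    unfolding homeomorphic_maps_def
  proof (intro conjI)
    show "continuous_map (subtopology Ob (U g)) (top_of_set T) (\<phi> g)"
      unfolding continuous_map
    proof (intro conjI allI impI)
      show "\<phi> g ` topspace (subtopology Ob (U g)) \<subseteq> topspace (top_of_set T)"
        using image_\<phi>[OF g] by auto
      fix O' assume O': "openin (top_of_set T) O'"
      then obtain S where S: "open S" "O' = T \<inter> S" by (auto simp: openin_open)
      let ?V = "{u \<in> U g. \<phi> g u \<in> S}"
      have "openin (top_of_set M) ({y \<in> Gr. Pi y \<in> U g} \<inter> (\<lambda>y. \<phi> g (Pi y)) -` S)"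
      proof (rule openin_trans[OF _ open_preimage_U[OF g]])
        have "continuous_on {y \<in> Gr. Pi y \<in> U g} (\<lambda>y. \<phi> g (Pi y))"
          by (rule M.cd_continuous_on) (use M.Gr_M cd_\<phi>_Pi(1)[OF g] in auto)
        then show "openin (top_of_set {y \<in> Gr. Pi y \<in> U g}) ({y \<in> Gr. Pi y \<in> U g} \<inter> (\<lambda>y. \<phi> g (Pi y)) -` S)"
          by (rule continuous_openin_preimage_gen[OF _ S(1)])
      qed
      moreover have "{y \<in> Gr. Pi y \<in> U g} \<inter> (\<lambda>y. \<phi> g (Pi y)) -` S = {y \<in> Gr. Pi y \<in> ?V}" by auto
      ultimately have "openin Ob ?V" using U_sub[OF g] by (auto simp: openin_Ob openin_GTop)
      moreover have "{x \<in> topspace (subtopology Ob (U g)). \<phi> g x \<in> O'} = ?V"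
        using image_\<phi>[OF g] U_sub[OF g] by (auto simp: S(2) topspace_Ob)
      ultimately show "openin (subtopology Ob (U g)) {x \<in> topspace (subtopology Ob (U g)). \<phi> g x \<in> O'}"
        using openin_U[OF g] by (simp add: openin_open_subtopology)
    qed
    have "continuous_map (top_of_set T) Ob (\<sigma> g)"
      using continuous_map_compose[OF continuous_translate[OF g] continuous_Pi] by (simp add: o_def \<sigma>_def[abs_def])
    then show "continuous_map (top_of_set T) (subtopology Ob (U g)) (\<sigma> g)"
      by (auto simp: continuous_map_in_subtopology U_def)
  qed (use \<phi>_\<sigma>[OF g] \<sigma>_\<phi>[OF g] in auto)
  then show ?thesis
    using openin_U[OF g] Z_props openin_T unfolding chart_on_def split image_\<phi>[OF g] homeomorphic_map_maps by blast
qed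

lemma cdiff_Pi: assumes g: "g \<in> Gr" and y: "y \<in> Gr" "Pi y \<in> U g" shows "cdiff_at Pi c0 (ch g) y"
  using cd_\<phi>_Pi(1)[OF g y] unfolding cdiff_c0_iff[OF y(1)] M.cd_def by (simp add: o_def)

text \<open>The local section of the orbit map that belongs to the chart.\<close>

definition s where "s g u = g o\<^sub>L (id_blinfun + \<phi> g u)"

lemma s_props:
  assumes g: "g \<in> Gr"
  shows Pi_s: "u \<in> U g \<Longrightarrow> Pi (s g u) = u" and s_Gr: "u \<in> U g \<Longrightarrow> s g u \<in> Gr"
    and continuous_s: "continuous_map (subtopology Ob (U g)) GTop (s g)"
proof -
  show "u \<in> U g \<Longrightarrow> Pi (s g u) = u" using \<sigma>_\<phi>[OF g] by (simp add: s_def \<sigma>_def)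
  show "u \<in> U g \<Longrightarrow> s g u \<in> Gr" using \<sigma>_\<phi>[OF g] M.Gr_compose[OF g T_Gr] by (simp add: s_def)
  have "continuous_map (subtopology Ob (U g)) (top_of_set T) (\<phi> g)"
    using homeomorphic_imp_continuous_map[OF chart_on_homeomorphic[OF chart_ch[OF g]]] by (simp add: image_\<phi>[OF g])
  from continuous_map_compose[OF this continuous_translate[OF g]]
  show "continuous_map (subtopology Ob (U g)) GTop (s g)" by (simp add: o_def s_def[abs_def])
qed

text \<open>In the chart the section is an affine map, differentiable on \<open>M\<close> and hence
  on the subspace \<open>Z\<close>.\<close>

lemma cdiff_s: assumes g: "g \<in> Gr" and u: "u \<in> U g" shows "cdiff_at (s g) (ch g) c0 u"
proof -
  let ?z = "\<phi> g u"
  note gM = M.Gr_M[OF g]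
  have z: "?z \<in> T" using \<sigma>_\<phi>[OF g u] by simp
  then have zM: "?z \<in> M" "?z \<in> Z" by (auto simp: T_def Z_M)
  have "cd (\<lambda>z. g o\<^sub>L (id_blinfun + z)) ?z" by (intro M.cd_compose M.cd_const M.cd_add M.cd_id zM gM)
  then obtain D where "has_cderiv_within (\<lambda>z. g o\<^sub>L (id_blinfun + z)) D ?z M" unfolding M.cd_def by blast
  then have D: "has_cderiv_within (\<lambda>z. g o\<^sub>L (id_blinfun + z)) D ?z Z"
    by (rule has_cderiv_within_subspace[OF _ M.csub Z_props(1)]) (use Z_M in auto)
  obtain d where d: "d > 0" "\<And>v. v \<in> Z \<Longrightarrow> dist v ?z < d \<Longrightarrow> v \<in> T"
    using openin_T z unfolding openin_euclidean_subtopology_iff by blast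
  have inv: "inv_into (U g) (\<phi> g) v = \<sigma> g v" if "v \<in> T" for v
    by (rule inv_into_f_eq[OF chart_on_inj[OF chart_ch[OF g]]]) (use that \<phi>_\<sigma>[OF g] in \<open>auto simp: U_def\<close>)
  have "has_cderiv_within (id \<circ> s g \<circ> inv_into (U g) (\<phi> g)) D ?z Z"
    by (rule has_cderiv_within_cong[OF D Z_props(1) d(1)])
      (use z d(2) inv \<phi>_\<sigma>[OF g] in \<open>auto simp: s_def dist_norm\<close>)
  then show ?thesis by (auto simp: cdiff_at_def)
qed

lemma chart_ch_sub: "g \<in> Gr \<Longrightarrow> chart_on (subtopology Ob (U g)) (ch g)"
  using chart_on_open(2)[OF chart_ch openin_U, of g g] by simp

text \<open>The change of charts is the section over one chart followed by the orbit map read in the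
  other, both known to be differentiable.\<close>

lemma cdiff_ch_ch:
  assumes g: "g \<in> Gr" and h: "h \<in> Gr" and u: "u \<in> U g" "u \<in> U h"
  shows "cdiff_at id (ch g) (ch h) u"
proof -
  have "cdiff_at (Pi \<circ> s g) (ch g) (ch h) u"
    by (rule cdiff_at_compose[OF chart_ch_sub[OF g] chart_c0 continuous_s[OF g]])
      (use u cdiff_s[OF g] cdiff_Pi[OF h s_Gr[OF g]] s_Gr[OF g] Pi_s[OF g] in auto)
  then show ?thesis
    by (rule cdiff_at_cong[OF chart_ch[OF g] _ openin_U[OF g], rotated 3]) (use u Pi_s[OF g] in auto)
qed

lemma Pi_U: assumes g: "g \<in> Gr" shows "Pi g \<in> U g"
proof -
  have "0 \<in> T" using csubspace_0[OF Z_props(1)] by (simp add: T_def)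
  moreover have "\<sigma> g 0 = Pi g" by (simp add: \<sigma>_def)
  ultimately show ?thesis unfolding U_def by force
qed

text \<open>Two different points of the orbit differ as maps at some \<open>x\<close> in
  \<open>M\<close>; evaluation at \<open>x\<close> is continuous for the quotient topology because
  it depends continuously on \<open>g\<close>.\<close>

lemma Hausdorff_Ob: "Hausdorff_space Ob"
  unfolding Hausdorff_space_def
proof (intro allI impI, elim conjE)
  fix u v assume "u \<in> topspace Ob" "v \<in> topspace Ob" "u \<noteq> v"
  then obtain g h where gh: "g \<in> Gr" "h \<in> Gr" "u = Pi g" "v = Pi h" by (auto simp: topspace_Ob)
  obtain x where x: "x \<in> M" "u x \<noteq> v x"
    using \<open>u \<noteq> v\<close> unfolding gh(3,4) similarity_def by (metis (no_types, lifting) restrict_ext restrict_apply')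
  have ev: "continuous_map Ob euclidean (\<lambda>u. u x)"
    unfolding continuous_map
  proof (intro conjI allI impI)
    fix S :: "'h op set" assume S: "openin euclidean S"
    have "continuous_on Gr (\<lambda>g. g o\<^sub>L E (gi g o\<^sub>L x o\<^sub>L g) o\<^sub>L gi g)"
    proof (rule M.cd_continuous_on)
      fix g assume g: "g \<in> Gr"
      have gM: "g \<in> M" "gi g \<in> M" using g M.Gr_M M.Gr_gi by auto
      have i: "cd (\<lambda>g. gi g o\<^sub>L x o\<^sub>L g) g"
        by (intro M.cd_compose M.cd_gi M.cd_const M.cd_id gM g MI x)
      have "gi g o\<^sub>L x o\<^sub>L g \<in> M" using gM x by simp
      have e: "cd (\<lambda>g. E (gi g o\<^sub>L x o\<^sub>L g)) g"
      proof -
        obtain d where d: "d > 0" "\<And>y. y \<in> M \<Longrightarrow> norm (y - g) < d \<Longrightarrow> y \<in> Gr" using Gr_nbhd[OF g] by blast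
        show ?thesis
          by (rule M.cd_chain[OF gM(1) i cd_E[OF \<open>gi g o\<^sub>L x o\<^sub>L g \<in> M\<close>] d(1)]) (use d(2) M.Gr_M M.Gr_gi x in auto)
      qed
      show "cd (\<lambda>g. g o\<^sub>L E (gi g o\<^sub>L x o\<^sub>L g) o\<^sub>L gi g) g"
        by (intro M.cd_compose M.cd_gi e M.cd_id gM g MI E_in_M x)
    qed (use M.Gr_M in auto)
    then have "openin GTop (Gr \<inter> (\<lambda>g. g o\<^sub>L E (gi g o\<^sub>L x o\<^sub>L g) o\<^sub>L gi g) -` S)"
      using S by (intro continuous_openin_preimage_gen) auto
    moreover have "Gr \<inter> (\<lambda>g. g o\<^sub>L E (gi g o\<^sub>L x o\<^sub>L g) o\<^sub>L gi g) -` S = {g \<in> Gr. Pi g \<in> {u \<in> topspace Ob. u x \<in> S}}"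
      using x by (auto simp: similarity_def topspace_Ob)
    ultimately show "openin Ob {u \<in> topspace Ob. u x \<in> S}" by (auto simp: openin_Ob topspace_Ob)
  qed simp
  obtain S S' where S: "open S" "open S'" "u x \<in> S" "v x \<in> S'" "S \<inter> S' = {}" using hausdorff[OF x(2)] by blast
  show "\<exists>A A'. openin Ob A \<and> openin Ob A' \<and> u \<in> A \<and> v \<in> A' \<and> disjnt A A'"
  proof (intro exI conjI)
    show "openin Ob {u \<in> topspace Ob. u x \<in> S}" "openin Ob {u \<in> topspace Ob. u x \<in> S'}"
      using S(1,2) by (auto intro: openin_continuous_map_preimage[OF ev])
    show "u \<in> {u \<in> topspace Ob. u x \<in> S}" "v \<in> {u \<in> topspace Ob. u x \<in> S'}"
      using S \<open>u \<in> topspace Ob\<close> \<open>v \<in> topspace Ob\<close> by auto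
    show "disjnt {u \<in> topspace Ob. u x \<in> S} {u \<in> topspace Ob. u x \<in> S'}" using S(5) by (auto simp: disjnt_def)
  qed
qed

section \<open>The atlas of the orbit\<close>

abbreviation "OA0 \<equiv> {ch g |g. g \<in> Gr}"
abbreviation "OA \<equiv> maximal_atlas Ob OA0"

lemma complex_manifold_OA0: "complex_manifold Ob OA0"
  unfolding complex_manifold_def
proof (intro conjI ballI Hausdorff_Ob)
  show "chart_on Ob c" if "c \<in> OA0" for c using that chart_ch by auto
  show "topspace Ob \<subseteq> \<Union> (fst ` OA0)" using Pi_U by (fastforce simp: topspace_Ob)
  show "compatible_charts c d" if "c \<in> OA0" "d \<in> OA0" for c d
    using that cdiff_ch_ch by (auto simp: compatible_charts_iff)
qed

lemma OA_structure: "complex_manifold_structure Ob OA"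
  by (rule complex_manifold_structure_maximal_atlas[OF complex_manifold_OA0])

lemma ch_in: "g \<in> Gr \<Longrightarrow> ch g \<in> OA"
  by (rule chart_on_imp_maximal_atlas[OF complex_manifold_OA0]) auto

lemma OA_D:
  assumes "a \<in> OA"
  shows "chart_on Ob a" "g \<in> Gr \<Longrightarrow> u \<in> fst a \<Longrightarrow> u \<in> U g \<Longrightarrow> cdiff_at id a (ch g) u"
    "g \<in> Gr \<Longrightarrow> u \<in> fst a \<Longrightarrow> u \<in> U g \<Longrightarrow> cdiff_at id (ch g) a u"
  using assms by (auto simp: maximal_atlas_def compatible_charts_iff)

lemma canalytic_Pi: "canalytic_map GTop (group_atlas M) Ob OA Pi"
proof (rule canalytic_mapI[OF group_atlasD(1) continuous_Pi])
  fix y assume "y \<in> topspace GTop"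
  then have y: "y \<in> Gr" by simp
  show "\<exists>(c :: ('h op, 'h op) chart) (d :: ('h op \<Rightarrow> 'h op, 'h op) chart). chart_on GTop c \<and> chart_on Ob d \<and> y \<in> fst c \<and> Pi y \<in> fst d \<and>
      (\<forall>a\<in>group_atlas M. y \<in> fst a \<longrightarrow> cdiff_at id a c y) \<and> (\<forall>b\<in>OA. Pi y \<in> fst b \<longrightarrow> cdiff_at id d b (Pi y)) \<and> cdiff_at Pi c d y"
    using chart_c0 chart_ch[OF y] y Pi_U[OF y] group_atlasD(2) OA_D(3)[OF _ y] cdiff_Pi[OF y y Pi_U[OF y]]
    by (intro exI[of _ c0] exI[of _ "ch y"]) auto
qed


section \<open>The orbit as a homogeneous space\<close>

lemma zero_T: "0 \<in> T"
  using csubspace_0[OF Z_props(1)] by (simp add: T_def)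

lemma id_Bp: "id_blinfun \<in> Bp" "id_blinfun \<in> F ` Bp"
proof -
  show b: "id_blinfun \<in> Bp" using T_Bp(1)[OF zero_T] by simp
  show "id_blinfun \<in> F ` Bp" using imageI[OF b, of F] by (simp add: F_id)
qed

text \<open>Near the identity \<open>\<rho>\<close> is the inverse of \<open>F\<close>, whose
  derivative there is the identity, followed by the linear map
  \<open>w \<mapsto> w - Q w\<close>.\<close>

lemma \<rho>_deriv_id:
  obtains D where "has_cderiv_within \<rho> D id_blinfun M" "\<And>v. v \<in> M \<Longrightarrow> D v = v - Q v"
proof -
  have "\<exists>D. has_cderiv_within Fi D id_blinfun M \<and> (\<forall>v\<in>M. D v = v)" by (rule Fi_deriv_id) blast
  then obtain D where D: "has_cderiv_within Fi D id_blinfun M" "\<And>v. v \<in> M \<Longrightarrow> D v = v" by blast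
  have Fi_id: "Fi id_blinfun = id_blinfun" using Fi_F[of id_blinfun] id_Bp(1) by (simp add: F_id Bp_def)
  have o: "openin (top_of_set M) (F ` B)" by (rule open_image[OF open_B order_refl])
  have "id_blinfun \<in> F ` B" using id_Bp(2) by (auto simp: Bp_def)
  then obtain d where d: "d > 0" "\<And>y. y \<in> M \<Longrightarrow> dist y id_blinfun < d \<Longrightarrow> y \<in> F ` B"
    using o unfolding openin_euclidean_subtopology_iff by blast
  have FM: "Fi y \<in> M" if "y \<in> M" "norm (y - id_blinfun) < d" for y
  proof -
    have "y \<in> F ` B" using d(2) that by (simp add: dist_norm)
    then show ?thesis using Fi_F by auto
  qed
  have R: "has_cderiv_within (\<lambda>w. w - Q w) (\<lambda>w. w - Q w) (Fi id_blinfun) M"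
    unfolding Fi_id by (rule has_cderiv_within_linear[OF R_lin M.csub R_norm M.id_in])
  have "has_cderiv_within ((\<lambda>w. w - Q w) \<circ> Fi) ((\<lambda>w. w - Q w) \<circ> D) id_blinfun M"
    by (rule has_cderiv_within_compose[OF D(1) M.csub M.id_in R M.csub complete_imp_closed[OF M.complete] d(1) FM])
  moreover have "(\<lambda>w. w - Q w) \<circ> Fi = \<rho>" by (simp add: fun_eq_iff \<rho>_def)
  ultimately show thesis using that[of "(\<lambda>w. w - Q w) \<circ> D"] D(2) by simp
qed

text \<open>Moves \<open>g\<close> to the identity, so that the submersion property at
  \<open>g\<close> can be read off from \<open>\<rho>\<close> at the identity.\<close>

lemma translated_chart:
  assumes g: "g \<in> Gr" shows "(Gr, \<lambda>y. gi g o\<^sub>L y, M) \<in> group_atlas M"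
proof (rule group_chartI[OF M.open_Gr order_refl M.open_Gr, where \<psi> = "\<lambda>w. g o\<^sub>L w"])
  have gM: "g \<in> M" "gi g \<in> M" using g M.Gr_M M.Gr_gi by auto
  show "cd (\<lambda>y. gi g o\<^sub>L y) u" "cd (\<lambda>y. g o\<^sub>L y) u" if "u \<in> Gr" for u
    using M.Gr_M[OF that] gM by (intro M.cd_compose M.cd_const M.cd_id; simp)+
  show "g o\<^sub>L (gi g o\<^sub>L u) = u" for u by (rule M.gi_right'[OF g])
  show "(\<lambda>y. gi g o\<^sub>L y) ` Gr = Gr"
  proof
    show "(\<lambda>y. gi g o\<^sub>L y) ` Gr \<subseteq> Gr" using M.Gr_compose[OF M.Gr_gi[OF g]] by auto
    show "Gr \<subseteq> (\<lambda>y. gi g o\<^sub>L y) ` Gr"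
    proof
      fix y assume "y \<in> Gr"
      then have "g o\<^sub>L y \<in> Gr" by (rule M.Gr_compose[OF g])
      moreover have "y = gi g o\<^sub>L (g o\<^sub>L y)" by (rule M.gi_left'[OF g, symmetric])
      ultimately show "y \<in> (\<lambda>y. gi g o\<^sub>L y) ` Gr" by (rule rev_image_eqI)
    qed
  qed
qed

text \<open>In the translated chart the orbit map is \<open>\<rho>\<close> near the identity. Its
  derivative is the projection of \<open>M\<close> onto \<open>Z\<close> with kernel
  \<open>W\<close>, and \<open>W\<close> is complemented.\<close>

lemma csubmersion_Pi: "csubmersion GTop (group_atlas M) Ob OA Pi"
  unfolding csubmersion_def
proof (intro conjI ballI canalytic_Pi)
  fix g assume "g \<in> topspace GTop"
  then have g: "g \<in> Gr" by simp
  let ?l = "\<lambda>y. gi g o\<^sub>L y"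
  obtain D where D: "has_cderiv_within \<rho> D id_blinfun M" "\<And>v. v \<in> M \<Longrightarrow> D v = v - Q v" by (rule \<rho>_deriv_id) blast
  obtain d where d: "d > 0" "\<And>y. y \<in> M \<Longrightarrow> dist y id_blinfun < d \<Longrightarrow> y \<in> F ` Bp"
    using open_image[OF open_Bp] id_Bp(2) unfolding openin_euclidean_subtopology_iff Bp_def by blast
  obtain d' where d': "d' > 0" "\<And>y. y \<in> M \<Longrightarrow> norm (y - id_blinfun) < d' \<Longrightarrow> y \<in> Gr"
    using Gr_nbhd[OF M.Gr_id] by blast
  have rep: "\<rho> x = (\<phi> g \<circ> Pi \<circ> inv_into Gr ?l) x" if x: "x \<in> M" "norm (x - id_blinfun) < min d d'" for x
  proof -
    have xG: "x \<in> Gr" "x \<in> F ` Bp" using d(2) d'(2) x by (auto simp: dist_norm)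
    have gx: "g o\<^sub>L x \<in> Gr" by (rule M.Gr_compose[OF g xG(1)])
    have inj: "inj_on ?l Gr" by (rule inj_on_inverseI[where g = "\<lambda>w. g o\<^sub>L w"]) (rule M.gi_right'[OF g])
    have "inv_into Gr ?l x = g o\<^sub>L x" by (rule inv_into_f_eq[OF inj gx M.gi_left'[OF g]])
    moreover have "gi g o\<^sub>L (g o\<^sub>L x) o\<^sub>L gi id_blinfun = x" by (simp add: M.gi_left'[OF g] M.gi_id)
    moreover have "\<phi> g (Pi (g o\<^sub>L x)) = \<rho> (gi g o\<^sub>L (g o\<^sub>L x) o\<^sub>L gi id_blinfun)"
      by (rule orbit_local(3)[OF g Iso_id M.Gr_M[OF gx]]) (use calculation(2) xG(2) in simp)
    ultimately show ?thesis by simp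
  qed
  have "has_cderiv_within (\<phi> g \<circ> Pi \<circ> inv_into Gr ?l) D id_blinfun M"
  proof (rule has_cderiv_within_cong[OF D(1) M.csub])
    show "0 < min d d'" using d(1) d'(1) by simp
    show "\<rho> id_blinfun = (\<phi> g \<circ> Pi \<circ> inv_into Gr ?l) id_blinfun" by (rule rep) (use d(1) d'(1) M.id_in in auto)
  qed (rule rep)
  moreover have "D ` M = Z"
  proof
    show "D ` M \<subseteq> Z" using D(2) R_Z by auto
    show "Z \<subseteq> D ` M"
    proof
      fix z assume z: "z \<in> Z"
      then have "D z = z" using D(2)[OF Z_M[OF z]] by (simp add: Z_def)
      then show "z \<in> D ` M" using Z_M[OF z] by force
    qed
  qed
  moreover have "{v \<in> M. D v = 0} = W" unfolding W_eq using D(2) by auto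
  moreover have "?l g = id_blinfun" by (rule M.gi_left[OF g])
  ultimately have "\<exists>D. has_cderiv_within (\<phi> g \<circ> Pi \<circ> inv_into Gr ?l) D (?l g) M \<and> D ` M = Z \<and>
      complemented_subspace M {v \<in> M. D v = 0}"
    using complemented_W by (intro exI[of _ D]) simp
  then show "\<exists>(V, \<psi>, X)\<in>group_atlas M. \<exists>(V', \<psi>', X')\<in>OA. g \<in> V \<and> Pi g \<in> V' \<and>
      (\<exists>D. has_cderiv_within (\<psi>' \<circ> Pi \<circ> inv_into V \<psi>) D (\<psi> g) X \<and> D ` X = X' \<and>
        complemented_subspace X {v \<in> X. D v = 0})"
    by (intro bexI[OF _ translated_chart[OF g]] case_prodI bexI[OF _ ch_in[OF g]] conjI g Pi_U)
qed

lemma canalytic_action: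
  "canalytic_map (prod_topology GTop IT) (prod_atlas (group_atlas M) IA) GTop (group_atlas M) (\<lambda>(p, k). p o\<^sub>L k)"
proof -
  have m: "(\<lambda>(p, k). p o\<^sub>L k) = (\<lambda>p :: 'h op \<times> 'h op. fst p o\<^sub>L snd p)" by (auto simp: fun_eq_iff)
  have c1: "continuous_map (prod_topology GTop IT) GTop fst" by (rule continuous_map_fst)
  have c2: "continuous_map (prod_topology GTop IT) GTop snd" by (rule prod_GTop(2)[OF continuous_incl])
  have cm: "continuous_map (prod_topology GTop IT) GTop (\<lambda>p. fst p o\<^sub>L snd p)" by (rule continuous_compose_GTop[OF c1 c2])
  show ?thesis
    unfolding canalytic_map_iff m prod_atlas_eq
  proof (intro conjI ballI allI impI cm)
    fix a e p assume a: "a \<in> {prod_chart c d |c d. c \<in> group_atlas M \<and> d \<in> IA}"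
      and e: "e \<in> group_atlas M" "p \<in> fst a" "fst p o\<^sub>L snd p \<in> fst e"
    from a obtain c d where cd: "c \<in> group_atlas M" "d \<in> IA" "a = prod_chart c d" by blast
    note ch = group_atlasD(1)[OF cd(1)] IA_chart[OF cd(2)]
    have p: "p \<in> fst c \<times> fst d" using e(2) cd(3) by simp
    have "cdiff_at (\<lambda>p. id (fst p)) a c0 p"
      unfolding cd(3) by (rule cdiff_fst_compose[where f = id, OF ch p]) (use p group_atlasD(2)[OF cd(1)] in auto)
    moreover have "cdiff_at (\<lambda>p. id (snd p)) a c0 p"
      unfolding cd(3) by (rule cdiff_snd_compose[where f = id, OF ch p]) (use p IA_incl[OF cd(2)] in auto)
    ultimately have "cdiff_at (\<lambda>p. fst p o\<^sub>L snd p) a c0 p"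
      using e(2) chart_on_prod[OF ch] cd(3) by (intro cdiff_mult[OF _ _ c1 _ c2]) auto
    from cdiff_to_group[OF _ cm e(2) this e(1,3)]
    show "cdiff_at (\<lambda>p. fst p o\<^sub>L snd p) a e p" using chart_on_prod[OF ch] cd(3) by simp
  qed
qed

abbreviation "PU g \<equiv> {p \<in> topspace GTop. Pi p \<in> U g}"

lemma openin_PU: "g \<in> Gr \<Longrightarrow> openin GTop (PU g)"
  using open_preimage_U by (auto simp: openin_GTop)

lemma cdiff_s_OA:
  assumes g: "g \<in> Gr" and c: "(U', \<psi>, V) \<in> OA" and u: "u \<in> U'" "u \<in> U g"
  shows "cdiff_at (s g) (U' \<inter> U g, \<psi>, V) c0 u"
proof (rule cdiff_at_open_source[OF OA_D(1)[OF c] openin_U[OF g] u])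
  have "cdiff_at id (U' \<inter> U g, \<psi>, V) (ch g) u"
    by (rule cdiff_at_open_source[OF OA_D(1)[OF c] openin_U[OF g] u]) (use OA_D(2)[OF c g] u in auto)
  from cdiff_at_compose[OF chart_on_open(2)[OF OA_D(1)[OF c] openin_U[OF g]] chart_ch_sub[OF g] _ _ _ this, where g = "s g" and e = c0]
  have "cdiff_at (s g \<circ> id) (U' \<inter> U g, \<psi>, V) c0 u"
    using u cdiff_s[OF g u(2)] by (simp add: id_def)
  then show "cdiff_at (s g) (U', \<psi>, V) c0 u"
    using cdiff_at_open_source_rev[OF OA_D(1)[OF c] openin_U[OF g] u] by simp
qed

text \<open>The inverse sends \<open>p\<close> to its base point and to
  \<open>gi (s g (Pi p)) o\<^sub>L p\<close>, which measures \<open>p\<close> against the section;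
  this element lies in the isotropy group because \<open>p\<close> and the value of the section have
  the same image.\<close>

lemma local_trivialization:
  assumes g: "g \<in> Gr"
  shows "bianalytic_map (prod_topology (subtopology Ob (U g)) IT) (prod_atlas (open_atlas OA (U g)) IA)
    (subtopology GTop (PU g)) (open_atlas (group_atlas M) (PU g)) (\<lambda>p. s g (fst p) o\<^sub>L snd p)"
    (is "bianalytic_map ?X ?A ?Y ?B ?\<tau>")
proof -
  let ?k = "\<lambda>p. gi (s g (Pi p)) o\<^sub>L p"
  let ?\<eta> = "\<lambda>p. (Pi p, ?k p)"
  note s = s_Gr[OF g] Pi_s[OF g]
  have kI: "?k p \<in> Iso" if "p \<in> PU g" for p
    using that Pi_eq_iff[of "s g (Pi p)" p] s by auto
  have \<tau>P: "?\<tau> q \<in> PU g" "Pi (?\<tau> q) = fst q" if "fst q \<in> U g" "snd q \<in> Iso" for q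
    using that s[of "fst q"] Pi_Iso[of "s g (fst q)" "snd q"] M.Gr_compose[OF _ Iso_Gr] by auto
  have c1: "continuous_map ?X GTop (\<lambda>p. s g (fst p))" by (rule prod_GTop(1)[OF continuous_s[OF g]])
  have c2: "continuous_map ?X GTop snd" by (rule prod_GTop(2)[OF continuous_incl])
  have c\<tau>: "continuous_map ?X GTop ?\<tau>" by (rule continuous_compose_GTop[OF c1 c2])
  have topX: "topspace ?X = U g \<times> Iso" using openin_subset[OF openin_U[OF g]] by (auto simp: Int_absorb1)
  have topY: "topspace ?Y = PU g" by auto
  have c\<tau>': "continuous_map ?X ?Y ?\<tau>"
    by (rule continuous_map_into_subtopology[OF c\<tau>]) (unfold topX, rule funcsetI, rule \<tau>P; auto)
  have i: "continuous_map ?Y GTop (\<lambda>p. p)" using continuous_map_id_subt[of GTop "PU g"] by (simp add: id_def)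
  have cPi: "continuous_map ?Y (subtopology Ob (U g)) Pi"
    by (rule continuous_map_into_subtopology) (use continuous_map_compose[OF i continuous_Pi] in \<open>auto simp: o_def\<close>)
  have csPi: "continuous_map ?Y GTop (\<lambda>p. s g (Pi p))"
    using continuous_map_compose[OF cPi continuous_s[OF g]] by (simp add: o_def)
  have cgi: "continuous_map ?Y GTop (\<lambda>p. gi (s g (Pi p)))"
    using continuous_map_compose[OF csPi continuous_gi] by (simp add: o_def)
  have ck: "continuous_map ?Y GTop ?k" by (rule continuous_compose_GTop[OF cgi i])
  have ckI: "continuous_map ?Y IT ?k" by (rule continuous_into_IT[OF ck]) (use kI topY in auto)
  have c\<eta>: "continuous_map ?Y ?X ?\<eta>" by (rule continuous_map_pairedI[OF cPi ckI])
  have "homeomorphic_maps ?X ?Y ?\<tau> ?\<eta>"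
    unfolding homeomorphic_maps_def topX topY
  proof (intro conjI ballI c\<tau>' c\<eta>)
    fix q assume q: "q \<in> U g \<times> Iso"
    then have "Pi (?\<tau> q) = fst q" by (intro \<tau>P) auto
    moreover have "gi (s g (fst q)) o\<^sub>L (s g (fst q) o\<^sub>L snd q) = snd q" by (rule M.gi_left'[OF s(1)]) (use q in auto)
    ultimately show "?\<eta> (?\<tau> q) = q" by simp
  next
    fix p assume p: "p \<in> PU g"
    have "s g (Pi p) o\<^sub>L ?k p = p" by (rule M.gi_right'[OF s(1)]) (use p in simp)
    then show "?\<tau> (?\<eta> p) = p" by simp
  qed
  moreover have "canalytic_map ?X ?A ?Y ?B ?\<tau>"
    unfolding canalytic_map_iff prod_atlas_eq
  proof (intro conjI ballI allI impI c\<tau>')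
    fix a d q
    assume "a \<in> {prod_chart c e |c e. c \<in> open_atlas OA (U g) \<and> e \<in> IA}" "d \<in> ?B" and q: "q \<in> fst a" "?\<tau> q \<in> fst d"
    then obtain U' \<psi> V e where c: "(U', \<psi>, V) \<in> OA" "e \<in> IA" and a: "a = prod_chart (U' \<inter> U g, \<psi>, V) e"
      by (auto simp: open_atlas_def)
    obtain G \<xi> V' where d: "(G, \<xi>, V') \<in> group_atlas M" "d = (G \<inter> PU g, \<xi>, V')" using \<open>d \<in> ?B\<close> unfolding open_atlas_def by blast
    note ch = chart_on_open(2)[OF OA_D(1)[OF c(1)] openin_U[OF g]] IA_chart[OF c(2)]
    have q': "q \<in> fst (U' \<inter> U g, \<psi>, V) \<times> fst e" using q(1) a by simp
    have ca: "chart_on ?X a" unfolding a by (rule chart_on_prod[OF ch])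
    have "cdiff_at (\<lambda>p. s g (fst p)) a c0 q"
      unfolding a by (rule cdiff_fst_compose[OF ch q' cdiff_s_OA[OF g c(1)]]) (use q' in auto)
    moreover have "cdiff_at (\<lambda>p. id (snd p)) a c0 q"
      unfolding a by (rule cdiff_snd_compose[where f = id, OF ch q']) (use q' IA_incl[OF c(2)] in auto)
    ultimately have "cdiff_at ?\<tau> a c0 q" by (intro cdiff_mult[OF ca q(1) c1 _ c2]) simp_all
    from cdiff_to_group[OF ca c\<tau> q(1) this d(1)]
    have "cdiff_at ?\<tau> a (G, \<xi>, V') q" using q(2) d(2) by simp
    then show "cdiff_at ?\<tau> a d q" unfolding d(2) by (rule cdiff_at_target[THEN iffD1])
  qed
  moreover have "canalytic_map ?Y ?B ?X ?A ?\<eta>"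
    unfolding canalytic_map_iff prod_atlas_eq
  proof (intro conjI ballI allI impI c\<eta>)
    fix d a p
    assume "d \<in> ?B" "a \<in> {prod_chart c e |c e. c \<in> open_atlas OA (U g) \<and> e \<in> IA}" and p: "p \<in> fst d" "?\<eta> p \<in> fst a"
    then obtain U' \<psi> V e where c: "(U', \<psi>, V) \<in> OA" "e \<in> IA" and a: "a = prod_chart (U' \<inter> U g, \<psi>, V) e"
      by (auto simp: open_atlas_def)
    obtain G \<xi> V' where d: "(G, \<xi>, V') \<in> group_atlas M" "d = (G \<inter> PU g, \<xi>, V')" using \<open>d \<in> ?B\<close> unfolding open_atlas_def by blast
    have pG: "p \<in> G" "p \<in> PU g" "Pi p \<in> U'" "Pi p \<in> U g" "?k p \<in> fst e" using p d(2) a by auto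
    note cG = group_atlasD(1)[OF d(1)] and oP = openin_PU[OF g]
    have cd: "chart_on ?Y d" unfolding d(2) by (rule chart_on_open(2)[OF cG oP])
    have "cdiff_at Pi (G, \<xi>, V') (U', \<psi>, V) p"
      using canalytic_Pi c(1) d(1) pG unfolding canalytic_map_iff by fastforce
    then have "cdiff_at Pi d (U', \<psi>, V) p"
      unfolding d(2) by (rule cdiff_at_open_source[OF cG oP pG(1,2)])
    then have dPi: "cdiff_at Pi d (U' \<inter> U g, \<psi>, V) p" by (rule cdiff_at_target[THEN iffD1])
    have "cdiff_at (s g \<circ> Pi) d c0 p"
      by (rule cdiff_at_compose[OF cd chart_on_open(2)[OF OA_D(1)[OF c(1)] openin_U[OF g]] cPi p(1) _ dPi cdiff_s_OA[OF g c(1)]])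
        (use pG in auto)
    then have "cdiff_at (\<lambda>p. gi (s g (Pi p))) d c0 p"
      by (intro cdiff_gi[OF cd p(1) csPi]) (simp add: o_def)
    moreover have "cdiff_at id d c0 p"
      unfolding d(2) by (rule cdiff_at_open_source[OF cG oP pG(1,2)]) (use group_atlasD(2)[OF d(1)] pG in auto)
    ultimately have "cdiff_at ?k d c0 p"
      by (intro cdiff_mult[OF cd p(1) cgi _ i]) (simp_all add: id_def)
    then have "cdiff_at ?k d e p" by (intro cdiff_to_IA[OF c(2) cd ck p(1)] pG)
    then show "cdiff_at ?\<eta> d a p" unfolding a by (rule cdiff_at_Pair[OF cd p(1) dPi])
  qed
  ultimately show ?thesis unfolding bianalytic_map_def by blast
qed

lemma principal_bundle_Pi:
  "principal_bundle GTop (group_atlas M) Ob OA (isotropy_group M E) IT IA (o\<^sub>L) Pi"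
  unfolding principal_bundle_def
proof (intro conjI ballI complex_manifold_group complex_Lie_group_Iso canalytic_action canalytic_Pi)
  show "complex_manifold Ob OA" using OA_structure by (simp add: complex_manifold_structure_def)
  show "Pi ` topspace GTop = topspace Ob" by (simp add: topspace_Ob)
  show "p o\<^sub>L \<one>\<^bsub>isotropy_group M E\<^esub> = p" for p by simp
  show "p o\<^sub>L (k \<otimes>\<^bsub>isotropy_group M E\<^esub> l) = p o\<^sub>L k o\<^sub>L l" for p k l by (simp add: blinfun_compose_assoc)
  fix y assume "y \<in> topspace Ob"
  then obtain g where g: "g \<in> Gr" "y = Pi g" by (auto simp: topspace_Ob)
  show "\<exists>V \<tau>. openin Ob V \<and> y \<in> V \<and>
      bianalytic_map (prod_topology (subtopology Ob V) IT) (prod_atlas (open_atlas OA V) IA)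
        (subtopology GTop {p \<in> topspace GTop. Pi p \<in> V}) (open_atlas (group_atlas M) {p \<in> topspace GTop. Pi p \<in> V}) \<tau> \<and>
      (\<forall>u\<in>V. \<forall>k\<in>Iso. Pi (\<tau> (u, k)) = u \<and> (\<forall>l\<in>Iso. \<tau> (u, k \<otimes>\<^bsub>isotropy_group M E\<^esub> l) = \<tau> (u, k) o\<^sub>L l))"
  proof (intro exI[of _ "U g"] exI[of _ "\<lambda>p. s g (fst p) o\<^sub>L snd p"] conjI ballI openin_U local_trivialization g(1))
    show "y \<in> U g" using g Pi_U by simp
    fix u k assume u: "u \<in> U g" and k: "k \<in> Iso"
    show "Pi (s g (fst (u, k)) o\<^sub>L snd (u, k)) = u" using Pi_Iso[OF s_Gr[OF g(1) u] k] Pi_s[OF g(1) u] by simp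
    show "s g (fst (u, k \<otimes>\<^bsub>isotropy_group M E\<^esub> l)) o\<^sub>L snd (u, k \<otimes>\<^bsub>isotropy_group M E\<^esub> l) = s g (fst (u, k)) o\<^sub>L snd (u, k) o\<^sub>L l" for l
      by (simp add: blinfun_compose_assoc)
  qed
qed

lemma homogeneous_OA: "homogeneous_structure M E OA"
  unfolding homogeneous_structure_def using OA_structure principal_bundle_Pi csubmersion_Pi by blast

subsection \<open>Uniqueness\<close>

lemma homogeneous_structureD:
  assumes "homogeneous_structure M E A"
  shows "canalytic_map GTop (group_atlas M) Ob A Pi" "complex_manifold Ob A" "maximal_atlas Ob A = A" "c \<in> A \<Longrightarrow> chart_on Ob c"
  using assms unfolding homogeneous_structure_def csubmersion_def complex_manifold_structure_def complex_manifold_def by auto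

lemma homogeneous_section:
  fixes A :: "('h op \<Rightarrow> 'h op, 'b::complex_normed_vector) chart set"
  assumes A: "homogeneous_structure M E A" and y: "y \<in> topspace Ob"
  shows "\<exists>V t. openin Ob V \<and> y \<in> V \<and> continuous_map (subtopology Ob V) GTop t \<and> (\<forall>u\<in>V. Pi (t u) = u) \<and>
    (\<forall>U' \<psi> X. (U', \<psi>, X) \<in> A \<longrightarrow> y \<in> U' \<longrightarrow> cdiff_at t (U' \<inter> V, \<psi>, X) c0 y)"
proof -
  have "principal_bundle GTop (group_atlas M) Ob A (isotropy_group M E) IT IA (o\<^sub>L) Pi"
    using A by (simp add: homogeneous_structure_def)
  then have "\<forall>y\<in>topspace Ob. \<exists>V \<tau>. openin Ob V \<and> y \<in> V \<and>
      bianalytic_map (prod_topology (subtopology Ob V) IT) (prod_atlas (open_atlas A V) IA)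
        (subtopology GTop {p \<in> topspace GTop. Pi p \<in> V}) (open_atlas (group_atlas M) {p \<in> topspace GTop. Pi p \<in> V}) \<tau> \<and>
      (\<forall>u\<in>V. \<forall>k\<in>Iso. Pi (\<tau> (u, k)) = u \<and> (\<forall>l\<in>Iso. \<tau> (u, k \<otimes>\<^bsub>isotropy_group M E\<^esub> l) = \<tau> (u, k) o\<^sub>L l))"
    unfolding principal_bundle_def by (elim conjE)
  from bspec[OF this y] obtain V \<tau> where V: "openin Ob V" "y \<in> V"
    and bi: "bianalytic_map (prod_topology (subtopology Ob V) IT) (prod_atlas (open_atlas A V) IA)
      (subtopology GTop {p \<in> topspace GTop. Pi p \<in> V}) (open_atlas (group_atlas M) {p \<in> topspace GTop. Pi p \<in> V}) \<tau>"
    and triv: "\<forall>u\<in>V. \<forall>k\<in>Iso. Pi (\<tau> (u, k)) = u \<and> (\<forall>l\<in>Iso. \<tau> (u, k \<otimes>\<^bsub>isotropy_group M E\<^esub> l) = \<tau> (u, k) o\<^sub>L l)"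
    by (elim exE conjE) (rule that)
  have Pi\<tau>: "Pi (\<tau> (u, k)) = u" if "u \<in> V" "k \<in> Iso" for u k using triv that by blast
  let ?P = "{p \<in> topspace GTop. Pi p \<in> V}" and ?X = "subtopology Ob V"
  let ?j = "\<lambda>u :: 'h op \<Rightarrow> 'h op. (u, id_blinfun :: 'h op)"
  let ?t = "\<lambda>u. \<tau> (u, id_blinfun)"
  have an: "canalytic_map (prod_topology ?X IT) (prod_atlas (open_atlas A V) IA) (subtopology GTop ?P) (open_atlas (group_atlas M) ?P) \<tau>"
    using bi by (auto simp: bianalytic_map_def)
  have idc: "continuous_map ?X ?X (\<lambda>u. u)" using continuous_map_id[of ?X] by (simp add: id_def)
  have cj: "continuous_map ?X (prod_topology ?X IT) ?j"
    by (rule continuous_map_pairedI[OF idc]) (use Iso_id in simp)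
  have ct: "continuous_map ?X (subtopology GTop ?P) ?t"
    using continuous_map_compose[OF cj an[unfolded canalytic_map_def, THEN conjunct1]] by (simp add: o_def)
  then have ct': "continuous_map ?X GTop ?t" by (simp add: continuous_map_in_subtopology)
  have "cdiff_at ?t (U' \<inter> V, \<psi>, X) c0 y" if c: "(U', \<psi>, X) \<in> A" "y \<in> U'" for U' \<psi> X
  proof -
    let ?c = "(U' \<inter> V, \<psi>, X)"
    have cc: "chart_on ?X ?c" by (rule chart_on_open(2)[OF homogeneous_structureD(4)[OF A c(1)] V(1)])
    \<comment> \<open>A chart of the isotropy group around the identity turns
      \<open>u \<mapsto> (u, id_blinfun)\<close> into a map between charts, to which the
      trivialization can then be applied.\<close>
    obtain e where e: "e \<in> IA" "id_blinfun \<in> fst e" using isotropy_chart[OF Iso_id] by blast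
    have yc: "y \<in> fst ?c" using c(2) V(2) by simp
    have "cdiff_at (\<lambda>u. u) ?c ?c y" using cdiff_at_id[OF cc yc] by (simp add: id_def)
    then have dj: "cdiff_at ?j ?c (prod_chart ?c e) y" by (rule cdiff_at_Pair[OF cc yc _ cdiff_at_const[OF cc yc]])
    have "?t y \<in> ?P" using continuous_map_funspace[OF ct] V y by auto
    moreover have "prod_chart ?c e \<in> prod_atlas (open_atlas A V) IA" "(Gr \<inter> ?P, id, M) \<in> open_atlas (group_atlas M) ?P"
      unfolding prod_atlas_eq open_atlas_def using c(1) e(1) c0_in by blast+
    ultimately have "cdiff_at \<tau> (prod_chart ?c e) (Gr \<inter> ?P, id, M) (?j y)"
      using an yc e(2) unfolding canalytic_map_iff by fastforce
    from cdiff_at_compose[where f = ?j and x = y, OF cc chart_on_prod[OF cc IA_chart[OF e(1)]] cj yc _ dj this]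
    have "cdiff_at (\<tau> \<circ> ?j) ?c (Gr \<inter> ?P, id, M) y" using yc e(2) by simp
    then have "cdiff_at (\<tau> \<circ> ?j) ?c c0 y" by (rule cdiff_at_target[THEN iffD1])
    then show ?thesis by (simp add: o_def)
  qed
  then show ?thesis using V ct' Pi\<tau>[OF _ Iso_id] by blast
qed

lemma homogeneous_canalytic_id:
  fixes A :: "('h op \<Rightarrow> 'h op, 'b::complex_normed_vector) chart set"
    and B :: "('h op \<Rightarrow> 'h op, 'c::complex_normed_vector) chart set"
  assumes A: "homogeneous_structure M E A" and B: "homogeneous_structure M E B"
  shows "canalytic_map Ob A Ob B id"
  unfolding canalytic_map_iff
proof (intro conjI ballI allI impI continuous_map_id)
  fix c d y assume c: "c \<in> A" and d: "d \<in> B" and y: "y \<in> fst c" "id y \<in> fst d"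
  obtain U' \<psi> X where c_eq: "c = (U', \<psi>, X)" by (cases c)
  note cc = homogeneous_structureD(4)[OF A c, unfolded c_eq]
  have yU: "y \<in> U'" using y(1) c_eq by simp
  then have "y \<in> topspace Ob" using openin_subset[OF chart_on_openin[OF cc]] by blast
  from homogeneous_section[OF A this] c yU c_eq obtain V t where V: "openin Ob V" "y \<in> V" and ct: "continuous_map (subtopology Ob V) GTop t"
    and Pt: "\<forall>u\<in>V. Pi (t u) = u" and dt: "cdiff_at t (U' \<inter> V, \<psi>, X) c0 y"
    by blast
  have tG: "t y \<in> Gr" using continuous_map_funspace[OF ct] V openin_subset[OF V(1)] by auto
  have "cdiff_at Pi c0 d (t y)"
    using homogeneous_structureD(1)[OF B] c0_in d tG Pt V(2) y(2) unfolding canalytic_map_iff by fastforce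
  from cdiff_at_compose[where f = t and x = y, OF chart_on_open(2)[OF cc V(1)] chart_c0 ct _ _ dt this]
  have "cdiff_at (Pi \<circ> t) (U' \<inter> V, \<psi>, X) d y" using yU V(2) tG by simp
  then have "cdiff_at id (U' \<inter> V, \<psi>, X) d y"
    by (rule cdiff_at_cong[OF chart_on_open(1)[OF cc V(1)] _ V, rotated 2]) (use yU V(2) Pt in auto)
  then show "cdiff_at id c d y" unfolding c_eq by (rule cdiff_at_open_source_rev[OF cc V(1) yU V(2)])
qed

lemma homogeneous_unique_bianalytic:
  fixes A :: "('h op \<Rightarrow> 'h op, 'b::complex_normed_vector) chart set"
    and B :: "('h op \<Rightarrow> 'h op, 'c::complex_normed_vector) chart set"
  assumes A: "homogeneous_structure M E A" and B: "homogeneous_structure M E B"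
  shows "bianalytic_map Ob A Ob B (\<lambda>F. F)"
proof -
  have "homeomorphic_maps Ob Ob id id" by (simp add: homeomorphic_maps_def)
  then have "bianalytic_map Ob A Ob B id"
    unfolding bianalytic_map_def using homogeneous_canalytic_id[OF A B] homogeneous_canalytic_id[OF B A] by blast
  then show ?thesis by (simp add: id_def)
qed

text \<open>The identity being analytic in both directions makes every chart of \<open>A\<close>
  compatible with all of \<open>B\<close>, and the maximal atlas \<open>B\<close> then contains
  it.\<close>

lemma homogeneous_subset:
  fixes A B :: "('h op \<Rightarrow> 'h op, 'b::complex_normed_vector) chart set"
  assumes A: "homogeneous_structure M E A" and B: "homogeneous_structure M E B"
  shows "A \<subseteq> B"
proof
  fix c assume c: "c \<in> A"
  have "compatible_charts c d" if "d \<in> B" for d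
    using homogeneous_canalytic_id[OF A B] homogeneous_canalytic_id[OF B A] c that
    unfolding compatible_charts_iff canalytic_map_iff by simp
  then have "c \<in> maximal_atlas Ob B" using homogeneous_structureD(4)[OF A c] by (simp add: maximal_atlas_def)
  then show "c \<in> B" by (simp only: homogeneous_structureD(3)[OF B])
qed

lemma homogeneous_ex1: "\<exists>!A :: ('h op \<Rightarrow> 'h op, 'h op) chart set. homogeneous_structure M E A"
proof (rule ex1I)
  show "homogeneous_structure M E OA" by (rule homogeneous_OA)
  show "A = OA" if "homogeneous_structure M E A" for A
    using homogeneous_subset[OF that homogeneous_OA] homogeneous_subset[OF homogeneous_OA that] by (rule subset_antisym)
qed

end

text \<open>The model space \<open>Z\<close> lies in \<open>M\<close>, so charts with values in the
  operator type suffice for existence. For structures modelled in another type equality of atlases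
  cannot be stated, and uniqueness is expressed by analyticity of the identity in both
  directions.\<close>

theorem theorem4p8:
  fixes M N :: "'h::chilbert_space op set"
    and E :: "'h op \<Rightarrow> 'h op"
  assumes "von_neumann_algebra M"
    and "separable_predual M"
    and "conditional_expectation M N E"
    and "faithful_map M E"
    and "normal_map M E"
  shows "(\<exists>!A :: ('h op \<Rightarrow> 'h op, 'h op) chart set. homogeneous_structure M E A) \<and>
    (\<forall>(A :: ('h op \<Rightarrow> 'h op, 'h op) chart set)
        (B :: ('h op \<Rightarrow> 'h op, 'b::complex_normed_vector) chart set).
      homogeneous_structure M E A \<longrightarrow> homogeneous_structure M E B \<longrightarrow>
      bianalytic_map (orbit_topology M E) A (orbit_topology M E) B (\<lambda>F. F))"
proof -
  have "von_neumann_algebra N" using assms(3) by (simp add: conditional_expectation_def)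
  then interpret cond_exp M N E
    using assms(1,3) by unfold_locales
  obtain P where "\<And>x. x \<in> M \<Longrightarrow> P x \<in> centralizer" "\<And>c. c \<in> centralizer \<Longrightarrow> P c = c"
    "clinear_on M P" "\<And>x. x \<in> M \<Longrightarrow> norm (P x) \<le> norm x"
    by (rule centralizer_complemented[OF assms(2,4,5)]) blast
  then interpret complemented_cond_exp M N E P by unfold_locales
  show ?thesis using homogeneous_ex1 homogeneous_unique_bianalytic by blast
qed

end
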